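(* Assume the standing setup, fix integers $p\ge2$, $k\ge p$, $\lambda>0$ and $\delta\in(0,1)$. With probability at least $1-5\delta$ the following hold simultaneously: (a) if $k\ge\max\{k_1(p,\delta),k_2(k,p,\delta)\}$, then $$\mathcal T_p\bar E_k\bar E_k^*\mathcal T_p^*\succeq\frac{k-p+1}{2}\Sigma_E\succeq\frac{k-p+1}{2}\sigma_RI\quad\text{and}\quad \bar Z_k\bar Z_k^*\succeq\tfrac12\mathcal O_p\bar X_k\bar X_k^*\mathcal O_p^*+\tfrac12\mathcal T_p\bar E_k\bar E_k^*\mathcal T_p^*;$$ (b) $\bar Z_k\bar Z_k^*\preceq(k-p+1)\frac{mp}{\delta}\Gamma_{Z,k}$; (c) $\|S_k\bar V_k^{-1/2}\|_2\le g_1(k,p,\delta)$.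
   Context: Standing setup: $x_{k+1}=Ax_k+w_k$, $y_k=Cx_k+v_k$, $x_k\in\mathbb R^n$, $y_k\in\mathbb R^m$, $w_k\sim\mathcal N(0,Q)$, $v_k\sim\mathcal N(0,R)$ i.i.d. independent, $x_0\sim\mathcal N(0,P)$; $\rho(A)\le1$; $(A,C)$ observable, $(A,Q^{1/2})$ controllable, $R\succ0$; $K=APC^*(CPC^*+R)^{-1}$ with $P\succ0$ solving $P=(A-KC)P(A-KC)^*+Q+KRK^*$; $(A,K)$ controllable. Kalman filter $\hat x_{k+1}=A\hat x_k+Ke_k$, $\hat x_0=0$, $e_k=y_k-C\hat x_k$ i.i.d. $\mathcal N(0,\bar R)$, $\bar R=CPC^*+R$. $\sigma_R=\sigma_{\min}(R)$. Notation: $Z_t=[y_{t-p}^*,\dots,y_{t-1}^*]^*$, $E_t=[e_{t-p}^*,\dots,e_{t-1}^*]^*$; $\bar Z_k=[Z_p,\dots,Z_k]$, $\bar E_k=[E_p,\dots,E_k]$, $\bar X_k=[\hat x_0,\dots,\hat x_{k-p}]$; $\bar V_k=\lambda I+\bar Z_k\bar Z_k^*$; $S_k=\sum_{t=p}^ke_tZ_t^*$; $\mathcal O_p=[C^*,A^*C^*,\dots,(A^* )^{p-1}C^*]^*$; $\mathcal T_p$ is the $mp\times mp$ lower block-triangular block-Toeplitz matrix with diagonal blocks $I_m$ and $(i,j)$ block $CA^{i-j-1}K$ for $i>j$ (so $Z_t=\mathcal O_p\hat x_{t-p}+\mathcal T_pE_t$); $\Sigma_E=\mathcal T_p\operatorname{diag}(\bar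 R,\dots,\bar R)\mathcal T_p^*$; $\Gamma_t=\mathbb E\hat x_t\hat x_t^*$; $\Gamma_{Z,k}=\mathbb EZ_kZ_k^*$. $k_1(p,\delta)=p+128(mp^2\log9+p\log2+p\log\tfrac1\delta)$; $k_2(k,p,\delta)=p+\frac{64}{\min\{4,\sigma_R\}}\Big(4pn\log\big(\tfrac{n\|\mathcal O_p\|_2^2\|\Gamma_{k-p}\|_2}{\delta}+1\big)+8p\log\tfrac{p5^m}{\delta}\Big)$; $g_1(k,p,\delta)=\sqrt8\sqrt{\|\bar R\|_2mp}\sqrt{\log\tfrac{3mp}{\delta}+\tfrac12\log(k-p+1)+\tfrac1{2mp}\log\det(\Gamma_{Z,k}\lambda^{-1}+I)}$. *)

theory Defs
  imports "HOL-Probability.Probability" "Jordan_Normal_Form.Spectral_Radius" "Jordan_Normal_Form.DL_Rank"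
begin

definition vnorm :: "real vec \<Rightarrow> real" where
  "vnorm x = sqrt (x \<bullet> x)"

definition norm2 :: "real mat \<Rightarrow> real" where
  "norm2 M = Sup {vnorm (M *\<^sub>v x) | x. x \<in> carrier_vec (dim_col M) \<and> vnorm x \<le> 1}"

definition sigma_min :: "real mat \<Rightarrow> real" where
  "sigma_min M = sqrt (Min {ev. eigenvalue (transpose_mat M * M) ev})"

definition psd_mat :: "real mat \<Rightarrow> bool" where
  "psd_mat M \<longleftrightarrow> M \<in> carrier_mat (dim_row M) (dim_row M) \<and> transpose_mat M = M \<and>
     (\<forall>x \<in> carrier_vec (dim_row M). x \<bullet> (M *\<^sub>v x) \<ge> 0)"

definition pd_mat :: "real mat \<Rightarrow> bool" where
  "pd_mat M \<longleftrightarrow> M \<in> carrier_mat (dim_row M) (dim_row M) \<and> transpose_mat M = M \<and>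
     (\<forall>x \<in> carrier_vec (dim_row M). x \<noteq> 0\<^sub>v (dim_row M) \<longrightarrow> x \<bullet> (M *\<^sub>v x) > 0)"

definition loewner_ge :: "real mat \<Rightarrow> real mat \<Rightarrow> bool" (infix "\<succeq>\<^sub>L" 50) where
  "M \<succeq>\<^sub>L N \<longleftrightarrow> dim_row M = dim_row N \<and> dim_col M = dim_col N \<and> psd_mat (M - N)"

definition mat_inv :: "real mat \<Rightarrow> real mat" where
  "mat_inv M = (THE N. N \<in> carrier_mat (dim_row M) (dim_row M) \<and>
      M * N = 1\<^sub>m (dim_row M) \<and> N * M = 1\<^sub>m (dim_row M))"

definition mat_sqrt :: "real mat \<Rightarrow> real mat" where
  "mat_sqrt M = (THE S. S \<in> carrier_mat (dim_row M) (dim_row M) \<and> psd_mat S \<and> S * S = M)"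

definition ctrb_mat :: "real mat \<Rightarrow> real mat \<Rightarrow> real mat" where
  "ctrb_mat A B = (let n = dim_row A; c = dim_col B in
     mat n (n * c) (\<lambda>(i,j). (A ^\<^sub>m (j div c) * B) $$ (i, j mod c)))"

definition controllable :: "real mat \<Rightarrow> real mat \<Rightarrow> bool" where
  "controllable A B \<longleftrightarrow> vec_space.rank (dim_row A) (ctrb_mat A B) = dim_row A"

definition obs_mat :: "nat \<Rightarrow> real mat \<Rightarrow> real mat \<Rightarrow> real mat" where
  "obs_mat q A C = (let n = dim_row A; m = dim_row C in
     mat (m * q) n (\<lambda>(i,j). (C * A ^\<^sub>m (i div m)) $$ (i mod m, j)))"

definition observable :: "real mat \<Rightarrow> real mat \<Rightarrow> bool" where
  "observable A C \<longleftrightarrow>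
     vec_space.rank (dim_row C * dim_row A) (obs_mat (dim_row A) A C) = dim_row A"

definition toep_mat :: "nat \<Rightarrow> real mat \<Rightarrow> real mat \<Rightarrow> real mat \<Rightarrow> real mat" where
  "toep_mat p A C K = (let m = dim_row C in
     mat (m * p) (m * p) (\<lambda>(r,c). let i = r div m; j = c div m in
        if i = j then (if r mod m = c mod m then 1 else 0)
        else if j < i then (C * A ^\<^sub>m (i - j - 1) * K) $$ (r mod m, c mod m)
        else 0))"

definition blkdiag :: "nat \<Rightarrow> real mat \<Rightarrow> real mat" where
  "blkdiag p B = (let m = dim_row B in
     mat (m * p) (m * p) (\<lambda>(r,c). if r div m = c div m then B $$ (r mod m, c mod m) else 0))"

text \<open>Z_t = [y_(t-p); ...; y_(t-1)] (for t \<ge> p).\<close>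
definition stack_past :: "nat \<Rightarrow> nat \<Rightarrow> (nat \<Rightarrow> real vec) \<Rightarrow> nat \<Rightarrow> real vec" where
  "stack_past m p y t = vec (m * p) (\<lambda>i. y (t - p + i div m) $ (i mod m))"

definition data_mat :: "nat \<Rightarrow> nat \<Rightarrow> (nat \<Rightarrow> real vec) \<Rightarrow> nat \<Rightarrow> real mat" where
  "data_mat m p y k = mat (m * p) (k - p + 1) (\<lambda>(i,c). stack_past m p y (p + c) $ i)"

definition state_mat :: "nat \<Rightarrow> nat \<Rightarrow> (nat \<Rightarrow> real vec) \<Rightarrow> nat \<Rightarrow> real mat" where
  "state_mat n p xh k = mat n (k - p + 1) (\<lambda>(i,c). xh c $ i)"

definition cross_sum :: "nat \<Rightarrow> nat \<Rightarrow> (nat \<Rightarrow> real vec) \<Rightarrow> (nat \<Rightarrow> real vec) \<Rightarrow> nat \<Rightarrow> real mat" where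
  "cross_sum m p e y k = mat m (m * p)
     (\<lambda>(i,j). \<Sum>t\<in>{p..k}. e t $ i * stack_past m p y t $ j)"

text \<open>Random vectors in R^d are represented as measurable maps into the product space.\<close>
definition rv_space :: "nat \<Rightarrow> (nat \<Rightarrow> real) measure" where
  "rv_space d = PiM {..<d} (\<lambda>_. borel)"

definition gaussian_rv :: "'a measure \<Rightarrow> nat \<Rightarrow> real mat \<Rightarrow> ('a \<Rightarrow> nat \<Rightarrow> real) \<Rightarrow> bool" where
  "gaussian_rv M d S X \<longleftrightarrow> S \<in> carrier_mat d d \<and> psd_mat S \<and> X \<in> measurable M (rv_space d) \<and>
     (\<forall>a :: nat \<Rightarrow> real.
        let s = (\<Sum>i<d. \<Sum>j<d. a i * S $$ (i,j) * a j);
            Y = (\<lambda>\<omega>. \<Sum>i<d. a i * X \<omega> i) in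
        (s > 0 \<longrightarrow> distributed M lborel Y (normal_density 0 (sqrt s))) \<and>
        (s = 0 \<longrightarrow> (AE \<omega> in M. Y \<omega> = 0)))"

text \<open>Index set for the primitive random variables x_0, w_k, v_k.\<close>
datatype noise_src = X0 | W nat | V nat

definition second_moment :: "'a measure \<Rightarrow> nat \<Rightarrow> ('a \<Rightarrow> real vec) \<Rightarrow> real mat" where
  "second_moment M d X = mat d d (\<lambda>(i,j). integral\<^sup>L M (\<lambda>\<omega>. X \<omega> $ i * X \<omega> $ j))"

definition k1 :: "nat \<Rightarrow> nat \<Rightarrow> real \<Rightarrow> real" where
  "k1 m p \<delta> = real p + 128 * (real m * real p ^ 2 * ln 9 + real p * ln 2 + real p * ln (1 / \<delta>))"

definition k2 :: "nat \<Rightarrow> nat \<Rightarrow> nat \<Rightarrow> real \<Rightarrow> real \<Rightarrow> real \<Rightarrow> real \<Rightarrow> real" where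
  "k2 n m p \<delta> sigR normOp normGamma = real p + 64 / min 4 sigR *
     (4 * real p * real n * ln (real n * normOp ^ 2 * normGamma / \<delta> + 1)
      + 8 * real p * ln (real p * 5 ^ m / \<delta>))"

definition g1 :: "nat \<Rightarrow> nat \<Rightarrow> nat \<Rightarrow> real \<Rightarrow> real \<Rightarrow> real \<Rightarrow> real \<Rightarrow> real" where
  "g1 m k p \<delta> normRbar lam logdet = sqrt 8 * sqrt (normRbar * real m * real p) *
     sqrt (ln (3 * real m * real p / \<delta>) + 1 / 2 * ln (real (k - p + 1))
           + 1 / (2 * real m * real p) * logdet)"

end

theory Submission
  imports Defs
begin

text \<open>
  Expanding the innovations and the outputs backwards into the independent Gaussian sources and
  using the Riccati equation, the characteristic function of any linear functional of the
  innovations is that of an i.i.d. \<open>N(0, Rbar)\<close> sequence. After whitening, the state estimates and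
  the regressors \<open>Z_t\<close> are therefore linear functionals of past white noise.

  The innovation Gram matrix is bounded below by a chi-square Chernoff bound over a net, with the
  overlapping windows split into residue classes modulo \<open>p\<close>. Bound (b) is Markov's inequality for
  the sum of \<open>|GammaZ^(-1/2) Z_t|^2\<close>. Everything else rests on one self-normalised inequality: a product
  of one-step factors, each of conditional mean one, equals \<open>exp (Q/2)\<close> up to a determinant,
  where \<open>Q\<close> is the quadratic form of the score in the inverse Gram matrix; Markov's inequality over a
  net of directions makes it vector valued. Applied to \<open>Z_t\<close>, with the
  determinant controlled by (b), it gives (c). Applied to the state estimates and to each of the
  \<open>p\<close> blocks of \<open>E_t\<close>, it bounds the cross term in \<open>Z Z\<^sup>T\<close>, and \<open>k2\<close> is the sample size at which this
  cross term is at most a quarter of the sum of the two diagonal terms.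
\<close>

section \<open>The spectral theorem and positive definite matrices\<close>

text \<open>The failure budget is five times \<open>\<delta>\<close>: one for (b), one for the score
  in (c), whose determinant reuses the event of (b), and one each for the innovation Gram matrix,
  the state energy and the cross term of (a); the \<open>p\<close> blocks of the cross term share
  theirs as \<open>\<delta> / p\<close>. The obstacle is that marginally stable states need not mix
  and their variances may grow, so no stationary law is available for comparison. Two facts replace
  it: the regressors are linear in past white noise, and the variance of each linear functional is
  nondecreasing in time, so the covariance at the last time dominates all earlier ones. The explicit
  constants dictate the nets. At most \<open>5 ^ m\<close> unit directions, with one within 60
  degrees of any vector, produce the \<open>5 ^ m\<close> under the logarithms and a factor 4 = (1 /
  cos 60)^2 in squared norms. The term 128 * ln 9 of \<open>k1\<close> becomes, at the chi-square
  rate 3/256, 3/2 * ln 9 = ln 27 per coordinate, so a net of the unit ball with radius 1/4 may have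
  up to \<open>27 ^ d\<close> points.\<close>

definition ip :: "nat \<Rightarrow> (nat \<Rightarrow> real) \<Rightarrow> (nat \<Rightarrow> real) \<Rightarrow> real" where
  "ip n x y = (\<Sum>i<n. x i * y i)"

definition mv :: "nat \<Rightarrow> (nat \<Rightarrow> nat \<Rightarrow> real) \<Rightarrow> (nat \<Rightarrow> real) \<Rightarrow> nat \<Rightarrow> real" where
  "mv n a x i = (\<Sum>j<n. a i j * x j)"

lemma ip_add_left: "ip n (\<lambda>i. x i + y i) z = ip n x z + ip n y z"
  and ip_add_right: "ip n z (\<lambda>i. x i + y i) = ip n z x + ip n z y"
  and ip_diff_left: "ip n (\<lambda>i. x i - y i) z = ip n x z - ip n y z"
  and ip_diff_right: "ip n z (\<lambda>i. x i - y i) = ip n z x - ip n z y"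
  and ip_scale_left: "ip n (\<lambda>i. c * x i) z = c * ip n x z"
  and ip_scale_right: "ip n z (\<lambda>i. c * x i) = c * ip n z x"
  by (simp_all add: ip_def sum.distrib sum_subtractf algebra_simps sum_distrib_left)

lemma ip_sum_left: "ip n (\<lambda>i. \<Sum>k\<in>K. x k i) z = (\<Sum>k\<in>K. ip n (x k) z)"
  unfolding ip_def sum_distrib_right by (rule sum.swap)

lemmas ip_linear = ip_add_left ip_add_right ip_diff_left ip_diff_right ip_scale_left ip_scale_right

lemma ip_commute: "ip n x y = ip n y x"
  by (simp add: ip_def mult.commute)

lemma ip_ge_0: "ip n x x \<ge> 0"
  by (simp add: ip_def sum_nonneg)

lemma ip_eq_0_iff: "ip n x x = 0 \<longleftrightarrow> (\<forall>i<n. x i = 0)"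
  unfolding ip_def by (subst sum_nonneg_eq_0_iff) auto

lemma mv_add: "mv n a (\<lambda>i. x i + y i) r = mv n a x r + mv n a y r"
  and mv_scale: "mv n a (\<lambda>i. c * x i) r = c * mv n a x r"
  by (simp_all add: mv_def sum.distrib algebra_simps sum_distrib_left)

section \<open>Rayleigh quotients and the spectral theorem\<close>

lemma ip_mv_symmetric:
  assumes "\<And>i j. i < n \<Longrightarrow> j < n \<Longrightarrow> a i j = a j i"
  shows "ip n x (mv n a y) = ip n (mv n a x) y"
proof -
  have "ip n x (mv n a y) = (\<Sum>i<n. \<Sum>j<n. x i * a i j * y j)"
    by (simp add: ip_def mv_def sum_distrib_left mult.assoc)
  also have "\<dots> = (\<Sum>j<n. \<Sum>i<n. x i * a i j * y j)" by (rule sum.swap)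
  also have "\<dots> = ip n (mv n a x) y"
    unfolding ip_def mv_def sum_distrib_right
    by (intro sum.cong refl) (auto simp: assms)
  finally show ?thesis .
qed

text \<open>First-order optimality without derivatives: at t = -g / (c + 1) the quadratic equals
  -g^2 (c + 2) / (c + 1)^2. Dividing by c + 1 instead of c covers the case c = 0 as well.\<close>

lemma linear_coeff_eq_0:
  fixes g c :: real
  assumes "\<And>t. 0 \<le> 2 * t * g + t\<^sup>2 * c"
  shows "g = 0"
proof (rule ccontr)
  assume g: "g \<noteq> 0"
  have c: "c \<ge> 0" using assms[of 1] assms[of "-1"] by simp
  have "0 \<le> 2 * (- g / (c+1)) * g + (- g / (c+1))\<^sup>2 * c" by (rule assms)
  also have "\<dots> = - g\<^sup>2 * (c + 2) / (c+1)\<^sup>2"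
    using c by (simp add: divide_simps power2_eq_square) (simp add: algebra_simps)?
  also have "\<dots> < 0" using g c by (simp add: divide_neg_pos)
  finally show False by simp
qed

text \<open>A trace argument replaces dimension theory. The squared lengths of the projections of
  the n unit vectors onto the span of the \<open>u i\<close> add up to k < n, so some unit vector
  projects to length below one; its residual is orthogonal to every \<open>u i\<close> and non-zero
  in coordinate \<open>r\<close>.\<close>

lemma orthonormal_extension:
  assumes "k < n" and on: "\<And>i j. i < k \<Longrightarrow> j < k \<Longrightarrow> ip n (u i) (u j) = (if i = j then 1 else 0)"
  shows "\<exists>x. ip n x x > 0 \<and> (\<forall>i<k. ip n x (u i) = 0)"
proof -
  have "(\<Sum>r<n. \<Sum>i<k. (u i r)\<^sup>2) = (\<Sum>i<k. \<Sum>r<n. (u i r)\<^sup>2)" by (rule sum.swap)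
  also have "\<dots> = (\<Sum>i<k. ip n (u i) (u i))" by (simp add: ip_def power2_eq_square)
  also have "\<dots> = real k" using on by simp
  finally have s: "(\<Sum>r<n. \<Sum>i<k. (u i r)\<^sup>2) = real k" .
  have "\<exists>r<n. (\<Sum>i<k. (u i r)\<^sup>2) < 1"
  proof (rule ccontr)
    assume "\<not> ?thesis"
    then have "(\<Sum>r<n. 1) \<le> (\<Sum>r<n. \<Sum>i<k. (u i r)\<^sup>2)" by (intro sum_mono) force
    then show False using s \<open>k < n\<close> by simp
  qed
  then obtain r where r: "r < n" "(\<Sum>i<k. (u i r)\<^sup>2) < 1" by blast
  define e where "e = (\<lambda>l::nat. if l = r then 1 else (0::real))"
  define x where "x = (\<lambda>l. e l - (\<Sum>i<k. u i r * u i l))"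
  have e: "ip n e y = y r" for y
  proof -
    have "ip n e y = (\<Sum>i<n. if i = r then y r else 0)"
      unfolding ip_def e_def by (intro sum.cong) auto
    then show ?thesis using r by simp
  qed
  have orth: "ip n x (u j) = 0" if "j < k" for j
  proof -
    have "ip n x (u j) = u j r - (\<Sum>i<k. u i r * ip n (u i) (u j))"
      unfolding x_def by (simp add: ip_diff_left e ip_sum_left ip_scale_left)
    also have "(\<Sum>i<k. u i r * ip n (u i) (u j)) = (\<Sum>i<k. if i = j then u j r else 0)"
      using on that by (intro sum.cong) auto
    finally show ?thesis using that by simp
  qed
  have "ip n x e = 1 - (\<Sum>i<k. (u i r)\<^sup>2)"
    using e[of x] by (simp add: ip_commute) (simp add: x_def e_def power2_eq_square)
  then have "x r \<noteq> 0" using r e[of x] by (simp add: ip_commute)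
  then have "ip n x x \<noteq> 0" using r by (auto simp: ip_eq_0_iff)
  then show ?thesis using orth ip_ge_0[of n x] by (intro exI[of _ x]) auto
qed

text \<open>Vectors are functions on all of \<open>nat\<close>, so compactness comes from
  Tychonoff's theorem. Fixing the coordinates from n on at zero places the slice inside a product of
  compact intervals, in which it is closed.\<close>

lemma compact_unit_sphere_slice:
  "compact {x :: nat \<Rightarrow> real. (\<forall>i\<ge>n. x i = 0) \<and> ip n x x = 1 \<and> (\<forall>i<k. ip n x (u i) = 0)}"
proof -
  let ?S = "{x :: nat \<Rightarrow> real. (\<forall>i\<ge>n. x i = 0) \<and> ip n x x = 1 \<and> (\<forall>i<k. ip n x (u i) = 0)}"
  let ?B = "PiE UNIV (\<lambda>i. if i < n then {-1..1} else {0::real})"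
  have "compactin (product_topology (\<lambda>i. euclidean) UNIV) ?B"
    by (subst compactin_PiE) auto
  then have B: "compact ?B" by (simp add: euclidean_product_topology)
  have c: "continuous_on UNIV (\<lambda>x::nat \<Rightarrow> real. ip n x (u i))" for i
    unfolding ip_def by (intro continuous_intros continuous_on_product_coordinates)
  have c2: "continuous_on UNIV (\<lambda>x::nat \<Rightarrow> real. ip n x x)"
    unfolding ip_def by (intro continuous_intros continuous_on_product_coordinates)
  have "closed ({x. ip n x x = 1} \<inter> (\<Inter>i\<in>{..<k}. {x :: nat \<Rightarrow> real. ip n x (u i) = 0}))"
    by (intro closed_Int closed_INT ballI closed_Collect_eq c c2 continuous_on_const)
  then have "compact (?B \<inter> ({x. ip n x x = 1} \<inter> (\<Inter>i\<in>{..<k}. {x :: nat \<Rightarrow> real. ip n x (u i) = 0})))"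
    by (rule compact_Int_closed[OF B])
  moreover have "?B \<inter> ({x. ip n x x = 1} \<inter> (\<Inter>i\<in>{..<k}. {x :: nat \<Rightarrow> real. ip n x (u i) = 0})) = ?S"
  proof (rule subset_antisym; rule subsetI)
    fix x assume x: "x \<in> ?B \<inter> ({x. ip n x x = 1} \<inter> (\<Inter>i\<in>{..<k}. {x. ip n x (u i) = 0}))"
    then have *: "x i \<in> (if i < n then {-1..1} else {0})" for i by (blast dest: PiE_mem)
    have "x i = 0" if "i \<ge> n" for i using *[of i] that by simp
    then show "x \<in> ?S" using x by simp
  next
    fix x assume x: "x \<in> ?S"
    have "\<bar>x i\<bar> \<le> 1" if "i < n" for i
    proof -
      have "(x i)\<^sup>2 \<le> (\<Sum>i<n. (x i)\<^sup>2)" using that by (intro member_le_sum) auto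
      also have "\<dots> = 1" using x by (simp add: ip_def power2_eq_square)
      finally show ?thesis by (simp add: abs_square_le_1)
    qed
    then have "x i \<in> (if i < n then {-1..1} else {0})" for i
      using x by (auto simp: abs_le_iff minus_le_iff)
    then have "x \<in> ?B" by (simp only: PiE_UNIV_domain) auto
    then show "x \<in> ?B \<inter> ({x. ip n x x = 1} \<inter> (\<Inter>i\<in>{..<k}. {x. ip n x (u i) = 0}))"
      using x by blast
  qed
  ultimately show ?thesis by simp
qed

text \<open>Maximise the Rayleigh quotient over the unit vectors orthogonal to the eigenvectors
  found so far. By symmetry the residual \<open>h = l x - a x\<close> of a maximiser is again
  orthogonal to them, so moving from \<open>x\<close> along \<open>h\<close> is admissible, and
  first-order optimality along \<open>h\<close> says that \<open>h\<close> has norm zero.\<close>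

lemma next_eigenvector:
  assumes sym: "\<And>i j. i < n \<Longrightarrow> j < n \<Longrightarrow> a i j = a j i"
    and "k < n"
    and on: "\<And>i j. i < k \<Longrightarrow> j < k \<Longrightarrow> ip n (u i) (u j) = (if i = j then 1 else 0)"
    and ev: "\<And>i r. i < k \<Longrightarrow> r < n \<Longrightarrow> mv n a (u i) r = d i * u i r"
  shows "\<exists>x l. ip n x x = 1 \<and> (\<forall>i<k. ip n x (u i) = 0) \<and> (\<forall>r<n. mv n a x r = l * x r)"
proof -
  let ?S = "{x :: nat \<Rightarrow> real. (\<forall>i\<ge>n. x i = 0) \<and> ip n x x = 1 \<and> (\<forall>i<k. ip n x (u i) = 0)}"
  define F where "F x = ip n x (mv n a x)" for x
  have norm: "\<exists>y\<in>?S. F y = F x / ip n x x"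
    if x: "ip n x x > 0" "\<forall>i<k. ip n x (u i) = 0" for x
  proof -
    define c where "c = 1 / sqrt (ip n x x)"
    define y where "y i = (if i < n then c * x i else 0)" for i
    have y: "ip n y z = c * ip n x z" "ip n z y = c * ip n z x" for z
      unfolding ip_def y_def sum_distrib_left by (auto intro!: sum.cong)
    have my: "mv n a y = (\<lambda>i. c * mv n a x i)"
      unfolding mv_def y_def sum_distrib_left by (auto intro!: sum.cong)
    have c2: "c * c = 1 / ip n x x" using x by (simp add: c_def)
    have "F y = (c * c) * F x" unfolding F_def my by (simp add: y ip_linear)
    moreover have "ip n y y = 1" using x c2 by (simp add: y mult.assoc[symmetric])
    ultimately show ?thesis using x c2 by (intro bexI[of _ y]) (auto simp: y y_def)
  qed
  have "continuous_on ?S F"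
    unfolding F_def ip_def mv_def by (intro continuous_intros continuous_on_subset[OF continuous_on_product_coordinates]) auto
  moreover have "?S \<noteq> {}" using orthonormal_extension[OF \<open>k < n\<close> on] norm by blast
  ultimately have "\<exists>x\<in>?S. \<forall>y\<in>?S. F y \<le> F x"
    by (intro continuous_attains_sup compact_unit_sphere_slice)
  then obtain x where x: "x \<in> ?S" and mx: "\<forall>y\<in>?S. F y \<le> F x" by (elim bexE)
  define l where "l = F x"
  have le: "F y \<le> l * ip n y y" if yu: "\<forall>i<k. ip n y (u i) = 0" for y
  proof (cases "ip n y y > 0")
    case True
    obtain z where "z \<in> ?S" "F z = F y / ip n y y" using norm[OF True yu] by (elim bexE)
    then show ?thesis using bspec[OF mx, of z] True by (simp add: l_def pos_divide_le_eq)
  next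
    case False
    then have "\<forall>i<n. y i = 0" using ip_ge_0[of n y] by (simp flip: ip_eq_0_iff)
    then show ?thesis by (simp add: F_def ip_def)
  qed
  define h where "h i = l * x i - mv n a x i" for i
  have hu: "ip n h (u i) = 0" if "i < k" for i
  proof -
    have "ip n (mv n a x) (u i) = ip n x (mv n a (u i))" by (simp add: ip_mv_symmetric sym)
    also have "\<dots> = d i * ip n x (u i)"
      unfolding ip_def sum_distrib_left by (intro sum.cong) (auto simp: ev that)
    also have "\<dots> = 0" using x that by simp
    finally show ?thesis using x that unfolding h_def by (simp add: ip_linear)
  qed
  have "ip n h h = 0"
  proof (rule linear_coeff_eq_0)
    fix t
    let ?y = "\<lambda>i. x i + t * h i"
    have 1: "F ?y \<le> l * ip n ?y ?y"
      by (rule le) (use x hu in \<open>auto simp: ip_linear\<close>)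
    have my: "mv n a ?y = (\<lambda>i. mv n a x i + t * mv n a h i)" by (auto simp: mv_add mv_scale)
    have hx: "ip n x (mv n a h) = ip n (mv n a x) h" by (simp add: ip_mv_symmetric sym)
    have "F ?y = F x + 2 * t * ip n (mv n a x) h + t\<^sup>2 * F h"
      unfolding F_def my by (simp add: ip_linear hx ip_commute[of n h "mv n a x"] algebra_simps power2_eq_square)
    moreover have "ip n ?y ?y = 1 + 2 * t * ip n x h + t\<^sup>2 * ip n h h"
      using x by (simp add: ip_linear ip_commute[of n h x] algebra_simps power2_eq_square)
    ultimately have 2: "0 \<le> 2 * t * (l * ip n x h - ip n (mv n a x) h) + t\<^sup>2 * (l * ip n h h - F h)"
      using 1 by (simp only: l_def[symmetric]) (simp add: algebra_simps)
    have "ip n h h = l * ip n x h - ip n (mv n a x) h"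
    proof -
      have "ip n h h = ip n (\<lambda>i. l * x i - mv n a x i) h" by (simp add: h_def[abs_def])
      then show ?thesis by (simp add: ip_linear)
    qed
    then show "0 \<le> 2 * t * ip n h h + t\<^sup>2 * (l * ip n h h - F h)"
      using 2 by (simp only:)
  qed
  then have "\<forall>r<n. mv n a x r = l * x r" by (auto simp: ip_eq_0_iff h_def)
  then show ?thesis using x by blast
qed

lemma orthonormal_eigenvectors:
  assumes sym: "\<And>i j. i < n \<Longrightarrow> j < n \<Longrightarrow> a i j = a j i" and "k \<le> n"
  shows "\<exists>u d. (\<forall>i<k. \<forall>j<k. ip n (u i) (u j) = (if i = j then 1 else 0)) \<and>
    (\<forall>i<k. \<forall>r<n. mv n a (u i) r = d i * u i r)"
  using \<open>k \<le> n\<close>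
proof (induction k)
  case (Suc k)
  then obtain u d where "\<forall>i<k. \<forall>j<k. ip n (u i) (u j) = (if i = j then 1 else 0)"
    "\<forall>i<k. \<forall>r<n. mv n a (u i) r = d i * u i r" using Suc_leD by blast
  then have u: "\<And>i j. i < k \<Longrightarrow> j < k \<Longrightarrow> ip n (u i) (u j) = (if i = j then 1 else 0)"
    "\<And>i r. i < k \<Longrightarrow> r < n \<Longrightarrow> mv n a (u i) r = d i * u i r" by blast+
  have "\<exists>x l. ip n x x = 1 \<and> (\<forall>i<k. ip n x (u i) = 0) \<and> (\<forall>r<n. mv n a x r = l * x r)"
    by (rule next_eigenvector[of n a k u d]) (use sym u Suc.prems in auto)
  then obtain x l where x: "ip n x x = 1" "\<forall>i<k. ip n x (u i) = 0" "\<forall>r<n. mv n a x r = l * x r"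
    by blast
  show ?case
    by (intro exI[of _ "u(k := x)"] exI[of _ "d(k := l)"])
      (use u x in \<open>auto simp: less_Suc_eq ip_commute\<close>)
qed auto

theorem real_spectral:
  assumes A: "A \<in> carrier_mat n n" and sym: "transpose_mat A = (A :: real mat)"
  shows "\<exists>U d. U \<in> carrier_mat n n \<and> transpose_mat U * U = 1\<^sub>m n \<and> U * transpose_mat U = 1\<^sub>m n \<and>
    A = U * mat_diag n d * transpose_mat U"
proof -
  have s: "A $$ (i,j) = A $$ (j,i)" if "i < n" "j < n" for i j
    using arg_cong[OF sym, of "\<lambda>M. M $$ (i,j)"] A that by simp
  have "\<exists>u d. (\<forall>i<n. \<forall>j<n. ip n (u i) (u j) = (if i = j then 1 else 0)) \<and>
    (\<forall>i<n. \<forall>r<n. mv n (\<lambda>i j. A $$ (i,j)) (u i) r = d i * u i r)"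
    by (rule orthonormal_eigenvectors) (simp_all add: s)
  then obtain u d where "\<forall>i<n. \<forall>j<n. ip n (u i) (u j) = (if i = j then 1 else 0)"
    "\<forall>i<n. \<forall>r<n. mv n (\<lambda>i j. A $$ (i,j)) (u i) r = d i * u i r" by (elim exE conjE)
  then have u: "\<And>i j. i < n \<Longrightarrow> j < n \<Longrightarrow> ip n (u i) (u j) = (if i = j then 1 else 0)"
    "\<And>i r. i < n \<Longrightarrow> r < n \<Longrightarrow> mv n (\<lambda>i j. A $$ (i,j)) (u i) r = d i * u i r" by simp_all
  define U where "U = mat n n (\<lambda>(i,j). u j i)"
  have U: "U \<in> carrier_mat n n" by (simp add: U_def)
  have 1: "transpose_mat U * U = 1\<^sub>m n"
    by (rule eq_matI) (auto simp: U_def scalar_prod_def u(1)[unfolded ip_def lessThan_atLeast0])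
  have 2: "U * transpose_mat U = 1\<^sub>m n" using mat_mult_left_right_inverse[OF _ U 1] U by auto
  have "A * U = U * mat_diag n d"
    apply (rule eq_matI)
    using A u(2)[unfolded mv_def lessThan_atLeast0]
    by (auto simp: U_def scalar_prod_def mat_diag_def if_distrib cong: if_cong)
  then have "A * U * transpose_mat U = U * mat_diag n d * transpose_mat U" by simp
  moreover have "A * U * transpose_mat U = A" using A U 2 by (simp add: assoc_mult_mat[of _ n n _ n _ n])
  ultimately show ?thesis using U 1 2 by metis
qed

section \<open>Definiteness, the Loewner order and quadratic forms\<close>

lemma mat_diag_carrier [simp]: "mat_diag n d \<in> carrier_mat n n"
  and dim_mat_diag [simp]: "dim_row (mat_diag n d) = n" "dim_col (mat_diag n d) = n"
  by (simp_all add: mat_diag_def)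

lemma square_mult_carrier [simp]:
  "A \<in> carrier_mat n n \<Longrightarrow> B \<in> carrier_mat n n \<Longrightarrow> A * B \<in> carrier_mat n n"
  by (rule mult_carrier_mat)

lemma mult_mat_zero_vec [simp]: "M \<in> carrier_mat r c \<Longrightarrow> M *\<^sub>v 0\<^sub>v c = (0\<^sub>v r :: real vec)"
  by (intro eq_vecI) auto

lemma psd_matD:
  assumes "psd_mat M" "M \<in> carrier_mat n n"
  shows "transpose_mat M = M" "\<And>x. x \<in> carrier_vec n \<Longrightarrow> 0 \<le> x \<bullet> (M *\<^sub>v x)"
  using assms by (auto simp: psd_mat_def)

lemma pd_matD:
  assumes "pd_mat M" "M \<in> carrier_mat n n"
  shows "transpose_mat M = M" "\<And>x. x \<in> carrier_vec n \<Longrightarrow> x \<noteq> 0\<^sub>v n \<Longrightarrow> 0 < x \<bullet> (M *\<^sub>v x)"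
  using assms by (auto simp: pd_mat_def)

lemma pd_imp_psd: "pd_mat M \<Longrightarrow> psd_mat M"
proof -
  assume M: "pd_mat M"
  then have c: "M \<in> carrier_mat (dim_row M) (dim_row M)" by (simp add: pd_mat_def)
  have "0 \<le> x \<bullet> (M *\<^sub>v x)" if x: "x \<in> carrier_vec (dim_row M)" for x
  proof (cases "x = 0\<^sub>v (dim_row M)")
    case True
    then have "M *\<^sub>v x = 0\<^sub>v (dim_row M)" using mult_mat_zero_vec[OF c] by (simp only:)
    then show ?thesis using True by (simp only: scalar_prod_right_zero[OF x] scalar_prod_left_zero[OF zero_carrier_vec] order_refl)
  next
    case False
    then show ?thesis using M x by (auto simp: pd_mat_def less_imp_le)
  qed
  then show ?thesis using M by (auto simp: pd_mat_def psd_mat_def)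
qed

lemma loewner_geI:
  assumes A: "A \<in> carrier_mat n n" and B: "B \<in> carrier_mat n n"
    and "transpose_mat A = A" "transpose_mat B = B"
    and q: "\<And>x. x \<in> carrier_vec n \<Longrightarrow> x \<bullet> (B *\<^sub>v x) \<le> x \<bullet> (A *\<^sub>v x)"
  shows "A \<succeq>\<^sub>L B"
proof -
  have AB: "A - B \<in> carrier_mat n n" by (rule minus_carrier_mat[OF B])
  have "x \<bullet> ((A - B) *\<^sub>v x) = x \<bullet> (A *\<^sub>v x) - x \<bullet> (B *\<^sub>v x)" if x: "x \<in> carrier_vec n" for x
    unfolding minus_mult_distrib_mat_vec[OF A B x]
    by (rule scalar_prod_minus_distrib[OF x mult_mat_vec_carrier[OF A x] mult_mat_vec_carrier[OF B x]])
  moreover have "transpose_mat (A - B) = A - B"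
    using assms by (simp add: transpose_minus[OF A B])
  ultimately show ?thesis
    using A B q AB unfolding loewner_ge_def psd_mat_def by auto
qed

lemma quad_add_scaled:
  assumes S: "S \<in> carrier_mat n n" "transpose_mat S = S"
    and x: "x \<in> carrier_vec n" and y: "y \<in> carrier_vec n"
  shows "(x + t \<cdot>\<^sub>v y) \<bullet> (S *\<^sub>v (x + t \<cdot>\<^sub>v y)) = x \<bullet> (S *\<^sub>v x) + 2 * t * (x \<bullet> (S *\<^sub>v y)) + t\<^sup>2 * (y \<bullet> (S *\<^sub>v y :: real vec))"
proof -
  note c = x y mult_mat_vec_carrier[OF S(1) x] mult_mat_vec_carrier[OF S(1) y]
  have yx: "y \<bullet> (S *\<^sub>v x) = x \<bullet> (S *\<^sub>v y)"
    using transpose_vec_mult_scalar[OF S(1) x y] S c comm_scalar_prod[of "S *\<^sub>v y" n x] by simp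
  have "S *\<^sub>v (x + t \<cdot>\<^sub>v y) = S *\<^sub>v x + t \<cdot>\<^sub>v (S *\<^sub>v y)"
    using S c by (simp add: mult_add_distrib_mat_vec[of S n n] mult_mat_vec[of S n n])
  then show ?thesis using c
    by (simp add: add_scalar_prod_distrib[of _ n] scalar_prod_add_distrib[of _ n] yx)
      (simp add: algebra_simps power2_eq_square)
qed

lemma discriminant_nonneg_quadratic:
  fixes a b c :: real
  assumes "\<And>t. 0 \<le> a + 2 * t * b + t\<^sup>2 * c" and "c \<ge> 0"
  shows "b\<^sup>2 \<le> a * c"
proof (cases "c = 0")
  case True
  have "b = 0"
  proof (rule ccontr)
    assume "b \<noteq> 0"
    \<comment> \<open>For c = 0 this t makes the affine function equal to -1.\<close>
    then show False using assms(1)[of "- (a + 1) / (2 * b)"] True by (simp add: field_simps)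
  qed
  then show ?thesis using True by simp
next
  case False
  then have c: "c > 0" using \<open>c \<ge> 0\<close> by simp
  have "0 \<le> a + 2 * (- b / c) * b + (- b / c)\<^sup>2 * c" by (rule assms(1))
  also have "\<dots> = a - b\<^sup>2 / c" using c by (simp add: field_simps power2_eq_square)
  finally show ?thesis using c by (simp add: field_simps)
qed

text \<open>The form at \<open>x + t y\<close> is a nonnegative quadratic in t, so its discriminant
  is not positive.\<close>

lemma psd_cauchy_schwarz:
  assumes S: "psd_mat S" "S \<in> carrier_mat n n" and x: "x \<in> carrier_vec n" and y: "y \<in> carrier_vec n"
  shows "(x \<bullet> (S *\<^sub>v y))\<^sup>2 \<le> (x \<bullet> (S *\<^sub>v x)) * (y \<bullet> (S *\<^sub>v y))"
proof (rule discriminant_nonneg_quadratic)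
  fix t :: real
  show "0 \<le> x \<bullet> (S *\<^sub>v x) + 2 * t * (x \<bullet> (S *\<^sub>v y)) + t\<^sup>2 * (y \<bullet> (S *\<^sub>v y))"
    using psd_matD(2)[OF S, of "x + t \<cdot>\<^sub>v y"] x y
    by (simp add: quad_add_scaled[OF S(2) psd_matD(1)[OF S] x y])
qed (rule psd_matD(2)[OF S y])

lemma scalar_self_ge_0: "0 \<le> (x :: real vec) \<bullet> x"
  by (simp add: scalar_prod_def sum_nonneg)

lemma scalar_self_eq_0: "x \<in> carrier_vec n \<Longrightarrow> (x :: real vec) \<bullet> x = 0 \<longleftrightarrow> x = 0\<^sub>v n"
  by (auto simp: scalar_prod_def sum_nonneg_eq_0_iff intro!: eq_vecI)

lemma psd_one_mat: "psd_mat (1\<^sub>m n)"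
  by (auto simp: psd_mat_def scalar_self_ge_0)

lemma vec_cauchy_schwarz:
  assumes "x \<in> carrier_vec n" "y \<in> carrier_vec n"
  shows "(x \<bullet> y)\<^sup>2 \<le> (x \<bullet> x) * (y \<bullet> (y :: real vec))"
  using psd_cauchy_schwarz[OF psd_one_mat one_carrier_mat assms] assms by simp

text \<open>Cauchy-Schwarz in the form S, tested against y = S x, bounds the square of |S x|^2 by
  zero.\<close>

lemma psd_quad_eq_0:
  assumes S: "psd_mat S" "S \<in> carrier_mat n n" and x: "x \<in> carrier_vec n" and 0: "x \<bullet> (S *\<^sub>v x) = 0"
  shows "S *\<^sub>v x = 0\<^sub>v n"
proof -
  let ?y = "S *\<^sub>v x"
  have y: "?y \<in> carrier_vec n" using S x by simp
  have "(x \<bullet> (S *\<^sub>v ?y))\<^sup>2 \<le> 0" using psd_cauchy_schwarz[OF S x y] 0 by simp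
  moreover have "x \<bullet> (S *\<^sub>v ?y) = ?y \<bullet> ?y"
    using transpose_vec_mult_scalar[OF S(2) y x] psd_matD(1)[OF S] by simp
  ultimately show ?thesis using y by (simp add: scalar_self_eq_0)
qed

lemma mat_diag_mult_vec:
  assumes "z \<in> carrier_vec n" "i < n"
  shows "(mat_diag n d *\<^sub>v z) $ i = d i * (z $ i :: real)"
  using assms by (simp add: mat_diag_def scalar_prod_def if_distrib if_distribR cong: if_cong)

lemma quad_mat_diag:
  assumes z: "z \<in> carrier_vec n"
  shows "z \<bullet> (mat_diag n d *\<^sub>v z) = (\<Sum>i<n. d i * (z $ i)\<^sup>2 :: real)"
proof -
  have "(mat_diag n d *\<^sub>v z) $ i = d i * z $ i" if "i < n" for i
    using mat_diag_mult_vec[OF z that] .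
  then show ?thesis using z
    by (simp add: scalar_prod_def[of z] lessThan_atLeast0 power2_eq_square mult.left_commute del: index_mult_mat_vec)
qed

lemma scalar_self_sum: "z \<in> carrier_vec n \<Longrightarrow> z \<bullet> z = (\<Sum>i<n. (z $ i :: real)\<^sup>2)"
  by (simp add: scalar_prod_def lessThan_atLeast0 power2_eq_square)

lemma quad_spectral:
  assumes U: "U \<in> carrier_mat n n" and x: "x \<in> carrier_vec n"
  shows "x \<bullet> (U * mat_diag n d * transpose_mat U *\<^sub>v x) = (\<Sum>i<n. d i * ((transpose_mat U *\<^sub>v x) $ i)\<^sup>2 :: real)"
proof -
  have z: "transpose_mat U *\<^sub>v x \<in> carrier_vec n" using U x by simp
  have D: "mat_diag n d \<in> carrier_mat n n" by simp
  have "U * mat_diag n d * transpose_mat U *\<^sub>v x = U *\<^sub>v (mat_diag n d *\<^sub>v (transpose_mat U *\<^sub>v x))"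
    using U x D by (simp add: assoc_mult_mat_vec[of _ n n _ n])
  then have "x \<bullet> (U * mat_diag n d * transpose_mat U *\<^sub>v x) =
    (transpose_mat U *\<^sub>v x) \<bullet> (mat_diag n d *\<^sub>v (transpose_mat U *\<^sub>v x))"
    using transpose_vec_mult_scalar[OF U mult_mat_vec_carrier[OF D z] x] by simp
  then show ?thesis by (simp add: quad_mat_diag[OF z])
qed

lemma orthogonal_norm:
  assumes U: "U \<in> carrier_mat n n" "U * transpose_mat U = 1\<^sub>m n" and x: "x \<in> carrier_vec n"
  shows "(\<Sum>i<n. ((transpose_mat U *\<^sub>v x) $ i)\<^sup>2) = x \<bullet> (x :: real vec)"
  using quad_spectral[OF U(1) x, of "\<lambda>_. 1"] U x by simp

lemma spectral_col:
  assumes U: "U \<in> carrier_mat n n" "transpose_mat U * U = 1\<^sub>m n" and i: "i < n"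
  shows "col U i \<in> carrier_vec n" "col U i \<bullet> col U i = (1::real)"
    "U * mat_diag n d * transpose_mat U *\<^sub>v col U i = d i \<cdot>\<^sub>v col U i"
proof -
  show c: "col U i \<in> carrier_vec n" using U i by simp
  have e: "transpose_mat U *\<^sub>v col U i = unit_vec n i"
  proof (rule eq_vecI)
    fix j assume "j < dim_vec (unit_vec n i)"
    then have j: "j < n" by simp
    then have "(transpose_mat U *\<^sub>v col U i) $ j = (transpose_mat U * U) $$ (j,i)" using U(1) i by simp
    then show "(transpose_mat U *\<^sub>v col U i) $ j = unit_vec n i $ j"
      using i j by (simp add: U(2) unit_vec_def)
  qed (use U in simp)
  have "(transpose_mat U * U) $$ (i,i) = col U i \<bullet> col U i" using U(1) i by simp
  then show "col U i \<bullet> col U i = 1" using i by (simp add: U(2))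
  have D: "mat_diag n d *\<^sub>v unit_vec n i = d i \<cdot>\<^sub>v unit_vec n i"
    using i by (intro eq_vecI) (auto simp: mat_diag_mult_vec simp del: index_mult_mat_vec)
  have "U * mat_diag n d * transpose_mat U *\<^sub>v col U i = U *\<^sub>v (mat_diag n d *\<^sub>v (transpose_mat U *\<^sub>v col U i))"
    using U c by (simp add: assoc_mult_mat_vec[of _ n n _ n])
  also have "\<dots> = d i \<cdot>\<^sub>v (U *\<^sub>v unit_vec n i)" unfolding e D using U
    by (simp add: mult_mat_vec[of _ n n])
  also have "U *\<^sub>v unit_vec n i = col U i"
    using U i by (intro eq_vecI) (auto simp: scalar_prod_right_unit[of _ n])
  finally show "U * mat_diag n d * transpose_mat U *\<^sub>v col U i = d i \<cdot>\<^sub>v col U i" .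
qed

lemma spectral_eigenvalue_quad:
  assumes U: "U \<in> carrier_mat n n" "transpose_mat U * U = 1\<^sub>m n" and i: "i < n"
    and M: "M = U * mat_diag n d * transpose_mat U"
  shows "col U i \<bullet> (M *\<^sub>v col U i) = (d i :: real)"
  using spectral_col[OF U i] by (simp add: M scalar_prod_smult_right)

lemma spectral_product:
  assumes U: "U \<in> carrier_mat n n" "transpose_mat U * U = 1\<^sub>m n"
  shows "(U * mat_diag n c * transpose_mat U) * (U * mat_diag n d * transpose_mat U) =
    U * mat_diag n (\<lambda>i. c i * d i :: real) * transpose_mat U"
proof -
  have c: "mat_diag n c \<in> carrier_mat n n" "mat_diag n d \<in> carrier_mat n n" "transpose_mat U \<in> carrier_mat n n"
    using U by auto
  have "(U * mat_diag n c * transpose_mat U) * (U * mat_diag n d * transpose_mat U) =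
    U * (mat_diag n c * ((transpose_mat U * U) * (mat_diag n d * transpose_mat U)))"
    using U(1) c by (simp add: assoc_mult_mat[of _ n n _ n _ n])
  also have "\<dots> = U * ((mat_diag n c * mat_diag n d) * transpose_mat U)"
    using U c(3) by (simp add: assoc_mult_mat[OF c] del: mat_diag_diag)
  also have "\<dots> = U * mat_diag n (\<lambda>i. c i * d i) * transpose_mat U"
    using U(1) by (simp add: assoc_mult_mat[of _ n n _ n _ n] mat_diag_diag)
  finally show ?thesis .
qed

lemma spectral_symmetric:
  assumes U: "U \<in> carrier_mat n n"
  shows "transpose_mat (U * mat_diag n d * transpose_mat U) = U * mat_diag n (d :: nat \<Rightarrow> real) * transpose_mat U"
proof -
  have "transpose_mat (mat_diag n d) = mat_diag n d" by (auto simp: mat_diag_def)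
  then show ?thesis using U
    by (simp add: transpose_mult[of _ n n _ n] assoc_mult_mat[of _ n n _ n _ n])
qed

section \<open>Square roots\<close>

lemma psd_sqrt_exists:
  assumes M: "M \<in> carrier_mat n n" "psd_mat M"
  shows "\<exists>S \<in> carrier_mat n n. psd_mat S \<and> S * S = M"
proof -
  obtain U d where U: "U \<in> carrier_mat n n" "transpose_mat U * U = 1\<^sub>m n" "U * transpose_mat U = 1\<^sub>m n"
    and Md: "M = U * mat_diag n d * transpose_mat U"
    using real_spectral[OF M(1) psd_matD(1)[OF M(2,1)]] by blast
  have d: "d i \<ge> 0" if "i < n" for i
    using spectral_eigenvalue_quad[OF U(1,2) that Md] psd_matD(2)[OF M(2,1)] spectral_col(1)[OF U(1,2) that] by metis
  let ?S = "U * mat_diag n (\<lambda>i. sqrt (d i)) * transpose_mat U"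
  have S: "?S \<in> carrier_mat n n" using U by simp
  have "mat_diag n (\<lambda>i. sqrt (d i) * sqrt (d i)) = mat_diag n d" using d by (auto simp: mat_diag_def)
  then have "?S * ?S = M" by (simp add: spectral_product[OF U(1,2)] Md)
  moreover have "0 \<le> x \<bullet> (?S *\<^sub>v x)" if "x \<in> carrier_vec n" for x
    unfolding quad_spectral[OF U(1) that] using d by (intro sum_nonneg) auto
  then have "psd_mat ?S" using S U spectral_symmetric[OF U(1)] by (auto simp: psd_mat_def)
  ultimately show ?thesis using S by blast
qed

lemma psd_sqrt_of_pd_is_pd:
  assumes S: "S \<in> carrier_mat n n" "psd_mat S" and F: "pd_mat (S * S)"
  shows "pd_mat S"
proof -
  have "x \<bullet> (S *\<^sub>v x) > 0" if x: "x \<in> carrier_vec n" "x \<noteq> 0\<^sub>v n" for x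
  proof -
    have "x \<bullet> (S *\<^sub>v x) \<noteq> 0"
    proof
      assume "x \<bullet> (S *\<^sub>v x) = 0"
      then have "S *\<^sub>v x = 0\<^sub>v n" by (rule psd_quad_eq_0[OF S(2,1) x(1)])
      then have "S * S *\<^sub>v x = 0\<^sub>v n" using S x by (simp add: assoc_mult_mat_vec[of _ n n _ n])
      moreover have "x \<bullet> (S * S *\<^sub>v x) > 0" using pd_matD(2)[OF F _ x] S by simp
      ultimately show False using x by simp
    qed
    then show ?thesis using psd_matD(2)[OF S(2,1) x(1)] by simp
  qed
  then show ?thesis using S by (auto simp: pd_mat_def psd_mat_def)
qed

text \<open>With X = S - T one has S X + X T = S^2 - T^2 = 0. Testing this on a unit eigenvector u
  of X with eigenvalue d gives d * (u \<bullet> S u + u \<bullet> T u) = 0, and both forms are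
  positive, so X has only the eigenvalue zero. Uniqueness is what lets the definite description in
  \<open>mat_sqrt\<close> denote.\<close>

lemma pd_sqrt_unique:
  assumes F: "pd_mat F" and S: "S \<in> carrier_mat n n" "psd_mat S" "S * S = F"
    and T: "T \<in> carrier_mat n n" "psd_mat T" "T * T = F"
  shows "S = T"
proof -
  have pd: "pd_mat S" "pd_mat T" using psd_sqrt_of_pd_is_pd[of _ n] assms by auto
  let ?X = "S - T"
  have X: "?X \<in> carrier_mat n n" by (rule minus_carrier_mat[OF T(1)])
  have "transpose_mat ?X = ?X" using psd_matD(1) S T by (simp add: transpose_minus[of _ n n])
  then obtain U d where U: "U \<in> carrier_mat n n" "transpose_mat U * U = 1\<^sub>m n" "U * transpose_mat U = 1\<^sub>m n"
    and Xd: "?X = U * mat_diag n d * transpose_mat U"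
    using real_spectral[OF X] by blast
  have "d i = 0" if i: "i < n" for i
  proof -
    let ?u = "col U i"
    note u = spectral_col(1,2)[OF U(1,2) i] spectral_col(3)[OF U(1,2) i, of d, folded Xd]
    have u0: "?u \<noteq> 0\<^sub>v n" using u(2) by auto
    have c: "S *\<^sub>v ?u \<in> carrier_vec n" "T *\<^sub>v ?u \<in> carrier_vec n" using S T u by auto
    have "S *\<^sub>v (?X *\<^sub>v ?u) + ?X *\<^sub>v (T *\<^sub>v ?u) = 0\<^sub>v n"
    proof -
      have Fu: "F *\<^sub>v ?u = S *\<^sub>v (S *\<^sub>v ?u)" "F *\<^sub>v ?u = T *\<^sub>v (T *\<^sub>v ?u)"
        using assoc_mult_mat_vec[OF S(1) S(1) u(1)] assoc_mult_mat_vec[OF T(1) T(1) u(1)] S(3) T(3) by auto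
      have "?X *\<^sub>v ?u = S *\<^sub>v ?u - T *\<^sub>v ?u"
        by (rule minus_mult_distrib_mat_vec[OF S(1) T(1) u(1)])
      then have 1: "S *\<^sub>v (?X *\<^sub>v ?u) = F *\<^sub>v ?u - S *\<^sub>v (T *\<^sub>v ?u)"
        using mult_minus_distrib_mat_vec[OF S(1) c] Fu(1) by simp
      have 2: "?X *\<^sub>v (T *\<^sub>v ?u) = S *\<^sub>v (T *\<^sub>v ?u) - F *\<^sub>v ?u"
        using minus_mult_distrib_mat_vec[OF S(1) T(1) c(2)] Fu(2) by simp
      have "F *\<^sub>v ?u \<in> carrier_vec n" "S *\<^sub>v (T *\<^sub>v ?u) \<in> carrier_vec n"
        using Fu(1) S c by auto
      then show ?thesis unfolding 1 2 by (intro eq_vecI) (auto simp del: index_mult_mat_vec dim_mult_mat_vec)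
    qed
    then have "?u \<bullet> (S *\<^sub>v (?X *\<^sub>v ?u)) + ?u \<bullet> (?X *\<^sub>v (T *\<^sub>v ?u)) = 0"
      using u(1) S T X c scalar_prod_add_distrib[of ?u n "S *\<^sub>v (?X *\<^sub>v ?u)" "?X *\<^sub>v (T *\<^sub>v ?u)"] by simp
    moreover have "?u \<bullet> (S *\<^sub>v (?X *\<^sub>v ?u)) = d i * (?u \<bullet> (S *\<^sub>v ?u))"
      using S u c by (simp add: mult_mat_vec[of _ n n] scalar_prod_smult_right)
    moreover have "?u \<bullet> (?X *\<^sub>v (T *\<^sub>v ?u)) = d i * (?u \<bullet> (T *\<^sub>v ?u))"
      using transpose_vec_mult_scalar[OF X c(2) u(1)] \<open>transpose_mat ?X = ?X\<close> u c by simp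
    ultimately have "d i * (?u \<bullet> (S *\<^sub>v ?u) + ?u \<bullet> (T *\<^sub>v ?u)) = 0" by (simp add: algebra_simps)
    moreover have "?u \<bullet> (S *\<^sub>v ?u) + ?u \<bullet> (T *\<^sub>v ?u) > 0"
      using pd_matD(2)[OF pd(1) S(1) u(1) u0] pd_matD(2)[OF pd(2) T(1) u(1) u0] by simp
    ultimately show ?thesis by simp
  qed
  then have "mat_diag n d = 0\<^sub>m n n" by (auto simp: mat_diag_def)
  then have X0: "?X = 0\<^sub>m n n" using Xd U by simp
  show ?thesis
  proof (rule eq_matI)
    fix i j assume "i < dim_row T" "j < dim_col T"
    then show "S $$ (i,j) = T $$ (i,j)" using arg_cong[OF X0, of "\<lambda>M. M $$ (i,j)"] S T by auto
  qed (use S T in auto)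
qed

lemma mat_sqrt_pd:
  assumes F: "F \<in> carrier_mat n n" "pd_mat F"
  shows "mat_sqrt F \<in> carrier_mat n n" "pd_mat (mat_sqrt F)" "mat_sqrt F * mat_sqrt F = F"
proof -
  have "\<exists>!S. S \<in> carrier_mat n n \<and> psd_mat S \<and> S * S = F"
    using psd_sqrt_exists[OF F(1) pd_imp_psd[OF F(2)]] pd_sqrt_unique[OF F(2)] by metis
  moreover have "dim_row F = n" using F by simp
  ultimately have *: "mat_sqrt F \<in> carrier_mat n n \<and> psd_mat (mat_sqrt F) \<and> mat_sqrt F * mat_sqrt F = F"
    unfolding mat_sqrt_def by (simp only:) (rule theI')
  then show "mat_sqrt F \<in> carrier_mat n n" "pd_mat (mat_sqrt F)" "mat_sqrt F * mat_sqrt F = F"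
    using psd_sqrt_of_pd_is_pd[of "mat_sqrt F" n] F by auto
qed

section \<open>Inverses of positive definite matrices\<close>

lemma mat_inv_eqI:
  assumes M: "M \<in> carrier_mat n n" and N: "N \<in> carrier_mat n n" and 1: "M * N = 1\<^sub>m n"
  shows "mat_inv M = N" "N * M = 1\<^sub>m n"
proof -
  show 2: "N * M = 1\<^sub>m n" by (rule mat_mult_left_right_inverse[OF M N 1])
  show "mat_inv M = N" unfolding mat_inv_def
  proof (rule the_equality)
    fix L assume L: "L \<in> carrier_mat (dim_row M) (dim_row M) \<and> M * L = 1\<^sub>m (dim_row M) \<and> L * M = 1\<^sub>m (dim_row M)"
    then have L': "L \<in> carrier_mat n n" "L * M = 1\<^sub>m n" using M by auto
    have "L = L * (M * N)" using L' 1 by simp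
    also have "\<dots> = (L * M) * N" by (rule assoc_mult_mat[OF L'(1) M N, symmetric])
    also have "\<dots> = N" using L' N by simp
    finally show "L = N" .
  qed (use M N 1 2 in auto)
qed

lemma pd_inverse_exists:
  assumes F: "F \<in> carrier_mat n n" "pd_mat F"
  shows "\<exists>J \<in> carrier_mat n n. F * J = 1\<^sub>m n \<and> J * F = 1\<^sub>m n \<and> transpose_mat J = J"
proof -
  obtain U d where U: "U \<in> carrier_mat n n" "transpose_mat U * U = 1\<^sub>m n" "U * transpose_mat U = 1\<^sub>m n"
    and Fd: "F = U * mat_diag n d * transpose_mat U"
    using real_spectral[OF F(1) pd_matD(1)[OF F(2,1)]] by blast
  have d: "d i > 0" if "i < n" for i
  proof -
    note u = spectral_col(1,2)[OF U(1,2) that]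
    have "col U i \<noteq> 0\<^sub>v n" using u(2) by auto
    then show ?thesis using spectral_eigenvalue_quad[OF U(1,2) that Fd] pd_matD(2)[OF F(2,1) u(1)] by simp
  qed
  let ?J = "U * mat_diag n (\<lambda>i. inverse (d i)) * transpose_mat U"
  have J: "?J \<in> carrier_mat n n" using U by simp
  have "mat_diag n (\<lambda>i. d i * inverse (d i)) = 1\<^sub>m n" using d by (force simp: mat_diag_def)
  then have FJ: "F * ?J = 1\<^sub>m n" using U by (simp add: Fd spectral_product[OF U(1,2)])
  show ?thesis
    using J FJ mat_inv_eqI(2)[OF F(1) J FJ] spectral_symmetric[OF U(1)] by blast
qed

section \<open>Determinants of definite matrices\<close>

lemma det_spectral:
  assumes U: "U \<in> carrier_mat n n" "U * transpose_mat U = 1\<^sub>m n"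
  shows "Determinant.det (U * mat_diag n d * transpose_mat U) = (\<Prod>i<n. d i :: real)"
proof -
  have "Determinant.det U * Determinant.det (transpose_mat U) = 1"
    using det_mult[of U n "transpose_mat U"] U by simp
  moreover have "Determinant.det (mat_diag n d) = (\<Prod>i<n. d i)"
  proof -
    have "upper_triangular (mat_diag n d)" by (auto simp: mat_diag_def)
    then have "Determinant.det (mat_diag n d) = prod_list (diag_mat (mat_diag n d))"
      by (rule det_upper_triangular[OF _ mat_diag_carrier])
    also have "diag_mat (mat_diag n d) = map d [0..<n]" by (auto simp: diag_mat_def mat_diag_def)
    also have "prod_list (map d [0..<n]) = (\<Prod>i<n. d i)"
      using prod.distinct_set_conv_list[of "[0..<n]" d] by (simp add: lessThan_atLeast0)
    finally show ?thesis .
  qed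
  ultimately show ?thesis using U
    by (simp add: det_mult[of _ n] mult.commute mult.left_commute)
qed

lemma det_ge_1:
  assumes C: "C \<in> carrier_mat n n" "transpose_mat C = C"
    and ge: "\<And>x. x \<in> carrier_vec n \<Longrightarrow> x \<bullet> x \<le> x \<bullet> (C *\<^sub>v x :: real vec)"
  shows "1 \<le> Determinant.det C"
proof -
  obtain U d where U: "U \<in> carrier_mat n n" "transpose_mat U * U = 1\<^sub>m n" "U * transpose_mat U = 1\<^sub>m n"
    and Cd: "C = U * mat_diag n d * transpose_mat U"
    using real_spectral[OF C] by blast
  have "1 \<le> d i" if "i < n" for i
    using spectral_eigenvalue_quad[OF U(1,2) that Cd] ge spectral_col(1,2)[OF U(1,2) that] by metis
  then have "1 \<le> (\<Prod>i<n. d i)" by (intro prod_ge_1) auto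
  then show ?thesis by (simp add: Cd det_spectral[OF U(1,3)])
qed

text \<open>The determinant is the square of that of the root, and invertibility excludes
  zero.\<close>

lemma det_pd:
  assumes F: "F \<in> carrier_mat n n" "pd_mat F"
  shows "Determinant.det F > 0"
proof -
  note S = mat_sqrt_pd[OF F]
  obtain J where J: "J \<in> carrier_mat n n" "F * J = 1\<^sub>m n" using pd_inverse_exists[OF F] by blast
  have "Determinant.det F * Determinant.det J = 1" using det_mult[OF F(1) J(1)] J by simp
  moreover have "Determinant.det F = (Determinant.det (mat_sqrt F))\<^sup>2"
    using det_mult[OF S(1) S(1)] S(3) by (simp add: power2_eq_square)
  ultimately show ?thesis by (metis mult_zero_left zero_less_power2 power_zero_numeral zero_neq_one)
qed

text \<open>Congruence with T, the inverse square root of A, turns A into the identity and B into a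
  matrix C that dominates it. All eigenvalues of C are then at least one, and det B = det C * det
  A.\<close>

lemma det_mono_loewner:
  assumes A: "A \<in> carrier_mat n n" "pd_mat A" and B: "B \<in> carrier_mat n n" "transpose_mat B = B"
    and le: "\<And>x. x \<in> carrier_vec n \<Longrightarrow> x \<bullet> (A *\<^sub>v x) \<le> x \<bullet> (B *\<^sub>v x)"
  shows "Determinant.det A \<le> Determinant.det B"
proof -
  obtain S where S: "S \<in> carrier_mat n n" "pd_mat S" "S * S = A" using mat_sqrt_pd[OF A] by blast
  let ?S = S
  obtain T where T: "T \<in> carrier_mat n n" "?S * T = 1\<^sub>m n" "T * ?S = 1\<^sub>m n" "transpose_mat T = T"
    using pd_inverse_exists[OF S(1,2)] by blast
  let ?C = "T * B * T"
  have C: "?C \<in> carrier_mat n n" using T B by simp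
  have sym: "transpose_mat ?C = ?C"
    using T B by (simp add: transpose_mult[of _ n n _ n] assoc_mult_mat[of _ n n _ n _ n])
  have quad: "x \<bullet> (T * M * T *\<^sub>v x) = (T *\<^sub>v x) \<bullet> (M *\<^sub>v (T *\<^sub>v x))"
    if x: "x \<in> carrier_vec n" and M: "M \<in> carrier_mat n n" for x M
  proof -
    have "T * M * T *\<^sub>v x = T *\<^sub>v (M *\<^sub>v (T *\<^sub>v x))"
      using T x M by (simp add: assoc_mult_mat_vec[of _ n n _ n])
    then show ?thesis
      using transpose_vec_mult_scalar[of T n n "M *\<^sub>v (T *\<^sub>v x)" x] T M x by simp
  qed
  have TAT: "T * A * T = 1\<^sub>m n"
  proof -
    have "T * A * T = (T * ?S) * (?S * T)"
      unfolding S(3)[symmetric] using T(1) S(1) by (simp add: assoc_mult_mat[of _ n n _ n _ n])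
    then show ?thesis using T by simp
  qed
  have "1 \<le> Determinant.det ?C"
  proof (rule det_ge_1[OF C sym])
    fix x :: "real vec" assume x: "x \<in> carrier_vec n"
    have "x \<bullet> x = x \<bullet> (T * A * T *\<^sub>v x)" using x by (simp add: TAT)
    also have "\<dots> \<le> x \<bullet> (?C *\<^sub>v x)"
      unfolding quad[OF x A(1)] quad[OF x B(1)] using T x by (intro le) simp
    finally show "x \<bullet> x \<le> x \<bullet> (?C *\<^sub>v x)" .
  qed
  moreover have "Determinant.det ?C * Determinant.det A = Determinant.det B"
  proof -
    have ST: "Determinant.det T * Determinant.det ?S = 1" using det_mult[OF T(1) S(1)] T by simp
    have "Determinant.det A = Determinant.det ?S * Determinant.det ?S" using det_mult[OF S(1) S(1)] S(3) by simp
    then have "Determinant.det ?C * Determinant.det A = (Determinant.det T * Determinant.det ?S) * (Determinant.det T * Determinant.det ?S) * Determinant.det B"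
      using T B by (simp add: det_mult[of _ n] mult.assoc mult.left_commute)
    then show ?thesis by (simp add: ST)
  qed
  ultimately show ?thesis using det_pd[OF A]
    by (metis mult_le_cancel_right1 less_eq_real_def not_less)
qed

text \<open>\<open>sigma_min\<close> is read off from the eigenvalues of R^T R. For a positive
  semidefinite R these contain the squares of its eigenvalues, so the root of the smallest lies
  below every eigenvalue \<open>d i\<close> of R.\<close>

lemma sigma_min_le_quad:
  assumes R: "R \<in> carrier_mat n n" "psd_mat R" and x: "x \<in> carrier_vec n"
  shows "sigma_min R * (x \<bullet> x) \<le> x \<bullet> (R *\<^sub>v x)"
proof -
  obtain U d where U: "U \<in> carrier_mat n n" "transpose_mat U * U = 1\<^sub>m n" "U * transpose_mat U = 1\<^sub>m n"
    and Rd: "R = U * mat_diag n d * transpose_mat U"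
    using real_spectral[OF R(1) psd_matD(1)[OF R(2,1)]] by blast
  have RR: "transpose_mat R * R = U * mat_diag n (\<lambda>i. d i * d i) * transpose_mat U"
    unfolding psd_matD(1)[OF R(2,1)] by (simp add: Rd spectral_product[OF U(1,2)])
  have RRc: "transpose_mat R * R \<in> carrier_mat n n" using R by simp
  have fin: "finite {ev. eigenvalue (transpose_mat R * R) ev}"
    using card_finite_spectrum(1)[OF RRc] by (simp add: spectrum_def)
  have d: "sigma_min R \<le> d i" if i: "i < n" for i
  proof -
    note u = spectral_col[OF U(1,2) i]
    have d0: "d i \<ge> 0"
      using spectral_eigenvalue_quad[OF U(1,2) i Rd] psd_matD(2)[OF R(2,1) u(1)] by simp
    have "eigenvector (transpose_mat R * R) (col U i) (d i * d i)"
      unfolding eigenvector_def using u(1,2) RRc u(3)[of "\<lambda>i. d i * d i"] by (auto simp: RR)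
    then have "Min {ev. eigenvalue (transpose_mat R * R) ev} \<le> d i * d i"
      by (intro Min_le fin) (auto simp: eigenvalue_def)
    then show ?thesis unfolding sigma_min_def using d0
      by (intro real_le_lsqrt) (simp_all add: power2_eq_square)
  qed
  have "sigma_min R * (x \<bullet> x) = (\<Sum>i<n. sigma_min R * ((transpose_mat U *\<^sub>v x) $ i)\<^sup>2)"
    by (simp only: orthogonal_norm[OF U(1,3) x] sum_distrib_left[symmetric])
  also have "\<dots> \<le> (\<Sum>i<n. d i * ((transpose_mat U *\<^sub>v x) $ i)\<^sup>2)"
    using d by (intro sum_mono mult_right_mono) auto
  also have "\<dots> = x \<bullet> (R *\<^sub>v x)"
    unfolding Rd quad_spectral[OF U(1) x] ..
  finally show ?thesis .
qed

text \<open>Because n > 0 there is an eigenvalue at all, so \<open>Min\<close> is attained at some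
  eigenvector v. Then |R v|^2 = Min * |v|^2, and R v is non-zero because R is positive
  definite.\<close>

lemma sigma_min_pos:
  assumes R: "R \<in> carrier_mat n n" "pd_mat R" and n: "n > 0"
  shows "sigma_min R > 0"
proof -
  let ?E = "{ev. eigenvalue (transpose_mat R * R) ev}"
  obtain U d where U: "U \<in> carrier_mat n n" "transpose_mat U * U = 1\<^sub>m n" "U * transpose_mat U = 1\<^sub>m n"
    and Rd: "R = U * mat_diag n d * transpose_mat U"
    using real_spectral[OF R(1) pd_matD(1)[OF R(2,1)]] by blast
  have RR: "transpose_mat R * R = U * mat_diag n (\<lambda>i. d i * d i) * transpose_mat U"
    unfolding pd_matD(1)[OF R(2,1)] by (simp add: Rd spectral_product[OF U(1,2)])
  have RRc: "transpose_mat R * R \<in> carrier_mat n n" using R by simp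
  have fin: "finite ?E"
    using card_finite_spectrum(1)[OF RRc] by (simp add: spectrum_def)
  note u = spectral_col[OF U(1,2) n]
  have "eigenvector (transpose_mat R * R) (col U 0) (d 0 * d 0)"
    unfolding eigenvector_def using u(1,2) RRc u(3)[of "\<lambda>i. d i * d i"] by (auto simp: RR)
  then have "?E \<noteq> {}" by (auto simp: eigenvalue_def)
  then have "Min ?E \<in> ?E" using fin by (intro Min_in)
  then obtain v where "eigenvector (transpose_mat R * R) v (Min ?E)" by (auto simp: eigenvalue_def)
  then have v: "v \<in> carrier_vec n" "v \<noteq> 0\<^sub>v n" "(transpose_mat R * R) *\<^sub>v v = Min ?E \<cdot>\<^sub>v v"
    using RRc by (auto simp: eigenvector_def)
  have Rv: "R *\<^sub>v v \<in> carrier_vec n" using R v by simp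
  have "(R *\<^sub>v v) \<bullet> (R *\<^sub>v v) = v \<bullet> ((transpose_mat R * R) *\<^sub>v v)"
    using transpose_vec_mult_scalar[of "transpose_mat R" n n "R *\<^sub>v v" v] R v Rv
    by (simp add: assoc_mult_mat_vec[of _ n n _ n])
  also have "\<dots> = Min ?E * (v \<bullet> v)" unfolding v(3) using v by (simp add: scalar_prod_smult_right)
  finally have "(R *\<^sub>v v) \<bullet> (R *\<^sub>v v) = Min ?E * (v \<bullet> v)" .
  moreover have "R *\<^sub>v v \<noteq> 0\<^sub>v n" using pd_matD(2)[OF R(2,1) v(1,2)] v(1) by auto
  then have "(R *\<^sub>v v) \<bullet> (R *\<^sub>v v) > 0" using scalar_self_eq_0[OF Rv] scalar_self_ge_0[of "R *\<^sub>v v"] by simp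
  ultimately have "Min ?E > 0" using scalar_self_ge_0[of v] by (metis mult_nonpos_nonneg not_less)
  then show ?thesis unfolding sigma_min_def by simp
qed

text \<open>The Frobenius norm is an upper bound. Boundedness is needed because \<open>norm2\<close>
  is a supremum of reals, which says nothing about an unbounded set.\<close>

lemma norm2_bdd:
  assumes M: "M \<in> carrier_mat r c"
  shows "bdd_above {vnorm (M *\<^sub>v x) | x. x \<in> carrier_vec (dim_col M) \<and> vnorm x \<le> 1}"
proof (rule bdd_aboveI)
  fix y assume "y \<in> {vnorm (M *\<^sub>v x) | x. x \<in> carrier_vec (dim_col M) \<and> vnorm x \<le> 1}"
  then obtain x where x: "x \<in> carrier_vec c" "vnorm x \<le> 1" and y: "y = vnorm (M *\<^sub>v x)" using M by auto
  have xx: "x \<bullet> x \<le> 1" using x(2) by (simp add: vnorm_def)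
  have "(M *\<^sub>v x) \<bullet> (M *\<^sub>v x) = (\<Sum>i<r. (row M i \<bullet> x)\<^sup>2)"
    using M x by (subst scalar_self_sum[of _ r]) auto
  also have "\<dots> \<le> (\<Sum>i<r. row M i \<bullet> row M i)"
  proof (rule sum_mono)
    fix i assume "i \<in> {..<r}"
    have "(row M i \<bullet> x)\<^sup>2 \<le> (row M i \<bullet> row M i) * (x \<bullet> x)" using M x by (intro vec_cauchy_schwarz[of _ c]) auto
    also have "\<dots> \<le> row M i \<bullet> row M i" using xx scalar_self_ge_0[of "row M i"] by (metis mult_left_mono mult.right_neutral)
    finally show "(row M i \<bullet> x)\<^sup>2 \<le> row M i \<bullet> row M i" .
  qed
  finally show "y \<le> sqrt (\<Sum>i<r. row M i \<bullet> row M i)" by (simp add: y vnorm_def)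
qed

lemma vnorm_smult: "vnorm (a \<cdot>\<^sub>v x) = \<bar>a\<bar> * vnorm x"
proof -
  have "(a \<cdot>\<^sub>v x) \<bullet> (a \<cdot>\<^sub>v x) = a\<^sup>2 * (x \<bullet> x)"
    by (simp add: scalar_prod_def sum_distrib_left power2_eq_square mult_ac)
  then show ?thesis by (simp add: vnorm_def real_sqrt_mult)
qed

lemma vnorm_ge_0: "0 \<le> vnorm x" by (simp add: vnorm_def scalar_self_ge_0)

lemma vnorm_mult_le_norm2:
  assumes M: "M \<in> carrier_mat r c" and x: "x \<in> carrier_vec c"
  shows "vnorm (M *\<^sub>v x) \<le> norm2 M * vnorm x"
proof (cases "vnorm x = 0")
  case True
  then have "x = 0\<^sub>v c" using scalar_self_eq_0[OF x] by (simp add: vnorm_def)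
  then have "M *\<^sub>v x = 0\<^sub>v r" using M by simp
  then show ?thesis using True by (simp add: vnorm_def)
next
  case False
  let ?a = "1 / vnorm x"
  have pos: "vnorm x > 0" using False vnorm_ge_0[of x] by simp
  have "vnorm (M *\<^sub>v (?a \<cdot>\<^sub>v x)) \<le> norm2 M" unfolding norm2_def
    using M x pos by (intro cSup_upper norm2_bdd[OF M]) (auto simp: vnorm_smult intro!: exI[of _ "?a \<cdot>\<^sub>v x"])
  moreover have "vnorm (M *\<^sub>v (?a \<cdot>\<^sub>v x)) = ?a * vnorm (M *\<^sub>v x)"
    using M x pos by (simp add: mult_mat_vec[of _ r c] vnorm_smult)
  ultimately show ?thesis using pos by (simp add: field_simps)
qed

lemma norm2_le:
  assumes M: "M \<in> carrier_mat r c" and b: "b \<ge> 0"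
    and le: "\<And>x. x \<in> carrier_vec c \<Longrightarrow> vnorm (M *\<^sub>v x) \<le> b * vnorm x"
  shows "norm2 M \<le> b"
  unfolding norm2_def
proof (rule cSup_least)
  show "{vnorm (M *\<^sub>v x) |x. x \<in> carrier_vec (dim_col M) \<and> vnorm x \<le> 1} \<noteq> {}"
  proof -
    have "0\<^sub>v c \<in> carrier_vec (dim_col M) \<and> vnorm (0\<^sub>v c) \<le> 1" using M by (simp add: vnorm_def)
    then show ?thesis by blast
  qed
  fix y assume "y \<in> {vnorm (M *\<^sub>v x) |x. x \<in> carrier_vec (dim_col M) \<and> vnorm x \<le> 1}"
  then obtain x where x: "x \<in> carrier_vec c" "vnorm x \<le> 1" and y: "y = vnorm (M *\<^sub>v x)" using M by auto
  then show "y \<le> b" using le[OF x(1)] mult_left_mono[OF x(2) b] by simp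
qed

lemma norm2_ge_0: "M \<in> carrier_mat r c \<Longrightarrow> 0 \<le> norm2 M"

proof -
  assume M: "M \<in> carrier_mat r c"
  have "0\<^sub>v c \<in> carrier_vec (dim_col M) \<and> vnorm (0\<^sub>v c) \<le> 1" using M by (simp add: vnorm_def)
  then have "vnorm (M *\<^sub>v 0\<^sub>v c) \<le> norm2 M"
    unfolding norm2_def by (intro cSup_upper norm2_bdd[OF M]) blast
  then show ?thesis using vnorm_ge_0 order_trans by blast
qed

lemma quad_le_norm2:
  assumes M: "M \<in> carrier_mat n n" and x: "x \<in> carrier_vec n"
  shows "x \<bullet> (M *\<^sub>v x) \<le> norm2 M * (x \<bullet> x)"
proof -
  have "(x \<bullet> (M *\<^sub>v x))\<^sup>2 \<le> (x \<bullet> x) * ((M *\<^sub>v x) \<bullet> (M *\<^sub>v x))"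
    using M x by (intro vec_cauchy_schwarz[of _ n]) auto
  then have "x \<bullet> (M *\<^sub>v x) \<le> vnorm x * vnorm (M *\<^sub>v x)"
    unfolding vnorm_def real_sqrt_mult[symmetric] by (rule real_le_rsqrt)
  also have "\<dots> \<le> vnorm x * (norm2 M * vnorm x)"
    by (intro mult_left_mono vnorm_mult_le_norm2[OF M x] vnorm_ge_0)
  also have "\<dots> = norm2 M * (x \<bullet> x)" by (simp add: vnorm_def scalar_self_ge_0)
  finally show ?thesis .
qed

section \<open>Gaussian families determined by characteristic functions\<close>

lemma norm_iexp [simp]: "cmod (iexp x) = 1"
  by (simp add: norm_exp_i_times)

lemma integrable_bounded_real_times_iexp:
  assumes "prob_space M" and [measurable]: "h \<in> borel_measurable M" "X \<in> borel_measurable M"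
    and b: "\<And>\<omega>. \<omega> \<in> space M \<Longrightarrow> \<bar>h \<omega>\<bar> \<le> (K::real)"
  shows "integrable M (\<lambda>\<omega>. complex_of_real (h \<omega>) * iexp (X \<omega>))"
proof -
  interpret prob_space M by fact
  show ?thesis
    by (rule integrable_const_bound[of _ K]) (auto simp: norm_mult b)
qed

text \<open>Dividing the weight by its total mass makes it a probability density; the hypothesis
  says that X and Y have equal characteristic functions under these densities, so Levy's uniqueness
  theorem applies. The bounds 1 and 3 are those of a weight in [-1, 1] shifted by 2: they keep the
  mass positive and finite.\<close>

lemma nonneg_weight_char_unique:
  fixes X :: "'a \<Rightarrow> real" and Y :: "'b \<Rightarrow> real"
  assumes M: "prob_space M" and N: "prob_space N"
    and [measurable]: "X \<in> borel_measurable M" "f \<in> borel_measurable M"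
      "Y \<in> borel_measurable N" "g \<in> borel_measurable N" "B \<in> sets borel"
    and f: "\<And>\<omega>. \<omega> \<in> space M \<Longrightarrow> 1 \<le> f \<omega> \<and> f \<omega> \<le> (3::real)"
    and g: "\<And>\<omega>. \<omega> \<in> space N \<Longrightarrow> 1 \<le> g \<omega> \<and> g \<omega> \<le> (3::real)"
    and eq: "\<And>t. (CLINT \<omega>|M. complex_of_real (f \<omega>) * iexp (t * X \<omega>)) = (CLINT \<omega>|N. complex_of_real (g \<omega>) * iexp (t * Y \<omega>))"
  shows "(LINT \<omega>|M. f \<omega> * indicator B (X \<omega>)) = (LINT \<omega>|N. g \<omega> * indicator B (Y \<omega>))"
proof -
  interpret M: prob_space M by fact
  interpret N: prob_space N by fact
  have fi: "integrable M f" by (rule M.integrable_const_bound[of _ 3]) (auto intro!: AE_I2 dest: f)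
  have gi: "integrable N g" by (rule N.integrable_const_bound[of _ 3]) (auto intro!: AE_I2 dest: g)
  define z where "z = integral\<^sup>L M f"
  \<comment> \<open>At t = 0 the hypothesis compares the total masses.\<close>
  have z: "z = integral\<^sup>L N g"
    using eq[of 0] by (simp add: z_def)
  have "(LINT \<omega>|M. 1) \<le> z" unfolding z_def using f by (intro integral_mono fi) auto
  then have z1: "z > 0" by (simp add: M.prob_space)
  have law: "real_distribution (distr (density D (\<lambda>\<omega>. h \<omega> / z)) borel Z) \<and>
      char (distr (density D (\<lambda>\<omega>. h \<omega> / z)) borel Z) = (\<lambda>t. (CLINT \<omega>|D. complex_of_real (h \<omega>) * iexp (t * Z \<omega>)) / z) \<and>
      measure (distr (density D (\<lambda>\<omega>. h \<omega> / z)) borel Z) B = (LINT \<omega>|D. h \<omega> * indicator B (Z \<omega>)) / z"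
    if D: "prob_space D" and [measurable]: "Z \<in> borel_measurable D" "h \<in> borel_measurable D"
      and h: "\<And>\<omega>. \<omega> \<in> space D \<Longrightarrow> 1 \<le> h \<omega> \<and> h \<omega> \<le> 3" and hi: "integrable D h" "integral\<^sup>L D h = z"
    for D :: "'c measure" and h Z
  proof -
    interpret D: prob_space D by fact
    have h0: "AE \<omega> in D. 0 \<le> h \<omega> / z" using h z1 by (intro AE_I2) (auto intro!: divide_nonneg_pos dest: h)
    have "emeasure (density D (\<lambda>\<omega>. h \<omega> / z)) (space (density D (\<lambda>\<omega>. h \<omega> / z))) = (\<integral>\<^sup>+\<omega>. ennreal (h \<omega> / z) \<partial>D)"
      by (subst emeasure_density) (auto intro!: nn_integral_cong)
    also have "\<dots> = ennreal (LINT \<omega>|D. h \<omega> / z)"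
      by (rule nn_integral_eq_integral) (use hi h0 in auto)
    also have "\<dots> = 1" using hi z1 by simp
    finally have pd: "prob_space (density D (\<lambda>\<omega>. h \<omega> / z))" by (rule prob_spaceI)
    have 1: "real_distribution (distr (density D (\<lambda>\<omega>. h \<omega> / z)) borel Z)"
      by (rule prob_space.real_distribution_distr[OF pd]) simp
    have 2: "char (distr (density D (\<lambda>\<omega>. h \<omega> / z)) borel Z) t = (CLINT \<omega>|D. complex_of_real (h \<omega>) * iexp (t * Z \<omega>)) / z" for t
    proof -
      have "char (distr (density D (\<lambda>\<omega>. h \<omega> / z)) borel Z) t = (CLINT \<omega>|D. (h \<omega> / z) *\<^sub>R iexp (t * Z \<omega>))"
        unfolding char_def by (subst integral_distr, simp, simp, subst integral_density) (use h0 in auto)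
      also have "\<dots> = (CLINT \<omega>|D. complex_of_real (h \<omega>) * iexp (t * Z \<omega>) / z)"
        by (intro Bochner_Integration.integral_cong) (auto simp: scaleR_conv_of_real)
      finally show ?thesis by simp
    qed
    interpret R: real_distribution "distr (density D (\<lambda>\<omega>. h \<omega> / z)) borel Z" by (rule 1)
    have "measure (distr (density D (\<lambda>\<omega>. h \<omega> / z)) borel Z) B = (LINT x|distr (density D (\<lambda>\<omega>. h \<omega> / z)) borel Z. indicator B x)"
      by simp
    also have "\<dots> = (LINT \<omega>|D. (h \<omega> / z) *\<^sub>R indicator B (Z \<omega>))"
      by (subst integral_distr, simp, simp, subst integral_density) (use h0 in auto)
    also have "\<dots> = (LINT \<omega>|D. h \<omega> * indicator B (Z \<omega>) / z)"
      by (intro Bochner_Integration.integral_cong) auto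
    finally show ?thesis using 1 2 by auto
  qed
  note lM = law[OF M, of X f, simplified, OF f fi z_def[symmetric]]
  note lN = law[OF N, of Y g, simplified, OF g gi z[symmetric]]
  have "distr (density M (\<lambda>\<omega>. f \<omega> / z)) borel X = distr (density N (\<lambda>\<omega>. g \<omega> / z)) borel Y"
    using lM lN eq by (intro Levy_uniqueness) auto
  then show ?thesis using lM lN z1 by simp
qed

text \<open>A signed weight is shifted by 2 to become positive. The contribution of the shift is
  subtracted again with the constant weight 1, and for that \<open>eq1\<close> is assumed.\<close>

lemma bounded_weight_char_unique:
  fixes X :: "'a \<Rightarrow> real" and Y :: "'b \<Rightarrow> real"
  assumes M: "prob_space M" and N: "prob_space N"
    and [measurable]: "X \<in> borel_measurable M" "f \<in> borel_measurable M"
      "Y \<in> borel_measurable N" "g \<in> borel_measurable N" "B \<in> sets borel"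
    and f: "\<And>\<omega>. \<omega> \<in> space M \<Longrightarrow> \<bar>f \<omega>\<bar> \<le> (1::real)"
    and g: "\<And>\<omega>. \<omega> \<in> space N \<Longrightarrow> \<bar>g \<omega>\<bar> \<le> (1::real)"
    and eq: "\<And>t. (CLINT \<omega>|M. complex_of_real (f \<omega>) * iexp (t * X \<omega>)) = (CLINT \<omega>|N. complex_of_real (g \<omega>) * iexp (t * Y \<omega>))"
    and eq1: "\<And>t. (CLINT \<omega>|M. iexp (t * X \<omega>)) = (CLINT \<omega>|N. iexp (t * Y \<omega>))"
  shows "(LINT \<omega>|M. f \<omega> * indicator B (X \<omega>)) = (LINT \<omega>|N. g \<omega> * indicator B (Y \<omega>))"
proof -
  interpret M: prob_space M by fact
  interpret N: prob_space N by fact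
  note int = integrable_bounded_real_times_iexp[OF M, of _ "\<lambda>\<omega>. t * X \<omega>" 1 for t]
    integrable_bounded_real_times_iexp[OF N, of _ "\<lambda>\<omega>. t * Y \<omega>" 1 for t]
  have int1: "integrable M (\<lambda>\<omega>. iexp (t * X \<omega>))" "integrable N (\<lambda>\<omega>. iexp (t * Y \<omega>))" for t
    using int(1)[of "\<lambda>_. 1"] int(2)[of "\<lambda>_. 1"] by simp_all
  have s: "(LINT \<omega>|M. (f \<omega> + 2) * indicator B (X \<omega>)) = (LINT \<omega>|N. (g \<omega> + 2) * indicator B (Y \<omega>))"
  proof (rule nonneg_weight_char_unique[OF M N])
    fix t
    have "(CLINT \<omega>|M. complex_of_real (f \<omega> + 2) * iexp (t * X \<omega>)) =
       (CLINT \<omega>|M. complex_of_real (f \<omega>) * iexp (t * X \<omega>) + 2 * iexp (t * X \<omega>))"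
      by (simp add: distrib_right)
    also have "\<dots> = (CLINT \<omega>|M. complex_of_real (f \<omega>) * iexp (t * X \<omega>)) + 2 * (CLINT \<omega>|M. iexp (t * X \<omega>))"
      by (subst Bochner_Integration.integral_add) (use int(1) int1 f in auto)
    also have "\<dots> = (CLINT \<omega>|N. complex_of_real (g \<omega>) * iexp (t * Y \<omega>)) + 2 * (CLINT \<omega>|N. iexp (t * Y \<omega>))"
      by (simp only: eq eq1)
    also have "\<dots> = (CLINT \<omega>|N. complex_of_real (g \<omega>) * iexp (t * Y \<omega>) + 2 * iexp (t * Y \<omega>))"
      by (subst Bochner_Integration.integral_add) (use int(2) int1 g in auto)
    also have "\<dots> = (CLINT \<omega>|N. complex_of_real (g \<omega> + 2) * iexp (t * Y \<omega>))"
      by (simp add: distrib_right)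
    finally show "(CLINT \<omega>|M. complex_of_real (f \<omega> + 2) * iexp (t * X \<omega>)) = (CLINT \<omega>|N. complex_of_real (g \<omega> + 2) * iexp (t * Y \<omega>))" .
  next
    fix \<omega> assume "\<omega> \<in> space M" then show "1 \<le> f \<omega> + 2 \<and> f \<omega> + 2 \<le> 3" using f[of \<omega>] by (auto simp: abs_le_iff)
  next
    fix \<omega> assume "\<omega> \<in> space N" then show "1 \<le> g \<omega> + 2 \<and> g \<omega> + 2 \<le> 3" using g[of \<omega>] by (auto simp: abs_le_iff)
  qed measurable
  have t: "(LINT \<omega>|M. 1 * indicator B (X \<omega>)) = (LINT \<omega>|N. 1 * indicator B (Y \<omega>) :: real)"
    by (rule nonneg_weight_char_unique[OF M N]) (auto simp del: of_real_mult simp add: eq1)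
  have fB: "integrable M (\<lambda>\<omega>. f \<omega> * indicator B (X \<omega>))" "integrable M (\<lambda>\<omega>. indicator B (X \<omega>) :: real)"
    by (rule M.integrable_const_bound[of _ 1], auto intro!: AE_I2 split: split_indicator dest: f)+
  have gB: "integrable N (\<lambda>\<omega>. g \<omega> * indicator B (Y \<omega>))" "integrable N (\<lambda>\<omega>. indicator B (Y \<omega>) :: real)"
    by (rule N.integrable_const_bound[of _ 1], auto intro!: AE_I2 split: split_indicator dest: g)+
  have "(LINT \<omega>|M. (f \<omega> + 2) * indicator B (X \<omega>)) = (LINT \<omega>|M. f \<omega> * indicator B (X \<omega>)) + 2 * (LINT \<omega>|M. 1 * indicator B (X \<omega>))"
    using fB by (simp add: distrib_right)
  moreover have "(LINT \<omega>|N. (g \<omega> + 2) * indicator B (Y \<omega>)) = (LINT \<omega>|N. g \<omega> * indicator B (Y \<omega>)) + 2 * (LINT \<omega>|N. 1 * indicator B (Y \<omega>))"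
    using gB by (simp add: distrib_right)
  ultimately show ?thesis using s t by simp
qed

text \<open>The coordinates are moved one at a time from the exponential into indicator
  functions; the complex weight is split into its real and imaginary parts, each of which
  is a combination of the weights for \<open>c\<close> and \<open>- c\<close>.\<close>

lemma joint_char_unique_aux:
  fixes X :: "'i \<Rightarrow> 'a \<Rightarrow> real" and Y :: "'i \<Rightarrow> 'b \<Rightarrow> real"
  assumes M: "prob_space M" and N: "prob_space N" and I: "finite I"
    and X[measurable]: "\<And>i. i \<in> I \<Longrightarrow> X i \<in> borel_measurable M"
    and Y[measurable]: "\<And>i. i \<in> I \<Longrightarrow> Y i \<in> borel_measurable N"
    and eq: "\<And>c. (CLINT \<omega>|M. iexp (\<Sum>i\<in>I. c i * X i \<omega>)) = (CLINT \<omega>|N. iexp (\<Sum>i\<in>I. c i * Y i \<omega>))"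
    and B[measurable]: "\<And>i. i \<in> I \<Longrightarrow> B i \<in> sets borel"
    and J: "J \<subseteq> I"
  shows "(CLINT \<omega>|M. complex_of_real (\<Prod>i\<in>J. indicator (B i) (X i \<omega>)) * iexp (\<Sum>i\<in>I-J. c i * X i \<omega>)) =
    (CLINT \<omega>|N. complex_of_real (\<Prod>i\<in>J. indicator (B i) (Y i \<omega>)) * iexp (\<Sum>i\<in>I-J. c i * Y i \<omega>))"
  using finite_subset[OF J I] J
proof (induction J arbitrary: c rule: finite_induct)
  case empty
  then show ?case using eq by simp
next
  case (insert j J)
  have j: "j \<in> I" "j \<notin> J" "J \<subseteq> I" using insert by auto
  have [simp]: "finite J" by fact
  let ?K = "I - insert j J"
  define \<theta> where "\<theta> \<omega> = (\<Sum>i\<in>?K. c i * X i \<omega>)" for \<omega>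
  define \<phi> where "\<phi> \<omega> = (\<Sum>i\<in>?K. c i * Y i \<omega>)" for \<omega>
  define pX where "pX \<omega> = (\<Prod>i\<in>J. indicator (B i) (X i \<omega>) :: real)" for \<omega>
  define pY where "pY \<omega> = (\<Prod>i\<in>J. indicator (B i) (Y i \<omega>) :: real)" for \<omega>
  have meas[measurable]: "\<theta> \<in> borel_measurable M" "pX \<in> borel_measurable M" "X j \<in> borel_measurable M"
     "\<phi> \<in> borel_measurable N" "pY \<in> borel_measurable N" "Y j \<in> borel_measurable N" "B j \<in> sets borel"
    unfolding \<theta>_def \<phi>_def pX_def pY_def using j by (auto intro!: X Y B borel_measurable_sum borel_measurable_prod borel_measurable_times measurable_compose[OF _ borel_measurable_indicator] simp: subset_iff)
  have pb: "0 \<le> pX \<omega> \<and> pX \<omega> \<le> 1" "0 \<le> pY \<omega>' \<and> pY \<omega>' \<le> 1" for \<omega> \<omega>'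
    unfolding pX_def pY_def by (auto intro!: prod_nonneg prod_le_1)
  have split: "(\<Sum>i\<in>I-J. d i * Z i) = d j * Z j + (\<Sum>i\<in>?K. d i * Z i)" for d Z :: "'i \<Rightarrow> real"
  proof -
    have "I - J = insert j ?K" using j by auto
    show ?thesis unfolding \<open>I - J = insert j ?K\<close> by (rule sum.insert) (use I in auto)
  qed
  \<comment> \<open>Two free parameters: t moves the coordinate \<open>j\<close> that is about to
    become an indicator, s scales the phase of the remaining ones. Only s = 1 and s = -1 are used,
    to form cosine and sine.\<close>
  have IH: "(CLINT \<omega>|M. complex_of_real (pX \<omega>) * iexp (t * X j \<omega> + s * \<theta> \<omega>)) =
            (CLINT \<omega>|N. complex_of_real (pY \<omega>) * iexp (t * Y j \<omega> + s * \<phi> \<omega>))" for t s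
  proof -
    have "(\<Sum>i\<in>?K. ((\<lambda>i. s * c i)(j := t)) i * Z i) = s * (\<Sum>i\<in>?K. c i * Z i)" for Z :: "'i \<Rightarrow> real"
      unfolding sum_distrib_left by (intro sum.cong) auto
    then show ?thesis
      using insert.IH[of "(\<lambda>i. s * c i)(j := t)"] j
      by (simp add: split \<theta>_def \<phi>_def pX_def pY_def)
  qed
  have one: "(CLINT \<omega>|M. iexp (t * X j \<omega>)) = (CLINT \<omega>|N. iexp (t * Y j \<omega>))" for t
  proof -
    have "(\<Sum>i\<in>I. (if i = j then t else 0) * Z i) = t * Z j" for Z :: "'i \<Rightarrow> real"
      using I j by (simp add: if_distribR if_distrib cong: if_cong)
    then show ?thesis using eq[of "\<lambda>i. if i = j then t else 0"] by simp
  qed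
  have intX: "integrable M (\<lambda>\<omega>. complex_of_real (pX \<omega>) * iexp (t * X j \<omega> + s * \<theta> \<omega>))" for t s
    by (rule integrable_bounded_real_times_iexp[OF M, of _ _ 1]) (use pb in auto)
  have intY: "integrable N (\<lambda>\<omega>. complex_of_real (pY \<omega>) * iexp (t * Y j \<omega> + s * \<phi> \<omega>))" for t s
    by (rule integrable_bounded_real_times_iexp[OF N, of _ _ 1]) (use pb in auto)
  \<comment> \<open>Real weights are required for the density argument, so the remaining phase is
    split by Euler's formulas into exponentials with both signs, each covered by
    \<open>IH\<close>.\<close>
  have cosI: "complex_of_real (a * cos b) * iexp u = (complex_of_real a * iexp (u + 1 * b) + complex_of_real a * iexp (u + (-1) * b)) / 2"
    and sinI: "complex_of_real (a * sin b) * iexp u = (complex_of_real a * iexp (u + 1 * b) - complex_of_real a * iexp (u + (-1) * b)) / (2 * \<i>)" for a b u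
  proof -
    have c: "complex_of_real (cos b) = (exp (\<i> * complex_of_real b) + exp (- (\<i> * complex_of_real b))) / 2"
      and s: "complex_of_real (sin b) = (exp (\<i> * complex_of_real b) - exp (- (\<i> * complex_of_real b))) / (2 * \<i>)"
      by (simp_all only: cos_of_real[symmetric] sin_of_real[symmetric] cos_exp_eq sin_exp_eq)
    have e: "iexp (u + 1 * b) = iexp u * exp (\<i> * complex_of_real b)" "iexp (u + (-1) * b) = iexp u * exp (- (\<i> * complex_of_real b))"
      by (simp_all add: exp_add[symmetric] algebra_simps)
    show "complex_of_real (a * cos b) * iexp u = (complex_of_real a * iexp (u + 1 * b) + complex_of_real a * iexp (u + (-1) * b)) / 2"
      unfolding of_real_mult[of a] c e by (simp add: divide_simps) (simp add: algebra_simps)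
    show "complex_of_real (a * sin b) * iexp u = (complex_of_real a * iexp (u + 1 * b) - complex_of_real a * iexp (u + (-1) * b)) / (2 * \<i>)"
      unfolding of_real_mult[of a] s e by (simp add: divide_simps) (simp add: algebra_simps)
  qed
  have C: "(LINT \<omega>|M. (pX \<omega> * cos (\<theta> \<omega>)) * indicator (B j) (X j \<omega>)) = (LINT \<omega>|N. (pY \<omega> * cos (\<phi> \<omega>)) * indicator (B j) (Y j \<omega>))"
  proof (rule bounded_weight_char_unique[OF M N])
    fix t
    show "(CLINT \<omega>|M. complex_of_real (pX \<omega> * cos (\<theta> \<omega>)) * iexp (t * X j \<omega>)) = (CLINT \<omega>|N. complex_of_real (pY \<omega> * cos (\<phi> \<omega>)) * iexp (t * Y j \<omega>))"
      unfolding cosI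
      by (subst (1 2) integral_divide_zero, subst (1 2) Bochner_Integration.integral_add) (use intX intY in \<open>auto simp only: IH\<close>)
  qed (use pb in \<open>auto simp: one abs_mult simp del: of_real_mult intro!: mult_le_one\<close>)
  have S: "(LINT \<omega>|M. (pX \<omega> * sin (\<theta> \<omega>)) * indicator (B j) (X j \<omega>)) = (LINT \<omega>|N. (pY \<omega> * sin (\<phi> \<omega>)) * indicator (B j) (Y j \<omega>))"
  proof (rule bounded_weight_char_unique[OF M N])
    fix t
    show "(CLINT \<omega>|M. complex_of_real (pX \<omega> * sin (\<theta> \<omega>)) * iexp (t * X j \<omega>)) = (CLINT \<omega>|N. complex_of_real (pY \<omega> * sin (\<phi> \<omega>)) * iexp (t * Y j \<omega>))"
      unfolding sinI
      by (subst (1 2) integral_divide_zero, subst (1 2) Bochner_Integration.integral_diff) (use intX intY in \<open>auto simp only: IH\<close>)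
  qed (use pb in \<open>auto simp: one abs_mult simp del: of_real_mult intro!: mult_le_one\<close>)
  have fin: "(CLINT \<omega>|D. complex_of_real (a \<omega>) * iexp (b \<omega>)) = complex_of_real (LINT \<omega>|D. a \<omega> * cos (b \<omega>)) + \<i> * complex_of_real (LINT \<omega>|D. a \<omega> * sin (b \<omega>))"
    if D: "prob_space D" and [measurable]: "a \<in> borel_measurable D" "b \<in> borel_measurable D" and a: "\<And>\<omega>. \<bar>a \<omega>\<bar> \<le> 1"
    for D :: "'e measure" and a b
  proof -
    interpret D: prob_space D by fact
    have i: "integrable D (\<lambda>\<omega>. a \<omega> * cos (b \<omega>))" "integrable D (\<lambda>\<omega>. a \<omega> * sin (b \<omega>))"
      by (rule D.integrable_const_bound[of _ 1], auto simp: abs_mult intro!: AE_I2 mult_le_one a)+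
    have "(CLINT \<omega>|D. complex_of_real (a \<omega>) * iexp (b \<omega>)) =
       (CLINT \<omega>|D. complex_of_real (a \<omega> * cos (b \<omega>)) + \<i> * complex_of_real (a \<omega> * sin (b \<omega>)))"
      by (intro Bochner_Integration.integral_cong) (auto simp: complex_eq_iff cis_conv_exp[symmetric])
    also have "\<dots> = (CLINT \<omega>|D. complex_of_real (a \<omega> * cos (b \<omega>))) + (CLINT \<omega>|D. \<i> * complex_of_real (a \<omega> * sin (b \<omega>)))"
      by (intro Bochner_Integration.integral_add integrable_mult_right integrable_of_real i)
    finally show ?thesis by (simp only: integral_mult_right_zero integral_complex_of_real)
  qed
  have ind: "(\<Prod>i\<in>insert j J. indicator (B i) (Z i)) = (\<Prod>i\<in>J. indicator (B i) (Z i)) * (indicator (B j) (Z j) :: real)" for Z :: "'i \<Rightarrow> real"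
    using j by simp
  have ab: "\<bar>pX \<omega> * indicator (B j) (X j \<omega>)\<bar> \<le> 1" "\<bar>pY \<omega>' * indicator (B j) (Y j \<omega>')\<bar> \<le> 1" for \<omega> \<omega>'
    using pb by (auto split: split_indicator)
  show ?case
    unfolding ind \<theta>_def[symmetric] \<phi>_def[symmetric] pX_def[symmetric] pY_def[symmetric]
    by (subst fin[OF M], measurable, rule ab, subst fin[OF N], measurable, rule ab)
       (use C S in \<open>simp add: mult_ac\<close>)
qed

lemma joint_char_unique:
  fixes X :: "'i \<Rightarrow> 'a \<Rightarrow> real" and Y :: "'i \<Rightarrow> 'b \<Rightarrow> real"
  assumes M: "prob_space M" and N: "prob_space N" and I: "finite I"
    and X: "\<And>i. i \<in> I \<Longrightarrow> X i \<in> borel_measurable M"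
    and Y: "\<And>i. i \<in> I \<Longrightarrow> Y i \<in> borel_measurable N"
    and eq: "\<And>c. (CLINT \<omega>|M. iexp (\<Sum>i\<in>I. c i * X i \<omega>)) = (CLINT \<omega>|N. iexp (\<Sum>i\<in>I. c i * Y i \<omega>))"
    and B: "\<And>i. i \<in> I \<Longrightarrow> B i \<in> sets borel"
  shows "(LINT \<omega>|M. (\<Prod>i\<in>I. indicator (B i) (X i \<omega>)) :: real) = (LINT \<omega>|N. (\<Prod>i\<in>I. indicator (B i) (Y i \<omega>)))"
proof -
  have "(CLINT \<omega>|M. complex_of_real (\<Prod>i\<in>I. indicator (B i) (X i \<omega>))) = (CLINT \<omega>|N. complex_of_real (\<Prod>i\<in>I. indicator (B i) (Y i \<omega>)))"
    using joint_char_unique_aux[OF M N I X Y eq B order_refl] by (simp del: of_real_prod)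
  then show ?thesis by (simp only: integral_complex_of_real of_real_eq_iff)
qed

text \<open>Independent standard normal variables, described by their joint characteristic function,
  because that is what can be computed for the innovations. \<open>isonormal_distr\<close> recovers
  the joint law, and with it independence.\<close>

definition isonormal :: "'a measure \<Rightarrow> 'i set \<Rightarrow> ('i \<Rightarrow> 'a \<Rightarrow> real) \<Rightarrow> bool" where
  "isonormal M I X \<longleftrightarrow> (\<forall>i\<in>I. X i \<in> borel_measurable M) \<and>
    (\<forall>c. (CLINT \<omega>|M. iexp (\<Sum>i\<in>I. c i * X i \<omega>)) = complex_of_real (exp (- (\<Sum>i\<in>I. (c i)\<^sup>2) / 2)))"

text \<open>Rotation invariance: for orthonormal rows \<open>L j\<close> the combination with
  coefficients c has squared length equal to the sum of the squares of c. It provides the new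
  coordinates for projections onto a direction and for disjoint windows.\<close>

lemma isonormal_orthonormal:
  assumes X: "isonormal M I X" and fin: "finite I" "finite J"
    and on: "\<And>j k. j \<in> J \<Longrightarrow> k \<in> J \<Longrightarrow> (\<Sum>i\<in>I. L j i * L k i) = (if j = k then 1 else 0)"
    and Y: "\<And>j. j \<in> J \<Longrightarrow> Y j = (\<lambda>\<omega>. \<Sum>i\<in>I. L j i * X i \<omega>)"
  shows "isonormal M J Y"
  unfolding isonormal_def
proof (intro conjI ballI allI)
  fix j assume "j \<in> J" then show "Y j \<in> borel_measurable M"
    using X by (simp add: Y) (auto simp: isonormal_def intro!: borel_measurable_sum borel_measurable_times)
next
  fix c
  have "(\<Sum>j\<in>J. c j * Y j \<omega>) = (\<Sum>i\<in>I. (\<Sum>j\<in>J. c j * L j i) * X i \<omega>)" for \<omega>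
    by (simp add: Y sum_distrib_left sum_distrib_right mult.assoc cong: sum.cong) (rule sum.swap)
  then have "(CLINT \<omega>|M. iexp (\<Sum>j\<in>J. c j * Y j \<omega>)) = complex_of_real (exp (- (\<Sum>i\<in>I. (\<Sum>j\<in>J. c j * L j i)\<^sup>2) / 2))"
    using X by (simp only: isonormal_def)
  also have "(\<Sum>i\<in>I. (\<Sum>j\<in>J. c j * L j i)\<^sup>2) = (\<Sum>i\<in>I. \<Sum>j\<in>J. \<Sum>k\<in>J. c j * c k * (L j i * L k i))"
    by (simp add: power2_eq_square sum_product mult_ac)
  also have "\<dots> = (\<Sum>j\<in>J. \<Sum>i\<in>I. \<Sum>k\<in>J. c j * c k * (L j i * L k i))" by (rule sum.swap)
  also have "\<dots> = (\<Sum>j\<in>J. \<Sum>k\<in>J. c j * c k * (\<Sum>i\<in>I. L j i * L k i))"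
    unfolding sum_distrib_left by (intro sum.cong refl sum.swap)
  also have "\<dots> = (\<Sum>j\<in>J. \<Sum>k\<in>J. if j = k then (c j)\<^sup>2 else 0)"
    by (intro sum.cong refl) (auto simp: on power2_eq_square)
  also have "\<dots> = (\<Sum>j\<in>J. (c j)\<^sup>2)" using fin by simp
  finally show "(CLINT \<omega>|M. iexp (\<Sum>j\<in>J. c j * Y j \<omega>)) = complex_of_real (exp (- (\<Sum>j\<in>J. (c j)\<^sup>2) / 2))" .
qed

lemma product_sigma_finite_std_normal: "product_sigma_finite (\<lambda>_. std_normal_distribution)"
  by (simp add: product_sigma_finite_def prob_space_imp_sigma_finite prob_space_normal_density)

lemma prob_space_PiM_std_normal: "prob_space (PiM I (\<lambda>_. std_normal_distribution))"
  by (intro prob_space_PiM prob_space_normal_density) simp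

lemma isonormal_PiM:
  assumes I: "finite I"
  shows "isonormal (PiM I (\<lambda>_. std_normal_distribution)) I (\<lambda>i x. x i)"
  unfolding isonormal_def
proof (intro conjI ballI allI)
  fix i assume "i \<in> I"
  then show "(\<lambda>x. x i) \<in> borel_measurable (PiM I (\<lambda>_. std_normal_distribution))"
    using measurable_component_singleton[of i I "\<lambda>_. std_normal_distribution"] by simp
next
  fix c :: "_ \<Rightarrow> real"
  interpret product_sigma_finite "\<lambda>_. std_normal_distribution" by (rule product_sigma_finite_std_normal)
  interpret S: real_distribution std_normal_distribution by (rule real_dist_normal_dist)
  have "(CLINT x|PiM I (\<lambda>_. std_normal_distribution). iexp (\<Sum>i\<in>I. c i * x i)) =
     (CLINT x|PiM I (\<lambda>_. std_normal_distribution). (\<Prod>i\<in>I. iexp (c i * x i)))"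
    using I by (simp add: exp_sum[symmetric] sum_distrib_left)
  also have "\<dots> = (\<Prod>i\<in>I. CLINT x|std_normal_distribution. iexp (c i * x))"
    by (rule product_integral_prod[OF I]) (use S.integrable_iexp[of "\<lambda>x. c _ * x"] in simp)
  also have "\<dots> = (\<Prod>i\<in>I. complex_of_real (exp (- (c i)\<^sup>2 / 2)))"
    using char_std_normal_distribution by (simp add: char_def fun_eq_iff)
  also have "\<dots> = complex_of_real (exp (- (\<Sum>i\<in>I. (c i)\<^sup>2) / 2))"
    using I by (simp add: exp_sum[symmetric] sum_negf sum_divide_distrib flip: of_real_prod)
  finally show "(CLINT x|PiM I (\<lambda>_. std_normal_distribution). iexp (\<Sum>i\<in>I. c i * x i)) = complex_of_real (exp (- (\<Sum>i\<in>I. (c i)\<^sup>2) / 2))" .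
qed

text \<open>Boxes determine a product measure, and on boxes the family is compared with the
  coordinates of the product measure, which are isonormal themselves. Expectations can then be moved
  to the product space, where Fubini is available.\<close>

theorem isonormal_distr:
  assumes M: "prob_space M" and X: "isonormal M I X" and I: "finite I"
  shows "distr M (PiM I (\<lambda>_. std_normal_distribution)) (\<lambda>\<omega>. \<lambda>i\<in>I. X i \<omega>) = PiM I (\<lambda>_. std_normal_distribution)"
proof -
  interpret M: prob_space M by fact
  interpret P: product_sigma_finite "\<lambda>_. std_normal_distribution" by (rule product_sigma_finite_std_normal)
  let ?N = "PiM I (\<lambda>_. std_normal_distribution)"
  interpret N: prob_space ?N by (rule prob_space_PiM_std_normal)
  have Xm: "X i \<in> borel_measurable M" if "i \<in> I" for i using X that by (simp add: isonormal_def)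
  have "X i \<in> measurable M std_normal_distribution" if "i \<in> I" for i
    using Xm[OF that] by (simp cong: measurable_cong_sets)
  then have m: "(\<lambda>\<omega>. \<lambda>i\<in>I. X i \<omega>) \<in> measurable M ?N" by (rule measurable_restrict)
  note Y = isonormal_PiM[OF I]
  show ?thesis
  proof (rule P.PiM_eqI[OF I])
    fix B :: "_ \<Rightarrow> real set" assume B: "\<And>i. i \<in> I \<Longrightarrow> B i \<in> sets std_normal_distribution"
    then have B': "\<And>i. i \<in> I \<Longrightarrow> B i \<in> sets borel" by simp
    have PB: "PiE I B \<in> sets ?N" using B I by (intro sets_PiM_I_finite) auto
    have "emeasure (distr M ?N (\<lambda>\<omega>. \<lambda>i\<in>I. X i \<omega>)) (PiE I B) = emeasure M ((\<lambda>\<omega>. \<lambda>i\<in>I. X i \<omega>) -` PiE I B \<inter> space M)"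
      by (rule emeasure_distr[OF m PB])
    also have "\<dots> = ennreal (measure M ((\<lambda>\<omega>. \<lambda>i\<in>I. X i \<omega>) -` PiE I B \<inter> space M))" by (simp add: M.emeasure_eq_measure)
    also have "measure M ((\<lambda>\<omega>. \<lambda>i\<in>I. X i \<omega>) -` PiE I B \<inter> space M) = integral\<^sup>L M (indicator ((\<lambda>\<omega>. \<lambda>i\<in>I. X i \<omega>) -` PiE I B \<inter> space M))"
      using measurable_sets[OF m PB] by simp
    also have "\<dots> = (LINT \<omega>|M. (\<Prod>i\<in>I. indicator (B i) (X i \<omega>)))"
      using I by (intro Bochner_Integration.integral_cong) (auto simp: indicator_def prod_eq_1_iff PiE_iff intro!: prod.neutral)
    also have "\<dots> = (LINT x|?N. (\<Prod>i\<in>I. indicator (B i) (x i)))"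
      using X Y by (intro joint_char_unique[OF M prob_space_PiM_std_normal I] B') (auto simp: isonormal_def)
    also have "\<dots> = integral\<^sup>L ?N (indicator (PiE I B))"
      using I by (intro Bochner_Integration.integral_cong) (auto simp: indicator_def prod_eq_1_iff PiE_iff space_PiM intro!: prod.neutral)
    also have "\<dots> = measure ?N (PiE I B)" using PB by simp
    also have "ennreal (measure ?N (PiE I B)) = emeasure ?N (PiE I B)" by (simp add: N.emeasure_eq_measure)
    also have "\<dots> = (\<Prod>i\<in>I. emeasure std_normal_distribution (B i))" using B I by (intro P.emeasure_PiM) auto
    finally show "emeasure (distr M ?N (\<lambda>\<omega>. \<lambda>i\<in>I. X i \<omega>)) (PiE I B) = (\<Prod>i\<in>I. emeasure std_normal_distribution (B i))" .
  qed simp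
qed

lemma isonormal_nn_integral:
  assumes M: "prob_space M" and X: "isonormal M I X" and I: "finite I"
    and f: "f \<in> borel_measurable (PiM I (\<lambda>_. borel))"
  shows "(\<integral>\<^sup>+\<omega>. f (\<lambda>i\<in>I. X i \<omega>) \<partial>M) = (\<integral>\<^sup>+x. f x \<partial>PiM I (\<lambda>_. std_normal_distribution))"
proof -
  let ?N = "PiM I (\<lambda>_. std_normal_distribution)"
  have "sets ?N = sets (PiM I (\<lambda>_. borel))" by (intro sets_PiM_cong) auto
  then have f': "f \<in> borel_measurable ?N" using f by (simp cong: measurable_cong_sets)
  have "X i \<in> measurable M std_normal_distribution" if "i \<in> I" for i
    using X that by (simp add: isonormal_def cong: measurable_cong_sets)
  then have m: "(\<lambda>\<omega>. \<lambda>i\<in>I. X i \<omega>) \<in> measurable M ?N" by (rule measurable_restrict)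
  show ?thesis
    using nn_integral_distr[OF m, of f] f' by (simp add: isonormal_distr[OF M X I])
qed

section \<open>Self-normalised likelihood\<close>

text \<open>The inverse of the Gram matrix, updated by the Sherman--Morrison formula; \<open>gram_rls_inverse\<close>
  justifies the name (recursive least squares).\<close>

primrec rls :: "real \<Rightarrow> nat \<Rightarrow> (nat \<Rightarrow> nat \<Rightarrow> real) \<Rightarrow> nat \<Rightarrow> nat \<Rightarrow> nat \<Rightarrow> real" where
  "rls \<mu> d z 0 = (\<lambda>i j. if i = j then 1 / \<mu> else 0)"
| "rls \<mu> d z (Suc t) = (\<lambda>i j. rls \<mu> d z t i j -
     mv d (rls \<mu> d z t) (z t) i * mv d (rls \<mu> d z t) (z t) j / (1 + ip d (z t) (mv d (rls \<mu> d z t) (z t))))"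

definition gram :: "real \<Rightarrow> (nat \<Rightarrow> nat \<Rightarrow> real) \<Rightarrow> nat \<Rightarrow> nat \<Rightarrow> nat \<Rightarrow> real" where
  "gram \<mu> z t i j = (if i = j then \<mu> else 0) + (\<Sum>s<t. z s i * z s j)"

definition gain :: "real \<Rightarrow> nat \<Rightarrow> (nat \<Rightarrow> nat \<Rightarrow> real) \<Rightarrow> nat \<Rightarrow> real" where
  "gain \<mu> d z t = ip d (z t) (mv d (rls \<mu> d z t) (z t))"

definition score :: "(nat \<Rightarrow> nat \<Rightarrow> real) \<Rightarrow> (nat \<Rightarrow> real) \<Rightarrow> nat \<Rightarrow> nat \<Rightarrow> real" where
  "score z g t i = (\<Sum>s<t. g s * z s i)"

text \<open>With \<open>rls\<close> as inverse Gram matrix this is the ridge-regression prediction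
  of \<open>g t\<close> from the first \<open>t\<close> samples; \<open>gain\<close> is the leverage
  of the new regressor.\<close>

definition drift :: "real \<Rightarrow> nat \<Rightarrow> (nat \<Rightarrow> nat \<Rightarrow> real) \<Rightarrow> (nat \<Rightarrow> real) \<Rightarrow> nat \<Rightarrow> real" where
  "drift \<mu> d z g t = ip d (score z g t) (mv d (rls \<mu> d z t) (z t))"

text \<open>With gain \<open>s\<close> and drift \<open>b\<close>, this is the increment of the likelihood ratio obtained by mixing
  \<open>exp (h \<cdot> S - h \<cdot> (V - \<mu>) h / 2)\<close> over a Gaussian prior for \<open>h\<close>. Written as a one-step factor it
  has mean one for a standard normal \<open>\<eta>\<close>, so that Fubini in the last coordinate replaces
  martingale theory.\<close>

definition lik_step :: "real \<Rightarrow> real \<Rightarrow> real \<Rightarrow> real" where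
  "lik_step s b \<eta> = exp ((2 * b * \<eta> + s * \<eta>\<^sup>2 - b\<^sup>2) / (2 * (1 + s))) / sqrt (1 + s)"

primrec lik :: "real \<Rightarrow> nat \<Rightarrow> (nat \<Rightarrow> nat \<Rightarrow> real) \<Rightarrow> (nat \<Rightarrow> real) \<Rightarrow> nat \<Rightarrow> real" where
  "lik \<mu> d z g 0 = 1"
| "lik \<mu> d z g (Suc t) = lik \<mu> d z g t * lik_step (gain \<mu> d z t) (drift \<mu> d z g t) (g t)"

section \<open>Inverse and determinant of the Gram matrix\<close>

lemma ip_gram:
  "ip d f (mv d (gram \<mu> z t) h) = \<mu> * ip d f h + (\<Sum>s<t. ip d (z s) f * ip d (z s) h)"
proof -
  have "mv d (gram \<mu> z t) h i = \<mu> * h i + (\<Sum>s<t. z s i * ip d (z s) h)" if "i < d" for i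
  proof -
    have "mv d (gram \<mu> z t) h i = (\<Sum>j<d. if i = j then \<mu> * h j else 0) + (\<Sum>j<d. \<Sum>s<t. z s i * z s j * h j)"
      unfolding mv_def gram_def sum.distrib[symmetric]
      by (intro sum.cong) (auto simp: distrib_right sum_distrib_right)
    also have "(\<Sum>j<d. \<Sum>s<t. z s i * z s j * h j) = (\<Sum>s<t. \<Sum>j<d. z s i * z s j * h j)" by (rule sum.swap)
    also have "\<dots> = (\<Sum>s<t. z s i * ip d (z s) h)"
      by (simp add: ip_def sum_distrib_left mult.assoc)
    finally show ?thesis using that by simp
  qed
  then have "ip d f (mv d (gram \<mu> z t) h) = ip d f (\<lambda>i. \<mu> * h i + (\<Sum>s<t. z s i * ip d (z s) h))"
    unfolding ip_def by (intro sum.cong) auto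
  also have "\<dots> = \<mu> * ip d f h + ip d f (\<lambda>i. \<Sum>s<t. z s i * ip d (z s) h)"
    by (simp add: ip_linear)
  also have "ip d f (\<lambda>i. \<Sum>s<t. z s i * c s) = (\<Sum>s<t. ip d (z s) f * c s)" for c
    unfolding ip_def sum_distrib_left sum_distrib_right by (subst sum.swap) (simp add: mult_ac)
  finally show ?thesis .
qed

lemma rls_symmetric: "rls \<mu> d z t i j = rls \<mu> d z t j i"
  by (induction t) (auto simp: mult.commute)

text \<open>The inverse identity is a hypothesis here and in the next two lemmas because the
  induction that proves it uses them at the previous stage, in particular to know that the
  denominator 1 + gain is not zero.\<close>

lemma gram_rls_vec:
  assumes inv: "\<And>i j. i < d \<Longrightarrow> j < d \<Longrightarrow> (\<Sum>k<d. gram \<mu> z t i k * rls \<mu> d z t k j) = (if i = j then 1 else 0)"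
    and "i < d"
  shows "mv d (gram \<mu> z t) (mv d (rls \<mu> d z t) x) i = x i"
proof -
  have "mv d (gram \<mu> z t) (mv d (rls \<mu> d z t) x) i = (\<Sum>k<d. \<Sum>j<d. gram \<mu> z t i k * rls \<mu> d z t k j * x j)"
    by (simp add: mv_def sum_distrib_left mult.assoc)
  also have "\<dots> = (\<Sum>j<d. (\<Sum>k<d. gram \<mu> z t i k * rls \<mu> d z t k j) * x j)"
    unfolding sum_distrib_right by (rule sum.swap)
  also have "\<dots> = (\<Sum>j<d. if i = j then x j else 0)"
    using \<open>i < d\<close> by (intro sum.cong) (auto simp: inv)
  finally show ?thesis using \<open>i < d\<close> by simp
qed

lemma quad_rls_eq:
  assumes inv: "\<And>i j. i < d \<Longrightarrow> j < d \<Longrightarrow> (\<Sum>k<d. gram \<mu> z t i k * rls \<mu> d z t k j) = (if i = j then 1 else 0)"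
  shows "ip d x (mv d (rls \<mu> d z t) y) = ip d (mv d (rls \<mu> d z t) y) (mv d (gram \<mu> z t) (mv d (rls \<mu> d z t) x))"
  using gram_rls_vec[OF inv, of _ x] by (subst ip_commute) (simp add: ip_def)

lemma gain_nonneg_aux:
  assumes inv: "\<And>i j. i < d \<Longrightarrow> j < d \<Longrightarrow> (\<Sum>k<d. gram \<mu> z t i k * rls \<mu> d z t k j) = (if i = j then 1 else 0)"
    and "\<mu> > 0"
  shows "gain \<mu> d z t \<ge> 0"
proof -
  let ?y = "mv d (rls \<mu> d z t) (z t)"
  have "gain \<mu> d z t = ip d ?y (mv d (gram \<mu> z t) ?y)" unfolding gain_def by (rule quad_rls_eq[OF inv])
  also have "\<dots> \<ge> 0" unfolding ip_gram
    using \<open>\<mu> > 0\<close> by (intro add_nonneg_nonneg sum_nonneg) (auto simp: ip_ge_0)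
  finally show ?thesis .
qed

text \<open>Multiplying out the two rank-one updates leaves, beyond the induction hypothesis,
  \<open>z t i\<close> times y_j - c - s c with s the gain, and c = y_j / (1 + s) makes it
  vanish.\<close>

lemma gram_rls_inverse:
  assumes "\<mu> > 0" "i < d" "j < d"
  shows "(\<Sum>k<d. gram \<mu> z t i k * rls \<mu> d z t k j) = (if i = j then 1 else 0)"
  using assms(2,3)
proof (induction t arbitrary: i j)
  case 0
  have "(\<Sum>k<d. gram \<mu> z 0 i k * rls \<mu> d z 0 k j) = (\<Sum>k<d. if k = i then (if i = j then 1 else 0) else 0)"
    using \<open>\<mu> > 0\<close> by (intro sum.cong) (auto simp: gram_def)
  then show ?case using 0 by simp
next
  case (Suc t)
  let ?W = "rls \<mu> d z t" and ?V = "gram \<mu> z t"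
  let ?y = "mv d ?W (z t)" and ?s = "gain \<mu> d z t"
  note inv = Suc.IH
  have s: "?s \<ge> 0" by (rule gain_nonneg_aux[OF inv \<open>\<mu> > 0\<close>])
  have V: "gram \<mu> z (Suc t) i k = ?V i k + z t i * z t k" for k by (simp add: gram_def)
  define c where "c = ?y j / (1 + ?s)"
  have W: "rls \<mu> d z (Suc t) k j = ?W k j - ?y k * c" for k by (simp add: gain_def c_def)
  have e1: "(\<Sum>k<d. z t k * ?W k j) = ?y j"
    unfolding mv_def by (intro sum.cong) (auto simp: rls_symmetric[of \<mu> d z t _ j])
  have e2: "(\<Sum>k<d. ?V i k * ?y k) = z t i" using gram_rls_vec[OF inv, of i] Suc.prems by (simp add: mv_def)
  have e3: "(\<Sum>k<d. z t k * ?y k) = ?s" by (simp add: gain_def ip_def)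
  have "(\<Sum>k<d. gram \<mu> z (Suc t) i k * rls \<mu> d z (Suc t) k j) =
     (\<Sum>k<d. ?V i k * ?W k j + z t i * (z t k * ?W k j) - (?V i k * ?y k) * c - z t i * (z t k * ?y k) * c)"
    unfolding V W by (simp add: algebra_simps)
  also have "\<dots> = (if i = j then 1 else 0) + z t i * ?y j - z t i * c - z t i * ?s * c"
    using Suc by (simp add: sum.distrib sum_subtractf e1 e2 e3 flip: sum_distrib_left sum_distrib_right)
  also have "\<dots> = (if i = j then 1 else 0)"
    
  proof -
    have "(1 + ?s) * c = ?y j" using s by (simp add: c_def)
    then have "z t i * ?y j - z t i * c - z t i * ?s * c = 0" by (simp add: algebra_simps flip: \<open>(1 + ?s) * c = ?y j\<close>)
    then show ?thesis by simp
  qed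
  finally show ?case .
qed

lemma gain_nonneg: "\<mu> > 0 \<Longrightarrow> gain \<mu> d z t \<ge> 0"
  by (rule gain_nonneg_aux) (simp_all add: gram_rls_inverse)

lemma lik_pos: "\<mu> > 0 \<Longrightarrow> lik \<mu> d z g t > 0"
  by (induction t) (auto simp: lik_step_def add_pos_nonneg gain_nonneg)

text \<open>The bordered matrix with blocks V, -z, z^T and 1 is evaluated twice. Clearing against
  the corner entry 1 leaves V + z z^T; clearing the last column with a solution y of V y = z leaves
  V and the corner 1 + z \<bullet> y. Taking y as given avoids an inverse of V.\<close>

lemma det_rank_one_update:
  fixes V :: "real mat"
  assumes V: "V \<in> carrier_mat d d" and z: "z \<in> carrier_vec d" and y: "y \<in> carrier_vec d" and Vy: "V *\<^sub>v y = z"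
  shows "Determinant.det (V + mat d d (\<lambda>(i,j). z $ i * z $ j)) = Determinant.det V * (1 + z \<bullet> y)"
proof -
  define Z where "Z = mat d d (\<lambda>(i,j). z $ i * z $ j)"
  define c where "c = mat d 1 (\<lambda>(i,j). - z $ i)"
  define r where "r = mat 1 d (\<lambda>(i,j). z $ j)"
  define u where "u = mat d 1 (\<lambda>(i,j). y $ i)"
  define a where "a = mat 1 1 (\<lambda>_. 1 + z \<bullet> y)"
  have car[simp]: "Z \<in> carrier_mat d d" "c \<in> carrier_mat d 1" "r \<in> carrier_mat 1 d" "u \<in> carrier_mat d 1" "a \<in> carrier_mat 1 1"
    by (auto simp: Z_def c_def r_def u_def a_def)
  let ?M = "four_block_mat V c r (1\<^sub>m 1)"
  have ZV: "V + Z \<in> carrier_mat d d" using V by simp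
  have cr: "c * r = - Z"
    by (rule eq_matI) (auto simp: c_def r_def Z_def scalar_prod_def)
  have 1: "four_block_mat (V + Z) c (0\<^sub>m 1 d) (1\<^sub>m 1) * four_block_mat (1\<^sub>m d) (0\<^sub>m d 1) r (1\<^sub>m 1) = ?M"
  proof -
    have "(V + Z) * 1\<^sub>m d + c * r = V"
      using V unfolding cr by (intro eq_matI) (auto simp: Z_def)
    moreover have "(V + Z) * 0\<^sub>m d 1 + c * 1\<^sub>m 1 = c"
      unfolding right_mult_zero_mat[OF ZV] by (simp del: One_nat_def add: right_mult_one_mat[of c d 1])
    moreover have "0\<^sub>m 1 d * 1\<^sub>m d + 1\<^sub>m 1 * r = r" "0\<^sub>m 1 d * 0\<^sub>m d 1 + 1\<^sub>m 1 * 1\<^sub>m 1 = (1\<^sub>m 1 :: real mat)"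
      by (simp_all del: One_nat_def add: left_mult_one_mat[of r 1 d])
    ultimately show ?thesis using ZV
      by (subst mult_four_block_mat[of _ d d _ 1 _ 1 _ _ d _ 1]) (auto simp del: One_nat_def)
  qed
  have Vu: "V * u + c = 0\<^sub>m d 1"
  proof (rule eq_matI)
    fix i j assume ij: "i < dim_row (0\<^sub>m d 1)" "j < dim_col (0\<^sub>m d 1)"
    have "col u 0 = y" using y by (intro eq_vecI) (auto simp: u_def)
    then have "(V * u) $$ (i,j) = (V *\<^sub>v y) $ i" using ij V car(4) by auto
    then show "(V * u + c) $$ (i,j) = 0\<^sub>m d 1 $$ (i,j)" using ij V by (simp add: Vy c_def)
  qed (use V car(2,4) in auto)
  have ru: "r * u + 1\<^sub>m 1 = a"
    using z y by (intro eq_matI) (auto simp: r_def u_def a_def scalar_prod_def)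
  have 2: "?M * four_block_mat (1\<^sub>m d) u (0\<^sub>m 1 d) (1\<^sub>m 1) = four_block_mat V (0\<^sub>m d 1) r a"
  proof -
    have "V * 1\<^sub>m d + c * 0\<^sub>m 1 d = V" "r * 1\<^sub>m d + 1\<^sub>m 1 * 0\<^sub>m 1 d = r"
      using V by (auto simp: right_mult_zero_mat[OF car(2)] right_mult_one_mat[OF car(3)] right_add_zero_mat simp del: One_nat_def)
    moreover have "V * u + c * 1\<^sub>m 1 = 0\<^sub>m d 1" "r * u + 1\<^sub>m 1 * 1\<^sub>m 1 = a"
      using Vu ru by (simp_all add: right_mult_one_mat[OF car(2)] del: One_nat_def)
    ultimately show ?thesis using V
      by (subst mult_four_block_mat[of _ d d _ 1 _ 1 _ _ d _ 1]) (auto simp del: One_nat_def)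
  qed
  have "Determinant.det ?M = Determinant.det (V + Z)"
    unfolding 1[symmetric] using ZV
    by (subst det_mult[of _ "d+1"]) (auto simp: det_four_block_mat_lower_left_zero[of _ d _ 1] det_four_block_mat_upper_right_zero[of _ d _ 1] simp del: One_nat_def)
  moreover have "Determinant.det ?M * 1 = Determinant.det V * Determinant.det a"
  proof -
    have "Determinant.det (?M * four_block_mat (1\<^sub>m d) u (0\<^sub>m 1 d) (1\<^sub>m 1)) = Determinant.det ?M * Determinant.det (four_block_mat (1\<^sub>m d) u (0\<^sub>m 1 d) (1\<^sub>m 1))"
      using V by (intro det_mult[of _ "d+1"]) (auto simp del: One_nat_def)
    also have "Determinant.det (four_block_mat (1\<^sub>m d) u (0\<^sub>m 1 d) (1\<^sub>m 1)) = 1"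
      by (subst det_four_block_mat_lower_left_zero[of _ d _ 1]) (auto simp del: One_nat_def)
    also have "Determinant.det (?M * four_block_mat (1\<^sub>m d) u (0\<^sub>m 1 d) (1\<^sub>m 1)) = Determinant.det V * Determinant.det a"
      unfolding 2 using V by (subst det_four_block_mat_upper_right_zero[of _ d _ 1]) (auto simp del: One_nat_def)
    finally show ?thesis by simp
  qed
  moreover have "Determinant.det a = 1 + z \<bullet> y" by (simp add: a_def det_single)
  ultimately show ?thesis by (simp add: Z_def)
qed

definition gram_mat :: "real \<Rightarrow> nat \<Rightarrow> (nat \<Rightarrow> nat \<Rightarrow> real) \<Rightarrow> nat \<Rightarrow> real mat" where
  "gram_mat \<mu> d z t = mat d d (\<lambda>(i,j). gram \<mu> z t i j)"

lemma det_gram_Suc: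
  assumes "\<mu> > 0"
  shows "Determinant.det (gram_mat \<mu> d z (Suc t)) = Determinant.det (gram_mat \<mu> d z t) * (1 + gain \<mu> d z t)"
proof -
  have "gram_mat \<mu> d z (Suc t) = gram_mat \<mu> d z t + mat d d (\<lambda>(i,j). vec d (z t) $ i * vec d (z t) $ j)"
    by (intro eq_matI) (auto simp: gram_mat_def gram_def)
  moreover have "gram_mat \<mu> d z t *\<^sub>v vec d (mv d (rls \<mu> d z t) (z t)) = vec d (z t)"
  proof (rule eq_vecI)
    fix i assume "i < dim_vec (vec d (z t))"
    then have i: "i < d" by simp
    have "(gram_mat \<mu> d z t *\<^sub>v vec d (mv d (rls \<mu> d z t) (z t))) $ i = mv d (gram \<mu> z t) (mv d (rls \<mu> d z t) (z t)) i"
      using i by (simp add: gram_mat_def scalar_prod_def mv_def lessThan_atLeast0)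
    then show "(gram_mat \<mu> d z t *\<^sub>v vec d (mv d (rls \<mu> d z t) (z t))) $ i = vec d (z t) $ i"
      using i by (simp add: gram_rls_vec[OF gram_rls_inverse[OF assms]])
  qed (simp add: gram_mat_def)
  moreover have "vec d (z t) \<bullet> vec d (mv d (rls \<mu> d z t) (z t)) = gain \<mu> d z t"
    by (simp add: gain_def ip_def scalar_prod_def lessThan_atLeast0)
  ultimately show ?thesis
    using det_rank_one_update[of "gram_mat \<mu> d z t" d "vec d (z t)" "vec d (mv d (rls \<mu> d z t) (z t))"]
    by (simp add: gram_mat_def)
qed

lemma det_gram_0: "Determinant.det (gram_mat \<mu> d z 0) = \<mu> ^ d"
proof -
  have "gram_mat \<mu> d z 0 = \<mu> \<cdot>\<^sub>m 1\<^sub>m d" by (intro eq_matI) (auto simp: gram_mat_def gram_def)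
  then show ?thesis by (simp add: det_smult)
qed

lemma det_gram_pos: "\<mu> > 0 \<Longrightarrow> Determinant.det (gram_mat \<mu> d z t) > 0"
  by (induction t) (auto simp: det_gram_0 det_gram_Suc gain_nonneg add_pos_nonneg)

text \<open>Both sides obey the same recursion. With gain s, drift b and new value g, the quadratic
  form grows by (2 b g + s g^2 - b^2) / (1 + s), twice the exponent in \<open>lik_step\<close>; the
  factor 1 / sqrt (1 + s) contributes - ln (1 + s), which the growth of the determinant cancels. The
  term \<open>d * ln \<mu>\<close> is the initial log determinant.\<close>

lemma score_rls_quad:
  assumes mu: "\<mu> > 0"
  shows "ip d (score z g t) (mv d (rls \<mu> d z t) (score z g t)) =
    2 * ln (lik \<mu> d z g t) + ln (Determinant.det (gram_mat \<mu> d z t)) - d * ln \<mu>"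
proof (induction t)
  case 0
  then show ?case using mu by (simp add: score_def ip_def det_gram_0 ln_realpow)
next
  case (Suc t)
  let ?W = "rls \<mu> d z t" and ?S = "score z g t"
  let ?y = "mv d ?W (z t)" and ?s = "gain \<mu> d z t" and ?b = "drift \<mu> d z g t" and ?S' = "score z g (Suc t)"
  have s: "?s \<ge> 0" by (rule gain_nonneg[OF mu])
  have sym: "ip d x (mv d ?W x') = ip d (mv d ?W x) x'" for x x'
    by (rule ip_mv_symmetric) (rule rls_symmetric)
  have S': "?S' = (\<lambda>i. ?S i + g t * z t i)" by (auto simp: score_def)
  have W': "mv d (rls \<mu> d z (Suc t)) x i = mv d ?W x i - ip d ?y x / (1 + ?s) * ?y i" for x i
  proof -
    have "mv d (rls \<mu> d z (Suc t)) x i = (\<Sum>j<d. ?W i j * x j - ?y i / (1 + ?s) * (?y j * x j))"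
      unfolding mv_def[of d "rls \<mu> d z (Suc t)"] by (simp add: gain_def algebra_simps)
    also have "\<dots> = mv d ?W x i - ?y i / (1 + ?s) * ip d ?y x"
      by (simp add: sum_subtractf mv_def[of d ?W x i] ip_def sum_distrib_left sum_divide_distrib)
    finally show ?thesis by simp
  qed
  have mW: "mv d ?W ?S' = (\<lambda>i. mv d ?W ?S i + g t * ?y i)" unfolding S' by (auto simp: mv_add mv_scale)
  have b: "ip d ?y ?S = ?b" by (simp add: drift_def ip_commute)
  have s': "ip d ?y (z t) = ?s" by (simp add: gain_def ip_commute)
  have yS: "ip d ?y ?S' = ?b + g t * ?s" unfolding S' by (simp add: ip_linear b s')
  have zW: "ip d (z t) (mv d ?W ?S) = ?b" by (simp add: sym b)
  have q: "ip d ?S' (mv d ?W ?S') = ip d ?S (mv d ?W ?S) + 2 * g t * ?b + (g t)\<^sup>2 * ?s"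
  proof -
    have "ip d ?S' (mv d ?W ?S') = ip d (\<lambda>i. ?S i + g t * z t i) (\<lambda>i. mv d ?W ?S i + g t * ?y i)"
      unfolding mW by (simp only: S')
    then show ?thesis
      by (simp add: ip_linear zW drift_def[symmetric] gain_def[symmetric] power2_eq_square algebra_simps)
  qed
  have "ip d ?S' (mv d (rls \<mu> d z (Suc t)) ?S') = ip d ?S' (\<lambda>i. mv d ?W ?S' i - ip d ?y ?S' / (1 + ?s) * ?y i)"
    by (simp add: W' ip_def del: rls.simps)
  also have "\<dots> = ip d ?S' (mv d ?W ?S') - (ip d ?y ?S')\<^sup>2 / (1 + ?s)"
    unfolding ip_diff_right ip_scale_right by (simp add: ip_commute[of d ?S' ?y] power2_eq_square)
  also have "\<dots> = ip d ?S (mv d ?W ?S) + (2 * ?b * g t + ?s * (g t)\<^sup>2 - ?b\<^sup>2) / (1 + ?s)"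
    unfolding q yS using s by (simp add: field_simps power2_eq_square)
  finally have A: "ip d ?S' (mv d (rls \<mu> d z (Suc t)) ?S') = ip d ?S (mv d ?W ?S) + (2 * ?b * g t + ?s * (g t)\<^sup>2 - ?b\<^sup>2) / (1 + ?s)" .
  define Y where "Y = (2 * ?b * g t + ?s * (g t)\<^sup>2 - ?b\<^sup>2) / (1 + ?s)"
  have Y: "(2 * ?b * g t + ?s * (g t)\<^sup>2 - ?b\<^sup>2) / (2 * (1 + ?s)) = Y / 2" using s by (simp add: Y_def)
  have "ln (lik \<mu> d z g (Suc t)) = ln (lik \<mu> d z g t) + Y / 2 - ln (1 + ?s) / 2"
  proof -
    have "ln (lik_step ?s ?b (g t)) = (2 * ?b * g t + ?s * (g t)\<^sup>2 - ?b\<^sup>2) / (2 * (1 + ?s)) - ln (1 + ?s) / 2"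
      using s by (simp only: lik_step_def) (subst ln_div, auto simp: ln_sqrt)
    moreover have "lik_step ?s ?b (g t) > 0" using s by (simp add: lik_step_def)
    ultimately show ?thesis using lik_pos[OF mu, of d z g t] by (simp only: lik.simps ln_mult_pos Y)
  qed
  moreover have "ln (Determinant.det (gram_mat \<mu> d z (Suc t))) = ln (Determinant.det (gram_mat \<mu> d z t)) + ln (1 + ?s)"
    using s det_gram_pos[OF mu, of d z t] by (simp add: det_gram_Suc[OF mu] ln_mult)
  ultimately show ?case unfolding A[folded Y_def] Suc.IH by linarith
qed

text \<open>Cauchy-Schwarz in the inner product of the Gram matrix V, applied to f and y = V^(-1) S
  with S the score, where S \<bullet> f is the inner product of y and f. It holds pathwise, so
  \<open>lik\<close> is the only quantity that must be bounded in probability.\<close>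

lemma self_normalized_deterministic:
  assumes mu: "\<mu> > 0"
  shows "(ip d (score z g t) f)\<^sup>2 \<le>
    (2 * ln (lik \<mu> d z g t) + ln (Determinant.det (gram_mat \<mu> d z t)) - d * ln \<mu>) * (\<mu> * ip d f f + (\<Sum>s<t. (ip d (z s) f)\<^sup>2))"
proof -
  let ?W = "rls \<mu> d z t" and ?S = "score z g t"
  let ?y = "mv d ?W ?S" and ?V = "gram \<mu> z t"
  have Vy: "ip d h (mv d ?V ?y) = ip d h ?S" for h
    unfolding ip_def by (intro sum.cong) (auto simp: gram_rls_vec[OF gram_rls_inverse[OF mu]])
  have "(ip d ?S f)\<^sup>2 \<le> ip d ?S ?y * (\<mu> * ip d f f + (\<Sum>s<t. (ip d (z s) f)\<^sup>2))"
  proof (rule discriminant_nonneg_quadratic)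
    fix r
    have "0 \<le> \<mu> * ip d (\<lambda>i. ?y i + r * f i) (\<lambda>i. ?y i + r * f i) + (\<Sum>s<t. (ip d (z s) (\<lambda>i. ?y i + r * f i))\<^sup>2)"
      using mu by (intro add_nonneg_nonneg mult_nonneg_nonneg sum_nonneg ip_ge_0) auto
    also have "\<dots> = (\<mu> * ip d ?y ?y + (\<Sum>s<t. (ip d (z s) ?y)\<^sup>2)) + 2 * r * (\<mu> * ip d f ?y + (\<Sum>s<t. ip d (z s) f * ip d (z s) ?y)) + r\<^sup>2 * (\<mu> * ip d f f + (\<Sum>s<t. (ip d (z s) f)\<^sup>2))"
      by (simp add: ip_linear power2_sum sum.distrib sum_distrib_left ip_commute[of d f ?y] algebra_simps power2_eq_square)
    also have "\<mu> * ip d ?y ?y + (\<Sum>s<t. (ip d (z s) ?y)\<^sup>2) = ip d ?S ?y"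
      using Vy[of ?y] unfolding ip_gram by (simp add: power2_eq_square ip_commute)
    also have "\<mu> * ip d f ?y + (\<Sum>s<t. ip d (z s) f * ip d (z s) ?y) = ip d ?S f"
      using Vy[of f] unfolding ip_gram by (simp add: ip_commute)
    finally show "0 \<le> ip d ?S ?y + 2 * r * ip d ?S f + r\<^sup>2 * (\<mu> * ip d f f + (\<Sum>s<t. (ip d (z s) f)\<^sup>2))" .
  next
    show "0 \<le> \<mu> * ip d f f + (\<Sum>s<t. (ip d (z s) f)\<^sup>2)"
      using mu by (intro add_nonneg_nonneg mult_nonneg_nonneg sum_nonneg ip_ge_0) auto
  qed
  then show ?thesis unfolding score_rls_quad[OF mu] .
qed

text \<open>Completing the square: the standard normal density times the factor is the density of
  N(b, 1 + s), the Bayesian predictive law of the next observation. The range s > -1 includes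
  negative s, used later for lower tails.\<close>

lemma nn_integral_lik_step:
  assumes s: "s > -1"
  shows "(\<integral>\<^sup>+\<eta>. ennreal (lik_step s b \<eta>) \<partial>std_normal_distribution) = 1"
proof -
  have "std_normal_density \<eta> * lik_step s b \<eta> = normal_density b (sqrt (1 + s)) \<eta>" for \<eta>
  proof -
    have "- \<eta>\<^sup>2 / 2 + (2 * b * \<eta> + s * \<eta>\<^sup>2 - b\<^sup>2) / (2 * (1 + s)) = - (\<eta> - b)\<^sup>2 / (2 * (1 + s))"
      using s by (simp add: divide_simps) (simp add: algebra_simps power2_eq_square)
    then have "exp (- \<eta>\<^sup>2 / 2) * exp ((2 * b * \<eta> + s * \<eta>\<^sup>2 - b\<^sup>2) / (2 * (1 + s))) = exp (- (\<eta> - b)\<^sup>2 / (2 * (1 + s)))"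
      by (simp only: exp_add[symmetric])
    then show ?thesis using s
      by (simp add: std_normal_density_def normal_density_def lik_step_def real_sqrt_mult)
  qed
  then have "(\<integral>\<^sup>+\<eta>. ennreal (lik_step s b \<eta>) \<partial>std_normal_distribution) = (\<integral>\<^sup>+\<eta>. ennreal (normal_density b (sqrt (1 + s)) \<eta>) \<partial>lborel)"
    by (subst nn_integral_density) (auto simp: lik_step_def[abs_def] ennreal_mult'[symmetric])
  also have "\<dots> = ennreal (LINT \<eta>|lborel. normal_density b (sqrt (1 + s)) \<eta>)"
    using s by (intro nn_integral_eq_integral) auto
  finally show ?thesis using s by simp
qed

section \<open>Measurability and dependence on the past\<close>

lemma measurable_rls:
  assumes "\<And>s i. s < t \<Longrightarrow> (\<lambda>x. z x s i) \<in> borel_measurable N"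
  shows "(\<lambda>x. rls \<mu> d (z x) t i j) \<in> borel_measurable N"
  using assms
proof (induction t arbitrary: i j)
  case (Suc t)
  have [measurable]: "(\<lambda>x. z x t i) \<in> borel_measurable N" for i using Suc.prems by simp
  have [measurable]: "(\<lambda>x. rls \<mu> d (z x) t i j) \<in> borel_measurable N" for i j using Suc by simp
  show ?case by (simp add: mv_def ip_def)
qed simp

text \<open>The index ranges record predictability: gain and drift at time t use \<open>z\<close> up
  to t but \<open>g\<close> only before t. This is why the last coordinate can be integrated out
  with both held fixed.\<close>

lemma measurable_gain_drift:
  assumes z: "\<And>s i. s \<le> t \<Longrightarrow> (\<lambda>x. z x s i) \<in> borel_measurable N"
    and g: "\<And>s. s < t \<Longrightarrow> (\<lambda>x. g x s) \<in> borel_measurable N"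
  shows "(\<lambda>x. gain \<mu> d (z x) t) \<in> borel_measurable N" "(\<lambda>x. drift \<mu> d (z x) (g x) t) \<in> borel_measurable N"
proof -
  have [measurable]: "(\<lambda>x. z x t i) \<in> borel_measurable N" for i using z by simp
  have [measurable]: "(\<lambda>x. rls \<mu> d (z x) t i j) \<in> borel_measurable N" for i j using z by (intro measurable_rls) simp
  have [measurable]: "(\<lambda>x. score (z x) (g x) t i) \<in> borel_measurable N" for i
    unfolding score_def using z g by (intro borel_measurable_sum borel_measurable_times) auto
  show "(\<lambda>x. gain \<mu> d (z x) t) \<in> borel_measurable N" "(\<lambda>x. drift \<mu> d (z x) (g x) t) \<in> borel_measurable N"
    unfolding gain_def drift_def mv_def ip_def by measurable
qed

lemma measurable_lik_step [measurable]:
  assumes [measurable]: "f \<in> borel_measurable N" "h \<in> borel_measurable N" "k \<in> borel_measurable N"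
  shows "(\<lambda>x. lik_step (f x) (h x) (k x)) \<in> borel_measurable N"
  unfolding lik_step_def by measurable

lemma measurable_lik:
  assumes "\<And>s i. s < t \<Longrightarrow> (\<lambda>x. z x s i) \<in> borel_measurable N"
    and "\<And>s. s < t \<Longrightarrow> (\<lambda>x. g x s) \<in> borel_measurable N"
  shows "(\<lambda>x. lik \<mu> d (z x) (g x) t) \<in> borel_measurable N"
  using assms
proof (induction t)
  case (Suc t)
  have [measurable]: "(\<lambda>x. g x t) \<in> borel_measurable N" using Suc.prems by simp
  have [measurable]: "(\<lambda>x. gain \<mu> d (z x) t) \<in> borel_measurable N" "(\<lambda>x. drift \<mu> d (z x) (g x) t) \<in> borel_measurable N"
    using Suc.prems by (intro measurable_gain_drift[where g = g]; simp)+
  have [measurable]: "(\<lambda>x. lik \<mu> d (z x) (g x) t) \<in> borel_measurable N" using Suc by simp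
  show ?case by simp
qed simp

lemma rls_cong: "(\<And>s. s < t \<Longrightarrow> z s = z' s) \<Longrightarrow> rls \<mu> d z t = rls \<mu> d z' t"
  by (induction t) auto

lemma gain_drift_cong:
  assumes "\<And>s. s \<le> t \<Longrightarrow> z s = z' s" "\<And>s. s < t \<Longrightarrow> g s = g' s"
  shows "gain \<mu> d z t = gain \<mu> d z' t" "drift \<mu> d z g t = drift \<mu> d z' g' t"
proof -
  have "rls \<mu> d z t = rls \<mu> d z' t" using assms by (intro rls_cong) auto
  moreover have "score z g t = score z' g' t" using assms by (auto simp: score_def)
  ultimately show "gain \<mu> d z t = gain \<mu> d z' t" "drift \<mu> d z g t = drift \<mu> d z' g' t"
    using assms(1)[of t] by (simp_all add: gain_def drift_def)
qed

lemma lik_cong: "(\<And>s. s < t \<Longrightarrow> z s = z' s) \<Longrightarrow> (\<And>s. s < t \<Longrightarrow> g s = g' s) \<Longrightarrow> lik \<mu> d z g t = lik \<mu> d z' g' t"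
proof (induction t)
  case (Suc t)
  then show ?case using gain_drift_cong[of t z z' g g' \<mu> d] by simp
qed simp

section \<open>Nets of the sphere and the ball\<close>

text \<open>Counting by weights: each point of Z contributes at least b to the sum of the product
  weights over the whole box, and that sum factorises over the coordinates.\<close>

lemma card_le_weight_sum:
  fixes w :: "int \<Rightarrow> real"
  assumes F: "finite F" and Z: "Z \<subseteq> PiE {..<m} (\<lambda>_. F)" and w: "\<And>j. w j \<ge> 0"
    and b: "\<And>z. z \<in> Z \<Longrightarrow> b \<le> (\<Prod>i<m. w (z i))"
  shows "finite Z" "real (card Z) * b \<le> (\<Sum>j\<in>F. w j) ^ m"
proof -
  have fin: "finite (PiE {..<m} (\<lambda>_. F))" using F by (intro finite_PiE) auto
  then show "finite Z" using Z finite_subset by blast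
  have "real (card Z) * b = (\<Sum>z\<in>Z. b)" by simp
  also have "\<dots> \<le> (\<Sum>z\<in>Z. \<Prod>i<m. w (z i))" by (intro sum_mono b)
  also have "\<dots> \<le> (\<Sum>z\<in>PiE {..<m} (\<lambda>_. F). \<Prod>i<m. w (z i))"
    using fin Z w by (intro sum_mono2 prod_nonneg) auto
  also have "\<dots> = (\<Prod>i<m. \<Sum>j\<in>F. w j)" using F by (intro prod_sum_PiE[symmetric]) auto
  finally show "real (card Z) * b \<le> (\<Sum>j\<in>F. w j) ^ m" by simp
qed

lemma sum_symmetric_int_interval:
  fixes w :: "nat \<Rightarrow> real"
  shows "(\<Sum>j\<in>{- int K..int K}. w (nat \<bar>j\<bar>)) = w 0 + 2 * (\<Sum>j<K. w (Suc j))"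
proof (induction K)
  case (Suc K)
  have "{- int (Suc K)..int (Suc K)} = insert (int (Suc K)) (insert (- int (Suc K)) {- int K..int K})" by auto
  then have "(\<Sum>j\<in>{- int (Suc K)..int (Suc K)}. w (nat \<bar>j\<bar>)) = w (nat \<bar>int (Suc K)\<bar>) + (w (nat \<bar>- int (Suc K)\<bar>) + (\<Sum>j\<in>{- int K..int K}. w (nat \<bar>j\<bar>)))"
    by (simp only:) (subst sum.insert, simp, simp, subst sum.insert, auto)
  moreover have "nat \<bar>int (Suc K)\<bar> = Suc K" "nat \<bar>- int (Suc K)\<bar> = Suc K" by auto
  ultimately show ?case unfolding Suc.IH by simp
qed simp

lemma geometric_sum_le:
  fixes r :: real
  assumes "0 \<le> r" "r < 1"
  shows "(\<Sum>j<K. r ^ j) \<le> 1 / (1 - r)"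
proof -
  have "(\<Sum>j<K. r ^ j) * (1 - r) = 1 - r ^ K"
  proof (induction K)
    case (Suc K)
    have "(\<Sum>j<Suc K. r ^ j) * (1 - r) = (\<Sum>j<K. r ^ j) * (1 - r) + r ^ K * (1 - r)" by (simp add: distrib_right)
    then show ?case unfolding Suc.IH by (simp add: right_diff_distrib)
  qed simp
  also have "\<dots> \<le> 1" using assms by simp
  finally show ?thesis using assms by (simp add: pos_le_divide_eq)
qed

text \<open>The weight is \<open>0.84^3\<close>: for \<open>|z|\<^sup>2 \<le> 4m/3\<close> the product of the weights is at least \<open>0.84^(4m)\<close>, and
  \<open>2.4768 / 0.84^4 \<le> 5\<close>.\<close>

lemma square_weight_sum_le:
  "(\<Sum>j\<in>{- int K..int K}. (592704/1000000 :: real) ^ (nat \<bar>j\<bar>)\<^sup>2) \<le> 24768/10000"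
proof -
  define a :: real where "a = 592704/1000000"
  let ?a = a
  have a: "0 \<le> a" "a < 1" by (auto simp: a_def)
  \<comment> \<open>Padding by two terms lets the first two split off for every K. For the others (j
    + 3)^2 \<ge> 9 + j reduces the sum to a geometric series. The final bound is 1 + 2 * 0.7384 =
    2.4768.\<close>
  have "(\<Sum>j<K. ?a ^ (Suc j)\<^sup>2) \<le> (\<Sum>j<K + 2. ?a ^ (Suc j)\<^sup>2)" using a by (intro sum_mono2) auto
  also have "\<dots> = ?a + ?a ^ 4 + (\<Sum>j<K. ?a ^ (Suc (Suc (Suc j)))\<^sup>2)"
  proof -
    have "(\<Sum>j<K + 2. f j) = f 0 + f 1 + (\<Sum>j<K. f (Suc (Suc j)))" for f :: "nat \<Rightarrow> real"
      by (induction K) simp_all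
    note this[of "\<lambda>j. a ^ (Suc j)\<^sup>2"]
    moreover have "(Suc (Suc 0))\<^sup>2 = 4" by (simp add: power2_eq_square)
    ultimately show ?thesis by simp
  qed
  also have "(\<Sum>j<K. ?a ^ (Suc (Suc (Suc j)))\<^sup>2) \<le> (\<Sum>j<K. ?a ^ 9 * ?a ^ j)"
    unfolding power_add[symmetric]
    using a by (intro sum_mono power_decreasing) (auto simp: power2_eq_square)
  also have "\<dots> = ?a ^ 9 * (\<Sum>j<K. ?a ^ j)" by (simp add: sum_distrib_left)
  also have "\<dots> \<le> ?a ^ 9 * (1 / (1 - ?a))" using a by (intro mult_left_mono geometric_sum_le) auto
  finally have "(\<Sum>j<K. ?a ^ (Suc j)\<^sup>2) \<le> ?a + ?a ^ 4 + ?a ^ 9 * (1 / (1 - ?a))" by simp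
  also have "\<dots> \<le> 7384/10000" by (simp add: a_def power_divide)
  finally show ?thesis
    unfolding a_def[symmetric] sum_symmetric_int_interval[of "\<lambda>j. ?a ^ j\<^sup>2"] by simp
qed

text \<open>The net consists of normalised integer vectors \<open>z\<close>: rounding \<open>b = sqrt (m/3) a / |a|\<close> to the
  nearest integer vector gives \<open>|b - z|\<^sup>2 \<le> m/4\<close> and hence an angle of at most 60 degrees, while
  \<open>|z|\<^sup>2 \<le> 4 |b|\<^sup>2 = 4m/3\<close> bounds the number of possible \<open>z\<close>.\<close>

lemma direction_net:
  assumes m: "m > 0"
  shows "\<exists>U. finite U \<and> real (card U) \<le> 5 ^ m \<and> (\<forall>u\<in>U. (\<Sum>c<m. (u c)\<^sup>2) = (1::real)) \<and>
    (\<forall>a. \<exists>u\<in>U. sqrt (\<Sum>c<m. (a c)\<^sup>2) \<le> 2 * (\<Sum>c<m. u c * a c))"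
proof -
  define F where "F = {- int (2 * m)..int (2 * m)}"
  define Z where "Z = {z \<in> PiE {..<m} (\<lambda>_. F). 3 * (\<Sum>i<m. (z i)\<^sup>2) \<le> 4 * int m}"
  define nrm where "nrm (z :: nat \<Rightarrow> int) = sqrt (\<Sum>i<m. (real_of_int (z i))\<^sup>2)" for z
  define U where "U = (\<lambda>z i. real_of_int (z i) / nrm z) ` {z \<in> Z. nrm z > 0}"
  let ?w = "\<lambda>j :: int. (592704/1000000 :: real) ^ (nat \<bar>j\<bar>)\<^sup>2"
  have wp: "(84/100 :: real) ^ (4 * m) \<le> (\<Prod>i<m. ?w (z i))" if z: "z \<in> Z" for z
  proof -
    have "(\<Prod>i<m. ?w (z i)) = (\<Prod>i<m. (84/100) ^ (3 * (nat \<bar>z i\<bar>)\<^sup>2))"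
      by (simp add: power_mult power_divide)
    also have "\<dots> = (84/100) ^ (\<Sum>i<m. 3 * (nat \<bar>z i\<bar>)\<^sup>2)" by (simp add: power_sum)
    finally have e: "(\<Prod>i<m. ?w (z i)) = (84/100) ^ (\<Sum>i<m. 3 * (nat \<bar>z i\<bar>)\<^sup>2)" .
    have "int (\<Sum>i<m. 3 * (nat \<bar>z i\<bar>)\<^sup>2) = 3 * (\<Sum>i<m. (z i)\<^sup>2)"
      by (simp add: sum_distrib_left)
    also have "\<dots> \<le> int (4 * m)" using z by (simp add: Z_def)
    finally have "(\<Sum>i<m. 3 * (nat \<bar>z i\<bar>)\<^sup>2) \<le> 4 * m" by (simp only: of_nat_le_iff)
    then show ?thesis unfolding e by (intro power_decreasing) auto
  qed
  have fF: "finite F" by (simp add: F_def)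
  have ZF: "Z \<subseteq> PiE {..<m} (\<lambda>_. F)" by (auto simp: Z_def)
  have finZ: "finite Z" by (rule card_le_weight_sum(1)[OF fF ZF _ wp]) auto
  have "real (card Z) * (84/100) ^ (4 * m) \<le> (\<Sum>j\<in>F. ?w j) ^ m"
    by (rule card_le_weight_sum(2)[OF fF ZF _ wp]) auto
  also have "\<dots> \<le> (24768/10000) ^ m"
    unfolding F_def by (intro power_mono square_weight_sum_le sum_nonneg) auto
  also have "\<dots> \<le> (5 * (84/100) ^ 4) ^ m" by (intro power_mono) (auto simp: power_divide)
  also have "\<dots> = 5 ^ m * (84/100) ^ (4 * m)" by (simp add: power_mult_distrib power_mult)
  finally have cZ: "real (card Z) \<le> 5 ^ m" by simp
  have finU: "finite U" using finZ by (simp add: U_def)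
  have "card U \<le> card {z \<in> Z. nrm z > 0}" unfolding U_def using finZ by (intro card_image_le) simp
  also have "\<dots> \<le> card Z" using finZ by (intro card_mono) auto
  finally have cU: "real (card U) \<le> 5 ^ m" using cZ by simp
  have nU: "(\<Sum>c<m. (u c)\<^sup>2) = 1" if uU: "u \<in> U" for u
  proof -
    obtain z where z: "nrm z > 0" "u = (\<lambda>i. real_of_int (z i) / nrm z)" using uU by (auto simp: U_def)
    have "(\<Sum>c<m. (u c)\<^sup>2) = (\<Sum>c<m. (real_of_int (z c))\<^sup>2) / (nrm z)\<^sup>2"
      unfolding z(2) by (simp add: power_divide sum_divide_distrib)
    also have "(\<Sum>c<m. (real_of_int (z c))\<^sup>2) = (nrm z)\<^sup>2" by (simp add: nrm_def sum_nonneg)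
    finally show ?thesis using z by simp
  qed
  have main: "\<exists>u\<in>U. sqrt (\<Sum>c<m. (a c)\<^sup>2) \<le> 2 * (\<Sum>c<m. u c * a c)" if a: "(\<Sum>c<m. (a c)\<^sup>2) > 0" for a
  proof -
    define \<alpha> where "\<alpha> = sqrt (\<Sum>c<m. (a c)\<^sup>2)"
    define \<kappa> where "\<kappa> = sqrt (m / 3)"
    have pos: "\<alpha> > 0" "\<kappa> > 0" "\<alpha>\<^sup>2 = (\<Sum>c<m. (a c)\<^sup>2)" "\<kappa>\<^sup>2 = m / 3"
      using a m by (auto simp: \<alpha>_def \<kappa>_def)
    define b where "b c = \<kappa> / \<alpha> * a c" for c
    have b2: "(\<Sum>c<m. (b c)\<^sup>2) = m / 3"
    proof -
      have "(\<Sum>c<m. (b c)\<^sup>2) = (\<kappa> / \<alpha>)\<^sup>2 * \<alpha>\<^sup>2"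
        unfolding b_def power_mult_distrib pos(3) by (simp add: sum_distrib_left)
      also have "\<dots> = \<kappa>\<^sup>2" using pos(1) by (simp add: power_divide)
      finally show ?thesis by (simp only: pos(4))
    qed
    define z where "z = (\<lambda>c\<in>{..<m}. round (b c))"
    have zb: "\<bar>real_of_int (z c) - b c\<bar> \<le> 1 / 2" if "c < m" for c
      using that of_int_round_abs_le[of "b c"] by (simp add: z_def)
    \<comment> \<open>A coordinate rounds to a non-zero integer only if |b c| is at least 1/2, and
      then the rounding error 1/2 is at most |b c|; hence rounding at most doubles it.\<close>
    have z4: "(real_of_int (z c))\<^sup>2 \<le> 4 * (b c)\<^sup>2" if "c < m" for c
    proof (cases "z c = 0")
      case False
      then have "1 \<le> \<bar>real_of_int (z c)\<bar>" by simp
      then have "\<bar>real_of_int (z c)\<bar> \<le> \<bar>2 * b c\<bar>" using zb[OF that] by linarith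
      then have "(real_of_int (z c))\<^sup>2 \<le> (2 * b c)\<^sup>2" by (simp only: abs_le_square_iff)
      then show ?thesis by (simp add: power_mult_distrib)
    qed simp
    have "(\<Sum>c<m. (real_of_int (z c))\<^sup>2) \<le> (\<Sum>c<m. 4 * (b c)\<^sup>2)" using z4 by (intro sum_mono) auto
    also have "\<dots> = 4 * real m / 3" using b2 by (simp flip: sum_distrib_left)
    finally have zr: "3 * (\<Sum>c<m. (real_of_int (z c))\<^sup>2) \<le> 4 * real m" by simp
    have "real_of_int (3 * (\<Sum>c<m. (z c)\<^sup>2)) \<le> real_of_int (4 * int m)" using zr by simp
    then have zi: "3 * (\<Sum>c<m. (z c)\<^sup>2) \<le> 4 * int m" by (simp only: of_int_le_iff)
    have "z c \<in> F" if "c < m" for c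
    proof -
      have "\<bar>z c\<bar> \<le> (z c)\<^sup>2"
      proof (cases "z c = 0")
        case False
        then have "\<bar>z c\<bar> * 1 \<le> \<bar>z c\<bar> * \<bar>z c\<bar>" by (intro mult_left_mono) auto
        then show ?thesis by (simp add: power2_eq_square)
      qed simp
      also have "\<dots> \<le> (\<Sum>c<m. (z c)\<^sup>2)" using that by (intro member_le_sum) auto
      finally show ?thesis using zi by (auto simp: F_def)
    qed
    then have zZ: "z \<in> Z" using zi by (auto simp: Z_def z_def)
    define \<rho> where "\<rho> = nrm z"
    have r2: "\<rho>\<^sup>2 = (\<Sum>c<m. (real_of_int (z c))\<^sup>2)" by (simp add: \<rho>_def nrm_def sum_nonneg)
    have r0: "\<rho> \<ge> 0" by (simp add: \<rho>_def nrm_def sum_nonneg)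
    have "(\<Sum>c<m. (real_of_int (z c) - b c)\<^sup>2) \<le> (\<Sum>c<m. (1/2)\<^sup>2)"
      using zb by (intro sum_mono) (metis abs_ge_zero lessThan_iff power2_abs power_mono)
    then have "\<rho>\<^sup>2 + m / 3 - 2 * (\<Sum>c<m. z c * b c) \<le> m / 4"
      unfolding r2 b2[symmetric] by (simp add: power2_diff sum.distrib sum_subtractf sum_distrib_left power_divide algebra_simps)
    then have zb2: "\<rho>\<^sup>2 + m / 12 \<le> 2 * (\<Sum>c<m. z c * b c)" by simp
    have "\<rho> \<noteq> 0"
    proof
      assume "\<rho> = 0"
      then have "\<forall>c\<in>{..<m}. (real_of_int (z c))\<^sup>2 = 0" using r2 by (subst (asm) eq_commute) (auto simp: sum_nonneg_eq_0_iff)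
      then have "(\<Sum>c<m. z c * b c) = 0" by (intro sum.neutral) auto
      then show False using zb2 m \<open>\<rho> = 0\<close> by simp
    qed
    then have rp: "\<rho> > 0" using r0 by simp
    \<comment> \<open>The square is centred at \<kappa> / 2 because \<kappa>^2 / 4 = m / 12 is
      exactly the surplus left in \<open>zb2\<close>. The resulting \<rho> \<kappa> \<le> 2 z
      \<bullet> b says that the angle between z and b is at most 60 degrees.\<close>
    have "0 \<le> (\<rho> - \<kappa> / 2)\<^sup>2" by simp
    then have "\<rho> * \<kappa> \<le> \<rho>\<^sup>2 + \<kappa>\<^sup>2 / 4" by (simp add: power2_diff power_divide)
    then have "\<rho> * \<kappa> \<le> 2 * (\<Sum>c<m. z c * b c)" using zb2 pos by simp
    also have "(\<Sum>c<m. z c * b c) = \<kappa> / \<alpha> * (\<Sum>c<m. z c * a c)" by (simp add: b_def sum_distrib_left mult_ac)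
    also have "(\<Sum>c<m. z c * a c) = \<rho> * (\<Sum>c<m. z c / \<rho> * a c)" using rp by (simp add: sum_distrib_left)
    finally have "\<alpha> \<le> 2 * (\<Sum>c<m. z c / \<rho> * a c)" using rp pos by (simp add: field_simps)
    moreover have "(\<lambda>c. z c / \<rho>) \<in> U" using zZ rp by (auto simp: U_def \<rho>_def)
    ultimately show ?thesis unfolding \<alpha>_def by (rule bexI)
  qed
  have "\<exists>u\<in>U. sqrt (\<Sum>c<m. (a c)\<^sup>2) \<le> 2 * (\<Sum>c<m. u c * a c)" for a
  proof (cases "(\<Sum>c<m. (a c)\<^sup>2) > 0")
    case True
    then show ?thesis by (rule main)
  next
    case False
    have "(\<Sum>c<m. (a c)\<^sup>2) \<ge> 0" by (intro sum_nonneg) auto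
    with False have s0: "(\<Sum>c<m. (a c)\<^sup>2) = 0" by simp
    then have "\<forall>c\<in>{..<m}. (a c)\<^sup>2 = 0" by (subst (asm) sum_nonneg_eq_0_iff) auto
    then have "(\<Sum>c<m. u c * a c) = 0" for u by (intro sum.neutral) auto
    \<comment> \<open>For a = 0 any net point will do, and the net is inhabited because the non-zero
      all-ones vector has a partner in it.\<close>
    moreover have "\<exists>u. u \<in> U" using main[of "\<lambda>c. 1"] m by auto
    ultimately show ?thesis using s0 by auto
  qed
  then show ?thesis using finU cU nU by blast
qed

text \<open>A lattice of spacing 1 / q with q = 4 sqrt d: an error of at most one spacing per
  coordinate costs d / q^2 = 1/16 in squared distance. Integer points of the scaled ball have l1
  norm at most q sqrt d = 4 d. Counted with weights (3/4)^|j|, which sum to at most 7 per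
  coordinate, they number at most (7 / (3/4)^4)^d = (1792/81)^d.\<close>

lemma ball_net:
  assumes d: "d > 0"
  shows "\<exists>U. finite U \<and> real (card U) \<le> (1792/81) ^ d \<and> (\<forall>u\<in>U. ip d u u \<le> 1) \<and>
    (\<forall>z. ip d z z \<le> 1 \<longrightarrow> (\<exists>u\<in>U. ip d (\<lambda>i. z i - u i) (\<lambda>i. z i - u i) \<le> 1/16))"
proof -
  define q where "q = 4 * sqrt d"
  have q: "q > 0" "q\<^sup>2 = 16 * d" using d by (auto simp: q_def power_mult_distrib)
  define F where "F = {- int (4 * d)..int (4 * d)}"
  define Z where "Z = {k \<in> PiE {..<d} (\<lambda>_. F). (\<Sum>i<d. nat \<bar>k i\<bar>) \<le> 4 * d \<and> ip d (\<lambda>i. k i / q) (\<lambda>i. k i / q) \<le> 1}"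
  define U where "U = (\<lambda>k i. real_of_int (k i) / q) ` Z"
  let ?w = "\<lambda>j :: int. (3/4 :: real) ^ (nat \<bar>j\<bar>)"
  have wp: "(3/4 :: real) ^ (4 * d) \<le> (\<Prod>i<d. ?w (k i))" if "k \<in> Z" for k
    unfolding power_sum[symmetric] using that by (intro power_decreasing) (auto simp: Z_def)
  have fF: "finite F" by (simp add: F_def)
  have ZF: "Z \<subseteq> PiE {..<d} (\<lambda>_. F)" by (auto simp: Z_def)
  have finZ: "finite Z" by (rule card_le_weight_sum(1)[OF fF ZF _ wp]) auto
  have "(\<Sum>j<K. (3/4::real) ^ Suc j) \<le> 3" for K
  proof -
    have "(\<Sum>j<K. (3/4::real) ^ Suc j) = 3/4 * (\<Sum>j<K. (3/4::real) ^ j)" by (simp add: sum_distrib_left)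
    then show ?thesis using geometric_sum_le[of "3/4" K] by simp
  qed
  then have "(\<Sum>j\<in>F. ?w j) \<le> 7"
    unfolding F_def sum_symmetric_int_interval[of "\<lambda>j. (3/4) ^ j"] by (simp add: mult_le_cancel_left_pos)
  moreover have "real (card Z) * (3/4) ^ (4 * d) \<le> (\<Sum>j\<in>F. ?w j) ^ d"
    by (rule card_le_weight_sum(2)[OF fF ZF _ wp]) auto
  ultimately have "real (card Z) * (3/4) ^ (4 * d) \<le> 7 ^ d"
    by (meson order_trans power_mono sum_nonneg zero_le_power zero_le_divide_iff zero_le_numeral)
  also have "(7::real) ^ d = ((1792/81) * (3/4) ^ 4) ^ d" by (simp add: power_divide)
  also have "\<dots> = (1792/81) ^ d * (3/4) ^ (4 * d)" by (simp only: power_mult_distrib power_mult)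
  finally have cZ: "real (card Z) \<le> (1792/81) ^ d" by simp
  have "card U \<le> card Z" unfolding U_def by (rule card_image_le[OF finZ])
  then have cU: "real (card U) \<le> (1792/81) ^ d" using cZ by simp
  have "\<exists>u\<in>U. ip d (\<lambda>i. z i - u i) (\<lambda>i. z i - u i) \<le> 1/16" if z: "ip d z z \<le> 1" for z
  proof -
    \<comment> \<open>Truncation towards zero instead of rounding to nearest keeps |k i| \<le> q |z
      i|, so the net point stays in the ball and within the l1 bound.\<close>
    define k where "k = (\<lambda>i\<in>{..<d}. if z i \<ge> 0 then \<lfloor>q * z i\<rfloor> else - \<lfloor>- q * z i\<rfloor>)"
    have kz: "\<bar>real_of_int (k i)\<bar> \<le> q * \<bar>z i\<bar> \<and> \<bar>q * z i - k i\<bar> \<le> 1" if "i < d" for i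
    proof (cases "z i \<ge> 0")
      case True
      then have "0 \<le> \<lfloor>q * z i\<rfloor>" using q by simp
      moreover have "real_of_int \<lfloor>q * z i\<rfloor> \<le> q * z i" "q * z i < real_of_int \<lfloor>q * z i\<rfloor> + 1" by linarith+
      ultimately show ?thesis using True that q by (simp add: k_def abs_mult; linarith)
    next
      case False
      then have "0 \<le> \<lfloor>- q * z i\<rfloor>" using q by (simp add: mult_le_0_iff)
      moreover have "real_of_int \<lfloor>- q * z i\<rfloor> \<le> - q * z i" "- q * z i < real_of_int \<lfloor>- q * z i\<rfloor> + 1" by linarith+
      ultimately show ?thesis using False that q by (simp add: k_def abs_mult; linarith)
    qed
    have "(\<Sum>i<d. \<bar>z i\<bar>)\<^sup>2 \<le> (\<Sum>i<d. \<bar>z i\<bar>\<^sup>2) * card {..<d}" by (rule sum_squared_le_sum_of_squares)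
    also have "\<dots> \<le> 1 * real d" using z by (intro mult_mono) (auto simp: ip_def power2_eq_square)
    finally have sz: "(\<Sum>i<d. \<bar>z i\<bar>) \<le> sqrt d" using real_le_rsqrt by simp
    have "(\<Sum>i<d. \<bar>real_of_int (k i)\<bar>) \<le> (\<Sum>i<d. q * \<bar>z i\<bar>)" using kz by (intro sum_mono) auto
    also have "\<dots> \<le> q * sqrt d" using q sz by (simp flip: sum_distrib_left)
    also have "\<dots> = 4 * d" by (simp add: q_def)
    finally have "real (\<Sum>i<d. nat \<bar>k i\<bar>) \<le> real (4 * d)" by simp
    then have sk: "(\<Sum>i<d. nat \<bar>k i\<bar>) \<le> 4 * d" by (simp only: of_nat_le_iff)
    have "k i \<in> F" if "i < d" for i
    proof -
      have "nat \<bar>k i\<bar> \<le> (\<Sum>i<d. nat \<bar>k i\<bar>)" using that by (intro member_le_sum) auto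
      then show ?thesis using sk by (auto simp: F_def)
    qed
    moreover have "ip d (\<lambda>i. k i / q) (\<lambda>i. k i / q) \<le> 1"
    proof -
      have "(k i / q) * (k i / q) \<le> z i * z i" if "i < d" for i
      proof -
        have "\<bar>k i / q\<bar> \<le> \<bar>z i\<bar>" using kz[OF that] q by (simp add: field_simps)
        then show ?thesis by (metis abs_le_square_iff power2_eq_square)
      qed
      then have "ip d (\<lambda>i. k i / q) (\<lambda>i. k i / q) \<le> ip d z z" unfolding ip_def by (intro sum_mono) auto
      then show ?thesis using z by simp
    qed
    ultimately have kZ: "k \<in> Z" using sk by (auto simp: Z_def k_def)
    have "(z i - k i / q) * (z i - k i / q) \<le> 1 / q\<^sup>2" if "i < d" for i
    proof -
      have "(q * z i - k i)\<^sup>2 \<le> 1" using kz[OF that] by (simp add: abs_square_le_1)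
      then have "(q * z i - k i)\<^sup>2 / q\<^sup>2 \<le> 1 / q\<^sup>2" by (intro divide_right_mono) auto
      moreover have "z i - k i / q = (q * z i - k i) / q" using q by (simp add: field_simps)
      ultimately show ?thesis by (simp only: power2_eq_square times_divide_times_eq)
    qed
    then have "ip d (\<lambda>i. z i - k i / q) (\<lambda>i. z i - k i / q) \<le> (\<Sum>i<d. 1 / q\<^sup>2)" unfolding ip_def by (intro sum_mono) auto
    also have "\<dots> = 1/16" using q d by simp
    finally show ?thesis using kZ by (auto simp: U_def)
  qed
  moreover have "\<forall>u\<in>U. ip d u u \<le> 1" by (auto simp: U_def Z_def)
  ultimately show ?thesis using finZ cU by (intro exI[of _ U]) (auto simp: U_def)
qed

section \<open>White noise\<close>

lemma ip_cauchy_schwarz: "(ip n x y)\<^sup>2 \<le> ip n x x * ip n y y"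
  using Cauchy_Schwarz_ineq_sum[of x y "{..<n}"] by (simp add: ip_def power2_eq_square)

text \<open>Let s be the supremum over the ball of the absolute deviation |Q|. Moving from z to a
  net point changes Q by at most s / 2, so s \<le> N / 4 + s / 2 and hence s \<le> N / 2. Although
  only the lower bound is wanted, the control on the net must be two-sided for s to absorb
  itself.\<close>

lemma net_quadratic_bound:
  assumes U: "\<And>z. ip d z z \<le> 1 \<Longrightarrow> \<exists>u\<in>U. ip d (\<lambda>i. z i - u i) (\<lambda>i. z i - u i) \<le> 1/16"
    and U1: "\<And>u. u \<in> U \<Longrightarrow> ip d u u \<le> 1"
    and b: "\<And>u. u \<in> U \<Longrightarrow> \<bar>(\<Sum>t<N. (ip d u (e t))\<^sup>2) - real N * ip d u u\<bar> \<le> real N / 4"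
  shows "real N / 2 * ip d z z \<le> (\<Sum>t<N. (ip d z (e t))\<^sup>2)"
proof -
  define Q where "Q z = (\<Sum>t<N. (ip d z (e t))\<^sup>2) - real N * ip d z z" for z
  let ?S = "(\<lambda>z. \<bar>Q z\<bar>) ` {z. ip d z z \<le> 1}"
  have Qb: "\<bar>Q z\<bar> \<le> (\<Sum>t<N. ip d (e t) (e t)) + real N" if z: "ip d z z \<le> 1" for z
  proof -
    have "(ip d z (e t))\<^sup>2 \<le> ip d (e t) (e t)" for t
    proof -
      have "(ip d z (e t))\<^sup>2 \<le> ip d z z * ip d (e t) (e t)" by (rule ip_cauchy_schwarz)
      also have "\<dots> \<le> 1 * ip d (e t) (e t)" using z by (intro mult_right_mono ip_ge_0)
      finally show ?thesis by simp
    qed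
    then have "(\<Sum>t<N. (ip d z (e t))\<^sup>2) \<le> (\<Sum>t<N. ip d (e t) (e t))" by (intro sum_mono)
    moreover have "0 \<le> (\<Sum>t<N. (ip d z (e t))\<^sup>2)" by (intro sum_nonneg) auto
    moreover have "0 \<le> real N * ip d z z" "real N * ip d z z \<le> real N * 1"
      using mult_left_mono[OF z, of "real N"] by (auto simp: ip_ge_0)
    ultimately show ?thesis unfolding Q_def by linarith
  qed
  have bdd: "bdd_above ?S" using Qb by (intro bdd_aboveI[of _ "(\<Sum>t<N. ip d (e t) (e t)) + real N"]) auto
  define s where "s = Sup ?S"
  have Qs: "\<bar>Q z\<bar> \<le> s" if "ip d z z \<le> 1" for z
    unfolding s_def using that bdd by (intro cSup_upper) auto
  have Qscale: "Q (\<lambda>i. c * z i) = c\<^sup>2 * Q z" for c z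
    by (simp add: Q_def ip_linear power_mult_distrib right_diff_distrib sum_distrib_left power2_eq_square[of c] mult_ac)
  have s0: "s \<ge> 0" using Qs[of "\<lambda>_. 0"] by (simp add: ip_def Q_def)
  have Qall: "\<bar>Q z\<bar> \<le> s * ip d z z" for z
  proof (cases "ip d z z = 0")
    case True
    then have "ip d z (e t) = 0" for t using ip_cauchy_schwarz[of d z "e t"] by simp
    then show ?thesis using True by (simp add: Q_def)
  next
    case False
    then have p: "ip d z z > 0" using ip_ge_0[of d z] by simp
    define c where "c = 1 / sqrt (ip d z z)"
    have c2: "c\<^sup>2 = 1 / ip d z z" using p by (simp add: c_def power_divide)
    have "ip d (\<lambda>i. c * z i) (\<lambda>i. c * z i) = c\<^sup>2 * ip d z z" by (simp add: ip_linear power2_eq_square)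
    then have "\<bar>c\<^sup>2 * Q z\<bar> \<le> s" using Qs[of "\<lambda>i. c * z i"] p c2 by (simp add: Qscale)
    then show ?thesis using p by (simp add: c2 abs_mult field_simps)
  qed
  have "\<bar>Q z\<bar> \<le> real N / 4 + s / 2" if z: "ip d z z \<le> 1" for z
  proof -
    obtain u where u: "u \<in> U" "ip d (\<lambda>i. z i - u i) (\<lambda>i. z i - u i) \<le> 1/16" using U[OF z] by blast
    \<comment> \<open>Polarisation with z - u = a / 4 and z + u = 2 h, both \<open>a\<close> and
      \<open>h\<close> in the unit ball: Q z - Q u is an eighth of Q (a + h) - Q (a - h), and by the
      parallelogram law the two squared norms add up to at most 4.\<close>
    define a where "a i = 4 * (z i - u i)" for i
    define h where "h i = (z i + u i) / 2" for i
    have aa: "ip d a a \<le> 1" using u(2) unfolding a_def ip_scale_left ip_scale_right by simp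
    have par: "ip d (\<lambda>i. x i + y i) (\<lambda>i. x i + y i) + ip d (\<lambda>i. x i - y i) (\<lambda>i. x i - y i) = 2 * ip d x x + 2 * ip d y y" for x y
      by (simp add: ip_linear)
    have "ip d (\<lambda>i. z i + u i) (\<lambda>i. z i + u i) \<le> 4"
      using par[of z u] z U1[OF u(1)] ip_ge_0[of d "\<lambda>i. z i - u i"] by linarith
    moreover have "ip d h h = ip d (\<lambda>i. z i + u i) (\<lambda>i. z i + u i) / 4"
      unfolding h_def ip_def by (simp add: sum_divide_distrib)
    ultimately have hh: "ip d h h \<le> 1" by simp
    have "Q z - Q u = (Q (\<lambda>i. a i + h i) - Q (\<lambda>i. a i - h i)) / 8"
    proof -
      have pol: "ip d (\<lambda>i. a i + h i) y * ip d (\<lambda>i. a i + h i) y' - ip d (\<lambda>i. a i - h i) y * ip d (\<lambda>i. a i - h i) y' =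
        2 * (ip d a y * ip d h y' + ip d h y * ip d a y')" for y y'
        by (simp add: ip_linear algebra_simps)
      have ay: "ip d a y = 4 * (ip d z y - ip d u y)" for y
        unfolding a_def ip_scale_left ip_diff_left ..
      have hy: "ip d h y = (ip d z y + ip d u y) / 2" for y
        unfolding h_def ip_def by (simp add: sum_divide_distrib sum.distrib add_divide_distrib algebra_simps)
      have sq: "(ip d (\<lambda>i. a i + h i) y)\<^sup>2 - (ip d (\<lambda>i. a i - h i) y)\<^sup>2 = 8 * ((ip d z y)\<^sup>2 - (ip d u y)\<^sup>2)" for y
        unfolding power2_eq_square pol ay hy by (simp add: algebra_simps)
      have nn: "ip d (\<lambda>i. a i + h i) (\<lambda>i. a i + h i) - ip d (\<lambda>i. a i - h i) (\<lambda>i. a i - h i) = 8 * (ip d z z - ip d u u)"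
      proof -
        have "ip d (\<lambda>i. a i + h i) (\<lambda>i. a i + h i) - ip d (\<lambda>i. a i - h i) (\<lambda>i. a i - h i) = 4 * ip d a h"
          by (simp add: ip_linear ip_commute[of d h a])
        moreover have "ip d z h = (ip d z z + ip d z u) / 2" "ip d u h = (ip d z u + ip d u u) / 2"
          using hy[of z] hy[of u] by (simp_all add: ip_commute)
        ultimately show ?thesis unfolding ay by (simp only:) (simp add: field_simps)
      qed
      have "Q (\<lambda>i. a i + h i) - Q (\<lambda>i. a i - h i) =
        (\<Sum>t<N. (ip d (\<lambda>i. a i + h i) (e t))\<^sup>2 - (ip d (\<lambda>i. a i - h i) (e t))\<^sup>2)
        - real N * (ip d (\<lambda>i. a i + h i) (\<lambda>i. a i + h i) - ip d (\<lambda>i. a i - h i) (\<lambda>i. a i - h i))"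
        unfolding Q_def sum_subtractf right_diff_distrib by (rule diff_diff_eq2[THEN trans]) simp
      also have "\<dots> = 8 * (Q z - Q u)"
        unfolding sq nn Q_def by (simp add: sum_subtractf algebra_simps flip: sum_distrib_left)
      finally show ?thesis by simp
    qed
    moreover have "\<bar>Q (\<lambda>i. a i + h i)\<bar> + \<bar>Q (\<lambda>i. a i - h i)\<bar> \<le> s * 4"
    proof -
      have "\<bar>Q (\<lambda>i. a i + h i)\<bar> + \<bar>Q (\<lambda>i. a i - h i)\<bar> \<le> s * (ip d (\<lambda>i. a i + h i) (\<lambda>i. a i + h i) + ip d (\<lambda>i. a i - h i) (\<lambda>i. a i - h i))"
        using Qall[of "\<lambda>i. a i + h i"] Qall[of "\<lambda>i. a i - h i"] by (simp add: distrib_left)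
      also have "\<dots> \<le> s * 4" unfolding par using aa hh s0 by (intro mult_left_mono) auto
      finally show ?thesis .
    qed
    moreover have "\<bar>Q u\<bar> \<le> real N / 4" using b[OF u(1)] by (simp add: Q_def)
    moreover have "\<bar>v\<bar> \<le> c / 4 + s / 2"
      if "v - w = (X - Y) / 8" "\<bar>X\<bar> + \<bar>Y\<bar> \<le> s * 4" "\<bar>w\<bar> \<le> c / 4" for v w X Y c :: real
    proof -
      have "8 * v - 8 * w = X - Y" using that(1) by simp
      then show ?thesis using that(2,3) by (simp add: abs_le_iff) linarith
    qed
    ultimately show ?thesis by blast
  qed
  then have "s \<le> real N / 4 + s / 2"
    unfolding s_def by (intro cSup_least) (auto intro!: exI[of _ "\<lambda>_. 0"] simp: ip_def)
  then have "s \<le> real N / 2" by simp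
  then have "s * ip d z z \<le> real N / 2 * ip d z z" by (intro mult_right_mono ip_ge_0)
  then show ?thesis using Qall[of z] by (simp add: Q_def abs_le_iff)
qed

lemma window_sum:
  fixes f g :: "nat \<Rightarrow> real"
  assumes "a + n \<le> D"
  shows "(\<Sum>i<D. (if a \<le> i \<and> i < a + n then f (i - a) else 0) * g i) = (\<Sum>c<n. f c * g (a + c))"
proof -
  have "(\<Sum>i<D. (if a \<le> i \<and> i < a + n then f (i - a) else 0) * g i) = (\<Sum>i\<in>{a..<a+n}. f (i - a) * g i)"
    using assms by (intro sum.mono_neutral_cong_right) auto
  also have "\<dots> = (\<Sum>c<n. f c * g (a + c))"
    by (rule sum.reindex_bij_witness[of _ "\<lambda>c. a + c" "\<lambda>i. i - a"]) auto
  finally show ?thesis .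
qed

lemma std_normal_measurable_borel: "f \<in> borel_measurable (PiM I (\<lambda>_. borel)) \<Longrightarrow> f \<in> borel_measurable (PiM I (\<lambda>_. std_normal_distribution))"
proof -
  have "sets (PiM I (\<lambda>_. std_normal_distribution)) = sets (PiM I (\<lambda>_. borel))" by (intro sets_PiM_cong) auto
  then show "f \<in> borel_measurable (PiM I (\<lambda>_. borel)) \<Longrightarrow> f \<in> borel_measurable (PiM I (\<lambda>_. std_normal_distribution))"
    by (simp cong: measurable_cong_sets)
qed

section \<open>White noise and elementary events\<close>

locale white_noise = prob_space M for M :: "'a measure" +
  fixes x :: "nat \<Rightarrow> 'a \<Rightarrow> real"
  assumes white: "\<And>D. isonormal M {..<D} x"
begin

lemma x_measurable [measurable]: "x i \<in> borel_measurable M"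
  using white[of "Suc i"] by (simp add: isonormal_def)

lemma markov_event:
  assumes [measurable]: "f \<in> borel_measurable M" and f: "(\<integral>\<^sup>+\<omega>. ennreal (f \<omega>) \<partial>M) \<le> 1"
    and f0: "\<And>\<omega>. f \<omega> \<ge> 0" and c: "c > 0"
  shows "{\<omega>\<in>space M. f \<omega> < c} \<in> events" "prob {\<omega>\<in>space M. f \<omega> < c} \<ge> 1 - 1 / c"
proof -
  show m: "{\<omega>\<in>space M. f \<omega> < c} \<in> events" by measurable
  have "emeasure M {\<omega>\<in>space M. 1 \<le> ennreal (1/c) * ennreal (f \<omega>)} \<le> ennreal (1/c) * (\<integral>\<^sup>+\<omega>. ennreal (f \<omega>) * indicator (space M) \<omega> \<partial>M)"
    by (rule nn_integral_Markov_inequality) auto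
  also have "(\<integral>\<^sup>+\<omega>. ennreal (f \<omega>) * indicator (space M) \<omega> \<partial>M) = (\<integral>\<^sup>+\<omega>. ennreal (f \<omega>) \<partial>M)"
    by (intro nn_integral_cong) auto
  also have "ennreal (1/c) * \<dots> \<le> ennreal (1/c) * 1" using f by (intro mult_left_mono) auto
  also have "{\<omega>\<in>space M. 1 \<le> ennreal (1/c) * ennreal (f \<omega>)} = {\<omega>\<in>space M. c \<le> f \<omega>}"
  proof -
    have "1 \<le> ennreal (1/c) * ennreal (f \<omega>) \<longleftrightarrow> c \<le> f \<omega>" for \<omega>
    proof -
      have "ennreal (1/c) * ennreal (f \<omega>) = ennreal (f \<omega> / c)"
        using c f0[of \<omega>] by (simp add: ennreal_mult[symmetric])
      then show ?thesis using c f0[of \<omega>] by (simp add: pos_le_divide_eq)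
    qed
    then show ?thesis by simp
  qed
  finally have "prob {\<omega>\<in>space M. c \<le> f \<omega>} \<le> 1 / c"
    using c by (simp add: emeasure_eq_measure)
  moreover have "prob {\<omega>\<in>space M. f \<omega> < c} = 1 - prob {\<omega>\<in>space M. c \<le> f \<omega>}"
    by (subst prob_compl[symmetric]) (auto intro!: arg_cong[where f = prob])
  ultimately show "prob {\<omega>\<in>space M. f \<omega> < c} \<ge> 1 - 1 / c" by simp
qed

lemma finite_intersection_event:
  assumes U: "finite U" and A: "\<And>u. u \<in> U \<Longrightarrow> A u \<in> events" and p: "\<And>u. u \<in> U \<Longrightarrow> prob (A u) \<ge> 1 - \<epsilon>"
  shows "\<exists>E\<in>events. prob E \<ge> 1 - real (card U) * \<epsilon> \<and> (\<forall>\<omega>\<in>E. \<omega> \<in> space M \<and> (\<forall>u\<in>U. \<omega> \<in> A u))"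
proof -
  let ?B = "\<Union>u\<in>U. space M - A u"
  have B: "?B \<in> events" using U A by (intro sets.finite_UN) auto
  have "prob ?B \<le> (\<Sum>u\<in>U. prob (space M - A u))" using U A by (intro finite_measure_subadditive_finite) auto
  also have "\<dots> \<le> (\<Sum>u\<in>U. \<epsilon>)"
    using A p by (intro sum_mono) (force simp: prob_compl)
  finally have "prob ?B \<le> real (card U) * \<epsilon>" by simp
  then have "prob (space M - ?B) \<ge> 1 - real (card U) * \<epsilon>" using B by (simp add: prob_compl)
  then show ?thesis using B by (intro bexI[of _ "space M - ?B"]) auto
qed

subsection \<open>The self-normalised bound\<close>

text \<open>Predictability by construction: regressor s is a linear function of the first
  \<open>K s\<close> coordinates only, while \<open>proj\<close> reads the block of m coordinates
  starting at \<open>K s\<close>. With \<open>K s + m \<le> K (Suc s)\<close> that block belongs to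
  the past of the next regressor.\<close>

definition regr :: "(nat \<Rightarrow> nat \<Rightarrow> nat \<Rightarrow> real) \<Rightarrow> (nat \<Rightarrow> nat) \<Rightarrow> (nat \<Rightarrow> real) \<Rightarrow> nat \<Rightarrow> nat \<Rightarrow> real" where
  "regr L K y s i = (\<Sum>j<K s. L s i j * y j)"

definition proj :: "(nat \<Rightarrow> real) \<Rightarrow> (nat \<Rightarrow> nat) \<Rightarrow> nat \<Rightarrow> (nat \<Rightarrow> real) \<Rightarrow> nat \<Rightarrow> real" where
  "proj u K m y s = (\<Sum>c<m. u c * y (K s + c))"

text \<open>At step T the new block enters only through its component along the unit vector
  \<open>u\<close>, which is standard normal and independent of the coordinates before
  \<open>K T\<close>. Fubini isolates this single coordinate; for a fixed past the last factor has
  mean one and the induction hypothesis covers the rest.\<close>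

lemma expectation_lik:
  assumes mu: "\<mu> > 0" and K: "\<And>s. K s + m \<le> K (Suc s)" and u: "(\<Sum>c<m. (u c)\<^sup>2) = 1"
  shows "(\<integral>\<^sup>+\<omega>. ennreal (lik \<mu> d (regr L K (\<lambda>j. x j \<omega>)) (proj u K m (\<lambda>j. x j \<omega>)) T) \<partial>M) = 1"
proof (induction T)
  case 0
  then show ?case by (simp add: emeasure_space_1)
next
  case (Suc T)
  have Kmono: "K s \<le> K t" if "s \<le> t" for s t
    using that by (rule lift_Suc_mono_le[rotated]) (use K add_leD1 in blast)
  have Km: "K s + m \<le> K T" if "s < T" for s using K[of s] Kmono[of "Suc s" T] that by linarith
  define a where "a = K T"
  \<comment> \<open>The coordinates below a = K T are kept, and index a is given to the component of
    the new block along \<open>u\<close>. The family stays isonormal because these functionals are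
    orthonormal.\<close>
  define X' where "X' j = (if j = a then (\<lambda>\<omega>. proj u K m (\<lambda>j. x j \<omega>) T) else x j)" for j
  define Lc where "Lc j i = (if j = a then (if a \<le> i \<and> i < a + m then u (i - a) else 0) else (if i = j then 1 else 0 :: real))" for j i
  let ?I = "{..<a}"
  have ws: "(\<Sum>i<a+m. Lc a i * g i) = (\<Sum>c<m. u c * g (a + c))" for g
    by (simp only: Lc_def simp_thms if_True) (rule window_sum[OF order_refl])
  have ds: "(\<Sum>i<a+m. Lc j i * g i) = g j" if "j < a" for g j
  proof -
    have "(\<Sum>i<a+m. Lc j i * g i) = (\<Sum>i<a+m. if i = j then g i else 0)"
      using that by (intro sum.cong) (auto simp: Lc_def)
    then show ?thesis using that by simp
  qed
  have iso: "isonormal M (insert a ?I) X'"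
  proof (rule isonormal_orthonormal[OF white[of "a + m"], where L = Lc])
    fix j k assume jk: "j \<in> insert a ?I" "k \<in> insert a ?I"
    consider "j < a" | "j = a" "k < a" | "j = a" "k = a" using jk by auto
    then show "(\<Sum>i<a+m. Lc j i * Lc k i) = (if j = k then 1 else 0)"
    proof cases
      case 1
      then show ?thesis using jk unfolding ds[OF 1] by (auto simp: Lc_def)
    next
      case 2
      then show ?thesis using ds[of k "Lc j"] by (simp add: mult.commute[of "Lc a _"]) (simp add: Lc_def)
    next
      case 3
      then show ?thesis using u by (simp add: ws) (simp add: Lc_def power2_eq_square)
    qed
  next
    fix j assume "j \<in> insert a ?I"
    then show "X' j = (\<lambda>\<omega>. \<Sum>i<a+m. Lc j i * x i \<omega>)"
      by (cases "j = a") (auto simp: X'_def ws ds proj_def a_def[symmetric])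
  qed auto
  interpret P: product_sigma_finite "\<lambda>_. std_normal_distribution" by (rule product_sigma_finite_std_normal)
  let ?z = "regr L K" and ?g = "proj u K m"
  define F where "F y = ennreal (lik \<mu> d (?z y) (?g y) T)" for y
  define H where "H y = lik_step (gain \<mu> d (?z y) T) (drift \<mu> d (?z y) (?g y) T)" for y
  have comp: "(\<lambda>y. y j) \<in> borel_measurable (PiM J (\<lambda>_. borel))" if "j \<in> J" for j :: nat and J
    using that by (rule measurable_component_singleton)
  have zm: "(\<lambda>y. ?z y s i) \<in> borel_measurable (PiM J (\<lambda>_. borel))" if "s \<le> T" "?I \<subseteq> J" for s i J
    unfolding regr_def using Kmono[OF that(1)] that(2)
    by (intro borel_measurable_sum borel_measurable_times borel_measurable_const comp) (auto simp: a_def)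
  have gm: "(\<lambda>y. ?g y s) \<in> borel_measurable (PiM J (\<lambda>_. borel))" if "s < T" "?I \<subseteq> J" for s J
    unfolding proj_def using Km[OF that(1)] that(2)
    by (intro borel_measurable_sum borel_measurable_times borel_measurable_const comp) (auto simp: a_def)
  have Fm: "F \<in> borel_measurable (PiM J (\<lambda>_. borel))" if "?I \<subseteq> J" for J
    unfolding F_def by (rule measurable_compose[OF measurable_lik measurable_ennreal]) (use zm gm that in auto)
  have Hm: "(\<lambda>y. H y (y a)) \<in> borel_measurable (PiM (insert a ?I) (\<lambda>_. borel))"
    unfolding H_def
    by (rule measurable_lik_step, rule measurable_gain_drift(1)[of T ?z _ ?g], rule zm, assumption, blast, rule gm, assumption, blast,
        rule measurable_gain_drift(2)[of T ?z _ ?g], rule zm, assumption, blast, rule gm, assumption, blast, rule comp, blast)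
  have zc: "?z y s = ?z y' s" if "s \<le> T" "\<And>j. j < a \<Longrightarrow> y j = y' j" for y y' s
    unfolding regr_def using Kmono[OF that(1)] that(2) by (intro ext sum.cong) (auto simp: a_def)
  have gc: "?g y s = ?g y' s" if "s < T" "\<And>j. j < a \<Longrightarrow> y j = y' j" for y y' s
    unfolding proj_def using Km[OF that(1)] that(2) by (intro sum.cong) (auto simp: a_def)
  have Fc: "F y = F y'" if "\<And>j. j < a \<Longrightarrow> y j = y' j" for y y'
    unfolding F_def by (intro arg_cong[where f = ennreal] lik_cong zc gc) (use that in auto)
  have Hc: "H y = H y'" if "\<And>j. j < a \<Longrightarrow> y j = y' j" for y y'
    unfolding H_def by (intro ext arg_cong2[where f = "\<lambda>p q. lik_step p q _"] gain_drift_cong zc gc) (use that in auto)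
  have "(\<integral>\<^sup>+\<omega>. ennreal (lik \<mu> d (?z (\<lambda>j. x j \<omega>)) (?g (\<lambda>j. x j \<omega>)) (Suc T)) \<partial>M) =
    (\<integral>\<^sup>+\<omega>. F (\<lambda>j\<in>insert a ?I. X' j \<omega>) * ennreal (H (\<lambda>j\<in>insert a ?I. X' j \<omega>) ((\<lambda>j\<in>insert a ?I. X' j \<omega>) a)) \<partial>M)"
  proof (rule nn_integral_cong)
    fix \<omega>
    have FF: "F (\<lambda>j. x j \<omega>) = F (\<lambda>j\<in>insert a ?I. X' j \<omega>)" by (rule Fc) (simp add: X'_def)
    have HH: "H (\<lambda>j. x j \<omega>) = H (\<lambda>j\<in>insert a ?I. X' j \<omega>)" by (rule Hc) (simp add: X'_def)
    have Xa: "(\<lambda>j\<in>insert a ?I. X' j \<omega>) a = X' a \<omega>" by simp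
    have "ennreal (lik \<mu> d (?z (\<lambda>j. x j \<omega>)) (?g (\<lambda>j. x j \<omega>)) (Suc T)) = F (\<lambda>j. x j \<omega>) * ennreal (H (\<lambda>j. x j \<omega>) (X' a \<omega>))"
      using lik_pos[OF mu] by (simp add: F_def H_def X'_def ennreal_mult' less_imp_le)
    then show "ennreal (lik \<mu> d (?z (\<lambda>j. x j \<omega>)) (?g (\<lambda>j. x j \<omega>)) (Suc T)) =
       F (\<lambda>j\<in>insert a ?I. X' j \<omega>) * ennreal (H (\<lambda>j\<in>insert a ?I. X' j \<omega>) ((\<lambda>j\<in>insert a ?I. X' j \<omega>) a))"
      unfolding FF HH Xa .
  qed
  also have "\<dots> = (\<integral>\<^sup>+y. F y * ennreal (H y (y a)) \<partial>PiM (insert a ?I) (\<lambda>_. std_normal_distribution))"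
    by (rule isonormal_nn_integral[OF prob_space_axioms iso])
      (use Hm in \<open>auto intro!: Fm borel_measurable_times_ennreal\<close>)
  also have "\<dots> = (\<integral>\<^sup>+y. (\<integral>\<^sup>+v. F (y(a := v)) * ennreal (H (y(a := v)) ((y(a := v)) a)) \<partial>std_normal_distribution) \<partial>PiM ?I (\<lambda>_. std_normal_distribution))"
    by (rule P.product_nn_integral_insert)
      (use Hm in \<open>auto intro!: Fm borel_measurable_times_ennreal std_normal_measurable_borel\<close>)
  also have "\<dots> = (\<integral>\<^sup>+y. F y \<partial>PiM ?I (\<lambda>_. std_normal_distribution))"
  proof (rule nn_integral_cong)
    fix y :: "nat \<Rightarrow> real"
    have F1: "F (y(a := v)) = F y" for v by (rule Fc) simp
    have H1: "H (y(a := v)) = H y" for v by (rule Hc) simp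
    have "(\<integral>\<^sup>+v. F (y(a := v)) * ennreal (H (y(a := v)) ((y(a := v)) a)) \<partial>std_normal_distribution) = F y * (\<integral>\<^sup>+v. ennreal (H y v) \<partial>std_normal_distribution)"
    proof -
      have "(\<lambda>v. ennreal (H y v)) \<in> borel_measurable std_normal_distribution" by (simp add: H_def)
      then show ?thesis by (simp only: F1 H1 fun_upd_same nn_integral_cmult)
    qed
    then show "(\<integral>\<^sup>+v. F (y(a := v)) * ennreal (H (y(a := v)) ((y(a := v)) a)) \<partial>std_normal_distribution) = F y"
      by (simp add: H_def nn_integral_lik_step[OF less_le_trans[OF _ gain_nonneg[OF mu]]])
  qed
  also have "\<dots> = (\<integral>\<^sup>+\<omega>. F (\<lambda>j\<in>?I. x j \<omega>) \<partial>M)"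
    by (rule isonormal_nn_integral[OF prob_space_axioms white _ Fm, symmetric]) auto
  also have "\<dots> = (\<integral>\<^sup>+\<omega>. F (\<lambda>j. x j \<omega>) \<partial>M)"
    by (intro nn_integral_cong Fc) auto
  also have "\<dots> = 1" unfolding F_def by (rule Suc.IH)
  finally show ?case .
qed

text \<open>Markov's inequality at level \<open>5 ^ m / \<delta>\<close> makes the union over at
  most \<open>5 ^ m\<close> directions cost \<delta>. A net direction at angle at most 60 degrees
  recovers the norm up to a factor 2, hence the 4. The event is chosen before \<open>f\<close>,
  since only the likelihoods are random and Cauchy-Schwarz handles every \<open>f\<close> at
  once.\<close>

lemma vector_self_normalized:
  assumes mu: "\<mu> > 0" and K: "\<And>s. K s + m \<le> K (Suc s)" and m: "m > 0" and \<delta>: "\<delta> > 0"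
  shows "\<exists>E\<in>events. prob E \<ge> 1 - \<delta> \<and> (\<forall>\<omega>\<in>E. \<omega> \<in> space M \<and> (\<forall>f.
    (\<Sum>c<m. (\<Sum>s<T. x (K s + c) \<omega> * ip d (regr L K (\<lambda>j. x j \<omega>) s) f)\<^sup>2) \<le>
    4 * (2 * ln (5 ^ m / \<delta>) + ln (Determinant.det (gram_mat \<mu> d (regr L K (\<lambda>j. x j \<omega>)) T)) - d * ln \<mu>) *
      (\<mu> * ip d f f + (\<Sum>s<T. (ip d (regr L K (\<lambda>j. x j \<omega>) s) f)\<^sup>2))))"
proof -
  obtain U where U: "finite U" "real (card U) \<le> 5 ^ m" "\<And>u. u \<in> U \<Longrightarrow> (\<Sum>c<m. (u c)\<^sup>2) = (1::real)"
    "\<And>a. \<exists>u\<in>U. sqrt (\<Sum>c<m. (a c)\<^sup>2) \<le> 2 * (\<Sum>c<m. u c * a c)" using direction_net[OF m] by blast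
  let ?z = "\<lambda>\<omega>. regr L K (\<lambda>j. x j \<omega>)" and ?g = "\<lambda>u \<omega>. proj u K m (\<lambda>j. x j \<omega>)"
  let ?c = "5 ^ m / \<delta>"
  have c: "?c > 0" using \<delta> by simp
  have lm: "(\<lambda>\<omega>. lik \<mu> d (?z \<omega>) (?g u \<omega>) T) \<in> borel_measurable M" for u
    by (intro measurable_lik) (auto simp: regr_def proj_def)
  have ev: "{\<omega>\<in>space M. lik \<mu> d (?z \<omega>) (?g u \<omega>) T < ?c} \<in> events"
    "prob {\<omega>\<in>space M. lik \<mu> d (?z \<omega>) (?g u \<omega>) T < ?c} \<ge> 1 - 1 / ?c" if "u \<in> U" for u
    using markov_event[OF lm, of u, OF _ less_imp_le[OF lik_pos[OF mu]] c]
      expectation_lik[OF mu _ U(3)[OF that], of K d L T] K by auto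
  have "\<exists>E\<in>events. prob E \<ge> 1 - real (card U) * (1 / ?c) \<and>
    (\<forall>\<omega>\<in>E. \<omega> \<in> space M \<and> (\<forall>u\<in>U. \<omega> \<in> {\<omega>\<in>space M. lik \<mu> d (?z \<omega>) (?g u \<omega>) T < ?c}))"
    by (rule finite_intersection_event[OF U(1)]) (rule ev, assumption)+
  then obtain E where E': "E \<in> events" "prob E \<ge> 1 - real (card U) * (1 / ?c)"
    "\<forall>\<omega>\<in>E. \<omega> \<in> space M \<and> (\<forall>u\<in>U. \<omega> \<in> {\<omega>\<in>space M. lik \<mu> d (?z \<omega>) (?g u \<omega>) T < ?c})"
    by (elim bexE conjE)
  then have E: "E \<in> events" "prob E \<ge> 1 - real (card U) * (1 / ?c)"
    "\<And>\<omega>. \<omega> \<in> E \<Longrightarrow> \<omega> \<in> space M \<and> (\<forall>u\<in>U. lik \<mu> d (?z \<omega>) (?g u \<omega>) T < ?c)" by auto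
  have "real (card U) * (1 / ?c) \<le> 5 ^ m * (1 / ?c)" using \<delta> U(2) by (intro mult_right_mono) auto
  then have pE: "prob E \<ge> 1 - \<delta>" using E(2) by simp
  show ?thesis
  proof (intro bexI[OF _ E(1)] conjI pE ballI allI)
    fix \<omega> f assume w: "\<omega> \<in> E"
    then show "\<omega> \<in> space M" using E(3) by blast
    define y where "y c = (\<Sum>s<T. x (K s + c) \<omega> * ip d (?z \<omega> s) f)" for c
    let ?V = "\<mu> * ip d f f + (\<Sum>s<T. (ip d (?z \<omega> s) f)\<^sup>2)"
    let ?B = "ln (Determinant.det (gram_mat \<mu> d (?z \<omega>) T)) - d * ln \<mu>"
    obtain u where u: "u \<in> U" "sqrt (\<Sum>c<m. (y c)\<^sup>2) \<le> 2 * (\<Sum>c<m. u c * y c)" using U(4) by blast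
    have "(\<Sum>c<m. u c * y c) = (\<Sum>c<m. \<Sum>s<T. u c * x (K s + c) \<omega> * ip d (?z \<omega> s) f)"
      by (simp add: y_def sum_distrib_left mult.assoc)
    also have "\<dots> = (\<Sum>s<T. \<Sum>c<m. u c * x (K s + c) \<omega> * ip d (?z \<omega> s) f)" by (rule sum.swap)
    also have "\<dots> = ip d (score (?z \<omega>) (?g u \<omega>) T) f"
      unfolding score_def[abs_def] ip_sum_left ip_scale_left proj_def by (simp add: sum_distrib_right)
    finally have e: "(\<Sum>c<m. u c * y c) = ip d (score (?z \<omega>) (?g u \<omega>) T) f" .
    have "(\<Sum>c<m. (y c)\<^sup>2) = (sqrt (\<Sum>c<m. (y c)\<^sup>2))\<^sup>2" by (simp add: sum_nonneg)
    also have "\<dots> \<le> (2 * (\<Sum>c<m. u c * y c))\<^sup>2" using u(2) by (intro power_mono) (auto simp: sum_nonneg)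
    also have "\<dots> = 4 * (ip d (score (?z \<omega>) (?g u \<omega>) T) f)\<^sup>2" unfolding e by (simp add: power_mult_distrib)
    also have "\<dots> \<le> 4 * ((2 * ln (lik \<mu> d (?z \<omega>) (?g u \<omega>) T) + ?B) * ?V)"
      using self_normalized_deterministic[OF mu, of d "?z \<omega>" "?g u \<omega>" T f] by (simp add: add_diff_eq)
    also have "\<dots> \<le> 4 * ((2 * ln ?c + ?B) * ?V)"
    proof -
      have "lik \<mu> d (?z \<omega>) (?g u \<omega>) T < ?c" using E(3)[OF w] u by blast
      then have "ln (lik \<mu> d (?z \<omega>) (?g u \<omega>) T) \<le> ln ?c" using lik_pos[OF mu] c by (subst ln_le_cancel_iff) auto
      moreover have "?V \<ge> 0" using mu by (intro add_nonneg_nonneg mult_nonneg_nonneg sum_nonneg ip_ge_0) auto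
      ultimately show ?thesis by (intro mult_left_mono mult_right_mono add_mono) auto
    qed
    finally show "(\<Sum>c<m. (\<Sum>s<T. x (K s + c) \<omega> * ip d (?z \<omega> s) f)\<^sup>2) \<le> 4 * (2 * ln ?c + ln (Determinant.det (gram_mat \<mu> d (?z \<omega>) T)) - d * ln \<mu>) * ?V"
      by (simp only: y_def add_diff_eq mult.assoc)
  qed
qed

end

text \<open>At drift zero the likelihood factor is the normalised exponential of a chi-square variable.\<close>

lemma ln_lik_step: "s > -1 \<Longrightarrow> ln (lik_step s 0 \<eta>) = s * \<eta>\<^sup>2 / (2 * (1 + s)) - ln (1 + s) / 2"
  unfolding lik_step_def by (subst ln_div) (auto simp: ln_sqrt)

text \<open>Jensen's inequality, by the tangent of exp at the average.\<close>

lemma exp_average_le: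
  fixes X :: "nat \<Rightarrow> real"
  assumes p: "p > 0"
  shows "exp ((\<Sum>r<p. X r) / p) \<le> (\<Sum>r<p. exp (X r)) / p"
proof -
  define y where "y = (\<Sum>r<p. X r) / p"
  have "exp y * (1 + (X r - y)) \<le> exp (X r)" for r
  proof -
    have "exp y * (1 + (X r - y)) \<le> exp y * exp (X r - y)" by (intro mult_left_mono) auto
    then show ?thesis by (simp add: exp_add[symmetric])
  qed
  then have "(\<Sum>r<p. exp y * (1 + (X r - y))) \<le> (\<Sum>r<p. exp (X r))" by (intro sum_mono)
  moreover have "(\<Sum>r<p. exp y * (1 + (X r - y))) = exp y * (p + ((\<Sum>r<p. X r) - p * y))"
    by (simp add: sum.distrib sum_subtractf flip: sum_distrib_left)
  moreover have "(\<Sum>r<p. X r) - p * y = 0" using p by (simp add: y_def)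
  ultimately show ?thesis using p by (simp add: y_def[symmetric] field_simps)
qed

lemma sum_residue_classes:
  fixes f :: "nat \<Rightarrow> real"
  assumes p: "p > 0"
  shows "(\<Sum>t<N. f t) = (\<Sum>r<p. \<Sum>j\<in>{j. j < N \<and> r + p * j < N}. f (r + p * j))"
proof -
  have "(\<Sum>r<p. \<Sum>j\<in>{j. j < N \<and> r + p * j < N}. f (r + p * j)) = (\<Sum>(r,j)\<in>Sigma {..<p} (\<lambda>r. {j. j < N \<and> r + p * j < N}). f (r + p * j))"
    by (rule sum.Sigma) auto
  also have "\<dots> = (\<Sum>t<N. f t)"
  proof (rule sum.reindex_bij_witness[of _ "\<lambda>t. (t mod p, t div p)" "\<lambda>(r,j). r + p * j"])
    fix t assume "t \<in> {..<N}"
    then show "(t mod p, t div p) \<in> Sigma {..<p} (\<lambda>r. {j. j < N \<and> r + p * j < N})"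
      using p by (auto intro: le_less_trans[OF div_le_dividend])
  qed (use p in auto)
  finally show ?thesis by simp
qed

text \<open>This bound and the next are tuned to the rate 3/256 so that both chi-square tails close
  exactly: 29/256 + 3/256 = 1/8 = (1/10) * (5/4), and 35/256 - 3/256 = 1/8 = (1/6) * (3/4).\<close>

lemma ln_5_4: "ln (5/4 :: real) \<le> 29/128"
proof -
  have "(5/4 :: real) \<le> 1 + 29/128 + (29/128)\<^sup>2 / 2" by (simp add: power2_eq_square)
  also have "\<dots> \<le> exp (29/128)" by (rule exp_lower_Taylor_quadratic) simp
  finally have "ln (5/4 :: real) \<le> ln (exp (29/128))" by (subst ln_le_cancel_iff) auto
  then show ?thesis by simp
qed

lemma ln_3_4: "ln (3/4 :: real) \<le> - (35/128)"
proof -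
  \<comment> \<open>The bound 1 + x \<le> exp x is applied to a quarter of the exponent; applied
    directly it gives 1 - 35/128, which falls short of 3/4.\<close>
  have "(1 + (- (35/512)) :: real) ^ 4 \<le> exp (- (35/512)) ^ 4" by (intro power_mono exp_ge_add_one_self) simp
  also have "\<dots> = exp (- (35/128) :: real)" by (simp flip: exp_of_nat_mult)
  finally have "(3/4 :: real) \<le> exp (- (35/128))" by (simp add: power_divide)
  then have "ln (3/4 :: real) \<le> ln (exp (- (35/128)))" by (subst ln_le_cancel_iff) auto
  then show ?thesis by simp
qed

section \<open>Chi-square deviations over overlapping windows\<close>

context white_noise
begin

text \<open>Starting positions for different j lie at least p * m apart, which is the length of a
  window, so the coefficient vectors have disjoint supports.\<close>

lemma window_isonormal:
  assumes u: "ip (p * m) u u = 1" and J: "finite J"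
  shows "isonormal M J (\<lambda>j \<omega>. \<Sum>i<p*m. u i * x ((r + p * j) * m + i) \<omega>)"
proof -
  obtain B where B: "\<And>j. j \<in> J \<Longrightarrow> j < B" using J by (metis finite_nat_set_iff_bounded)
  define D where "D = (r + p * B) * m"
  define Lc where "Lc j i = (if (r + p * j) * m \<le> i \<and> i < (r + p * j) * m + p * m then u (i - (r + p * j) * m) else 0)" for j i
  have DB: "(r + p * j) * m + p * m \<le> D" if "j \<in> J" for j
  proof -
    have "(r + p * j) * m + p * m = (r + p * Suc j) * m" by (simp add: algebra_simps)
    also have "\<dots> \<le> D" unfolding D_def using B[OF that] by (intro mult_le_mono1 add_left_mono mult_le_mono2) auto
    finally show ?thesis .
  qed
  have ws: "(\<Sum>i<D. Lc j i * g i) = (\<Sum>c<p*m. u c * g ((r + p * j) * m + c))" if "j \<in> J" for j g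
    unfolding Lc_def by (rule window_sum[OF DB[OF that]])
  show ?thesis
  proof (rule isonormal_orthonormal[OF white[of D], where L = Lc])
    fix j k assume jk: "j \<in> J" "k \<in> J"
    show "(\<Sum>i<D. Lc j i * Lc k i) = (if j = k then 1 else 0)"
    proof (cases "j = k")
      case True
      then show ?thesis using u by (simp add: ws jk) (simp add: Lc_def ip_def)
    next
      case False
      have disj: "Lc j i * Lc k i = 0" if "j < k" for j k i
      proof -
        have "(r + p * j) * m + p * m = (r + p * Suc j) * m" by (simp add: algebra_simps)
        also have "\<dots> \<le> (r + p * k) * m" using that by (intro mult_le_mono1 add_left_mono mult_le_mono2) auto
        finally show ?thesis by (auto simp: Lc_def)
      qed
      then have "Lc j i * Lc k i = 0" for i
        using False disj[of j k i] disj[of k j i] by (cases "j < k") (auto simp: mult.commute)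
      then show ?thesis using False by simp
    qed
  qed (use J ws in auto)
qed

lemma lik_step_product_expectation:
  assumes X: "isonormal M J X" and J: "finite J" and s: "s > -1"
  shows "(\<integral>\<^sup>+\<omega>. (\<Prod>j\<in>J. ennreal (lik_step s 0 (X j \<omega>))) \<partial>M) = 1"
proof -
  interpret P: product_sigma_finite "\<lambda>_. std_normal_distribution" by (rule product_sigma_finite_std_normal)
  have lm: "(\<lambda>v. ennreal (lik_step s 0 v)) \<in> borel_measurable borel" by measurable
  have "(\<integral>\<^sup>+\<omega>. (\<Prod>j\<in>J. ennreal (lik_step s 0 (X j \<omega>))) \<partial>M) = (\<integral>\<^sup>+\<omega>. (\<Prod>j\<in>J. ennreal (lik_step s 0 ((\<lambda>j\<in>J. X j \<omega>) j))) \<partial>M)"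
    by (intro nn_integral_cong prod.cong) auto
  also have "\<dots> = (\<integral>\<^sup>+y. (\<Prod>j\<in>J. ennreal (lik_step s 0 (y j))) \<partial>PiM J (\<lambda>_. std_normal_distribution))"
  proof (rule isonormal_nn_integral[OF prob_space_axioms X J])
    have "(\<lambda>y. ennreal (lik_step s 0 (y j))) \<in> borel_measurable (PiM J (\<lambda>_. borel))" if "j \<in> J" for j
      by (rule measurable_compose[OF measurable_component_singleton[OF that, of "\<lambda>_. borel"] lm])
    then show "(\<lambda>y. \<Prod>j\<in>J. ennreal (lik_step s 0 (y j))) \<in> borel_measurable (PiM J (\<lambda>_. borel))"
      by (intro borel_measurable_prod_ennreal)
  qed
  also have "\<dots> = (\<Prod>j\<in>J. \<integral>\<^sup>+v. ennreal (lik_step s 0 v) \<partial>std_normal_distribution)"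
    by (rule P.product_nn_integral_prod[OF J]) (use lm in \<open>simp cong: measurable_cong_sets\<close>)
  finally show ?thesis by (simp add: nn_integral_lik_step[OF s])
qed

text \<open>Windows whose starting times agree modulo \<open>p\<close> do not overlap; the \<open>p\<close> residue classes are
  recombined by convexity of the exponential, which costs no constant.\<close>

lemma window_chi_square_mgf:
  assumes u: "ip (p * m) u u = 1" and p: "p > 0" and s: "s > -1"
  defines "G \<equiv> \<lambda>t \<omega>. \<Sum>i<p*m. u i * x (t * m + i) \<omega>"
  shows "(\<integral>\<^sup>+\<omega>. ennreal (exp ((\<Sum>t<N. ln (lik_step s 0 (G t \<omega>))) / p)) \<partial>M) \<le> 1"
proof -
  define J where "J r = {j. j < N \<and> r + p * j < N}" for r
  define Z where "Z r \<omega> = (\<Sum>j\<in>J r. ln (lik_step s 0 (G (r + p * j) \<omega>)))" for r \<omega>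
  have lp: "lik_step s 0 v > 0" for v using s by (simp add: lik_step_def)
  have finJ: "finite (J r)" for r by (simp add: J_def)
  have Gm[measurable]: "G t \<in> borel_measurable M" for t unfolding G_def by measurable
  have Zm[measurable]: "Z r \<in> borel_measurable M" for r unfolding Z_def by measurable
  have EZ: "(\<integral>\<^sup>+\<omega>. ennreal (exp (Z r \<omega>)) \<partial>M) = 1" for r
  proof -
    have "ennreal (exp (Z r \<omega>)) = (\<Prod>j\<in>J r. ennreal (lik_step s 0 (G (r + p * j) \<omega>)))" for \<omega>
      unfolding Z_def using finJ lp by (simp add: exp_sum prod_ennreal less_imp_le)
    then show ?thesis
      using lik_step_product_expectation[OF window_isonormal[OF u finJ] finJ s, of r r] by (simp add: G_def)
  qed
  have "(\<integral>\<^sup>+\<omega>. ennreal (exp ((\<Sum>t<N. ln (lik_step s 0 (G t \<omega>))) / p)) \<partial>M) \<le> (\<integral>\<^sup>+\<omega>. (\<Sum>r<p. ennreal (exp (Z r \<omega>) / p)) \<partial>M)"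
  proof (rule nn_integral_mono)
    fix \<omega>
    have "exp ((\<Sum>t<N. ln (lik_step s 0 (G t \<omega>))) / p) = exp ((\<Sum>r<p. Z r \<omega>) / p)"
      unfolding Z_def J_def by (simp only: sum_residue_classes[OF p, of "\<lambda>t. ln (lik_step s 0 (G t \<omega>))" N])
    also have "\<dots> \<le> (\<Sum>r<p. exp (Z r \<omega>)) / p" by (rule exp_average_le[OF p])
    finally show "ennreal (exp ((\<Sum>t<N. ln (lik_step s 0 (G t \<omega>))) / p)) \<le> (\<Sum>r<p. ennreal (exp (Z r \<omega>) / p))"
      by (subst sum_ennreal) (auto simp: sum_divide_distrib intro!: ennreal_leI)
  qed
  also have "\<dots> = (\<Sum>r<p. \<integral>\<^sup>+\<omega>. ennreal (1 / p) * ennreal (exp (Z r \<omega>)) \<partial>M)"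
    using p by (subst nn_integral_sum) (auto simp: ennreal_mult[symmetric] intro!: sum.cong nn_integral_cong)
  also have "\<dots> = (\<Sum>r<p. ennreal (1 / p))"
    by (simp add: nn_integral_cmult EZ)
  also have "\<dots> = 1" using p by (subst sum_ennreal) auto
  finally show ?thesis .
qed

text \<open>A Chernoff bound with s = 1/4 above and s = -1/4 below, which puts the exponents s / (2
  (1 + s)) = 1/10 and -1/6 on the sum of squares. The division by \<open>p\<close> in the rate comes
  from averaging the residue classes.\<close>

lemma window_chi_square_event:
  assumes u: "ip (p * m) u u = 1" and p: "p > 0"
  defines "G \<equiv> \<lambda>t \<omega>. \<Sum>i<p*m. u i * x (t * m + i) \<omega>"
  shows "{\<omega>\<in>space M. \<bar>(\<Sum>t<N. (G t \<omega>)\<^sup>2) - real N\<bar> \<le> real N / 4} \<in> events"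
    "prob {\<omega>\<in>space M. \<bar>(\<Sum>t<N. (G t \<omega>)\<^sup>2) - real N\<bar> \<le> real N / 4} \<ge> 1 - 2 * exp (- (3/256 * N / p))"
proof -
  have Gm[measurable]: "G t \<in> borel_measurable M" for t unfolding G_def by measurable
  let ?F = "{\<omega>\<in>space M. \<bar>(\<Sum>t<N. (G t \<omega>)\<^sup>2) - real N\<bar> \<le> real N / 4}"
  show F: "?F \<in> events" by measurable
  define f where "f s \<omega> = exp ((\<Sum>t<N. ln (lik_step s 0 (G t \<omega>))) / p)" for s \<omega>
  have fm: "f s \<in> borel_measurable M" for s unfolding f_def by measurable
  have ev: "{\<omega>\<in>space M. f s \<omega> < exp (3/256 * N / p)} \<in> events"
    "prob {\<omega>\<in>space M. f s \<omega> < exp (3/256 * N / p)} \<ge> 1 - 1 / exp (3/256 * N / p)" if "s > -1" for s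
    using markov_event[OF fm, of s "exp (3/256 * N / p)"] window_chi_square_mgf[OF u p that, of N]
    by (auto simp: f_def G_def)
  have "\<exists>E\<in>events. prob E \<ge> 1 - real (card {1/4, -1/4 :: real}) * (1 / exp (3/256 * N / p)) \<and>
    (\<forall>\<omega>\<in>E. \<omega> \<in> space M \<and> (\<forall>s\<in>{1/4, -1/4}. \<omega> \<in> {\<omega>\<in>space M. f s \<omega> < exp (3/256 * N / p)}))"
  proof (rule finite_intersection_event)
    show "u \<in> {1/4, -1/4 :: real} \<Longrightarrow> {\<omega>\<in>space M. f u \<omega> < exp (3/256 * N / p)} \<in> events" for u
      by (rule ev) auto
    show "u \<in> {1/4, -1/4 :: real} \<Longrightarrow> prob {\<omega>\<in>space M. f u \<omega> < exp (3/256 * N / p)} \<ge> 1 - 1 / exp (3/256 * N / p)" for u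
      by (rule ev) auto
  qed simp
  then obtain E where E: "E \<in> events" "prob E \<ge> 1 - 2 * (1 / exp (3/256 * N / p))"
    "\<And>\<omega>. \<omega> \<in> E \<Longrightarrow> \<omega> \<in> space M \<and> f (1/4) \<omega> < exp (3/256 * N / p) \<and> f (-1/4) \<omega> < exp (3/256 * N / p)" by auto
  have "E \<subseteq> ?F"
  proof
    fix \<omega> assume w: "\<omega> \<in> E"
    have fe: "(\<Sum>t<N. ln (lik_step s 0 (G t \<omega>))) < 3/256 * N" if "f s \<omega> < exp (3/256 * N / p)" for s
    proof -
      have "(\<Sum>t<N. ln (lik_step s 0 (G t \<omega>))) / p < 3/256 * N / p" using that by (simp only: f_def exp_less_cancel_iff)
      then show ?thesis using p by (subst (asm) divide_less_cancel) auto
    qed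
    have le: "(\<Sum>t<N. ln (lik_step s 0 (G t \<omega>))) = s / (2 * (1 + s)) * (\<Sum>t<N. (G t \<omega>)\<^sup>2) - N * (ln (1 + s) / 2)" if "s > -1" for s
      using that by (simp add: ln_lik_step sum_subtractf sum_distrib_left)
    have "1/10 * (\<Sum>t<N. (G t \<omega>)\<^sup>2) - N * (ln (5/4) / 2) < 3/256 * N"
      using fe[of "1/4"] le[of "1/4"] E(3)[OF w] by simp
    moreover have "N * (ln (5/4) / 2) \<le> N * ((29/128) / 2 :: real)" using ln_5_4 by (intro mult_left_mono) auto
    ultimately have 1: "(\<Sum>t<N. (G t \<omega>)\<^sup>2) \<le> 5/4 * N" by simp
    have "- (1/6) * (\<Sum>t<N. (G t \<omega>)\<^sup>2) - N * (ln (3/4) / 2) < 3/256 * N"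
      using fe[of "-1/4"] le[of "-1/4"] E(3)[OF w] by simp
    moreover have "N * (ln (3/4) / 2) \<le> N * ((- (35/128)) / 2 :: real)" using ln_3_4 by (intro mult_left_mono) auto
    ultimately have 2: "(\<Sum>t<N. (G t \<omega>)\<^sup>2) \<ge> 3/4 * N" by simp
    have "\<bar>(\<Sum>t<N. (G t \<omega>)\<^sup>2) - real N\<bar> \<le> real N / 4" using 1 2 by (intro abs_leI) linarith+
    then show "\<omega> \<in> ?F" using E(3)[OF w] by blast
  qed
  then have "prob E \<le> prob ?F" by (intro finite_measure_mono F)
  then show "prob ?F \<ge> 1 - 2 * exp (- (3/256 * N / p))" using E(2) by (simp add: exp_minus inverse_eq_divide)
qed

text \<open>Write d = p * m and L = d ln 9 + ln 2 + ln (1 / \<delta>). The hypothesis makes the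
  Chernoff exponent at least 3/2 * L, so one net direction fails with probability at most \<delta> /
  27^d, while the net has at most (1792/81)^d \<le> 27^d points.\<close>

lemma empirical_covariance_event:
  assumes p: "p > 0" and m: "m > 0" and \<delta>: "0 < \<delta>" "\<delta> < 1"
    and N: "real N / p \<ge> 128 * (real (p * m) * ln 9 + ln 2 + ln (1 / \<delta>))"
  shows "\<exists>E\<in>events. prob E \<ge> 1 - \<delta> \<and> (\<forall>\<omega>\<in>E. \<omega> \<in> space M \<and>
    (\<forall>z. real N / 2 * ip (p * m) z z \<le> (\<Sum>t<N. (ip (p * m) z (\<lambda>i. x (t * m + i) \<omega>))\<^sup>2)))"
proof -
  let ?d = "p * m"
  have d: "?d > 0" using p m by simp
  obtain U where U: "finite U" "real (card U) \<le> (1792/81) ^ ?d" "\<And>u. u \<in> U \<Longrightarrow> ip ?d u u \<le> 1"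
    "\<And>z. ip ?d z z \<le> 1 \<Longrightarrow> \<exists>u\<in>U. ip ?d (\<lambda>i. z i - u i) (\<lambda>i. z i - u i) \<le> 1/16"
    using ball_net[OF d] by blast
  define S where "S u \<omega> = (\<Sum>t<N. (ip ?d u (\<lambda>i. x (t * m + i) \<omega>))\<^sup>2)" for u \<omega>
  define nu where "nu u i = u i / sqrt (ip ?d u u)" for u and i :: nat
  define \<epsilon> where "\<epsilon> = 2 * exp (- (3/256 * N / p))"
  \<comment> \<open>Net points are normalised before the chi-square bound is applied; a net point of
    norm zero has no direction and needs no event. Scaling back is harmless because net points have
    norm at most one.\<close>
  define A where "A u = (if ip ?d u u = 0 then space M else {\<omega>\<in>space M. \<bar>S (nu u) \<omega> - real N\<bar> \<le> real N / 4})" for u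
  have nu1: "ip ?d (nu u) (nu u) = 1" if "ip ?d u u \<noteq> 0" for u
  proof -
    have p0: "ip ?d u u > 0" using that ip_ge_0[of ?d u] by simp
    have "ip ?d (nu u) (nu u) = ip ?d u u / (sqrt (ip ?d u u))\<^sup>2"
      unfolding nu_def[abs_def] by (simp add: ip_def sum_divide_distrib power2_eq_square)
    then show ?thesis using p0 by simp
  qed
  have A: "A u \<in> events" "prob (A u) \<ge> 1 - \<epsilon>" for u
    using window_chi_square_event[OF nu1 p, of u N]
    by (auto simp: A_def S_def ip_def \<epsilon>_def prob_space)
  have "\<exists>E\<in>events. prob E \<ge> 1 - real (card U) * \<epsilon> \<and> (\<forall>\<omega>\<in>E. \<omega> \<in> space M \<and> (\<forall>u\<in>U. \<omega> \<in> A u))"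
    by (rule finite_intersection_event[OF U(1)]) (rule A)+
  then obtain E where E: "E \<in> events" "prob E \<ge> 1 - real (card U) * \<epsilon>"
    "\<And>\<omega>. \<omega> \<in> E \<Longrightarrow> \<omega> \<in> space M \<and> (\<forall>u\<in>U. \<omega> \<in> A u)" by auto
  have "real (card U) * \<epsilon> \<le> \<delta>"
  proof -
    define L where "L = real ?d * ln 9 + ln 2 + ln (1 / \<delta>)"
    have "3/256 * (128 * L) \<le> 3/256 * (real N / p)" using N unfolding L_def by (intro mult_left_mono) simp_all
    then have "3/256 * N / p \<ge> 3/256 * (128 * L)" by simp
    then have "exp (- (3/256 * N / p)) \<le> exp (- (3/2 * L))" by simp
    \<comment> \<open>Here 3/2 * ln 9 = ln 27; the other two logarithms are nonnegative, so
      enlarging them by 3/2 is in the right direction.\<close>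
    also have "3/2 * L \<ge> real ?d * ln 27 + ln 2 + ln (1 / \<delta>)"
    proof -
      have "ln (9::real) = 2 * ln 3" "ln (27::real) = 3 * ln 3"
        using ln_realpow[of 3 2] ln_realpow[of 3 3] by simp_all
      note lns = this
      have "ln (2::real) \<ge> 0" "ln (1 / \<delta>) \<ge> 0" using \<delta> by simp_all
      then show ?thesis unfolding L_def lns distrib_left by linarith
    qed
    then have "exp (- (3/2 * L)) \<le> exp (- (real ?d * ln 27 + ln 2 + ln (1 / \<delta>)))" by simp
    also have "\<dots> = \<delta> / (2 * 27 ^ ?d)"
    proof -
      have "exp (- (real ?d * ln 27 + ln 2 + ln (1 / \<delta>))) = inverse (exp (real ?d * ln 27) * exp (ln 2) * exp (ln (1 / \<delta>)))"
        by (simp only: exp_add exp_minus)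
      also have "exp (real ?d * ln 27) = (27::real) ^ ?d" by (subst exp_of_nat_mult) simp
      finally show ?thesis using \<delta> by (simp add: field_simps)
    qed
    finally have e: "\<epsilon> \<le> \<delta> / 27 ^ ?d" by (simp add: \<epsilon>_def)
    have "real (card U) * \<epsilon> \<le> (1792/81) ^ ?d * (\<delta> / 27 ^ ?d)"
      using U(2) e \<delta> by (intro mult_mono) (auto simp: \<epsilon>_def)
    also have "\<dots> = \<delta> * (1792/81 / 27) ^ ?d"
      unfolding power_divide[of "1792/81" 27] by (simp only: times_divide_eq_right times_divide_eq_left mult.commute)
    also have "\<dots> \<le> \<delta> * 1" using \<delta> by (intro mult_left_mono power_le_one) auto
    finally show ?thesis by simp
  qed
  then have pE: "prob E \<ge> 1 - \<delta>" using E(2) by linarith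
  show ?thesis
  proof (intro bexI[OF _ E(1)] conjI pE ballI allI)
    fix \<omega> z assume w: "\<omega> \<in> E"
    then show "\<omega> \<in> space M" using E(3) by blast
    show "real N / 2 * ip ?d z z \<le> (\<Sum>t<N. (ip ?d z (\<lambda>i. x (t * m + i) \<omega>))\<^sup>2)"
    proof (rule net_quadratic_bound[OF U(4) U(3)])
      fix u assume u: "u \<in> U"
      show "\<bar>(\<Sum>t<N. (ip ?d u (\<lambda>i. x (t * m + i) \<omega>))\<^sup>2) - real N * ip ?d u u\<bar> \<le> real N / 4"
      proof (cases "ip ?d u u = 0")
        case True
        then have "ip ?d u e = 0" for e using ip_cauchy_schwarz[of ?d u e] by simp
        then show ?thesis using True by simp
      next
        case False
        then have p0: "ip ?d u u > 0" using ip_ge_0[of ?d u] by simp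
        have "\<omega> \<in> A u" using E(3)[OF w] u by blast
        then have b: "\<bar>S (nu u) \<omega> - real N\<bar> \<le> real N / 4" using False by (simp add: A_def)
        have "ip ?d (nu u) e = ip ?d u e / sqrt (ip ?d u u)" for e
          unfolding nu_def[abs_def] by (simp add: ip_def sum_divide_distrib)
        then have "S (nu u) \<omega> = S u \<omega> / ip ?d u u"
          using p0 by (simp add: S_def power_divide sum_divide_distrib)
        then have "S u \<omega> - real N * ip ?d u u = ip ?d u u * (S (nu u) \<omega> - real N)" using p0 by (simp add: algebra_simps)
        then have "\<bar>S u \<omega> - real N * ip ?d u u\<bar> = ip ?d u u * \<bar>S (nu u) \<omega> - real N\<bar>" using p0 by (simp add: abs_mult)
        also have "\<dots> \<le> 1 * (real N / 4)" using U(3)[OF u] b p0 by (intro mult_mono) auto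
        finally show ?thesis by (simp add: S_def)
      qed
    qed auto
  qed
qed

end

section \<open>Innovations of the Kalman filter\<close>

lemma vec_ip: "vec n f \<bullet> vec n g = ip n f g"
  by (simp add: scalar_prod_def ip_def lessThan_atLeast0)

text \<open>The case s = 0 is separate because \<open>gaussian_rv\<close> describes a degenerate
  functional by vanishing almost everywhere, not by a density.\<close>

lemma iexp_gaussian:
  assumes M: "prob_space M" and Y: "Y \<in> borel_measurable M" and s: "s \<ge> 0"
    and pos: "s > 0 \<Longrightarrow> distributed M lborel Y (normal_density 0 (sqrt s))"
    and zero: "s = 0 \<Longrightarrow> AE \<omega> in M. Y \<omega> = 0"
  shows "(CLINT \<omega>|M. iexp (Y \<omega>)) = complex_of_real (exp (- s / 2))"
proof (cases "s = 0")
  case True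
  interpret prob_space M by fact
  have "(CLINT \<omega>|M. iexp (Y \<omega>)) = (CLINT \<omega>|M. 1)"
    using zero[OF True] Y by (intro integral_cong_AE) auto
  then show ?thesis using True by (simp add: prob_space)
next
  case False
  interpret prob_space M by fact
  have s0: "sqrt s > 0" using s False by simp
  have "distributed M lborel (\<lambda>\<omega>. (Y \<omega> - 0) / sqrt s) std_normal_density"
    using normal_standard_normal_convert[OF s0, of Y 0] pos s False by simp
  then have d: "distr M lborel (\<lambda>\<omega>. Y \<omega> / sqrt s) = std_normal_distribution"
    by (simp add: distributed_def)
  have "char std_normal_distribution (sqrt s) = (CLINT \<omega>|M. iexp (sqrt s * (Y \<omega> / sqrt s)))"
    unfolding char_def d[symmetric] using Y by (subst integral_distr) auto
  also have "\<dots> = (CLINT \<omega>|M. iexp (Y \<omega>))" using s0 by (intro Bochner_Integration.integral_cong) auto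
  finally show ?thesis using s by (simp add: char_std_normal_distribution)
qed

section \<open>The filtering model and its Gaussian sources\<close>

locale kalman = prob_space M for M :: "'a measure" +
  fixes n m :: nat
    and A C Q R P K :: "real mat"
    and x0 :: "'a \<Rightarrow> nat \<Rightarrow> real"
    and w v :: "nat \<Rightarrow> 'a \<Rightarrow> nat \<Rightarrow> real"
    and x y xh e :: "'a \<Rightarrow> nat \<Rightarrow> real vec"
  assumes m: "m > 0"
    and A: "A \<in> carrier_mat n n" and C: "C \<in> carrier_mat m n"
    and Q: "Q \<in> carrier_mat n n" "psd_mat Q"
    and R: "R \<in> carrier_mat m m" "pd_mat R"
    and P: "P \<in> carrier_mat n n" "pd_mat P"
    and K: "K \<in> carrier_mat n m"
    and K_def: "K = A * P * transpose_mat C * mat_inv (C * P * transpose_mat C + R)"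
    and riccati: "P = (A - K * C) * P * transpose_mat (A - K * C) + Q + K * R * transpose_mat K"
    and x0_gauss: "gaussian_rv M n P x0"
    and w_gauss: "\<And>j. gaussian_rv M n Q (w j)"
    and v_gauss: "\<And>j. gaussian_rv M m R (v j)"
    and indep: "indep_vars (\<lambda>s. rv_space (case s of V _ \<Rightarrow> m | _ \<Rightarrow> n))
                  (\<lambda>s. case s of X0 \<Rightarrow> x0 | W j \<Rightarrow> w j | V j \<Rightarrow> v j) UNIV"
    and state: "\<And>\<omega>. \<omega> \<in> space M \<Longrightarrow> x \<omega> 0 = vec n (x0 \<omega>)"
               "\<And>\<omega> j. \<omega> \<in> space M \<Longrightarrow> x \<omega> (Suc j) = A *\<^sub>v x \<omega> j + vec n (w j \<omega>)"
    and outp: "\<And>\<omega> j. \<omega> \<in> space M \<Longrightarrow> y \<omega> j = C *\<^sub>v x \<omega> j + vec m (v j \<omega>)"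
    and kf: "\<And>\<omega>. \<omega> \<in> space M \<Longrightarrow> xh \<omega> 0 = 0\<^sub>v n"
                "\<And>\<omega> j. \<omega> \<in> space M \<Longrightarrow> xh \<omega> (Suc j) = A *\<^sub>v xh \<omega> j + K *\<^sub>v e \<omega> j"
    and innov: "\<And>\<omega> j. \<omega> \<in> space M \<Longrightarrow> e \<omega> j = y \<omega> j - C *\<^sub>v xh \<omega> j"
begin

definition Rbar :: "real mat" where "Rbar = C * P * transpose_mat C + R"

definition src_dim :: "noise_src \<Rightarrow> nat" where
  "src_dim s = (case s of V _ \<Rightarrow> m | _ \<Rightarrow> n)"

definition src :: "noise_src \<Rightarrow> 'a \<Rightarrow> nat \<Rightarrow> real" where
  "src s = (case s of X0 \<Rightarrow> x0 | W j \<Rightarrow> w j | V j \<Rightarrow> v j)"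

definition src_cov :: "noise_src \<Rightarrow> real mat" where
  "src_cov s = (case s of X0 \<Rightarrow> P | W j \<Rightarrow> Q | V j \<Rightarrow> R)"

text \<open>The sources on which the estimation error at time T and the innovations before T
  depend.\<close>

definition srcs :: "nat \<Rightarrow> noise_src set" where
  "srcs T = insert X0 (W ` {..<T} \<union> V ` {..<T})"

lemma src_cov: "src_cov s \<in> carrier_mat (src_dim s) (src_dim s)" "psd_mat (src_cov s)"
  using P Q R pd_imp_psd by (auto simp: src_cov_def src_dim_def split: noise_src.split)

lemma src_gauss: "gaussian_rv M (src_dim s) (src_cov s) (src s)"
  using x0_gauss w_gauss v_gauss by (auto simp: src_def src_cov_def src_dim_def split: noise_src.split)

lemma src_comp_measurable:
  "(\<lambda>f. \<Sum>i<src_dim s. c i * f i) \<in> borel_measurable (rv_space (src_dim s))"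
  unfolding rv_space_def by (intro borel_measurable_sum borel_measurable_times borel_measurable_const measurable_component_singleton) auto

lemma src_functional_chf:
  assumes a: "a \<in> carrier_vec (src_dim s)"
  shows "(CLINT \<omega>|M. iexp (a \<bullet> vec (src_dim s) (src s \<omega>))) = complex_of_real (exp (- (a \<bullet> (src_cov s *\<^sub>v a)) / 2))"
proof -
  let ?d = "src_dim s" and ?S = "src_cov s"
  let ?q = "\<Sum>i<?d. \<Sum>j<?d. a $ i * ?S $$ (i,j) * a $ j"
  have g: "src s \<in> measurable M (rv_space ?d)" "0 < ?q \<longrightarrow> distributed M lborel (\<lambda>\<omega>. \<Sum>i<?d. a $ i * src s \<omega> i) (normal_density 0 (sqrt ?q))"
    "?q = 0 \<longrightarrow> (AE \<omega> in M. (\<Sum>i<?d. a $ i * src s \<omega> i) = 0)"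
    using src_gauss[of s] unfolding gaussian_rv_def Let_def by blast+
  have q: "a \<bullet> (?S *\<^sub>v a) = ?q"
    using a src_cov(1)[of s]
    by (simp add: scalar_prod_def lessThan_atLeast0 sum_distrib_left mult.assoc)
  have f: "a \<bullet> vec ?d (src s \<omega>) = (\<Sum>i<?d. a $ i * src s \<omega> i)" for \<omega>
    by (simp add: scalar_prod_def lessThan_atLeast0)
  have q0: "?q \<ge> 0" unfolding q[symmetric] by (rule psd_matD(2)[OF src_cov(2,1) a])
  show ?thesis unfolding f q
    by (rule iexp_gaussian[OF prob_space_axioms _ q0])
      (use g measurable_compose[OF g(1) src_comp_measurable] in auto)
qed

lemma sources_chf:
  assumes S: "finite S" and a: "\<And>s. a s \<in> carrier_vec (src_dim s)"
  shows "(CLINT \<omega>|M. iexp (\<Sum>s\<in>S. a s \<bullet> vec (src_dim s) (src s \<omega>))) =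
    complex_of_real (exp (- (\<Sum>s\<in>S. a s \<bullet> (src_cov s *\<^sub>v a s)) / 2))"
proof -
  let ?Y = "\<lambda>s \<omega>. a s \<bullet> vec (src_dim s) (src s \<omega>)"
  have f: "?Y s = (\<lambda>\<omega>. (\<lambda>f. \<Sum>i<src_dim s. a s $ i * f i) (src s \<omega>))" for s
    by (simp add: scalar_prod_def lessThan_atLeast0)
  have "indep_vars (\<lambda>s. rv_space (src_dim s)) src UNIV"
    using indep unfolding src_dim_def[abs_def] src_def[abs_def] by (simp add: fun_eq_iff)
  then have "indep_vars (\<lambda>s. rv_space (src_dim s)) src S" by (rule indep_vars_subset) simp
  then have ind: "indep_vars (\<lambda>_. borel) ?Y S"
    unfolding f by (rule indep_vars_compose2) (rule src_comp_measurable)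
  have Ym: "?Y s \<in> borel_measurable M" for s
  proof -
    have "src s \<in> measurable M (rv_space (src_dim s))" using src_gauss[of s] by (simp add: gaussian_rv_def)
    from measurable_compose[OF this src_comp_measurable[where c = "\<lambda>i. a s $ i"]] show ?thesis unfolding f .
  qed
  have "(CLINT \<omega>|M. iexp (\<Sum>s\<in>S. ?Y s \<omega>)) = char (distr M borel (\<lambda>\<omega>. \<Sum>s\<in>S. ?Y s \<omega>)) 1"
    unfolding char_def using Ym by (subst integral_distr) (auto intro!: borel_measurable_sum)
  also have "\<dots> = (\<Prod>s\<in>S. char (distr M borel (?Y s)) 1)" by (rule char_distr_sum[OF ind])
  also have "\<dots> = (\<Prod>s\<in>S. CLINT \<omega>|M. iexp (?Y s \<omega>))"
    unfolding char_def using Ym by (intro prod.cong refl) (subst integral_distr, auto)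
  also have "\<dots> = (\<Prod>s\<in>S. complex_of_real (exp (- (a s \<bullet> (src_cov s *\<^sub>v a s)) / 2)))"
    by (simp only: src_functional_chf[OF a])
  also have "\<dots> = complex_of_real (exp (- (\<Sum>s\<in>S. a s \<bullet> (src_cov s *\<^sub>v a s)) / 2))"
    using S by (simp add: exp_sum[symmetric] sum_negf sum_divide_distrib flip: of_real_prod)
  finally show ?thesis .
qed

lemma Rbar: "Rbar \<in> carrier_mat m m" "pd_mat Rbar"
proof -
  have CP: "C * P * transpose_mat C \<in> carrier_mat m m" using C P by (auto intro!: mult_carrier_mat)
  show c: "Rbar \<in> carrier_mat m m" unfolding Rbar_def using R(1) by simp
  have t: "transpose_mat (C * P * transpose_mat C) = C * P * transpose_mat C"
    using C P(1) pd_matD(1)[OF P(2,1)]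
    by (simp add: transpose_mult[of _ m n _ m] transpose_mult[of _ n n _ m] transpose_mult[of _ m n _ n] assoc_mult_mat[of _ m n _ n _ m])
  have "transpose_mat Rbar = Rbar"
    unfolding Rbar_def using t pd_matD(1)[OF R(2,1)] transpose_add[OF CP R(1)] by simp
  moreover have "z \<bullet> (Rbar *\<^sub>v z) > 0" if z: "z \<in> carrier_vec m" "z \<noteq> 0\<^sub>v m" for z
  proof -
    have h: "transpose_mat C *\<^sub>v z \<in> carrier_vec n" using C z by simp
    have "C * P * transpose_mat C *\<^sub>v z = C *\<^sub>v (P *\<^sub>v (transpose_mat C *\<^sub>v z))"
      using C P z h by (simp add: assoc_mult_mat_vec[of _ m n _ m] assoc_mult_mat_vec[of _ m n _ n])
    then have "z \<bullet> (C * P * transpose_mat C *\<^sub>v z) = (transpose_mat C *\<^sub>v z) \<bullet> (P *\<^sub>v (transpose_mat C *\<^sub>v z))"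
      using transpose_vec_mult_scalar[OF C mult_mat_vec_carrier[OF P(1) h] z(1)] by simp
    then have "z \<bullet> (C * P * transpose_mat C *\<^sub>v z) \<ge> 0" using psd_matD(2)[OF pd_imp_psd[OF P(2)] P(1) h] by simp
    moreover have "z \<bullet> (Rbar *\<^sub>v z) = z \<bullet> (C * P * transpose_mat C *\<^sub>v z) + z \<bullet> (R *\<^sub>v z)"
      unfolding Rbar_def add_mult_distrib_mat_vec[OF CP R(1) z(1)]
      by (rule scalar_prod_add_distrib[OF z(1) mult_mat_vec_carrier[OF CP z(1)] mult_mat_vec_carrier[OF R(1) z(1)]])
    ultimately show ?thesis using pd_matD(2)[OF R(2,1) z] by simp
  qed
  ultimately show "pd_mat Rbar" using c unfolding pd_mat_def by auto
qed

text \<open>The definition of the gain with the inverse cleared, K Rbar = A P C^T, transposed so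
  that it can act on functionals.\<close>

lemma gain_identity: "Rbar * transpose_mat K = C * P * transpose_mat A"
proof -
  obtain J where J: "J \<in> carrier_mat m m" "Rbar * J = 1\<^sub>m m" "J * Rbar = 1\<^sub>m m" using pd_inverse_exists[OF Rbar] by blast
  have inv: "mat_inv Rbar = J" by (rule mat_inv_eqI(1)[OF Rbar(1) J(1,2)])
  have APC: "A * P * transpose_mat C \<in> carrier_mat n m" using A P C by (auto intro!: mult_carrier_mat)
  have "K * Rbar = A * P * transpose_mat C * (J * Rbar)"
    unfolding K_def[folded Rbar_def] inv using APC J Rbar by (simp add: assoc_mult_mat[of _ n m _ m _ m])
  then have "K * Rbar = A * P * transpose_mat C" unfolding J(3) right_mult_one_mat[OF APC] .
  then have "transpose_mat (K * Rbar) = transpose_mat (A * P * transpose_mat C)" by simp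
  then show ?thesis
    using A P(1) C K Rbar(1) pd_matD(1)[OF P(2,1)] pd_matD(1)[OF Rbar(2,1)]
    by (simp add: transpose_mult[of _ n m _ m] transpose_mult[of _ n n _ m] transpose_mult[of _ n n _ n] assoc_mult_mat[of _ m n _ n _ n])
qed

text \<open>One step of the Riccati recursion, written for the linear functional
  \<open>c \<bullet> (x (t+1) - xh (t+1)) + b \<bullet> e t\<close> of the estimation error and the innovation.\<close>

lemma riccati_quadratic:
  assumes c: "c \<in> carrier_vec n" and b: "b \<in> carrier_vec m"
  defines "c' \<equiv> transpose_mat (A - K * C) *\<^sub>v c + transpose_mat C *\<^sub>v b"
    and "k \<equiv> b - transpose_mat K *\<^sub>v c"
  shows "c' \<bullet> (P *\<^sub>v c') + c \<bullet> (Q *\<^sub>v c) + k \<bullet> (R *\<^sub>v k) = c \<bullet> (P *\<^sub>v c) + b \<bullet> (Rbar *\<^sub>v b)"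
proof -
  let ?F = "A - K * C"
  have KC: "K * C \<in> carrier_mat n n" using K C by (rule mult_carrier_mat)
  have F: "?F \<in> carrier_mat n n" by (rule minus_carrier_mat[OF KC])
  have Ft: "transpose_mat ?F \<in> carrier_mat n n" using F by simp
  have Ct: "transpose_mat C \<in> carrier_mat n m" and Kt: "transpose_mat K \<in> carrier_mat m n" using C K by auto
  have PT: "transpose_mat P = P" and RT: "transpose_mat R = R" using pd_matD(1) P R by auto
  define g where "g = transpose_mat ?F *\<^sub>v c"
  define h where "h = transpose_mat C *\<^sub>v b"
  define l where "l = transpose_mat K *\<^sub>v c"
  have car: "g \<in> carrier_vec n" "h \<in> carrier_vec n" "l \<in> carrier_vec m"
    using Ft Ct Kt c b by (auto simp: g_def h_def l_def)
  have q1: "c' \<bullet> (P *\<^sub>v c') = g \<bullet> (P *\<^sub>v g) + 2 * (g \<bullet> (P *\<^sub>v h)) + h \<bullet> (P *\<^sub>v h)"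
    using quad_add_scaled[OF P(1) PT car(1,2), of 1] car unfolding c'_def g_def[symmetric] h_def[symmetric] by simp
  have kb: "k = b + (-1) \<cdot>\<^sub>v l" unfolding k_def l_def[symmetric] using b car by (intro eq_vecI) auto
  have q2: "k \<bullet> (R *\<^sub>v k) = b \<bullet> (R *\<^sub>v b) - 2 * (b \<bullet> (R *\<^sub>v l)) + l \<bullet> (R *\<^sub>v l)"
    unfolding kb using quad_add_scaled[OF R(1) RT b car(3), of "-1"] by simp
  have cPc: "c \<bullet> (P *\<^sub>v c) = g \<bullet> (P *\<^sub>v g) + c \<bullet> (Q *\<^sub>v c) + l \<bullet> (R *\<^sub>v l)"
  proof -
    have M1: "?F * P * transpose_mat ?F \<in> carrier_mat n n" using F P by simp
    have M2: "K * R * transpose_mat K \<in> carrier_mat n n" using K R by (auto intro!: mult_carrier_mat)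
    have e1: "?F * P * transpose_mat ?F *\<^sub>v c = ?F *\<^sub>v (P *\<^sub>v g)"
      using F P c by (simp add: g_def assoc_mult_mat_vec[of _ n n _ n])
    have e2: "K * R * transpose_mat K *\<^sub>v c = K *\<^sub>v (R *\<^sub>v l)"
      using K R c by (simp add: l_def assoc_mult_mat_vec[of _ n m _ n] assoc_mult_mat_vec[of _ n m _ m])
    have "P *\<^sub>v c = (?F * P * transpose_mat ?F *\<^sub>v c + Q *\<^sub>v c) + K * R * transpose_mat K *\<^sub>v c"
      using arg_cong[OF riccati, of "\<lambda>X. X *\<^sub>v c"]
        add_mult_distrib_mat_vec[OF add_carrier_mat[OF Q(1)] M2 c] add_mult_distrib_mat_vec[OF M1 Q(1) c] by simp
    then have "c \<bullet> (P *\<^sub>v c) = c \<bullet> (?F *\<^sub>v (P *\<^sub>v g)) + c \<bullet> (Q *\<^sub>v c) + c \<bullet> (K *\<^sub>v (R *\<^sub>v l))"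
      unfolding e1 e2 using c F P Q K R car by (simp add: scalar_prod_add_distrib[of _ n])
    also have "c \<bullet> (?F *\<^sub>v (P *\<^sub>v g)) = g \<bullet> (P *\<^sub>v g)"
      using transpose_vec_mult_scalar[OF F _ c, of "P *\<^sub>v g"] P car by (simp add: g_def)
    also have "c \<bullet> (K *\<^sub>v (R *\<^sub>v l)) = l \<bullet> (R *\<^sub>v l)"
      using transpose_vec_mult_scalar[OF K _ c, of "R *\<^sub>v l"] R car by (simp add: l_def)
    finally show ?thesis .
  qed
  have CP: "C * P * transpose_mat C \<in> carrier_mat m m" using C P by (auto intro!: mult_carrier_mat)
  have bRb: "b \<bullet> (Rbar *\<^sub>v z) = h \<bullet> (P *\<^sub>v (transpose_mat C *\<^sub>v z)) + b \<bullet> (R *\<^sub>v z)" if z: "z \<in> carrier_vec m" for z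
  proof -
    have Cz: "transpose_mat C *\<^sub>v z \<in> carrier_vec n" using C z by simp
    have "C * P * transpose_mat C *\<^sub>v z = C *\<^sub>v (P *\<^sub>v (transpose_mat C *\<^sub>v z))"
      using C P z Cz by (simp add: assoc_mult_mat_vec[of _ m n _ m] assoc_mult_mat_vec[of _ m n _ n])
    then have "b \<bullet> (C * P * transpose_mat C *\<^sub>v z) = h \<bullet> (P *\<^sub>v (transpose_mat C *\<^sub>v z))"
      using transpose_vec_mult_scalar[OF C mult_mat_vec_carrier[OF P(1) Cz] b] by (simp add: h_def)
    moreover have "b \<bullet> (Rbar *\<^sub>v z) = b \<bullet> (C * P * transpose_mat C *\<^sub>v z) + b \<bullet> (R *\<^sub>v z)"
      unfolding Rbar_def add_mult_distrib_mat_vec[OF CP R(1) z]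
      by (rule scalar_prod_add_distrib[OF b mult_mat_vec_carrier[OF CP z] mult_mat_vec_carrier[OF R(1) z]])
    ultimately show ?thesis by simp
  qed
  \<comment> \<open>Optimality of the gain: (A - K C) P C^T = K R, because A P C^T = K Rbar. It
    makes the cross terms of the two squares cancel, so that the predicted error and the innovation
    are uncorrelated.\<close>
  have cross: "g \<bullet> (P *\<^sub>v h) = b \<bullet> (R *\<^sub>v l)"
  proof -
    have g: "g = transpose_mat A *\<^sub>v c - transpose_mat C *\<^sub>v l"
    proof -
      have "transpose_mat ?F = transpose_mat A - transpose_mat C * transpose_mat K"
        using A KC K C by (simp add: transpose_minus[of _ n n] transpose_mult[of _ n m _ n])
      then show ?thesis unfolding g_def l_def using A Ct Kt c
        by (simp add: minus_mult_distrib_mat_vec[of _ n n] assoc_mult_mat_vec[of _ n m _ n] mult_carrier_mat[of _ n m _ n])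
    qed
    have Ac: "transpose_mat A *\<^sub>v c \<in> carrier_vec n" and Cl: "transpose_mat C *\<^sub>v l \<in> carrier_vec n" using A C c car by auto
    have Ph: "P *\<^sub>v h \<in> carrier_vec n" using P car by simp
    have sym: "u \<bullet> (P *\<^sub>v h) = h \<bullet> (P *\<^sub>v u)" if u: "u \<in> carrier_vec n" for u
      using transpose_vec_mult_scalar[OF P(1) u car(2)] PT comm_scalar_prod[OF u Ph] by simp
    have "g \<bullet> (P *\<^sub>v h) = (transpose_mat A *\<^sub>v c) \<bullet> (P *\<^sub>v h) - (transpose_mat C *\<^sub>v l) \<bullet> (P *\<^sub>v h)"
      unfolding g by (rule minus_scalar_prod_distrib[OF Ac Cl Ph])
    also have "\<dots> = h \<bullet> (P *\<^sub>v (transpose_mat A *\<^sub>v c)) - h \<bullet> (P *\<^sub>v (transpose_mat C *\<^sub>v l))"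
      by (simp add: sym Ac Cl)
    also have "h \<bullet> (P *\<^sub>v (transpose_mat A *\<^sub>v c)) = b \<bullet> (Rbar *\<^sub>v l)"
    proof -
      have "Rbar *\<^sub>v l = (C * P * transpose_mat A) *\<^sub>v c"
        unfolding gain_identity[symmetric] l_def using Rbar Kt c by (simp add: assoc_mult_mat_vec[of _ m m _ n])
      also have "\<dots> = C *\<^sub>v (P *\<^sub>v (transpose_mat A *\<^sub>v c))"
        using C P A c Ac by (simp add: assoc_mult_mat_vec[of _ m n _ n])
      finally show ?thesis
        using transpose_vec_mult_scalar[OF C mult_mat_vec_carrier[OF P(1) Ac] b] by (simp add: h_def)
    qed
    finally show ?thesis using bRb[OF car(3)] by simp
  qed
  show ?thesis unfolding q1 q2 cPc bRb[OF b] h_def[symmetric] cross by simp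
qed

lemma x_carrier: "\<omega> \<in> space M \<Longrightarrow> x \<omega> t \<in> carrier_vec n"
  by (induction t) (auto simp: state intro!: add_carrier_vec mult_mat_vec_carrier[OF A])

lemma xh_carrier: "\<omega> \<in> space M \<Longrightarrow> xh \<omega> t \<in> carrier_vec n"
  by (cases t) (use A K in \<open>auto simp: kf intro!: carrier_vecI\<close>)

lemma e_eq:
  assumes w: "\<omega> \<in> space M"
  shows "e \<omega> t = C *\<^sub>v (x \<omega> t - xh \<omega> t) + vec m (v t \<omega>)"
  unfolding innov[OF w] outp[OF w] mult_minus_distrib_mat_vec[OF C x_carrier[OF w] xh_carrier[OF w]]
  using C by (intro eq_vecI) auto

lemma e_carrier: "\<omega> \<in> space M \<Longrightarrow> e \<omega> t \<in> carrier_vec m"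
  using C by (simp add: e_eq carrier_vecI)

lemma y_carrier: "\<omega> \<in> space M \<Longrightarrow> y \<omega> t \<in> carrier_vec m"
  using C by (simp add: outp carrier_vecI)

lemma y_eq: "\<omega> \<in> space M \<Longrightarrow> y \<omega> t = C *\<^sub>v xh \<omega> t + e \<omega> t"
  using C y_carrier[of \<omega> t] by (intro eq_vecI) (auto simp: innov)

lemma srcs_Suc: "srcs (Suc T) = insert (W T) (insert (V T) (srcs T))" "W T \<notin> srcs T" "V T \<notin> srcs T" "finite (srcs T)"
  by (auto simp: srcs_def less_Suc_eq)

text \<open>Both the innovations and the outputs are expanded backwards in time into the independent
  sources, so that no conditional expectations are needed.\<close>

lemma innovation_representation:
  assumes "c \<in> carrier_vec n" and "\<And>t. b t \<in> carrier_vec m"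
  shows "\<exists>a. (\<forall>s. a s \<in> carrier_vec (src_dim s)) \<and>
    (\<forall>\<omega>\<in>space M. c \<bullet> (x \<omega> T - xh \<omega> T) + (\<Sum>t<T. b t \<bullet> e \<omega> t) = (\<Sum>s\<in>srcs T. a s \<bullet> vec (src_dim s) (src s \<omega>))) \<and>
    (\<Sum>s\<in>srcs T. a s \<bullet> (src_cov s *\<^sub>v a s)) = c \<bullet> (P *\<^sub>v c) + (\<Sum>t<T. b t \<bullet> (Rbar *\<^sub>v b t))"
  using assms(1)
proof (induction T arbitrary: c)
  case 0
  let ?a = "\<lambda>s. if s = X0 then c else 0\<^sub>v (src_dim s)"
  have "x \<omega> 0 - xh \<omega> 0 = vec n (x0 \<omega>)" if "\<omega> \<in> space M" for \<omega>
    using that by (intro eq_vecI) (auto simp: state kf)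
  then show ?case using 0 by (intro exI[of _ ?a]) (auto simp: srcs_def src_dim_def src_def src_cov_def)
next
  case (Suc T)
  let ?F = "A - K * C"
  have KC: "K * C \<in> carrier_mat n n" using K C by (rule mult_carrier_mat)
  have F: "?F \<in> carrier_mat n n" by (rule minus_carrier_mat[OF KC])
  \<comment> \<open>The last step of the dynamics, pulled back: \<open>c'\<close> acts on the error
    at time T, \<open>k\<close> on the measurement noise of that step, and \<open>c\<close> itself
    on its process noise.\<close>
  define c' where "c' = transpose_mat ?F *\<^sub>v c + transpose_mat C *\<^sub>v b T"
  define k where "k = b T - transpose_mat K *\<^sub>v c"
  have bT: "b T \<in> carrier_vec m" by (rule assms(2))
  have tr: "transpose_mat ?F \<in> carrier_mat n n" "transpose_mat C \<in> carrier_mat n m" "transpose_mat K \<in> carrier_mat m n"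
    using F C K by simp_all
  have c': "c' \<in> carrier_vec n"
    unfolding c'_def by (rule add_carrier_vec[OF mult_mat_vec_carrier[OF tr(1) Suc.prems] mult_mat_vec_carrier[OF tr(2) bT]])
  have kc: "k \<in> carrier_vec m"
    unfolding k_def by (rule minus_carrier_vec[OF bT mult_mat_vec_carrier[OF tr(3) Suc.prems]])
  obtain a where a': "\<forall>s. a s \<in> carrier_vec (src_dim s)"
    "\<forall>\<omega>\<in>space M. c' \<bullet> (x \<omega> T - xh \<omega> T) + (\<Sum>t<T. b t \<bullet> e \<omega> t) = (\<Sum>s\<in>srcs T. a s \<bullet> vec (src_dim s) (src s \<omega>))"
    "(\<Sum>s\<in>srcs T. a s \<bullet> (src_cov s *\<^sub>v a s)) = c' \<bullet> (P *\<^sub>v c') + (\<Sum>t<T. b t \<bullet> (Rbar *\<^sub>v b t))"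
    using Suc.IH[OF c'] by (elim exE conjE)
  note a = a'(1)[rule_format] a'(2)[rule_format] a'(3)
  let ?a = "a(W T := c, V T := k)"
  have upd: "(\<Sum>s\<in>srcs (Suc T). f s (?a s)) = f (W T) c + (f (V T) k + (\<Sum>s\<in>srcs T. f s (a s)))" for f :: "noise_src \<Rightarrow> real vec \<Rightarrow> real"
  proof -
    have "(\<Sum>s\<in>srcs T. f s (?a s)) = (\<Sum>s\<in>srcs T. f s (a s))"
      using srcs_Suc(2,3) by (intro sum.cong) auto
    then show ?thesis using srcs_Suc[of T] by simp
  qed
  have step: "c \<bullet> (x \<omega> (Suc T) - xh \<omega> (Suc T)) + b T \<bullet> e \<omega> T = c' \<bullet> (x \<omega> T - xh \<omega> T) + c \<bullet> vec n (w T \<omega>) + k \<bullet> vec m (v T \<omega>)"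
    if w: "\<omega> \<in> space M" for \<omega>
  proof -
    define \<epsilon> where "\<epsilon> = x \<omega> T - xh \<omega> T"
    define vv where "vv = vec m (v T \<omega>)"
    define ww where "ww = vec n (w T \<omega>)"
    have car: "\<epsilon> \<in> carrier_vec n" "vv \<in> carrier_vec m" "ww \<in> carrier_vec n"
      using x_carrier[OF w] xh_carrier[OF w] by (auto simp: \<epsilon>_def vv_def ww_def)
    have eT: "e \<omega> T = C *\<^sub>v \<epsilon> + vv" by (simp add: e_eq[OF w] \<epsilon>_def vv_def)
    have car2: "A *\<^sub>v \<epsilon> \<in> carrier_vec n" "K *\<^sub>v (C *\<^sub>v \<epsilon>) \<in> carrier_vec n" "K *\<^sub>v vv \<in> carrier_vec n" "C *\<^sub>v \<epsilon> \<in> carrier_vec m"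
      "?F *\<^sub>v \<epsilon> \<in> carrier_vec n" using A K C F car by auto
    have Fe: "?F *\<^sub>v \<epsilon> = A *\<^sub>v \<epsilon> - K *\<^sub>v (C *\<^sub>v \<epsilon>)"
      using minus_mult_distrib_mat_vec[OF A KC car(1)] assoc_mult_mat_vec[OF K C car(1)] by simp
    have Ke: "K *\<^sub>v e \<omega> T = K *\<^sub>v (C *\<^sub>v \<epsilon>) + K *\<^sub>v vv"
      unfolding eT by (rule mult_add_distrib_mat_vec[OF K car2(4) car(2)])
    have Ae: "A *\<^sub>v \<epsilon> = A *\<^sub>v x \<omega> T - A *\<^sub>v xh \<omega> T"
      unfolding \<epsilon>_def by (rule mult_minus_distrib_mat_vec[OF A x_carrier[OF w] xh_carrier[OF w]])
    have dims: "dim_vec (A *\<^sub>v x \<omega> T) = n" "dim_vec (A *\<^sub>v xh \<omega> T) = n" "dim_vec (K *\<^sub>v vv) = n" "dim_vec ww = n" "dim_vec (K *\<^sub>v (C *\<^sub>v \<epsilon>)) = n"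
      using A K car by auto
    have eps: "x \<omega> (Suc T) - xh \<omega> (Suc T) = (?F *\<^sub>v \<epsilon> + ww) - K *\<^sub>v vv"
      unfolding state(2)[OF w] kf(2)[OF w] Ke Fe Ae ww_def[symmetric]
      by (intro eq_vecI) (auto simp: dims simp del: index_mult_mat_vec dim_mult_mat_vec)
    have "c \<bullet> (x \<omega> (Suc T) - xh \<omega> (Suc T)) = c \<bullet> (?F *\<^sub>v \<epsilon>) + c \<bullet> ww - c \<bullet> (K *\<^sub>v vv)"
      unfolding eps using Suc.prems car car2
      by (simp add: scalar_prod_minus_distrib[of _ n] scalar_prod_add_distrib[of _ n])
    also have "c \<bullet> (?F *\<^sub>v \<epsilon>) = (transpose_mat ?F *\<^sub>v c) \<bullet> \<epsilon>"
      using transpose_vec_mult_scalar[OF F car(1) Suc.prems] by simp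
    also have "c \<bullet> (K *\<^sub>v vv) = (transpose_mat K *\<^sub>v c) \<bullet> vv"
      using transpose_vec_mult_scalar[OF K car(2) Suc.prems] by simp
    finally have 1: "c \<bullet> (x \<omega> (Suc T) - xh \<omega> (Suc T)) = (transpose_mat ?F *\<^sub>v c) \<bullet> \<epsilon> + c \<bullet> ww - (transpose_mat K *\<^sub>v c) \<bullet> vv" .
    have "b T \<bullet> e \<omega> T = b T \<bullet> (C *\<^sub>v \<epsilon>) + b T \<bullet> vv"
      unfolding eT by (rule scalar_prod_add_distrib[OF bT car2(4) car(2)])
    also have "b T \<bullet> (C *\<^sub>v \<epsilon>) = (transpose_mat C *\<^sub>v b T) \<bullet> \<epsilon>"
      using transpose_vec_mult_scalar[OF C car(1) bT] by simp
    finally have 2: "b T \<bullet> e \<omega> T = (transpose_mat C *\<^sub>v b T) \<bullet> \<epsilon> + b T \<bullet> vv" .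
    have 3: "c' \<bullet> \<epsilon> = (transpose_mat ?F *\<^sub>v c) \<bullet> \<epsilon> + (transpose_mat C *\<^sub>v b T) \<bullet> \<epsilon>"
      unfolding c'_def using F C Suc.prems bT car by (intro add_scalar_prod_distrib[of _ n]) auto
    have 4: "k \<bullet> vv = b T \<bullet> vv - (transpose_mat K *\<^sub>v c) \<bullet> vv"
      unfolding k_def using K Suc.prems bT car by (intro minus_scalar_prod_distrib[of _ m]) auto
    show ?thesis unfolding 1 2 \<epsilon>_def[symmetric] vv_def[symmetric] ww_def[symmetric] 3 4 by simp
  qed
  show ?case
  proof (intro exI[of _ ?a] conjI allI ballI)
    fix s show "?a s \<in> carrier_vec (src_dim s)" using a(1) Suc.prems kc by (auto simp: src_dim_def)
  next
    fix \<omega> assume w: "\<omega> \<in> space M"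
    show "c \<bullet> (x \<omega> (Suc T) - xh \<omega> (Suc T)) + (\<Sum>t<Suc T. b t \<bullet> e \<omega> t) = (\<Sum>s\<in>srcs (Suc T). ?a s \<bullet> vec (src_dim s) (src s \<omega>))"
      unfolding upd[of "\<lambda>s a. a \<bullet> vec (src_dim s) (src s \<omega>)"] a(2)[OF w, symmetric]
      using step[OF w] by (simp add: src_def src_dim_def)
  next
    show "(\<Sum>s\<in>srcs (Suc T). ?a s \<bullet> (src_cov s *\<^sub>v ?a s)) = c \<bullet> (P *\<^sub>v c) + (\<Sum>t<Suc T. b t \<bullet> (Rbar *\<^sub>v b t))"
      unfolding upd[of "\<lambda>s a. a \<bullet> (src_cov s *\<^sub>v a)"] a(3)
      using riccati_quadratic[OF Suc.prems bT] by (simp add: src_cov_def c'_def k_def)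
  qed
qed

text \<open>The measurement noise at time t enters only \<open>y \<omega> t\<close>, with
  coefficient \<open>b t\<close>, and contributes exactly its R-variance; every other source adds a
  nonnegative amount. This inequality is the origin of \<open>sigma_min R\<close> in the lower bound
  on the window covariance.\<close>

lemma output_representation:
  assumes "c \<in> carrier_vec n" and "\<And>t. b t \<in> carrier_vec m"
  shows "\<exists>a. (\<forall>s. a s \<in> carrier_vec (src_dim s)) \<and>
    (\<forall>\<omega>\<in>space M. c \<bullet> x \<omega> T + (\<Sum>t<T. b t \<bullet> y \<omega> t) = (\<Sum>s\<in>srcs T. a s \<bullet> vec (src_dim s) (src s \<omega>))) \<and>
    (\<Sum>s\<in>srcs T. a s \<bullet> (src_cov s *\<^sub>v a s)) \<ge> (\<Sum>t<T. b t \<bullet> (R *\<^sub>v b t))"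
  using assms(1)
proof (induction T arbitrary: c)
  case 0
  let ?a = "\<lambda>s. if s = X0 then c else 0\<^sub>v (src_dim s)"
  show ?case using 0 psd_matD(2)[OF pd_imp_psd[OF P(2)] P(1) 0]
    by (intro exI[of _ ?a]) (auto simp: srcs_def src_dim_def src_def src_cov_def state)
next
  case (Suc T)
  define c' where "c' = transpose_mat A *\<^sub>v c + transpose_mat C *\<^sub>v b T"
  have bT: "b T \<in> carrier_vec m" by (rule assms(2))
  have tr: "transpose_mat A \<in> carrier_mat n n" "transpose_mat C \<in> carrier_mat n m" using A C by simp_all
  have c': "c' \<in> carrier_vec n"
    unfolding c'_def by (rule add_carrier_vec[OF mult_mat_vec_carrier[OF tr(1) Suc.prems] mult_mat_vec_carrier[OF tr(2) bT]])
  obtain a where a': "\<forall>s. a s \<in> carrier_vec (src_dim s)"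
    "\<forall>\<omega>\<in>space M. c' \<bullet> x \<omega> T + (\<Sum>t<T. b t \<bullet> y \<omega> t) = (\<Sum>s\<in>srcs T. a s \<bullet> vec (src_dim s) (src s \<omega>))"
    "(\<Sum>s\<in>srcs T. a s \<bullet> (src_cov s *\<^sub>v a s)) \<ge> (\<Sum>t<T. b t \<bullet> (R *\<^sub>v b t))"
    using Suc.IH[OF c'] by (elim exE conjE)
  note a = a'(1)[rule_format] a'(2)[rule_format] a'(3)
  let ?a = "a(W T := c, V T := b T)"
  have upd: "(\<Sum>s\<in>srcs (Suc T). f s (?a s)) = f (W T) c + (f (V T) (b T) + (\<Sum>s\<in>srcs T. f s (a s)))" for f :: "noise_src \<Rightarrow> real vec \<Rightarrow> real"
  proof -
    have "(\<Sum>s\<in>srcs T. f s (?a s)) = (\<Sum>s\<in>srcs T. f s (a s))"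
      using srcs_Suc(2,3) by (intro sum.cong) auto
    then show ?thesis using srcs_Suc[of T] by simp
  qed
  have step: "c \<bullet> x \<omega> (Suc T) + b T \<bullet> y \<omega> T = c' \<bullet> x \<omega> T + c \<bullet> vec n (w T \<omega>) + b T \<bullet> vec m (v T \<omega>)"
    if w: "\<omega> \<in> space M" for \<omega>
  proof -
    note xc = x_carrier[OF w, of T]
    have car: "A *\<^sub>v x \<omega> T \<in> carrier_vec n" "C *\<^sub>v x \<omega> T \<in> carrier_vec m" "transpose_mat A *\<^sub>v c \<in> carrier_vec n" "transpose_mat C *\<^sub>v b T \<in> carrier_vec n"
      using A C xc Suc.prems bT by auto
    have 1: "c \<bullet> x \<omega> (Suc T) = (transpose_mat A *\<^sub>v c) \<bullet> x \<omega> T + c \<bullet> vec n (w T \<omega>)"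
      unfolding state(2)[OF w] transpose_vec_mult_scalar[OF A xc Suc.prems]
      by (rule scalar_prod_add_distrib[OF Suc.prems car(1)]) simp
    have 2: "b T \<bullet> y \<omega> T = (transpose_mat C *\<^sub>v b T) \<bullet> x \<omega> T + b T \<bullet> vec m (v T \<omega>)"
      unfolding outp[OF w] transpose_vec_mult_scalar[OF C xc bT]
      by (rule scalar_prod_add_distrib[OF bT car(2)]) simp
    have 3: "c' \<bullet> x \<omega> T = (transpose_mat A *\<^sub>v c) \<bullet> x \<omega> T + (transpose_mat C *\<^sub>v b T) \<bullet> x \<omega> T"
      unfolding c'_def by (rule add_scalar_prod_distrib[OF car(3,4) xc])
    show ?thesis unfolding 1 2 3 by simp
  qed
  show ?case
  proof (intro exI[of _ ?a] conjI allI ballI)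
    fix s show "?a s \<in> carrier_vec (src_dim s)" using a(1) Suc.prems bT by (auto simp: src_dim_def)
  next
    fix \<omega> assume w: "\<omega> \<in> space M"
    show "c \<bullet> x \<omega> (Suc T) + (\<Sum>t<Suc T. b t \<bullet> y \<omega> t) = (\<Sum>s\<in>srcs (Suc T). ?a s \<bullet> vec (src_dim s) (src s \<omega>))"
      unfolding upd[of "\<lambda>s a. a \<bullet> vec (src_dim s) (src s \<omega>)"] a(2)[OF w, symmetric]
      using step[OF w] by (simp add: src_def src_dim_def)
  next
    show "(\<Sum>t<Suc T. b t \<bullet> (R *\<^sub>v b t)) \<le> (\<Sum>s\<in>srcs (Suc T). ?a s \<bullet> (src_cov s *\<^sub>v ?a s))"
      unfolding upd[of "\<lambda>s a. a \<bullet> (src_cov s *\<^sub>v a)"]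
      using a(3) psd_matD(2)[OF Q(2,1) Suc.prems] by (simp add: src_cov_def)
  qed
qed

text \<open>Taking c = 0 removes the estimation error, and what remains of the variance is the sum
  over independent blocks of covariance \<open>Rbar\<close>.\<close>

lemma innovation_chf:
  assumes b: "\<And>t. b t \<in> carrier_vec m"
  shows "(CLINT \<omega>|M. iexp (\<Sum>t<T. b t \<bullet> e \<omega> t)) = complex_of_real (exp (- (\<Sum>t<T. b t \<bullet> (Rbar *\<^sub>v b t)) / 2))"
proof -
  obtain a where a': "\<forall>s. a s \<in> carrier_vec (src_dim s)"
    "\<forall>\<omega>\<in>space M. 0\<^sub>v n \<bullet> (x \<omega> T - xh \<omega> T) + (\<Sum>t<T. b t \<bullet> e \<omega> t) = (\<Sum>s\<in>srcs T. a s \<bullet> vec (src_dim s) (src s \<omega>))"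
    "(\<Sum>s\<in>srcs T. a s \<bullet> (src_cov s *\<^sub>v a s)) = 0\<^sub>v n \<bullet> (P *\<^sub>v 0\<^sub>v n) + (\<Sum>t<T. b t \<bullet> (Rbar *\<^sub>v b t))"
    using innovation_representation[where c = "0\<^sub>v n" and b = b and T = T, OF zero_carrier_vec b] by (elim exE conjE)
  note a = a'(1)[rule_format] a'(2)[rule_format] a'(3)
  have z: "0\<^sub>v n \<bullet> (x \<omega> T - xh \<omega> T) = 0" if "\<omega> \<in> space M" for \<omega>
    using x_carrier[OF that] xh_carrier[OF that] by simp
  have "(CLINT \<omega>|M. iexp (\<Sum>t<T. b t \<bullet> e \<omega> t)) = (CLINT \<omega>|M. iexp (\<Sum>s\<in>srcs T. a s \<bullet> vec (src_dim s) (src s \<omega>)))"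
    using a(2) z by (intro Bochner_Integration.integral_cong) (auto simp flip: a(2))
  also have "\<dots> = complex_of_real (exp (- (\<Sum>t<T. b t \<bullet> (Rbar *\<^sub>v b t)) / 2))"
    using sources_chf[OF srcs_Suc(4) a(1), of T] a(3) P(1) by simp
  finally show ?thesis .
qed

text \<open>Two expansions of one random variable have the same characteristic function, hence the same
  variance; this avoids inverting the Toeplitz matrix.\<close>

lemma innovation_variance_ge:
  assumes b: "\<And>t. b t \<in> carrier_vec m" "\<And>t. b' t \<in> carrier_vec m"
    and eq: "\<And>\<omega>. \<omega> \<in> space M \<Longrightarrow> (\<Sum>t<T. b t \<bullet> y \<omega> t) = (\<Sum>t<T. b' t \<bullet> e \<omega> t)"
  shows "(\<Sum>t<T. b t \<bullet> (R *\<^sub>v b t)) \<le> (\<Sum>t<T. b' t \<bullet> (Rbar *\<^sub>v b' t))"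
proof -
  obtain a where a': "\<forall>s. a s \<in> carrier_vec (src_dim s)"
    "\<forall>\<omega>\<in>space M. 0\<^sub>v n \<bullet> x \<omega> T + (\<Sum>t<T. b t \<bullet> y \<omega> t) = (\<Sum>s\<in>srcs T. a s \<bullet> vec (src_dim s) (src s \<omega>))"
    "(\<Sum>s\<in>srcs T. a s \<bullet> (src_cov s *\<^sub>v a s)) \<ge> (\<Sum>t<T. b t \<bullet> (R *\<^sub>v b t))"
    using output_representation[where c = "0\<^sub>v n" and b = b and T = T, OF zero_carrier_vec b(1)] by (elim exE conjE)
  note a = a'(1)[rule_format] a'(2)[rule_format] a'(3)
  have z: "0\<^sub>v n \<bullet> x \<omega> T = 0" if "\<omega> \<in> space M" for \<omega>
    using x_carrier[OF that] by simp
  have "(CLINT \<omega>|M. iexp (\<Sum>t<T. b' t \<bullet> e \<omega> t)) = (CLINT \<omega>|M. iexp (\<Sum>s\<in>srcs T. a s \<bullet> vec (src_dim s) (src s \<omega>)))"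
    by (intro Bochner_Integration.integral_cong) (auto simp: z simp flip: a(2) eq)
  then have "exp (- (\<Sum>t<T. b' t \<bullet> (Rbar *\<^sub>v b' t)) / 2) = exp (- (\<Sum>s\<in>srcs T. a s \<bullet> (src_cov s *\<^sub>v a s)) / 2)"
    unfolding innovation_chf[OF b(2)] sources_chf[OF srcs_Suc(4) a(1)] by (simp only: of_real_eq_iff)
  then show ?thesis using a(3) by simp
qed

end

section \<open>Block vectors and second moments\<close>

lemma sum_blocks: "(\<Sum>i<T * m. g i) = (\<Sum>t<T. \<Sum>c<m. g (t * m + c))" for g :: "nat \<Rightarrow> real"
proof -
  have "(\<Sum>i<T * m. g i) = (\<Sum>t<T. sum g {t * m..<t * m + m})" by (rule sum.nat_group[symmetric])
  also have "\<dots> = (\<Sum>t<T. \<Sum>c<m. g (t * m + c))"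
  proof (rule sum.cong[OF refl])
    show "sum g {t * m..<t * m + m} = (\<Sum>c<m. g (t * m + c))" for t
      by (rule sum.reindex_bij_witness[of _ "\<lambda>c. t * m + c" "\<lambda>i. i - t * m"]) auto
  qed
  finally show ?thesis .
qed

lemma pow_mat_Suc_left:
  assumes A: "A \<in> carrier_mat n n"
  shows "A ^\<^sub>m Suc i = A * A ^\<^sub>m i"
proof (induction i)
  case 0
  then show ?case using A by simp
next
  case (Suc i)
  have "A ^\<^sub>m Suc (Suc i) = A * A ^\<^sub>m i * A" using Suc by simp
  also have "\<dots> = A * (A ^\<^sub>m i * A)" using A by (intro assoc_mult_mat[of _ n n _ n _ n]) auto
  finally show ?case by simp
qed

lemma block_index:
  assumes "i < p" "c < m"
  shows "i * m + c < m * (p::nat)"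
proof -
  have "i * m + c < Suc i * m" using assms by simp
  also have "\<dots> \<le> p * m" using assms by (intro mult_le_mono1) simp
  finally show ?thesis by (simp add: mult.commute)
qed

definition blk :: "nat \<Rightarrow> nat \<Rightarrow> real vec \<Rightarrow> real vec" where
  "blk m i z = vec m (\<lambda>c. z $ (i * m + c))"

lemma blk_carrier [simp]: "blk m i z \<in> carrier_vec m"
  by (simp add: blk_def)

lemma scalar_prod_blocks:
  assumes z: "z \<in> carrier_vec (m * p)" and u: "u \<in> carrier_vec (m * p)"
  shows "z \<bullet> u = (\<Sum>i<p. blk m i z \<bullet> blk m i u)"
proof -
  have "z \<bullet> u = (\<Sum>i<p * m. z $ i * u $ i)" using u by (simp add: scalar_prod_def lessThan_atLeast0 mult.commute)
  then show ?thesis unfolding sum_blocks by (simp add: blk_def vec_ip ip_def)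
qed

lemma blk_stack_past: "i < p \<Longrightarrow> f (t - p + i) \<in> carrier_vec m \<Longrightarrow> blk m i (stack_past m p f t) = f (t - p + i)"
proof (rule eq_vecI)
  fix c assume i: "i < p" and f: "f (t - p + i) \<in> carrier_vec m" and c: "c < dim_vec (f (t - p + i))"
  then have c: "c < m" by simp
  have "i * m + c < m * p" by (rule block_index[OF i c])
  then show "blk m i (stack_past m p f t) $ c = f (t - p + i) $ c"
    using c by (simp add: blk_def stack_past_def)
qed (auto simp: blk_def)

lemma quad_blkdiag:
  assumes B: "B \<in> carrier_mat m m" and z: "z \<in> carrier_vec (m * p)"
  shows "z \<bullet> (blkdiag p B *\<^sub>v z) = (\<Sum>i<p. blk m i z \<bullet> (B *\<^sub>v blk m i z))"
proof -
  have d: "blkdiag p B \<in> carrier_mat (m * p) (m * p)" using B by (simp add: blkdiag_def Let_def)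
  have "blk m i (blkdiag p B *\<^sub>v z) = B *\<^sub>v blk m i z" if i: "i < p" for i
  proof (rule eq_vecI)
    fix c assume "c < dim_vec (B *\<^sub>v blk m i z)"
    then have c: "c < m" using B by simp
    have r: "i * m + c < m * p" by (rule block_index[OF i c])
    have "blk m i (blkdiag p B *\<^sub>v z) $ c = (\<Sum>q<p * m. blkdiag p B $$ (i * m + c, q) * z $ q)"
      using c r d z by (simp add: blk_def scalar_prod_def lessThan_atLeast0 mult.commute[of p m])
    also have "\<dots> = (\<Sum>j<p. \<Sum>c'<m. (if i = j then B $$ (c, c') * z $ (j * m + c') else 0))"
    proof -
      have rj: "j * m + c' < m * p" if "j < p" "c' < m" for j c'
        by (rule block_index[OF that])
      show ?thesis unfolding sum_blocks
        using B c r rj by (intro sum.cong refl) (auto simp: blkdiag_def Let_def)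
    qed
    also have "\<dots> = (\<Sum>j<p. if i = j then (\<Sum>c'<m. B $$ (c, c') * z $ (j * m + c')) else 0)"
      by (intro sum.cong) auto
    also have "\<dots> = (B *\<^sub>v blk m i z) $ c"
      using i c B by (simp add: blk_def scalar_prod_def lessThan_atLeast0)
    finally show "blk m i (blkdiag p B *\<^sub>v z) $ c = (B *\<^sub>v blk m i z) $ c" .
  qed (use B in \<open>simp add: blk_def\<close>)
  then show ?thesis using scalar_prod_blocks[OF z mult_mat_vec_carrier[OF d z]] by simp
qed

text \<open>After normalisation a single linear functional is an isonormal family with one index, so
  its second moment is that of a standard normal. The nonnegative integral requires no prior
  integrability.\<close>

lemma (in white_noise) linear_second_moment:
  "(\<integral>\<^sup>+\<omega>. ennreal ((\<Sum>i<D. l i * x i \<omega>)\<^sup>2) \<partial>M) = ennreal (\<Sum>i<D. (l i)\<^sup>2)"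
proof (cases "(\<Sum>i<D. (l i)\<^sup>2) = 0")
  case True
  then have "\<forall>i\<in>{..<D}. (l i)\<^sup>2 = 0" by (subst (asm) sum_nonneg_eq_0_iff) auto
  then have "(\<Sum>i<D. l i * x i \<omega>) = 0" for \<omega> by (intro sum.neutral) auto
  then show ?thesis using True by simp
next
  case False
  define q where "q = (\<Sum>i<D. (l i)\<^sup>2)"
  have q: "q > 0" using False by (simp add: q_def order.strict_iff_order sum_nonneg)
  define f where "f \<omega> = (\<Sum>i<D. l i / sqrt q * x i \<omega>)" for \<omega>
  have iso: "isonormal M {()} (\<lambda>_. f)"
  proof (rule isonormal_orthonormal[OF white[of D], where L = "\<lambda>_ i. l i / sqrt q"])
    show "(\<Sum>i<D. l i / sqrt q * (l i / sqrt q)) = (if j = k then 1 else 0)" for j k :: unit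
    proof -
      have "(\<Sum>i<D. l i / sqrt q * (l i / sqrt q)) = q / (sqrt q)\<^sup>2"
        by (simp add: q_def power2_eq_square sum_divide_distrib)
      then show ?thesis using q by simp
    qed
  qed (auto simp: f_def)
  interpret P: product_sigma_finite "\<lambda>_. std_normal_distribution" by (rule product_sigma_finite_std_normal)
  have "(\<integral>\<^sup>+\<omega>. ennreal ((f \<omega>)\<^sup>2) \<partial>M) = (\<integral>\<^sup>+\<omega>. ennreal (((\<lambda>i\<in>{()}. f \<omega>) ())\<^sup>2) \<partial>M)" by simp
  also have "\<dots> = (\<integral>\<^sup>+y. ennreal ((y ())\<^sup>2) \<partial>PiM {()} (\<lambda>_. std_normal_distribution))"
    by (rule isonormal_nn_integral[OF prob_space_axioms iso]) auto
  also have "\<dots> = (\<integral>\<^sup>+v. ennreal (v\<^sup>2) \<partial>std_normal_distribution)"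
    by (rule P.product_nn_integral_singleton) auto
  also have "\<dots> = ennreal (LINT v|std_normal_distribution. v\<^sup>2)"
    by (rule nn_integral_eq_integral) (auto intro: integrable_std_normal_distribution_moment)
  also have "(LINT v|std_normal_distribution. v\<^sup>2) = 1"
    using std_normal_distribution_even_moments(1)[of 1] by simp
  finally have 1: "(\<integral>\<^sup>+\<omega>. ennreal ((f \<omega>)\<^sup>2) \<partial>M) = 1" by simp
  have "(\<Sum>i<D. l i * x i \<omega>)\<^sup>2 = q * (f \<omega>)\<^sup>2" for \<omega>
  proof -
    have "(\<Sum>i<D. l i * x i \<omega>) = sqrt q * f \<omega>"
      unfolding f_def sum_distrib_left using q by (intro sum.cong) auto
    then show ?thesis using q by (simp add: power_mult_distrib)
  qed
  then have "(\<integral>\<^sup>+\<omega>. ennreal ((\<Sum>i<D. l i * x i \<omega>)\<^sup>2) \<partial>M) = ennreal q * (\<integral>\<^sup>+\<omega>. ennreal ((f \<omega>)\<^sup>2) \<partial>M)"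
    using q by (subst nn_integral_cmult[symmetric]) (auto simp: f_def ennreal_mult)
  then show ?thesis by (simp add: 1 q_def)
qed

text \<open>The entries of \<open>second_moment\<close> are Bochner integrals, which are zero for
  non-integrable functions. Finite second moments, with |ab| \<le> a^2 + b^2, make every entry
  genuine before the quadratic form is read as an expectation.\<close>

lemma (in prob_space) second_moment_quad:
  fixes X :: "'a \<Rightarrow> real vec"
  assumes X: "\<And>i. i < d \<Longrightarrow> (\<lambda>\<omega>. X \<omega> $ i) \<in> borel_measurable M"
    and X2: "\<And>i. i < d \<Longrightarrow> (\<integral>\<^sup>+\<omega>. ennreal ((X \<omega> $ i)\<^sup>2) \<partial>M) < \<infinity>"
    and b: "b \<in> carrier_vec d"
  shows "b \<bullet> (second_moment M d X *\<^sub>v b) = (LINT \<omega>|M. (\<Sum>i<d. b $ i * X \<omega> $ i)\<^sup>2)"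
    "integrable M (\<lambda>\<omega>. (\<Sum>i<d. b $ i * X \<omega> $ i)\<^sup>2)"
proof -
  have sq: "integrable M (\<lambda>\<omega>. (X \<omega> $ i)\<^sup>2)" if "i < d" for i
    by (rule integrableI_nonneg) (use X[OF that] X2[OF that] in auto)
  have pr: "integrable M (\<lambda>\<omega>. X \<omega> $ i * X \<omega> $ j)" if "i < d" "j < d" for i j
  proof (rule Bochner_Integration.integrable_bound[OF Bochner_Integration.integrable_add[OF sq[OF that(1)] sq[OF that(2)]]])
    show "AE \<omega> in M. norm (X \<omega> $ i * X \<omega> $ j) \<le> norm ((X \<omega> $ i)\<^sup>2 + (X \<omega> $ j)\<^sup>2)"
    proof (rule AE_I2)
      fix \<omega>
      have "0 \<le> (\<bar>X \<omega> $ i\<bar> - \<bar>X \<omega> $ j\<bar>)\<^sup>2" by simp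
      then have "2 * (\<bar>X \<omega> $ i\<bar> * \<bar>X \<omega> $ j\<bar>) \<le> (X \<omega> $ i)\<^sup>2 + (X \<omega> $ j)\<^sup>2" by (simp add: power2_diff)
      moreover have "0 \<le> \<bar>X \<omega> $ i\<bar> * \<bar>X \<omega> $ j\<bar>" by simp
      ultimately have "\<bar>X \<omega> $ i\<bar> * \<bar>X \<omega> $ j\<bar> \<le> (X \<omega> $ i)\<^sup>2 + (X \<omega> $ j)\<^sup>2" by linarith
      then show "norm (X \<omega> $ i * X \<omega> $ j) \<le> norm ((X \<omega> $ i)\<^sup>2 + (X \<omega> $ j)\<^sup>2)" by (simp add: abs_mult)
    qed
  qed (use X that in auto)
  have e: "(\<Sum>i<d. b $ i * X \<omega> $ i)\<^sup>2 = (\<Sum>i<d. \<Sum>j<d. b $ i * b $ j * (X \<omega> $ i * X \<omega> $ j))" for \<omega>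
    by (simp add: power2_eq_square sum_product mult_ac)
  show "integrable M (\<lambda>\<omega>. (\<Sum>i<d. b $ i * X \<omega> $ i)\<^sup>2)"
    unfolding e using pr by (intro Bochner_Integration.integrable_sum integrable_mult_right) auto
  have "(LINT \<omega>|M. (\<Sum>i<d. b $ i * X \<omega> $ i)\<^sup>2) = (\<Sum>i<d. \<Sum>j<d. b $ i * b $ j * (LINT \<omega>|M. X \<omega> $ i * X \<omega> $ j))"
    unfolding e using pr
    by (subst Bochner_Integration.integral_sum, force intro: Bochner_Integration.integrable_sum,
        intro sum.cong refl, subst Bochner_Integration.integral_sum) auto
  then show "b \<bullet> (second_moment M d X *\<^sub>v b) = (LINT \<omega>|M. (\<Sum>i<d. b $ i * X \<omega> $ i)\<^sup>2)"
    using b by (simp add: second_moment_def scalar_prod_def lessThan_atLeast0 sum_distrib_left mult_ac)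
qed

lemma second_moment_symmetric: "transpose_mat (second_moment M d X) = second_moment M d X"
  by (intro eq_matI) (auto simp: second_moment_def mult.commute)

section \<open>Whitened innovations and the state estimate\<close>

context kalman
begin

definition G :: "real mat" where "G = mat_sqrt Rbar"
definition Gi :: "real mat" where "Gi = mat_inv G"

lemma G: "G \<in> carrier_mat m m" "pd_mat G" "G * G = Rbar" "transpose_mat G = G"
  and Gi: "Gi \<in> carrier_mat m m" "G * Gi = 1\<^sub>m m" "Gi * G = 1\<^sub>m m" "transpose_mat Gi = Gi"
proof -
  show G: "G \<in> carrier_mat m m" "pd_mat G" "G * G = Rbar" unfolding G_def using mat_sqrt_pd[OF Rbar] by auto
  show "transpose_mat G = G" by (rule pd_matD(1)[OF G(2,1)])
  obtain J where J: "J \<in> carrier_mat m m" "G * J = 1\<^sub>m m" "J * G = 1\<^sub>m m" "transpose_mat J = J"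
    using pd_inverse_exists[OF G(1,2)] by blast
  have "Gi = J" unfolding Gi_def by (rule mat_inv_eqI(1)[OF G(1) J(1,2)])
  then show "Gi \<in> carrier_mat m m" "G * Gi = 1\<^sub>m m" "Gi * G = 1\<^sub>m m" "transpose_mat Gi = Gi" using J by auto
qed

text \<open>The innovations multiplied by the inverse square root of \<open>Rbar\<close> and laid
  end to end, with block t occupying the indices from t * m on.\<close>

definition wn :: "nat \<Rightarrow> 'a \<Rightarrow> real" where
  "wn i \<omega> = (Gi *\<^sub>v e \<omega> (i div m)) $ (i mod m)"

lemma wn_block: "c < m \<Longrightarrow> wn (t * m + c) \<omega> = (Gi *\<^sub>v e \<omega> t) $ c"
  using m by (simp add: wn_def)

text \<open>The innovations are specified only on \<open>space M\<close>; there they agree with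
  finite linear combinations of the sources, from which measurability is inherited.\<close>

lemma innovation_measurable:
  assumes b: "\<And>t. b t \<in> carrier_vec m"
  shows "(\<lambda>\<omega>. \<Sum>t<T. b t \<bullet> e \<omega> t) \<in> borel_measurable M"
proof -
  obtain a where a: "\<forall>s. a s \<in> carrier_vec (src_dim s)"
    "\<forall>\<omega>\<in>space M. 0\<^sub>v n \<bullet> (x \<omega> T - xh \<omega> T) + (\<Sum>t<T. b t \<bullet> e \<omega> t) = (\<Sum>s\<in>srcs T. a s \<bullet> vec (src_dim s) (src s \<omega>))"
    using innovation_representation[where c = "0\<^sub>v n" and b = b and T = T, OF zero_carrier_vec b] by (elim exE conjE)
  have "(\<lambda>\<omega>. a s \<bullet> vec (src_dim s) (src s \<omega>)) \<in> borel_measurable M" for s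
  proof -
    have "src s \<in> measurable M (rv_space (src_dim s))" using src_gauss[of s] by (simp add: gaussian_rv_def)
    from measurable_compose[OF this src_comp_measurable[where c = "\<lambda>i. a s $ i"]] show ?thesis
      by (simp add: scalar_prod_def lessThan_atLeast0)
  qed
  then have S: "(\<lambda>\<omega>. \<Sum>s\<in>srcs T. a s \<bullet> vec (src_dim s) (src s \<omega>)) \<in> borel_measurable M" by (intro borel_measurable_sum)
  have "(\<Sum>t<T. b t \<bullet> e \<omega> t) = (\<Sum>s\<in>srcs T. a s \<bullet> vec (src_dim s) (src s \<omega>))" if "\<omega> \<in> space M" for \<omega>
    using bspec[OF a(2) that] x_carrier[OF that, of T] xh_carrier[OF that, of T] by simp
  then show ?thesis using S by (subst measurable_cong) auto
qed

lemma innovation_term: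
  assumes w: "\<omega> \<in> space M" and b: "b \<in> carrier_vec m"
  shows "b \<bullet> e \<omega> t = (\<Sum>c<m. (G *\<^sub>v b) $ c * wn (t * m + c) \<omega>)"
proof -
  have ee: "e \<omega> t \<in> carrier_vec m" "Gi *\<^sub>v e \<omega> t \<in> carrier_vec m" using e_carrier[OF w] Gi by auto
  have "G *\<^sub>v (Gi *\<^sub>v e \<omega> t) = e \<omega> t"
    using assoc_mult_mat_vec[OF G(1) Gi(1) ee(1)] ee Gi(2) by simp
  then have "b \<bullet> e \<omega> t = (G *\<^sub>v b) \<bullet> (Gi *\<^sub>v e \<omega> t)"
    using transpose_vec_mult_scalar[OF G(1) ee(2) b] G(4) by simp
  also have "\<dots> = (\<Sum>c<m. (G *\<^sub>v b) $ c * wn (t * m + c) \<omega>)"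
    unfolding scalar_prod_def using Gi(1) by (auto simp: wn_block lessThan_atLeast0 intro!: sum.cong simp del: index_mult_mat_vec)
  finally show ?thesis .
qed

lemma innovation_whitened_shift:
  assumes w: "\<omega> \<in> space M" and b: "\<And>t. b t \<in> carrier_vec m"
  shows "(\<Sum>t<T. b t \<bullet> e \<omega> (s + t)) = (\<Sum>i<T * m. (G *\<^sub>v b (i div m)) $ (i mod m) * wn (s * m + i) \<omega>)"
  unfolding sum_blocks innovation_term[OF w b]
  by (intro sum.cong refl) (auto simp: algebra_simps simp del: index_mult_mat_vec)

lemmas innovation_whitened = innovation_whitened_shift[where s = 0, simplified]

lemma innovation_whitened_norm:
  assumes b: "\<And>t. b t \<in> carrier_vec m"
  shows "(\<Sum>i<T * m. ((G *\<^sub>v b (i div m)) $ (i mod m))\<^sup>2) = (\<Sum>t<T. b t \<bullet> (Rbar *\<^sub>v b t))"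
proof -
  have "(\<Sum>c<m. ((G *\<^sub>v b t) $ c)\<^sup>2) = b t \<bullet> (Rbar *\<^sub>v b t)" for t
  proof -
    have g: "G *\<^sub>v b t \<in> carrier_vec m" using G b by simp
    have "b t \<bullet> (Rbar *\<^sub>v b t) = b t \<bullet> (G *\<^sub>v (G *\<^sub>v b t))"
      using assoc_mult_mat_vec[OF G(1) G(1) b[of t]] G(3) by simp
    also have "\<dots> = (G *\<^sub>v b t) \<bullet> (G *\<^sub>v b t)"
      using transpose_vec_mult_scalar[OF G(1) g b[of t]] G(4) by simp
    finally show ?thesis using scalar_self_sum[OF g] by simp
  qed
  moreover have "(\<Sum>c<m. ((G *\<^sub>v b ((t * m + c) div m)) $ ((t * m + c) mod m))\<^sup>2) = (\<Sum>c<m. ((G *\<^sub>v b t) $ c)\<^sup>2)" for t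
    by (intro sum.cong refl) (auto simp del: index_mult_mat_vec)
  ultimately show ?thesis unfolding sum_blocks by (simp only:)
qed

lemma white_wn: "white_noise M wn"
proof
  fix D
  show "isonormal M {..<D} wn"
    unfolding isonormal_def
  proof (intro conjI ballI allI)
    fix i
    let ?b = "\<lambda>t. if t = i div m then row Gi (i mod m) else 0\<^sub>v m"
    have b: "?b t \<in> carrier_vec m" for t using Gi(1) m by auto
    have "(\<Sum>t<Suc (i div m). ?b t \<bullet> e \<omega> t) = wn i \<omega>" if w: "\<omega> \<in> space M" for \<omega>
    proof -
      have "(\<Sum>t<Suc (i div m). ?b t \<bullet> e \<omega> t) = (\<Sum>t<Suc (i div m). if t = i div m then row Gi (i mod m) \<bullet> e \<omega> t else 0)"
        using e_carrier[OF w] by (intro sum.cong) auto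
      also have "\<dots> = wn i \<omega>" using Gi(1) m by (simp add: wn_def)
      finally show ?thesis .
    qed
    then show "wn i \<in> borel_measurable M"
      using innovation_measurable[where b = ?b and T = "Suc (i div m)", OF b] by (subst (asm) measurable_cong) auto
  next
    fix c :: "nat \<Rightarrow> real"
    \<comment> \<open>The coefficients are cut into blocks of length m and padded with zeros; D
      blocks suffice because D \<le> D * m. Applying \<open>Gi\<close> yields the coefficients
      against the innovations, and \<open>G\<close> undoes it in the variance.\<close>
    define u where "u t = vec m (\<lambda>k. if t * m + k < D then c (t * m + k) else 0)" for t
    define b where "b t = Gi *\<^sub>v u t" for t
    have uc: "u t \<in> carrier_vec m" for t by (simp add: u_def)
    have b: "b t \<in> carrier_vec m" for t using Gi uc by (simp add: b_def)
    have Gb: "G *\<^sub>v b t = u t" for t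
      using assoc_mult_mat_vec[OF G(1) Gi(1) uc[of t]] Gi(2) uc[of t] by (simp add: b_def)
    have D: "D \<le> D * m" using m by simp
    have idx: "u (i div m) $ (i mod m) = (if i < D then c i else 0)" for i
      using m by (simp add: u_def)
    have s: "(\<Sum>t<D. b t \<bullet> e \<omega> t) = (\<Sum>i<D. c i * wn i \<omega>)" if "\<omega> \<in> space M" for \<omega>
    proof -
      have "(\<Sum>t<D. b t \<bullet> e \<omega> t) = (\<Sum>i<D * m. (if i < D then c i else 0) * wn i \<omega>)"
        unfolding innovation_whitened[OF that b] Gb idx ..
      also have "\<dots> = (\<Sum>i<D. c i * wn i \<omega>)" using D by (intro sum.mono_neutral_cong_right) auto
      finally show ?thesis .
    qed
    have q: "(\<Sum>t<D. b t \<bullet> (Rbar *\<^sub>v b t)) = (\<Sum>i<D. (c i)\<^sup>2)"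
    proof -
      have "(\<Sum>t<D. b t \<bullet> (Rbar *\<^sub>v b t)) = (\<Sum>i<D * m. (if i < D then c i else 0)\<^sup>2)"
        unfolding innovation_whitened_norm[OF b, symmetric] Gb idx ..
      also have "\<dots> = (\<Sum>i<D. (c i)\<^sup>2)" using D by (intro sum.mono_neutral_cong_right) auto
      finally show ?thesis .
    qed
    have "(CLINT \<omega>|M. iexp (\<Sum>i<D. c i * wn i \<omega>)) = (CLINT \<omega>|M. iexp (\<Sum>t<D. b t \<bullet> e \<omega> t))"
      by (intro Bochner_Integration.integral_cong refl) (simp only: s)
    also have "\<dots> = complex_of_real (exp (- (\<Sum>i<D. (c i)\<^sup>2) / 2))"
      unfolding innovation_chf[OF b] q ..
    finally show "(CLINT \<omega>|M. iexp (\<Sum>i<D. c i * wn i \<omega>)) = complex_of_real (exp (- (\<Sum>i<D. (c i)\<^sup>2) / 2))" .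
  qed
qed

sublocale wn: white_noise M wn by (rule white_wn)

lemma innovation_second_moment:
  assumes b: "\<And>t. b t \<in> carrier_vec m"
  shows "(\<integral>\<^sup>+\<omega>. ennreal ((\<Sum>t<T. b t \<bullet> e \<omega> t)\<^sup>2) \<partial>M) = ennreal (\<Sum>t<T. b t \<bullet> (Rbar *\<^sub>v b t))"
proof -
  have "(\<integral>\<^sup>+\<omega>. ennreal ((\<Sum>t<T. b t \<bullet> e \<omega> t)\<^sup>2) \<partial>M) =
     (\<integral>\<^sup>+\<omega>. ennreal ((\<Sum>i<T * m. (G *\<^sub>v b (i div m)) $ (i mod m) * wn i \<omega>)\<^sup>2) \<partial>M)"
    by (intro nn_integral_cong) (simp only: innovation_whitened[OF _ b])
  also have "\<dots> = ennreal (\<Sum>i<T * m. ((G *\<^sub>v b (i div m)) $ (i mod m))\<^sup>2)" by (rule wn.linear_second_moment)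
  finally show ?thesis unfolding innovation_whitened_norm[where b = b, OF b] .
qed

text \<open>The i-th power of A^T applied to f. After K^T it gives the weight of an innovation i + 1
  steps back in f \<bullet> xh.\<close>

definition bw :: "nat \<Rightarrow> real vec \<Rightarrow> real vec" where
  "bw i f = ((\<lambda>g. transpose_mat A *\<^sub>v g) ^^ i) f"

lemma bw_carrier: "f \<in> carrier_vec n \<Longrightarrow> bw i f \<in> carrier_vec n"
  by (induction i) (use A in \<open>auto simp: bw_def\<close>)

lemma KT_carrier: "f \<in> carrier_vec n \<Longrightarrow> transpose_mat K *\<^sub>v f \<in> carrier_vec m"
  using K by simp

lemma state_innovation:
  assumes w: "\<omega> \<in> space M" and f: "f \<in> carrier_vec n"
  shows "f \<bullet> xh \<omega> t = (\<Sum>j<t. (transpose_mat K *\<^sub>v bw (t - Suc j) f) \<bullet> e \<omega> j)"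
  using f
proof (induction t arbitrary: f)
  case 0
  then show ?case using w by (simp add: kf)
next
  case (Suc t)
  have Af: "transpose_mat A *\<^sub>v f \<in> carrier_vec n" using A Suc.prems by simp
  note xc = xh_carrier[OF w, of t] and ec = e_carrier[OF w, of t]
  have "f \<bullet> xh \<omega> (Suc t) = f \<bullet> (A *\<^sub>v xh \<omega> t) + f \<bullet> (K *\<^sub>v e \<omega> t)"
    unfolding kf(2)[OF w] using Suc.prems A K xc ec by (intro scalar_prod_add_distrib[of _ n]) auto
  also have "f \<bullet> (A *\<^sub>v xh \<omega> t) = (transpose_mat A *\<^sub>v f) \<bullet> xh \<omega> t"
    by (rule transpose_vec_mult_scalar[OF A xc Suc.prems, symmetric])
  also have "\<dots> = (\<Sum>j<t. (transpose_mat K *\<^sub>v bw (Suc t - Suc j) f) \<bullet> e \<omega> j)"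
    unfolding Suc.IH[OF Af]
  proof (intro sum.cong refl)
    fix j assume "j \<in> {..<t}"
    then have "Suc t - Suc j = Suc (t - Suc j)" by auto
    then have "bw (t - Suc j) (transpose_mat A *\<^sub>v f) = bw (Suc t - Suc j) f" by (simp add: bw_def funpow_swap1)
    then show "(transpose_mat K *\<^sub>v bw (t - Suc j) (transpose_mat A *\<^sub>v f)) \<bullet> e \<omega> j = (transpose_mat K *\<^sub>v bw (Suc t - Suc j) f) \<bullet> e \<omega> j" by simp
  qed
  also have "f \<bullet> (K *\<^sub>v e \<omega> t) = (transpose_mat K *\<^sub>v bw (Suc t - Suc t) f) \<bullet> e \<omega> t"
    using transpose_vec_mult_scalar[OF K ec Suc.prems] by (simp add: bw_def)
  finally show ?case by simp
qed

text \<open>The variance of f \<bullet> xh at time t. Summing by lag instead of by time makes it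
  visibly nondecreasing in t: a later time only adds lags.\<close>

definition vx :: "nat \<Rightarrow> real vec \<Rightarrow> real" where
  "vx t f = (\<Sum>i<t. (transpose_mat K *\<^sub>v bw i f) \<bullet> (Rbar *\<^sub>v (transpose_mat K *\<^sub>v bw i f)))"

lemma vx_nonneg_mono:
  assumes f: "f \<in> carrier_vec n"
  shows "0 \<le> vx t f" "s \<le> t \<Longrightarrow> vx s f \<le> vx t f"
proof -
  have "0 \<le> (transpose_mat K *\<^sub>v bw i f) \<bullet> (Rbar *\<^sub>v (transpose_mat K *\<^sub>v bw i f))" for i
    by (rule psd_matD(2)[OF pd_imp_psd[OF Rbar(2)] Rbar(1) KT_carrier[OF bw_carrier[OF f]]])
  then show "0 \<le> vx t f" "s \<le> t \<Longrightarrow> vx s f \<le> vx t f"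
    unfolding vx_def by (auto intro!: sum_nonneg sum_mono2)
qed

lemma vx_reverse: "(\<Sum>j<t. (transpose_mat K *\<^sub>v bw (t - Suc j) f) \<bullet> (Rbar *\<^sub>v (transpose_mat K *\<^sub>v bw (t - Suc j) f))) = vx t f"
  unfolding vx_def by (rule sum.nat_diff_reindex)

lemma state_second_moment:
  assumes f: "f \<in> carrier_vec n"
  shows "(\<integral>\<^sup>+\<omega>. ennreal ((f \<bullet> xh \<omega> t)\<^sup>2) \<partial>M) = ennreal (vx t f)"
proof -
  have "(\<integral>\<^sup>+\<omega>. ennreal ((f \<bullet> xh \<omega> t)\<^sup>2) \<partial>M) = (\<integral>\<^sup>+\<omega>. ennreal ((\<Sum>j<t. (transpose_mat K *\<^sub>v bw (t - Suc j) f) \<bullet> e \<omega> j)\<^sup>2) \<partial>M)"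
    by (intro nn_integral_cong) (simp only: state_innovation[OF _ f])
  also have "\<dots> = ennreal (vx t f)"
    unfolding vx_reverse[symmetric] by (rule innovation_second_moment) (rule KT_carrier[OF bw_carrier[OF f]])
  finally show ?thesis .
qed

lemma state_past:
  assumes w: "\<omega> \<in> space M" and g: "g \<in> carrier_vec n"
  shows "g \<bullet> xh \<omega> (s + i) = g \<bullet> (A ^\<^sub>m i *\<^sub>v xh \<omega> s) + (\<Sum>j<i. g \<bullet> (A ^\<^sub>m (i - j - 1) * K *\<^sub>v e \<omega> (s + j)))"
  using g
proof (induction i arbitrary: g)
  case 0
  then show ?case using A xh_carrier[OF w, of s] by simp
next
  case (Suc i)
  have Ag: "transpose_mat A *\<^sub>v g \<in> carrier_vec n" using A Suc.prems by simp
  have pw: "A ^\<^sub>m k \<in> carrier_mat n n" for k using A by simp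
  note xc = xh_carrier[OF w] and ec = e_carrier[OF w]
  have shift: "(transpose_mat A *\<^sub>v g) \<bullet> (A ^\<^sub>m k *\<^sub>v z) = g \<bullet> (A ^\<^sub>m Suc k *\<^sub>v z)" if z: "z \<in> carrier_vec n" for k z
  proof -
    have "A ^\<^sub>m Suc k *\<^sub>v z = A *\<^sub>v (A ^\<^sub>m k *\<^sub>v z)"
      unfolding pow_mat_Suc_left[OF A] by (rule assoc_mult_mat_vec[OF A pw z])
    then show ?thesis using transpose_vec_mult_scalar[OF A mult_mat_vec_carrier[OF pw z] Suc.prems] by simp
  qed
  have "g \<bullet> xh \<omega> (s + Suc i) = g \<bullet> (A *\<^sub>v xh \<omega> (s + i)) + g \<bullet> (K *\<^sub>v e \<omega> (s + i))"
    using Suc.prems A K xc ec by (simp add: kf(2)[OF w]) (intro scalar_prod_add_distrib[of _ n], auto)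
  also have "g \<bullet> (A *\<^sub>v xh \<omega> (s + i)) = (transpose_mat A *\<^sub>v g) \<bullet> xh \<omega> (s + i)"
    by (rule transpose_vec_mult_scalar[OF A xc Suc.prems, symmetric])
  also have "\<dots> = g \<bullet> (A ^\<^sub>m Suc i *\<^sub>v xh \<omega> s) + (\<Sum>j<i. g \<bullet> (A ^\<^sub>m (Suc i - j - 1) * K *\<^sub>v e \<omega> (s + j)))"
  proof -
    have "(transpose_mat A *\<^sub>v g) \<bullet> (A ^\<^sub>m (i - j - 1) * K *\<^sub>v e \<omega> (s + j)) = g \<bullet> (A ^\<^sub>m (Suc i - j - 1) * K *\<^sub>v e \<omega> (s + j))" if "j < i" for j
    proof -
      have Ke: "K *\<^sub>v e \<omega> (s + j) \<in> carrier_vec n" using K ec by simp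
      have "Suc i - j - 1 = Suc (i - j - 1)" using that by simp
      then show ?thesis
        unfolding assoc_mult_mat_vec[OF pw K ec] by (simp only: shift[OF Ke])
    qed
    note sh = this
    show ?thesis unfolding Suc.IH[OF Ag] shift[OF xc]
      by (intro arg_cong2[where f = "(+)"] refl sum.cong) (rule sh, simp only: lessThan_iff)
  qed
  finally show ?case using assoc_mult_mat_vec[OF pw K ec, of 0] K ec[of "s + i"] A by simp
qed

lemma Op_carrier: "obs_mat p A C \<in> carrier_mat (m * p) n"
  using A C by (simp add: obs_mat_def Let_def)

lemma Tp_carrier: "toep_mat p A C K \<in> carrier_mat (m * p) (m * p)"
  using C by (simp add: toep_mat_def Let_def)

lemma stack_carrier: "stack_past m p f t \<in> carrier_vec (m * p)"
  by (simp add: stack_past_def)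

text \<open>Row i * m + c is coordinate c of the output at time t - p + i. The state estimate is run
  forward from t - p, which yields the powers of A in both matrices, and the innovation of that very
  time yields the identity on the diagonal.\<close>

lemma stack_decomposition:
  assumes w: "\<omega> \<in> space M"
  shows "stack_past m p (y \<omega>) t = obs_mat p A C *\<^sub>v xh \<omega> (t - p) + toep_mat p A C K *\<^sub>v stack_past m p (e \<omega>) t"
proof (rule eq_vecI)
  let ?s = "t - p"
  fix r assume "r < dim_vec (obs_mat p A C *\<^sub>v xh \<omega> ?s + toep_mat p A C K *\<^sub>v stack_past m p (e \<omega>) t)"
  then have r: "r < m * p" using Tp_carrier[of p] by simp
  define i where "i = r div m"
  define c where "c = r mod m"
  have i: "i < p" using r by (simp add: i_def less_mult_imp_div_less mult.commute)
  have c: "c < m" using m by (simp add: c_def)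
  have pw: "A ^\<^sub>m k \<in> carrier_mat n n" for k using A by simp
  note xc = xh_carrier[OF w] and ec = e_carrier[OF w]
  have rC: "row C c \<in> carrier_vec n" using C c by auto
  have rowC: "(C * B) $$ (c, q) = row C c \<bullet> col B q" if "B \<in> carrier_mat n k" "q < k" for B k q
    using that C c by auto
  have O: "(obs_mat p A C *\<^sub>v xh \<omega> ?s) $ r = row C c \<bullet> (A ^\<^sub>m i *\<^sub>v xh \<omega> ?s)"
  proof -
    have "(obs_mat p A C *\<^sub>v xh \<omega> ?s) $ r = (\<Sum>q<n. (C * A ^\<^sub>m i) $$ (c, q) * xh \<omega> ?s $ q)"
      using r xc[of ?s] A C by (simp add: obs_mat_def Let_def scalar_prod_def lessThan_atLeast0 i_def c_def)
    also have "\<dots> = (C * A ^\<^sub>m i *\<^sub>v xh \<omega> ?s) $ c"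
      using xc[of ?s] C A c by (simp add: scalar_prod_def lessThan_atLeast0)
    also have "C * A ^\<^sub>m i *\<^sub>v xh \<omega> ?s = C *\<^sub>v (A ^\<^sub>m i *\<^sub>v xh \<omega> ?s)" by (rule assoc_mult_mat_vec[OF C pw xc])
    finally show ?thesis using C c by simp
  qed
  have T: "(toep_mat p A C K *\<^sub>v stack_past m p (e \<omega>) t) $ r =
     (\<Sum>j<i. row C c \<bullet> (A ^\<^sub>m (i - j - 1) * K *\<^sub>v e \<omega> (?s + j))) + e \<omega> (?s + i) $ c"
  proof -
    have rj: "j * m + k < m * p" if "j < p" "k < m" for j k
        by (rule block_index[OF that])
    define F where "F j k = (if i = j then (if c = k then 1 else 0) else if j < i then (C * A ^\<^sub>m (i - j - 1) * K) $$ (c, k) else 0)" for j k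
    have "(toep_mat p A C K *\<^sub>v stack_past m p (e \<omega>) t) $ r = (\<Sum>q<p * m. toep_mat p A C K $$ (r, q) * stack_past m p (e \<omega>) t $ q)"
      using r Tp_carrier[of p] stack_carrier[of p "e \<omega>" t] by (simp add: scalar_prod_def lessThan_atLeast0 mult.commute[of p m])
    also have "\<dots> = (\<Sum>j<p. \<Sum>k<m. F j k * e \<omega> (?s + j) $ k)"
      unfolding sum_blocks using r rj C
      by (intro sum.cong refl) (auto simp: toep_mat_def Let_def stack_past_def F_def i_def[symmetric] c_def[symmetric])
    also have "\<dots> = (\<Sum>j<p. if j < i then row C c \<bullet> (A ^\<^sub>m (i - j - 1) * K *\<^sub>v e \<omega> (?s + j)) else if j = i then e \<omega> (?s + i) $ c else 0)"
    proof (intro sum.cong refl)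
      fix j assume "j \<in> {..<p}"
      consider "j < i" | "j = i" | "j > i" by linarith
      then show "(\<Sum>k<m. F j k * e \<omega> (?s + j) $ k) = (if j < i then row C c \<bullet> (A ^\<^sub>m (i - j - 1) * K *\<^sub>v e \<omega> (?s + j)) else if j = i then e \<omega> (?s + i) $ c else 0)"
      proof cases
        case 1
        have CA: "C * A ^\<^sub>m (i - j - 1) \<in> carrier_mat m n" and AK: "A ^\<^sub>m (i - j - 1) * K \<in> carrier_mat n m"
          using C K pw by (auto intro!: mult_carrier_mat)
        then have CAK: "C * A ^\<^sub>m (i - j - 1) * K \<in> carrier_mat m m" using K by (auto intro!: mult_carrier_mat)
        have "(\<Sum>k<m. F j k * e \<omega> (?s + j) $ k) = (C * A ^\<^sub>m (i - j - 1) * K *\<^sub>v e \<omega> (?s + j)) $ c"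
          using 1 CAK c ec[of "?s + j"] by (simp add: F_def scalar_prod_def lessThan_atLeast0 carrier_matD[OF CAK] del: index_mult_mat)
        also have "C * A ^\<^sub>m (i - j - 1) * K *\<^sub>v e \<omega> (?s + j) = C *\<^sub>v (A ^\<^sub>m (i - j - 1) * K *\<^sub>v e \<omega> (?s + j))"
          unfolding assoc_mult_mat[OF C pw K] by (rule assoc_mult_mat_vec[OF C AK ec])
        finally show ?thesis using 1 C c by simp
      next
        case 2
        have "(\<Sum>k<m. F j k * e \<omega> (?s + j) $ k) = (\<Sum>k<m. if c = k then e \<omega> (?s + j) $ k else 0)"
          using 2 by (intro sum.cong) (auto simp: F_def)
        then show ?thesis using 2 c by simp
      next
        case 3
        then show ?thesis by (simp add: F_def)
      qed
    qed
    also have "\<dots> = (\<Sum>j<Suc i. if j < i then row C c \<bullet> (A ^\<^sub>m (i - j - 1) * K *\<^sub>v e \<omega> (?s + j)) else if j = i then e \<omega> (?s + i) $ c else 0)"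
      using i by (intro sum.mono_neutral_right) auto
    finally show ?thesis by simp
  qed
  have "stack_past m p (y \<omega>) t $ r = y \<omega> (?s + i) $ c" using r by (simp add: stack_past_def i_def c_def)
  also have "\<dots> = row C c \<bullet> xh \<omega> (?s + i) + e \<omega> (?s + i) $ c"
    using y_eq[OF w, of "?s + i"] C c ec[of "?s + i"] by simp
  also have "\<dots> = (obs_mat p A C *\<^sub>v xh \<omega> ?s) $ r + (toep_mat p A C K *\<^sub>v stack_past m p (e \<omega>) t) $ r"
    unfolding O T state_past[OF w rC] by simp
  finally show "stack_past m p (y \<omega>) t $ r = (obs_mat p A C *\<^sub>v xh \<omega> ?s + toep_mat p A C K *\<^sub>v stack_past m p (e \<omega>) t) $ r"
    using r Tp_carrier[of p] Op_carrier[of p] by simp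
qed (use Tp_carrier[of p] in \<open>simp add: stack_past_def\<close>)

end

section \<open>Bounds over the data window\<close>

lemma sum_lessThan_add: "(\<Sum>j<s + p. g j) = (\<Sum>j<s. g j) + (\<Sum>i<p. g (s + i))" for g :: "nat \<Rightarrow> real"
  by (induction p) auto

lemma (in prob_space) markov_event_expectation:
  assumes Y[measurable]: "Y \<in> borel_measurable M" and Y0: "\<And>\<omega>. Y \<omega> \<ge> 0"
    and E: "(\<integral>\<^sup>+\<omega>. ennreal (Y \<omega>) \<partial>M) \<le> ennreal c" and c: "c \<ge> 0" and \<delta>: "\<delta> > 0"
  shows "\<exists>F\<in>events. prob F \<ge> 1 - \<delta> \<and> (\<forall>\<omega>\<in>F. \<omega> \<in> space M \<and> Y \<omega> \<le> c / \<delta>)"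
proof (intro bexI conjI ballI)
  let ?F = "{\<omega>\<in>space M. Y \<omega> \<le> c / \<delta>}"
  show F: "?F \<in> events" by measurable
  show "prob ?F \<ge> 1 - \<delta>"
  \<comment> \<open>Markov's inequality scales by \<delta> / c; for c = 0 the variable vanishes
    almost surely instead.\<close>
  proof (cases "c = 0")
    case True
    then have "(\<integral>\<^sup>+\<omega>. ennreal (Y \<omega>) \<partial>M) = 0" using E by simp
    then have "AE \<omega> in M. ennreal (Y \<omega>) = 0" by (subst (asm) nn_integral_0_iff_AE) auto
    then have "AE \<omega> in M. \<omega> \<in> ?F" using Y0 True by (auto simp: ennreal_eq_0_iff)
    then have "prob ?F = 1" using F by (simp add: prob_eq_1)
    then show ?thesis using \<delta> by simp
  next
    case False
    then have c: "c > 0" using c by simp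
    have "emeasure M {\<omega>\<in>space M. 1 \<le> ennreal (\<delta> / c) * ennreal (Y \<omega>)} \<le> ennreal (\<delta> / c) * (\<integral>\<^sup>+\<omega>. ennreal (Y \<omega>) * indicator (space M) \<omega> \<partial>M)"
      by (rule nn_integral_Markov_inequality) auto
    also have "(\<integral>\<^sup>+\<omega>. ennreal (Y \<omega>) * indicator (space M) \<omega> \<partial>M) = (\<integral>\<^sup>+\<omega>. ennreal (Y \<omega>) \<partial>M)"
      by (intro nn_integral_cong) auto
    also have "ennreal (\<delta> / c) * \<dots> \<le> ennreal (\<delta> / c) * ennreal c" using E by (intro mult_left_mono) auto
    also have "\<dots> = ennreal \<delta>" using c \<delta> by (simp flip: ennreal_mult)
    finally have e: "emeasure M {\<omega>\<in>space M. 1 \<le> ennreal (\<delta> / c) * ennreal (Y \<omega>)} \<le> ennreal \<delta>" .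
    have "space M - ?F \<subseteq> {\<omega>\<in>space M. 1 \<le> ennreal (\<delta> / c) * ennreal (Y \<omega>)}"
    proof
      fix \<omega> assume w: "\<omega> \<in> space M - ?F"
      then have "c / \<delta> < Y \<omega>" by auto
      then have "1 \<le> \<delta> / c * Y \<omega>" using c \<delta> by (simp add: field_simps)
      then have "ennreal 1 \<le> ennreal (\<delta> / c * Y \<omega>)" by (rule ennreal_leI)
      moreover have "ennreal (\<delta> / c * Y \<omega>) = ennreal (\<delta> / c) * ennreal (Y \<omega>)"
        using c \<delta> Y0[of \<omega>] by (intro ennreal_mult) auto
      ultimately have "1 \<le> ennreal (\<delta> / c) * ennreal (Y \<omega>)" by (simp only: ennreal_1)
      then show "\<omega> \<in> {\<omega>\<in>space M. 1 \<le> ennreal (\<delta> / c) * ennreal (Y \<omega>)}"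
        using w by simp
    qed
    then have "emeasure M (space M - ?F) \<le> ennreal \<delta>"
      using e by (intro order_trans[OF emeasure_mono e]) auto
    then have "prob (space M - ?F) \<le> \<delta>" using \<delta> by (simp add: emeasure_eq_measure)
    then show ?thesis using F by (simp add: prob_compl)
  qed
qed auto

lemma gram_factor_quad:
  fixes T D :: "real mat"
  assumes T: "T \<in> carrier_mat r d" and D: "D \<in> carrier_mat d c" and x: "x \<in> carrier_vec r"
  shows "x \<bullet> (T * D * transpose_mat D * transpose_mat T *\<^sub>v x) = (\<Sum>j<c. (col D j \<bullet> (transpose_mat T *\<^sub>v x))\<^sup>2)"
    "T * D * transpose_mat D * transpose_mat T \<in> carrier_mat r r"
    "transpose_mat (T * D * transpose_mat D * transpose_mat T) = T * D * transpose_mat D * transpose_mat T"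
proof -
  have TD: "T * D \<in> carrier_mat r c" and Dt: "transpose_mat D \<in> carrier_mat c d" and Tt: "transpose_mat T \<in> carrier_mat d r"
    using T D by (auto intro!: mult_carrier_mat)
  have M: "T * D * transpose_mat D * transpose_mat T = (T * D) * transpose_mat (T * D)"
    unfolding transpose_mult[OF T D] by (rule assoc_mult_mat[OF TD Dt Tt])
  have TDt: "transpose_mat (T * D) \<in> carrier_mat c r" using TD by simp
  show "T * D * transpose_mat D * transpose_mat T \<in> carrier_mat r r" unfolding M by (rule mult_carrier_mat[OF TD TDt])
  show "transpose_mat (T * D * transpose_mat D * transpose_mat T) = T * D * transpose_mat D * transpose_mat T"
    unfolding M transpose_mult[OF TD TDt] by simp
  let ?z = "transpose_mat T *\<^sub>v x"
  have z: "?z \<in> carrier_vec d" using Tt x by simp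
  have Dz: "transpose_mat D *\<^sub>v ?z \<in> carrier_vec c" using Dt z by simp
  have "transpose_mat (T * D) *\<^sub>v x = transpose_mat D *\<^sub>v ?z"
    unfolding transpose_mult[OF T D] by (rule assoc_mult_mat_vec[OF Dt Tt x])
  moreover have "(T * D) * transpose_mat (T * D) *\<^sub>v x = (T * D) *\<^sub>v (transpose_mat (T * D) *\<^sub>v x)"
    by (rule assoc_mult_mat_vec[OF TD TDt x])
  ultimately have "x \<bullet> (T * D * transpose_mat D * transpose_mat T *\<^sub>v x) = (transpose_mat D *\<^sub>v ?z) \<bullet> (transpose_mat D *\<^sub>v ?z)"
    unfolding M using transpose_vec_mult_scalar[OF TD Dz x] by simp
  also have "\<dots> = (\<Sum>j<c. (col D j \<bullet> ?z)\<^sup>2)"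
    unfolding scalar_self_sum[OF Dz] using D z by (intro sum.cong) auto
  finally show "x \<bullet> (T * D * transpose_mat D * transpose_mat T *\<^sub>v x) = (\<Sum>j<c. (col D j \<bullet> (transpose_mat T *\<^sub>v x))\<^sup>2)" .
qed

lemma gram_quad:
  fixes D :: "real mat"
  assumes D: "D \<in> carrier_mat d c" and x: "x \<in> carrier_vec d"
  shows "x \<bullet> (D * transpose_mat D *\<^sub>v x) = (\<Sum>j<c. (col D j \<bullet> x)\<^sup>2)"
    "D * transpose_mat D \<in> carrier_mat d d" "transpose_mat (D * transpose_mat D) = D * transpose_mat D"
  using gram_factor_quad[OF one_carrier_mat D x] D x
  by (simp_all add: right_mult_one_mat[of _ d d] mult_carrier_mat[of _ d c _ d])

lemma smult_mat_quad:
  assumes M: "M \<in> carrier_mat d d" and x: "x \<in> carrier_vec d"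
  shows "x \<bullet> ((a \<cdot>\<^sub>m M) *\<^sub>v x) = a * (x \<bullet> (M *\<^sub>v x :: real vec))"
proof -
  have "(a \<cdot>\<^sub>m M) *\<^sub>v x = a \<cdot>\<^sub>v (M *\<^sub>v x)"
    using M x by (intro eq_vecI) (auto simp: scalar_prod_def sum_distrib_left mult.assoc)
  then show ?thesis using M x by (simp add: scalar_prod_smult_right)
qed

lemma transpose_smult: "transpose_mat (a \<cdot>\<^sub>m M) = a \<cdot>\<^sub>m transpose_mat M"
  by (intro eq_matI) auto

locale kalman_window = kalman +
  fixes p k :: nat
  assumes p: "p \<ge> 2" and k: "k \<ge> p" and n: "n > 0"
begin

section \<open>Variances of the data windows\<close>

definition N :: nat where "N = k - p + 1"

abbreviation Op :: "real mat" where "Op \<equiv> obs_mat p A C"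
abbreviation Tp :: "real mat" where "Tp \<equiv> toep_mat p A C K"
abbreviation Zs :: "nat \<Rightarrow> 'a \<Rightarrow> real vec" where "Zs s \<omega> \<equiv> stack_past m p (y \<omega>) (p + s)"
abbreviation Es :: "nat \<Rightarrow> 'a \<Rightarrow> real vec" where "Es s \<omega> \<equiv> stack_past m p (e \<omega>) (p + s)"

text \<open>The variance of the functional z of a window of p innovations; it is the same for every
  window.\<close>

definition vB :: "real vec \<Rightarrow> real" where
  "vB z = (\<Sum>i<p. blk m i z \<bullet> (Rbar *\<^sub>v blk m i z))"

text \<open>The coefficient of innovation j in b \<bullet> Z, for the window that starts at time s:
  before s it acts through the state estimate, from s on through the Toeplitz matrix. The two ranges
  are disjoint, so the variances add.\<close>

definition \<beta> :: "nat \<Rightarrow> real vec \<Rightarrow> nat \<Rightarrow> real vec" where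
  "\<beta> s b j = (if j < s then transpose_mat K *\<^sub>v bw (s - Suc j) (transpose_mat Op *\<^sub>v b) else blk m (j - s) (transpose_mat Tp *\<^sub>v b))"

lemma Opt: "b \<in> carrier_vec (m * p) \<Longrightarrow> transpose_mat Op *\<^sub>v b \<in> carrier_vec n"
  and Tpt: "b \<in> carrier_vec (m * p) \<Longrightarrow> transpose_mat Tp *\<^sub>v b \<in> carrier_vec (m * p)"
  using Op_carrier[of p] Tp_carrier[of p] by auto

lemma \<beta>_carrier: "b \<in> carrier_vec (m * p) \<Longrightarrow> \<beta> s b j \<in> carrier_vec m"
  unfolding \<beta>_def by (auto intro!: KT_carrier bw_carrier Opt)

lemma Es_prod:
  assumes w: "\<omega> \<in> space M" and z: "z \<in> carrier_vec (m * p)"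
  shows "z \<bullet> Es s \<omega> = (\<Sum>i<p. blk m i z \<bullet> e \<omega> (s + i))"
proof -
  have "blk m i (Es s \<omega>) = e \<omega> (s + i)" if "i < p" for i
    using blk_stack_past[OF that, of "e \<omega>" "p + s" m] e_carrier[OF w] by simp
  then show ?thesis unfolding scalar_prod_blocks[OF z stack_carrier] by simp
qed

lemma Zs_decomp:
  assumes w: "\<omega> \<in> space M" and b: "b \<in> carrier_vec (m * p)"
  shows "b \<bullet> Zs s \<omega> = (transpose_mat Op *\<^sub>v b) \<bullet> xh \<omega> s + (transpose_mat Tp *\<^sub>v b) \<bullet> Es s \<omega>"
proof -
  note xc = xh_carrier[OF w, of s] and ec = stack_carrier[of p "e \<omega>" "p + s"]
  have "b \<bullet> Zs s \<omega> = b \<bullet> (Op *\<^sub>v xh \<omega> s) + b \<bullet> (Tp *\<^sub>v Es s \<omega>)"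
    unfolding stack_decomposition[OF w] diff_add_inverse
    by (rule scalar_prod_add_distrib[OF b mult_mat_vec_carrier[OF Op_carrier xc] mult_mat_vec_carrier[OF Tp_carrier ec]])
  then show ?thesis
    by (simp only: transpose_vec_mult_scalar[OF Op_carrier xc b] transpose_vec_mult_scalar[OF Tp_carrier ec b])
qed

lemma Zs_innovation:
  assumes w: "\<omega> \<in> space M" and b: "b \<in> carrier_vec (m * p)"
  shows "b \<bullet> Zs s \<omega> = (\<Sum>j<s + p. \<beta> s b j \<bullet> e \<omega> j)"
  unfolding Zs_decomp[OF w b] state_innovation[OF w Opt[OF b]] Es_prod[OF w Tpt[OF b]] sum_lessThan_add
  by (simp add: \<beta>_def)

text \<open>The variance of b \<bullet> Z for the window starting at s. Only the state part depends
  on s, so it is nondecreasing in s and the last window dominates.\<close>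

definition zvar :: "nat \<Rightarrow> real vec \<Rightarrow> real" where
  "zvar s b = vx s (transpose_mat Op *\<^sub>v b) + vB (transpose_mat Tp *\<^sub>v b)"

lemma \<beta>_variance: "(\<Sum>j<s + p. \<beta> s b j \<bullet> (Rbar *\<^sub>v \<beta> s b j)) = zvar s b"
  unfolding sum_lessThan_add zvar_def vx_reverse[symmetric] vB_def by (simp add: \<beta>_def)

lemma Zs_measurable: "b \<in> carrier_vec (m * p) \<Longrightarrow> (\<lambda>\<omega>. b \<bullet> Zs s \<omega>) \<in> borel_measurable M"
  using innovation_measurable[where b = "\<beta> s b" and T = "s + p", OF \<beta>_carrier]
  by (subst measurable_cong[OF Zs_innovation]) auto

lemma xh_measurable: "f \<in> carrier_vec n \<Longrightarrow> (\<lambda>\<omega>. f \<bullet> xh \<omega> s) \<in> borel_measurable M"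
  using innovation_measurable[where b = "\<lambda>j. transpose_mat K *\<^sub>v bw (s - Suc j) f" and T = s, OF KT_carrier[OF bw_carrier]]
  by (subst measurable_cong[OF state_innovation]) auto

lemma Zs_second_moment:
  assumes b: "b \<in> carrier_vec (m * p)"
  shows "(\<integral>\<^sup>+\<omega>. ennreal ((b \<bullet> Zs s \<omega>)\<^sup>2) \<partial>M) = ennreal (zvar s b)"
proof -
  have "(\<integral>\<^sup>+\<omega>. ennreal ((b \<bullet> Zs s \<omega>)\<^sup>2) \<partial>M) = (\<integral>\<^sup>+\<omega>. ennreal ((\<Sum>j<s + p. \<beta> s b j \<bullet> e \<omega> j)\<^sup>2) \<partial>M)"
    by (intro nn_integral_cong) (simp only: Zs_innovation[OF _ b])
  also have "\<dots> = ennreal (\<Sum>j<s + p. \<beta> s b j \<bullet> (Rbar *\<^sub>v \<beta> s b j))"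
    by (rule innovation_second_moment) (rule \<beta>_carrier[OF b])
  finally show ?thesis unfolding \<beta>_variance .
qed

lemma vB_ge_0: "0 \<le> vB z"
  unfolding vB_def by (intro sum_nonneg psd_matD(2)[OF pd_imp_psd[OF Rbar(2)] Rbar(1)]) simp

lemma zvar_mono: "b \<in> carrier_vec (m * p) \<Longrightarrow> s \<le> t \<Longrightarrow> zvar s b \<le> zvar t b"
  unfolding zvar_def using vx_nonneg_mono(2)[OF Opt] by simp

lemma zvar_ge_0: "b \<in> carrier_vec (m * p) \<Longrightarrow> 0 \<le> zvar s b"
  unfolding zvar_def using vx_nonneg_mono(1)[OF Opt] vB_ge_0 by simp

text \<open>The first window starts from the state estimate zero, so b \<bullet> Z is at once a
  combination of outputs with blocks of b and of innovations with blocks of Tp^T b. Comparing the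
  variances, the measurement noise alone supplies R on each block.\<close>

lemma vB_Tp_ge:
  assumes b: "b \<in> carrier_vec (m * p)"
  shows "sigma_min R * (b \<bullet> b) \<le> vB (transpose_mat Tp *\<^sub>v b)"
proof -
  have "sigma_min R * (b \<bullet> b) = (\<Sum>i<p. sigma_min R * (blk m i b \<bullet> blk m i b))"
    unfolding scalar_prod_blocks[OF b b] by (rule sum_distrib_left)
  also have "\<dots> \<le> (\<Sum>i<p. blk m i b \<bullet> (R *\<^sub>v blk m i b))"
    by (intro sum_mono sigma_min_le_quad[OF R(1) pd_imp_psd[OF R(2)]]) simp
  also have "\<dots> \<le> (\<Sum>i<p. blk m i (transpose_mat Tp *\<^sub>v b) \<bullet> (Rbar *\<^sub>v blk m i (transpose_mat Tp *\<^sub>v b)))"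
  proof (rule innovation_variance_ge)
    fix \<omega> assume w: "\<omega> \<in> space M"
    have "b \<bullet> Zs 0 \<omega> = (\<Sum>i<p. blk m i b \<bullet> y \<omega> i)"
    proof -
      have "blk m i (Zs 0 \<omega>) = y \<omega> i" if "i < p" for i
        using blk_stack_past[OF that, of "y \<omega>" "p + 0" m] y_carrier[OF w] by simp
      then show ?thesis unfolding scalar_prod_blocks[OF b stack_carrier] by simp
    qed
    moreover have "b \<bullet> Zs 0 \<omega> = (\<Sum>i<p. blk m i (transpose_mat Tp *\<^sub>v b) \<bullet> e \<omega> i)"
      using Opt[OF b] by (simp only: Zs_decomp[OF w b] Es_prod[OF w Tpt[OF b]] kf(1)[OF w]) simp
    ultimately show "(\<Sum>i<p. blk m i b \<bullet> y \<omega> i) = (\<Sum>i<p. blk m i (transpose_mat Tp *\<^sub>v b) \<bullet> e \<omega> i)" by simp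
  qed auto
  finally show ?thesis by (simp add: vB_def)
qed

lemma SigmaE_quad:
  assumes b: "b \<in> carrier_vec (m * p)"
  shows "b \<bullet> (Tp * blkdiag p Rbar * transpose_mat Tp *\<^sub>v b) = vB (transpose_mat Tp *\<^sub>v b)"
    "Tp * blkdiag p Rbar * transpose_mat Tp \<in> carrier_mat (m * p) (m * p)"
    "transpose_mat (Tp * blkdiag p Rbar * transpose_mat Tp) = Tp * blkdiag p Rbar * transpose_mat Tp"
proof -
  have B: "blkdiag p Rbar \<in> carrier_mat (m * p) (m * p)" using Rbar(1) by (simp add: blkdiag_def Let_def)
  have T: "Tp \<in> carrier_mat (m * p) (m * p)" by (rule Tp_carrier)
  have Tt: "transpose_mat Tp \<in> carrier_mat (m * p) (m * p)" using T by simp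
  have Bt: "transpose_mat (blkdiag p Rbar) = blkdiag p Rbar"
  proof -
    have s: "Rbar $$ (i,j) = Rbar $$ (j,i)" if "i < m" "j < m" for i j
      using arg_cong[OF pd_matD(1)[OF Rbar(2,1)], of "\<lambda>M. M $$ (i,j)"] Rbar(1) that by simp
    show ?thesis using Rbar(1) m by (intro eq_matI) (auto simp: blkdiag_def Let_def s)
  qed
  note z = Tpt[OF b]
  have "Tp * blkdiag p Rbar * transpose_mat Tp *\<^sub>v b = Tp *\<^sub>v (blkdiag p Rbar *\<^sub>v (transpose_mat Tp *\<^sub>v b))"
    using T B Tt b z by (simp add: assoc_mult_mat_vec[of _ "m * p" "m * p" _ "m * p"])
  then show "b \<bullet> (Tp * blkdiag p Rbar * transpose_mat Tp *\<^sub>v b) = vB (transpose_mat Tp *\<^sub>v b)"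
    using transpose_vec_mult_scalar[OF T mult_mat_vec_carrier[OF B z] b] quad_blkdiag[OF Rbar(1) z] by (simp add: vB_def)
  show "Tp * blkdiag p Rbar * transpose_mat Tp \<in> carrier_mat (m * p) (m * p)" using T B Tt by simp
  show "transpose_mat (Tp * blkdiag p Rbar * transpose_mat Tp) = Tp * blkdiag p Rbar * transpose_mat Tp"
    using T B Tt Bt by (simp add: transpose_mult[of _ "m * p" "m * p" _ "m * p"] assoc_mult_mat[of _ "m * p" "m * p" _ "m * p" _ "m * p"])
qed

lemma Es_flat:
  assumes w: "\<omega> \<in> space M" and z: "z \<in> carrier_vec (m * p)"
  shows "z \<bullet> Es s \<omega> = ip (p * m) (\<lambda>i. (G *\<^sub>v blk m (i div m) z) $ (i mod m)) (\<lambda>i. wn (s * m + i) \<omega>)"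
  unfolding Es_prod[OF w z] innovation_whitened_shift[OF w blk_carrier] ip_def ..

lemma vB_flat: "vB z = ip (p * m) (\<lambda>i. (G *\<^sub>v blk m (i div m) z) $ (i mod m)) (\<lambda>i. (G *\<^sub>v blk m (i div m) z) $ (i mod m))"
  unfolding vB_def ip_def innovation_whitened_norm[where b = "\<lambda>i. blk m i z", OF blk_carrier, symmetric]
  by (simp add: power2_eq_square del: index_mult_mat_vec)

text \<open>\<open>k1 - p\<close> is p times the number of samples needed in each residue class. In
  whitened coordinates both sides become the isotropic statement for white noise.\<close>

lemma innovation_covariance_event:
  assumes \<delta>: "0 < \<delta>" "\<delta> < 1" and k1: "real k \<ge> k1 m p \<delta>"
  shows "\<exists>F\<in>events. prob F \<ge> 1 - \<delta> \<and> (\<forall>\<omega>\<in>F. \<omega> \<in> space M \<and> (\<forall>z\<in>carrier_vec (m * p).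
    real N / 2 * vB z \<le> (\<Sum>s<N. (z \<bullet> Es s \<omega>)\<^sup>2)))"
proof -
  have p0: "p > 0" using p by simp
  have "real N \<ge> real k - real p" using k by (simp add: N_def)
  also have "real k - real p \<ge> 128 * (real m * real p ^ 2 * ln 9 + real p * ln 2 + real p * ln (1 / \<delta>))"
    using k1 by (simp add: k1_def)
  finally have "real N / p \<ge> 128 * (real m * real p ^ 2 * ln 9 + real p * ln 2 + real p * ln (1 / \<delta>)) / p"
    by (intro divide_right_mono) auto
  also have "128 * (real m * real p ^ 2 * ln 9 + real p * ln 2 + real p * ln (1 / \<delta>)) / p =
    128 * (real (p * m) * ln 9 + ln 2 + ln (1 / \<delta>))"
    using p0 by (simp add: field_simps power2_eq_square)
  finally have N: "real N / p \<ge> 128 * (real (p * m) * ln 9 + ln 2 + ln (1 / \<delta>))" .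
  obtain F where F: "F \<in> events" "prob F \<ge> 1 - \<delta>"
    "\<forall>\<omega>\<in>F. \<omega> \<in> space M \<and> (\<forall>z. real N / 2 * ip (p * m) z z \<le> (\<Sum>t<N. (ip (p * m) z (\<lambda>i. wn (t * m + i) \<omega>))\<^sup>2))"
    using wn.empirical_covariance_event[OF p0 m \<delta> N] by (elim bexE conjE)
  show ?thesis
  proof (intro bexI[OF _ F(1)] conjI F(2) ballI)
    fix \<omega> assume w: "\<omega> \<in> F"
    then show sp: "\<omega> \<in> space M" using F(3) by blast
    fix z :: "real vec" assume z: "z \<in> carrier_vec (m * p)"
    show "real N / 2 * vB z \<le> (\<Sum>s<N. (z \<bullet> Es s \<omega>)\<^sup>2)"
      unfolding Es_flat[OF sp z] vB_flat using F(3) w by blast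
  qed
qed

definition GammaZ :: "real mat" where
  "GammaZ = second_moment M (m * p) (\<lambda>\<omega>. stack_past m p (y \<omega>) k)"

definition GammaX :: "real mat" where
  "GammaX = second_moment M n (\<lambda>\<omega>. xh \<omega> (k - p))"

lemma pk: "p + (k - p) = k" using k by simp

lemma GammaZ:
  shows "GammaZ \<in> carrier_mat (m * p) (m * p)" "transpose_mat GammaZ = GammaZ"
    "\<And>b. b \<in> carrier_vec (m * p) \<Longrightarrow> b \<bullet> (GammaZ *\<^sub>v b) = zvar (k - p) b"
proof -
  show "GammaZ \<in> carrier_mat (m * p) (m * p)" by (simp add: GammaZ_def second_moment_def)
  show "transpose_mat GammaZ = GammaZ" unfolding GammaZ_def by (rule second_moment_symmetric)
  let ?X = "\<lambda>\<omega>. stack_past m p (y \<omega>) k"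
  have u: "unit_vec (m * p) i \<bullet> ?X \<omega> = ?X \<omega> $ i" if "i < m * p" for i \<omega>
    using that by (simp add: stack_past_def)
  have m1: "(\<lambda>\<omega>. ?X \<omega> $ i) \<in> borel_measurable M" if "i < m * p" for i
    using Zs_measurable[of "unit_vec (m * p) i" "k - p"] unfolding pk u[OF that] by simp
  have m2: "(\<integral>\<^sup>+\<omega>. ennreal ((?X \<omega> $ i)\<^sup>2) \<partial>M) < \<infinity>" if "i < m * p" for i
    using Zs_second_moment[of "unit_vec (m * p) i" "k - p"] unfolding pk u[OF that] by simp
  fix b :: "real vec" assume b: "b \<in> carrier_vec (m * p)"
  have bX: "(\<Sum>i<m * p. b $ i * ?X \<omega> $ i) = b \<bullet> ?X \<omega>" for \<omega>
    by (simp add: scalar_prod_def lessThan_atLeast0 stack_past_def)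
  note q = second_moment_quad[of "m * p" ?X b, OF m1 m2 b]
  have "ennreal (b \<bullet> (GammaZ *\<^sub>v b)) = (\<integral>\<^sup>+\<omega>. ennreal ((b \<bullet> ?X \<omega>)\<^sup>2) \<partial>M)"
    unfolding GammaZ_def using q unfolding bX by (simp add: nn_integral_eq_integral)
  also have "\<dots> = ennreal (zvar (k - p) b)" using Zs_second_moment[OF b, of "k - p"] unfolding pk .
  finally show "b \<bullet> (GammaZ *\<^sub>v b) = zvar (k - p) b"
    using zvar_ge_0[OF b] q unfolding GammaZ_def bX by (subst (asm) ennreal_inj) auto
qed

lemma GammaX:
  shows "GammaX \<in> carrier_mat n n"
    "\<And>f. f \<in> carrier_vec n \<Longrightarrow> f \<bullet> (GammaX *\<^sub>v f) = vx (k - p) f"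
proof -
  show "GammaX \<in> carrier_mat n n" by (simp add: GammaX_def second_moment_def)
  \<comment> \<open>Outside \<open>space M\<close> nothing fixes the dimension of the estimate, so a
    version that is an n-vector everywhere takes its place.\<close>
  let ?X = "\<lambda>\<omega>. vec n (\<lambda>i. xh \<omega> (k - p) $ i)"
  have e: "?X \<omega> = xh \<omega> (k - p)" if "\<omega> \<in> space M" for \<omega>
    using xh_carrier[OF that, of "k - p"] by (intro eq_vecI) auto
  have GX: "GammaX = second_moment M n ?X"
    unfolding GammaX_def second_moment_def by (intro eq_matI) auto
  have u: "unit_vec n i \<bullet> ?X \<omega> = ?X \<omega> $ i" if "i < n" for i \<omega>
    using that by simp
  have xm: "(\<lambda>\<omega>. f \<bullet> ?X \<omega>) \<in> borel_measurable M" if "f \<in> carrier_vec n" for f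
    using xh_measurable[OF that, of "k - p"] by (subst measurable_cong[of _ _ "\<lambda>\<omega>. f \<bullet> xh \<omega> (k - p)"]) (simp_all only: e)
  have x2: "(\<integral>\<^sup>+\<omega>. ennreal ((f \<bullet> ?X \<omega>)\<^sup>2) \<partial>M) = ennreal (vx (k - p) f)" if "f \<in> carrier_vec n" for f
    unfolding state_second_moment[OF that, symmetric] by (intro nn_integral_cong) (simp only: e)
  have m1: "(\<lambda>\<omega>. ?X \<omega> $ i) \<in> borel_measurable M" if "i < n" for i
    using xm[of "unit_vec n i"] unfolding u[OF that] by simp
  have m2: "(\<integral>\<^sup>+\<omega>. ennreal ((?X \<omega> $ i)\<^sup>2) \<partial>M) < \<infinity>" if "i < n" for i
    using x2[of "unit_vec n i"] unfolding u[OF that] by simp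
  fix b :: "real vec" assume b: "b \<in> carrier_vec n"
  have bX: "(\<Sum>i<n. b $ i * ?X \<omega> $ i) = b \<bullet> ?X \<omega>" for \<omega>
    by (simp add: scalar_prod_def lessThan_atLeast0)
  note q = second_moment_quad[of n ?X b, OF m1 m2 b]
  have "ennreal (b \<bullet> (GammaX *\<^sub>v b)) = (\<integral>\<^sup>+\<omega>. ennreal ((b \<bullet> ?X \<omega>)\<^sup>2) \<partial>M)"
    unfolding GX using q unfolding bX by (simp add: nn_integral_eq_integral)
  also have "\<dots> = ennreal (vx (k - p) b)" by (rule x2[OF b])
  finally show "b \<bullet> (GammaX *\<^sub>v b) = vx (k - p) b"
    using vx_nonneg_mono(1)[OF b] q unfolding GX bX by (subst (asm) ennreal_inj) auto
qed

lemma GammaZ_pd: "pd_mat GammaZ"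
proof -
  have "0 < b \<bullet> (GammaZ *\<^sub>v b)" if b: "b \<in> carrier_vec (m * p)" "b \<noteq> 0\<^sub>v (m * p)" for b
  proof -
    have "0 < b \<bullet> b" using scalar_self_eq_0[OF b(1)] b(2) scalar_self_ge_0[of b] by simp
    then have "0 < sigma_min R * (b \<bullet> b)" using sigma_min_pos[OF R m] by simp
    also have "\<dots> \<le> zvar (k - p) b"
      using vB_Tp_ge[OF b(1)] vx_nonneg_mono(1)[OF Opt[OF b(1)], of "k - p"] by (simp add: zvar_def)
    finally show ?thesis by (simp only: GammaZ(3)[OF b(1)])
  qed
  then show ?thesis using GammaZ(1,2) by (auto simp: pd_mat_def)
qed

text \<open>Markov's inequality is applied once to the whole whitened energy, of expectation at most
  N * m * p. Cauchy-Schwarz between H b and J Z, with H the root of \<open>GammaZ\<close> and J its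
  inverse, then gives the bound for all b on the same event.\<close>

lemma output_covariance_event:
  assumes \<delta>: "0 < \<delta>"
  shows "\<exists>F\<in>events. prob F \<ge> 1 - \<delta> \<and> (\<forall>\<omega>\<in>F. \<omega> \<in> space M \<and> (\<forall>b\<in>carrier_vec (m * p).
    (\<Sum>s<N. (b \<bullet> Zs s \<omega>)\<^sup>2) \<le> real N * (real (m * p) / \<delta>) * (b \<bullet> (GammaZ *\<^sub>v b))))"
proof -
  let ?d = "m * p"
  note H = mat_sqrt_pd[OF GammaZ(1) GammaZ_pd]
  let ?H = "mat_sqrt GammaZ"
  have Ht: "transpose_mat ?H = ?H" by (rule pd_matD(1)[OF H(2,1)])
  obtain J where J: "J \<in> carrier_mat ?d ?d" "?H * J = 1\<^sub>m ?d" "J * ?H = 1\<^sub>m ?d" "transpose_mat J = J"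
    using pd_inverse_exists[OF H(1,2)] by blast
  have r: "row J i \<in> carrier_vec ?d" if "i < ?d" for i using J(1) that by auto
  \<comment> \<open>Each row of the inverse root is a functional of variance one at the last window,
    hence of variance at most one at every earlier one.\<close>
  have var1: "zvar (k - p) (row J i) = 1" if i: "i < ?d" for i
  proof -
    have e: "row J i = J *\<^sub>v unit_vec ?d i"
    proof (rule eq_vecI)
      fix j assume "j < dim_vec (J *\<^sub>v unit_vec ?d i)"
      then have "j < ?d" using J(1) by simp
      then show "row J i $ j = (J *\<^sub>v unit_vec ?d i) $ j"
        using J(1) i arg_cong[OF J(4), of "\<lambda>M. M $$ (i,j)"] by (simp add: scalar_prod_right_unit[of _ ?d])
    qed (use J in simp)
    have uc: "unit_vec ?d i \<in> carrier_vec ?d" by simp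
    have HJ: "?H *\<^sub>v row J i = unit_vec ?d i"
      unfolding e using assoc_mult_mat_vec[OF H(1) J(1) uc] J(2) by simp
    have "row J i \<bullet> (GammaZ *\<^sub>v row J i) = row J i \<bullet> (?H *\<^sub>v (?H *\<^sub>v row J i))"
      using assoc_mult_mat_vec[OF H(1) H(1) r[OF i]] H(3) by simp
    also have "\<dots> = (?H *\<^sub>v row J i) \<bullet> (?H *\<^sub>v row J i)"
      using transpose_vec_mult_scalar[OF H(1) mult_mat_vec_carrier[OF H(1) r[OF i]] r[OF i]] Ht by simp
    also have "\<dots> = 1" unfolding HJ using i by simp
    finally show ?thesis by (simp only: GammaZ(3)[OF r[OF i]])
  qed
  define Y where "Y \<omega> = (\<Sum>s<N. \<Sum>i<?d. (row J i \<bullet> Zs s \<omega>)\<^sup>2)" for \<omega>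
  have Ym: "(\<lambda>\<omega>. (row J i \<bullet> Zs s \<omega>)\<^sup>2) \<in> borel_measurable M" if "i < ?d" for i s
    using Zs_measurable[OF r[OF that]] by simp
  have "(\<integral>\<^sup>+\<omega>. ennreal (Y \<omega>) \<partial>M) = (\<integral>\<^sup>+\<omega>. (\<Sum>s<N. \<Sum>i<?d. ennreal ((row J i \<bullet> Zs s \<omega>)\<^sup>2)) \<partial>M)"
    unfolding Y_def by (simp add: sum_ennreal sum_nonneg)
  also have "\<dots> = (\<Sum>s<N. \<Sum>i<?d. \<integral>\<^sup>+\<omega>. ennreal ((row J i \<bullet> Zs s \<omega>)\<^sup>2) \<partial>M)"
    using Ym by (subst nn_integral_sum, force intro: borel_measurable_sum)
      (intro sum.cong refl nn_integral_sum, auto)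
  also have "\<dots> = (\<Sum>s<N. \<Sum>i<?d. ennreal (zvar s (row J i)))"
    by (intro sum.cong refl Zs_second_moment r) auto
  also have "\<dots> \<le> (\<Sum>s<N. \<Sum>i<?d. ennreal 1)"
  proof (intro sum_mono ennreal_leI)
    fix s i assume "s \<in> {..<N}" "i \<in> {..<?d}"
    then show "zvar s (row J i) \<le> 1" using zvar_mono[OF r[of i], of s "k - p"] var1[of i] by (simp add: N_def)
  qed
  also have "\<dots> = ennreal (real N * real ?d)" by (simp add: ennreal_mult ennreal_of_nat_eq_real_of_nat)
  finally have "\<exists>F\<in>events. prob F \<ge> 1 - \<delta> \<and> (\<forall>\<omega>\<in>F. \<omega> \<in> space M \<and> Y \<omega> \<le> real N * real ?d / \<delta>)"
    by (intro markov_event_expectation[OF _ _ _ _ \<delta>])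
      (use Ym in \<open>auto simp: Y_def intro!: borel_measurable_sum sum_nonneg\<close>)
  then obtain F where F: "F \<in> events" "prob F \<ge> 1 - \<delta>" "\<forall>\<omega>\<in>F. \<omega> \<in> space M \<and> Y \<omega> \<le> real N * real ?d / \<delta>"
    by (elim bexE conjE)
  show ?thesis
  proof (intro bexI[OF _ F(1)] conjI F(2) ballI)
    fix \<omega> assume w: "\<omega> \<in> F"
    then show sp: "\<omega> \<in> space M" using F(3) by blast
    fix b :: "real vec" assume b: "b \<in> carrier_vec ?d"
    have Hb: "?H *\<^sub>v b \<in> carrier_vec ?d" using H(1) b by simp
    have HbHb: "(?H *\<^sub>v b) \<bullet> (?H *\<^sub>v b) = b \<bullet> (GammaZ *\<^sub>v b)"
      using transpose_vec_mult_scalar[OF H(1) Hb b] assoc_mult_mat_vec[OF H(1) H(1) b] H(3) Ht by simp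
    have "(b \<bullet> Zs s \<omega>)\<^sup>2 \<le> (b \<bullet> (GammaZ *\<^sub>v b)) * (\<Sum>i<?d. (row J i \<bullet> Zs s \<omega>)\<^sup>2)" for s
    proof -
      note zc = stack_carrier[of p "y \<omega>" "p + s"]
      have JZ: "J *\<^sub>v Zs s \<omega> \<in> carrier_vec ?d" by (rule mult_mat_vec_carrier[OF J(1) zc])
      have "?H *\<^sub>v (J *\<^sub>v Zs s \<omega>) = Zs s \<omega>"
        unfolding assoc_mult_mat_vec[OF H(1) J(1) zc, symmetric] J(2) by (rule one_mult_mat_vec[OF zc])
      then have "b \<bullet> Zs s \<omega> = (?H *\<^sub>v b) \<bullet> (J *\<^sub>v Zs s \<omega>)"
        using transpose_vec_mult_scalar[OF H(1) JZ b] Ht by simp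
      then have "(b \<bullet> Zs s \<omega>)\<^sup>2 \<le> ((?H *\<^sub>v b) \<bullet> (?H *\<^sub>v b)) * ((J *\<^sub>v Zs s \<omega>) \<bullet> (J *\<^sub>v Zs s \<omega>))"
        using vec_cauchy_schwarz[OF Hb JZ] by simp
      also have "(J *\<^sub>v Zs s \<omega>) \<bullet> (J *\<^sub>v Zs s \<omega>) = (\<Sum>i<?d. (row J i \<bullet> Zs s \<omega>)\<^sup>2)"
        unfolding scalar_self_sum[OF JZ] using J(1) by (intro sum.cong) auto
      finally show ?thesis unfolding HbHb .
    qed
    then have "(\<Sum>s<N. (b \<bullet> Zs s \<omega>)\<^sup>2) \<le> (\<Sum>s<N. (b \<bullet> (GammaZ *\<^sub>v b)) * (\<Sum>i<?d. (row J i \<bullet> Zs s \<omega>)\<^sup>2))"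
      by (intro sum_mono)
    also have "\<dots> = (b \<bullet> (GammaZ *\<^sub>v b)) * Y \<omega>" by (simp add: Y_def sum_distrib_left)
    also have "\<dots> \<le> (b \<bullet> (GammaZ *\<^sub>v b)) * (real N * real ?d / \<delta>)"
      using F(3) w HbHb scalar_self_ge_0[of "?H *\<^sub>v b"] by (intro mult_left_mono) auto
    finally show "(\<Sum>s<N. (b \<bullet> Zs s \<omega>)\<^sup>2) \<le> real N * (real ?d / \<delta>) * (b \<bullet> (GammaZ *\<^sub>v b))"
      by (simp add: mult_ac)
  qed
qed

text \<open>A coordinatewise trace bound, E |xh|^2 \<le> n |GammaX| at every time up to k - p,
  followed by Markov. It serves only to control the log determinant of the state Gram matrix, where
  its looseness costs a logarithm.\<close>

lemma state_energy_event:
  assumes \<delta>: "0 < \<delta>"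
  shows "\<exists>F\<in>events. prob F \<ge> 1 - \<delta> \<and> (\<forall>\<omega>\<in>F. \<omega> \<in> space M \<and>
    (\<Sum>s<N. xh \<omega> s \<bullet> xh \<omega> s) \<le> real N * real n * norm2 GammaX / \<delta>)"
proof -
  define Y where "Y \<omega> = (\<Sum>s<N. \<Sum>i<n. (unit_vec n i \<bullet> xh \<omega> s)\<^sup>2)" for \<omega>
  have Ym: "(\<lambda>\<omega>. (unit_vec n i \<bullet> xh \<omega> s)\<^sup>2) \<in> borel_measurable M" for i s
    using xh_measurable[of "unit_vec n i" s] by simp
  have "(\<integral>\<^sup>+\<omega>. ennreal (Y \<omega>) \<partial>M) = (\<integral>\<^sup>+\<omega>. (\<Sum>s<N. \<Sum>i<n. ennreal ((unit_vec n i \<bullet> xh \<omega> s)\<^sup>2)) \<partial>M)"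
    unfolding Y_def by (simp add: sum_ennreal sum_nonneg)
  also have "\<dots> = (\<Sum>s<N. \<Sum>i<n. \<integral>\<^sup>+\<omega>. ennreal ((unit_vec n i \<bullet> xh \<omega> s)\<^sup>2) \<partial>M)"
    using Ym by (subst nn_integral_sum, force intro: borel_measurable_sum)
      (intro sum.cong refl nn_integral_sum, auto)
  also have "\<dots> = (\<Sum>s<N. \<Sum>i<n. ennreal (vx s (unit_vec n i)))"
    by (intro sum.cong refl state_second_moment) auto
  also have "\<dots> \<le> (\<Sum>s<N. \<Sum>i<n. ennreal (norm2 GammaX))"
  proof (intro sum_mono ennreal_leI)
    fix s i assume s: "s \<in> {..<N}" "i \<in> {..<n}"
    have "vx s (unit_vec n i) \<le> vx (k - p) (unit_vec n i)"
      using s by (intro vx_nonneg_mono(2)) (auto simp: N_def)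
    also have "\<dots> \<le> norm2 GammaX * (unit_vec n i \<bullet> unit_vec n i)"
      unfolding GammaX(2)[OF unit_vec_carrier, symmetric] by (rule quad_le_norm2[OF GammaX(1) unit_vec_carrier])
    finally show "vx s (unit_vec n i) \<le> norm2 GammaX" using s by simp
  qed
  also have "\<dots> = ennreal (real N * real n * norm2 GammaX)"
    using norm2_ge_0[OF GammaX(1)] by (simp add: ennreal_mult ennreal_of_nat_eq_real_of_nat mult.assoc)
  finally have "\<exists>F\<in>events. prob F \<ge> 1 - \<delta> \<and> (\<forall>\<omega>\<in>F. \<omega> \<in> space M \<and> Y \<omega> \<le> real N * real n * norm2 GammaX / \<delta>)"
    by (intro markov_event_expectation[OF _ _ _ _ \<delta>])
      (use Ym norm2_ge_0[OF GammaX(1)] in \<open>auto simp: Y_def intro!: borel_measurable_sum sum_nonneg\<close>)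
  then obtain F where F: "F \<in> events" "prob F \<ge> 1 - \<delta>" "\<forall>\<omega>\<in>F. \<omega> \<in> space M \<and> Y \<omega> \<le> real N * real n * norm2 GammaX / \<delta>"
    by (elim bexE conjE)
  have "Y \<omega> = (\<Sum>s<N. xh \<omega> s \<bullet> xh \<omega> s)" if "\<omega> \<in> space M" for \<omega>
    unfolding Y_def using scalar_self_sum[OF xh_carrier[OF that]] xh_carrier[OF that] by (intro sum.cong refl) simp
  then show ?thesis using F by (intro bexI[OF _ F(1)]) auto
qed

end

section \<open>Self-normalised bounds for predictable regressors\<close>

abbreviation vec_gram :: "real \<Rightarrow> nat \<Rightarrow> (nat \<Rightarrow> real vec) \<Rightarrow> nat \<Rightarrow> real mat" where
  "vec_gram \<mu> d z T \<equiv> gram_mat \<mu> d (\<lambda>s i. z s $ i) T"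

lemma gram_mat_carrier [simp]: "gram_mat \<mu> d z T \<in> carrier_mat d d"
  and gram_mat_symmetric: "transpose_mat (gram_mat \<mu> d z T) = gram_mat \<mu> d z T"
  by (simp add: gram_mat_def, intro eq_matI) (simp_all add: gram_mat_def gram_def mult.commute)

lemma gram_mat_quad:
  fixes z :: "nat \<Rightarrow> real vec"
  assumes z: "\<And>s. z s \<in> carrier_vec d" and x: "x \<in> carrier_vec d"
  shows "x \<bullet> (vec_gram \<mu> d z T *\<^sub>v x) = \<mu> * (x \<bullet> x) + (\<Sum>s<T. (z s \<bullet> x)\<^sup>2)"
proof -
  have zi: "ip d (\<lambda>i. z s $ i) (\<lambda>i. x $ i) = z s \<bullet> x" for s
    using z[of s] x by (simp add: ip_def scalar_prod_def lessThan_atLeast0)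
  have xi: "ip d (\<lambda>i. x $ i) (\<lambda>i. x $ i) = x \<bullet> x"
    using x by (simp add: ip_def scalar_prod_def lessThan_atLeast0)
  have "x \<bullet> (vec_gram \<mu> d z T *\<^sub>v x) = ip d (\<lambda>i. x $ i) (mv d (gram \<mu> (\<lambda>s i. z s $ i) T) (\<lambda>i. x $ i))"
    using x by (simp add: gram_mat_def ip_def mv_def scalar_prod_def lessThan_atLeast0)
  then show ?thesis by (simp add: ip_gram zi xi power2_eq_square)
qed

lemma gram_mat_pd:
  fixes z :: "nat \<Rightarrow> real vec"
  assumes z: "\<And>s. z s \<in> carrier_vec d" and \<mu>: "\<mu> > 0"
  shows "pd_mat (vec_gram \<mu> d z T)"
proof -
  have "0 < x \<bullet> (vec_gram \<mu> d z T *\<^sub>v x)" if x: "x \<in> carrier_vec d" "x \<noteq> 0\<^sub>v d" for x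
  proof -
    have "0 < x \<bullet> x" using scalar_self_eq_0[OF x(1)] x(2) scalar_self_ge_0[of x] by simp
    then have "0 < \<mu> * (x \<bullet> x)" using \<mu> by simp
    also have "\<dots> \<le> x \<bullet> (vec_gram \<mu> d z T *\<^sub>v x)"
      unfolding gram_mat_quad[where z = z, OF z x(1)] by (simp add: sum_nonneg)
    finally show ?thesis .
  qed
  moreover have "dim_row (vec_gram \<mu> d z T) = d" by (simp add: gram_mat_def)
  ultimately show ?thesis using gram_mat_symmetric by (auto simp: pd_mat_def)
qed

text \<open>By Cauchy-Schwarz the Gram matrix is dominated by \<mu> + S times the identity, and the
  determinant is monotone.\<close>

lemma ln_det_gram_le:
  fixes z :: "nat \<Rightarrow> real vec"
  assumes z: "\<And>s. z s \<in> carrier_vec d" and \<mu>: "\<mu> > 0"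
    and S: "(\<Sum>s<T. z s \<bullet> z s) \<le> S"
  shows "ln (Determinant.det (vec_gram \<mu> d z T)) - d * ln \<mu> \<le> d * ln (S / \<mu> + 1)"
proof -
  let ?M = "vec_gram \<mu> d z T"
  have S0: "0 \<le> S" using S by (intro order_trans[OF _ S] sum_nonneg scalar_self_ge_0)
  have "Determinant.det ?M \<le> Determinant.det ((\<mu> + S) \<cdot>\<^sub>m 1\<^sub>m d)"
  proof (rule det_mono_loewner[OF gram_mat_carrier gram_mat_pd[where z = z, OF z \<mu>]])
    fix x :: "real vec" assume x: "x \<in> carrier_vec d"
    have "(\<Sum>s<T. (z s \<bullet> x)\<^sup>2) \<le> (\<Sum>s<T. (z s \<bullet> z s) * (x \<bullet> x))"
      by (intro sum_mono vec_cauchy_schwarz[OF z x])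
    also have "\<dots> \<le> S * (x \<bullet> x)"
      unfolding sum_distrib_right[symmetric] using S by (intro mult_right_mono scalar_self_ge_0)
    finally show "x \<bullet> (?M *\<^sub>v x) \<le> x \<bullet> ((\<mu> + S) \<cdot>\<^sub>m 1\<^sub>m d *\<^sub>v x)"
      unfolding gram_mat_quad[where z = z, OF z x] smult_mat_quad[OF one_carrier_mat x]
      using x by (simp add: distrib_right)
  qed (auto simp: transpose_smult)
  also have "\<mu> + S = \<mu> * (S / \<mu> + 1)" using \<mu> by (simp add: field_simps)
  also have "Determinant.det (\<dots> \<cdot>\<^sub>m 1\<^sub>m d) = (\<mu> * (S / \<mu> + 1)) ^ d" by (simp only: det_smult det_one mult_1_right index_one_mat)
  finally have "ln (Determinant.det ?M) \<le> ln ((\<mu> * (S / \<mu> + 1)) ^ d)"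
    using det_pd[OF gram_mat_carrier gram_mat_pd[where z = z, OF z \<mu>]] by (intro ln_mono) auto
  also have "\<dots> = d * (ln \<mu> + ln (S / \<mu> + 1))"
  proof -
    have "S / \<mu> + 1 > 0" using \<mu> S0 by (intro add_nonneg_pos divide_nonneg_pos) auto
    then have "ln (\<mu> * (S / \<mu> + 1)) = ln \<mu> + ln (S / \<mu> + 1)"
      using \<mu> by (intro ln_mult_pos)
    then show ?thesis by (simp add: ln_realpow del: distrib_left_numeral)
  qed
  finally show ?thesis by (simp add: algebra_simps)
qed

context kalman
begin

text \<open>The condition \<open>\<tau> s \<le> s + h\<close> says that regressor s uses innovations
  strictly before s + h, the one it is multiplied with. The bound on the vector of whitened scores
  becomes one for a direction b by Cauchy-Schwarz, where |G b|^2 = b \<bullet> Rbar b.\<close>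

lemma predictable_self_normalized:
  fixes z :: "nat \<Rightarrow> 'a \<Rightarrow> real vec"
  assumes \<mu>: "\<mu> > 0" and \<delta>: "\<delta> > 0"
    and z: "\<And>s \<omega>. \<omega> \<in> space M \<Longrightarrow> z s \<omega> \<in> carrier_vec d"
    and \<gamma>: "\<And>s i j. i < d \<Longrightarrow> \<gamma> s i j \<in> carrier_vec m" and \<tau>: "\<And>s. \<tau> s \<le> s + h"
    and rep: "\<And>s \<omega> i. \<omega> \<in> space M \<Longrightarrow> i < d \<Longrightarrow> z s \<omega> $ i = (\<Sum>j<\<tau> s. \<gamma> s i j \<bullet> e \<omega> j)"
  shows "\<exists>F\<in>events. prob F \<ge> 1 - \<delta> \<and> (\<forall>\<omega>\<in>F. \<omega> \<in> space M \<and> (\<forall>b\<in>carrier_vec m. \<forall>g\<in>carrier_vec d.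
    (\<Sum>s<T. (b \<bullet> e \<omega> (s + h)) * (z s \<omega> \<bullet> g))\<^sup>2 \<le> (b \<bullet> (Rbar *\<^sub>v b)) *
      (4 * (2 * ln (5 ^ m / \<delta>) + ln (Determinant.det (vec_gram \<mu> d (\<lambda>s. z s \<omega>) T)) - d * ln \<mu>) *
       (\<mu> * (g \<bullet> g) + (\<Sum>s<T. (z s \<omega> \<bullet> g)\<^sup>2)))))"
proof -
  \<comment> \<open>The coefficients are padded with zeros up to index (s + h) * m, so that the next
    block of white noise is exactly the innovation at s + h.\<close>
  define L where "L s i q = (if q < \<tau> s * m then (G *\<^sub>v \<gamma> s i (q div m)) $ (q mod m) else 0)" for s i q
  let ?K = "\<lambda>s. (s + h) * m"
  have K: "?K s + m \<le> ?K (Suc s)" for s by simp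
  have r: "wn.regr L ?K (\<lambda>j. wn j \<omega>) s i = z s \<omega> $ i" if w: "\<omega> \<in> space M" and i: "i < d" for \<omega> s i
  proof -
    have "wn.regr L ?K (\<lambda>j. wn j \<omega>) s i = (\<Sum>q<\<tau> s * m. (G *\<^sub>v \<gamma> s i (q div m)) $ (q mod m) * wn q \<omega>)"
      unfolding wn.regr_def using \<tau>[of s]
      by (intro sum.mono_neutral_cong_right) (auto simp: L_def intro: less_le_trans)
    also have "\<dots> = z s \<omega> $ i"
      unfolding rep[OF w i] by (rule innovation_whitened[OF w \<gamma>[OF i], symmetric])
    finally show ?thesis .
  qed
  obtain F where F: "F \<in> events" "prob F \<ge> 1 - \<delta>" "\<forall>\<omega>\<in>F. \<omega> \<in> space M \<and> (\<forall>f.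
    (\<Sum>c<m. (\<Sum>s<T. wn (?K s + c) \<omega> * ip d (wn.regr L ?K (\<lambda>j. wn j \<omega>) s) f)\<^sup>2) \<le>
    4 * (2 * ln (5 ^ m / \<delta>) + ln (Determinant.det (gram_mat \<mu> d (wn.regr L ?K (\<lambda>j. wn j \<omega>)) T)) - d * ln \<mu>) *
      (\<mu> * ip d f f + (\<Sum>s<T. (ip d (wn.regr L ?K (\<lambda>j. wn j \<omega>) s) f)\<^sup>2)))"
    using wn.vector_self_normalized[where K = ?K, OF \<mu> K m \<delta>, where d = d and L = L and T = T] by (elim bexE conjE)
  show ?thesis
  proof (intro bexI[OF _ F(1)] conjI F(2) ballI)
    fix \<omega> assume wF: "\<omega> \<in> F"
    then show w: "\<omega> \<in> space M" using F(3) by blast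
    fix b g :: "real vec" assume b: "b \<in> carrier_vec m" and g: "g \<in> carrier_vec d"
    let ?B = "4 * (2 * ln (5 ^ m / \<delta>) + ln (Determinant.det (vec_gram \<mu> d (\<lambda>s. z s \<omega>) T)) - d * ln \<mu>) *
       (\<mu> * (g \<bullet> g) + (\<Sum>s<T. (z s \<omega> \<bullet> g)\<^sup>2))"
    let ?f = "\<lambda>i. g $ i"
    have ipz: "ip d (wn.regr L ?K (\<lambda>j. wn j \<omega>) s) ?f = z s \<omega> \<bullet> g" for s
      using z[OF w, of s] g by (simp add: ip_def scalar_prod_def lessThan_atLeast0 r[OF w])
    have ipf: "ip d ?f ?f = g \<bullet> g" using g by (simp add: ip_def scalar_prod_def lessThan_atLeast0)
    have gm: "gram_mat \<mu> d (wn.regr L ?K (\<lambda>j. wn j \<omega>)) T = vec_gram \<mu> d (\<lambda>s. z s \<omega>) T"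
      by (intro eq_matI) (auto simp: gram_mat_def gram_def r[OF w])
    define Y where "Y c = (\<Sum>s<T. wn ((s + h) * m + c) \<omega> * (z s \<omega> \<bullet> g))" for c
    have YB: "(\<Sum>c<m. (Y c)\<^sup>2) \<le> ?B"
      using F(3)[rule_format, OF wF, THEN conjunct2, THEN spec, of ?f] unfolding ipz ipf gm Y_def .
    have Gb: "G *\<^sub>v b \<in> carrier_vec m" using G(1) b by simp
    have "(\<Sum>s<T. (b \<bullet> e \<omega> (s + h)) * (z s \<omega> \<bullet> g)) = (\<Sum>s<T. \<Sum>c<m. (G *\<^sub>v b) $ c * (wn ((s + h) * m + c) \<omega> * (z s \<omega> \<bullet> g)))"
      unfolding innovation_term[OF w b] sum_distrib_right by (simp add: mult.assoc del: index_mult_mat_vec)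
    also have "\<dots> = (\<Sum>c<m. (G *\<^sub>v b) $ c * Y c)"
      unfolding Y_def sum_distrib_left by (rule sum.swap)
    also have "\<dots> = (G *\<^sub>v b) \<bullet> vec m Y" by (simp add: scalar_prod_def lessThan_atLeast0 del: index_mult_mat_vec)
    finally have "(\<Sum>s<T. (b \<bullet> e \<omega> (s + h)) * (z s \<omega> \<bullet> g))\<^sup>2 \<le> ((G *\<^sub>v b) \<bullet> (G *\<^sub>v b)) * (vec m Y \<bullet> vec m Y)"
      using vec_cauchy_schwarz[OF Gb, of "vec m Y"] by simp
    also have "(G *\<^sub>v b) \<bullet> (G *\<^sub>v b) = b \<bullet> (Rbar *\<^sub>v b)"
      using transpose_vec_mult_scalar[OF G(1) Gb b] assoc_mult_mat_vec[OF G(1) G(1) b] G(3,4) by simp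
    also have "vec m Y \<bullet> vec m Y = (\<Sum>c<m. (Y c)\<^sup>2)"
      by (simp add: scalar_self_sum[of _ m])
    also have "(b \<bullet> (Rbar *\<^sub>v b)) * \<dots> \<le> (b \<bullet> (Rbar *\<^sub>v b)) * ?B"
      by (intro mult_left_mono YB psd_matD(2)[OF pd_imp_psd[OF Rbar(2)] Rbar(1) b])
    finally show "(\<Sum>s<T. (b \<bullet> e \<omega> (s + h)) * (z s \<omega> \<bullet> g))\<^sup>2 \<le> (b \<bullet> (Rbar *\<^sub>v b)) * ?B" .
  qed
qed

end

context kalman_window
begin

text \<open>Consecutive windows overlap, so a whole window is not fresh noise given what precedes it
  in the sum over s. At a fixed offset i it is: the innovation at s + i is new and the state
  estimate at s belongs to its past. Hence one event per offset, each with failure probability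
  \<delta> / p.\<close>

lemma state_cross_event:
  assumes \<mu>: "\<mu> > 0" and \<delta>: "0 < \<delta>"
  shows "\<exists>F\<in>events. prob F \<ge> 1 - \<delta> \<and> (\<forall>\<omega>\<in>F. \<omega> \<in> space M \<and> (\<forall>i<p. \<forall>b\<in>carrier_vec m. \<forall>g\<in>carrier_vec n.
    (\<Sum>s<N. (b \<bullet> e \<omega> (s + i)) * (xh \<omega> s \<bullet> g))\<^sup>2 \<le> (b \<bullet> (Rbar *\<^sub>v b)) *
      (4 * (2 * ln (5 ^ m / (\<delta> / p)) + ln (Determinant.det (vec_gram \<mu> n (\<lambda>s. xh \<omega> s) N)) - n * ln \<mu>) *
       (\<mu> * (g \<bullet> g) + (\<Sum>s<N. (xh \<omega> s \<bullet> g)\<^sup>2)))))"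
proof -
  have p0: "real p > 0" using p by simp
  let ?P = "\<lambda>i \<omega>. \<forall>b\<in>carrier_vec m. \<forall>g\<in>carrier_vec n.
    (\<Sum>s<N. (b \<bullet> e \<omega> (s + i)) * (xh \<omega> s \<bullet> g))\<^sup>2 \<le> (b \<bullet> (Rbar *\<^sub>v b)) *
      (4 * (2 * ln (5 ^ m / (\<delta> / p)) + ln (Determinant.det (vec_gram \<mu> n (\<lambda>s. xh \<omega> s) N)) - n * ln \<mu>) *
       (\<mu> * (g \<bullet> g) + (\<Sum>s<N. (xh \<omega> s \<bullet> g)\<^sup>2)))"
  have "\<exists>F\<in>events. prob F \<ge> 1 - \<delta> / p \<and> (\<forall>\<omega>\<in>F. \<omega> \<in> space M \<and> ?P i \<omega>)" for i
  proof (rule predictable_self_normalized[OF \<mu>, where z = "\<lambda>s \<omega>. xh \<omega> s" and \<tau> = "\<lambda>s. s"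
      and \<gamma> = "\<lambda>s i j. transpose_mat K *\<^sub>v bw (s - Suc j) (unit_vec n i)"])
    show "\<delta> / p > 0" using \<delta> p0 by simp
    show "xh \<omega> s $ i = (\<Sum>j<s. (transpose_mat K *\<^sub>v bw (s - Suc j) (unit_vec n i)) \<bullet> e \<omega> j)"
      if "\<omega> \<in> space M" "i < n" for s \<omega> i
      using state_innovation[OF that(1) unit_vec_carrier, of i s] xh_carrier[OF that(1), of s] that(2) by simp
  qed (auto intro!: KT_carrier bw_carrier xh_carrier)
  then have "\<forall>i. \<exists>F. F \<in> events \<and> prob F \<ge> 1 - \<delta> / p \<and> (\<forall>\<omega>\<in>F. \<omega> \<in> space M \<and> ?P i \<omega>)" by blast
  then obtain F where F: "\<And>i. F i \<in> events \<and> prob (F i) \<ge> 1 - \<delta> / p \<and> (\<forall>\<omega>\<in>F i. \<omega> \<in> space M \<and> ?P i \<omega>)"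
    by (elim choice[THEN exE]) blast
  have "\<exists>E\<in>events. prob E \<ge> 1 - real (card {..<p}) * (\<delta> / p) \<and> (\<forall>\<omega>\<in>E. \<omega> \<in> space M \<and> (\<forall>u\<in>{..<p}. \<omega> \<in> F u))"
    by (rule wn.finite_intersection_event) (use F in auto)
  then obtain E where E: "E \<in> events" "prob E \<ge> 1 - real (card {..<p}) * (\<delta> / p)" "\<forall>\<omega>\<in>E. \<omega> \<in> space M \<and> (\<forall>u\<in>{..<p}. \<omega> \<in> F u)"
    by (elim bexE conjE)
  show ?thesis
  proof (intro bexI[OF _ E(1)] conjI ballI)
    show "prob E \<ge> 1 - \<delta>" using E(2) p0 by simp
    fix \<omega> assume wE: "\<omega> \<in> E"
    then show "\<omega> \<in> space M" using E(3) by blast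
    have wF: "\<omega> \<in> F i" if "i < p" for i using E(3) wE that by blast
    show "\<forall>i<p. ?P i \<omega>" using F wF by blast
  qed
qed

lemma output_cross_event:
  assumes lam: "lam > 0" and \<delta>: "0 < \<delta>"
  shows "\<exists>F\<in>events. prob F \<ge> 1 - \<delta> \<and> (\<forall>\<omega>\<in>F. \<omega> \<in> space M \<and> (\<forall>b\<in>carrier_vec m. \<forall>g\<in>carrier_vec (m * p).
    (\<Sum>s<N. (b \<bullet> e \<omega> (s + p)) * (Zs s \<omega> \<bullet> g))\<^sup>2 \<le> (b \<bullet> (Rbar *\<^sub>v b)) *
      (4 * (2 * ln (5 ^ m / \<delta>) + ln (Determinant.det (vec_gram lam (m * p) (\<lambda>s. Zs s \<omega>) N)) - (m * p) * ln lam) *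
       (lam * (g \<bullet> g) + (\<Sum>s<N. (Zs s \<omega> \<bullet> g)\<^sup>2)))))"
proof (rule predictable_self_normalized[OF lam \<delta>, where \<tau> = "\<lambda>s. s + p"
      and \<gamma> = "\<lambda>s i. \<beta> s (unit_vec (m * p) i)"])
  show "Zs s \<omega> $ i = (\<Sum>j<s + p. \<beta> s (unit_vec (m * p) i) j \<bullet> e \<omega> j)"
    if "\<omega> \<in> space M" "i < m * p" for s \<omega> i
    using Zs_innovation[OF that(1) unit_vec_carrier, of i s] stack_carrier[of p "y \<omega>" "p + s"] that(2) by simp
qed (auto intro!: \<beta>_carrier stack_carrier)

end

text \<open>Here X is the cross term, a the state energy, S the innovation energy and c the
  regularisation. In \<open>min 4 \<sigma>\<close> the 4 pays for the part of the bound proportional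
  to a, and \<sigma> for the part proportional to c, since \<sigma> c \<le> N v. Together 64 X^2
  \<le> (N v)^2 + 4 a N v \<le> 4 (a + S)^2, so |X| \<le> (a + S) / 4 and half of a + S
  survives.\<close>

lemma cross_term_small:
  fixes a S X :: real
  assumes X: "X\<^sup>2 \<le> v * (q * (c + a))" and v: "v \<ge> 0" and a: "a \<ge> 0" and c: "c \<ge> 0" and q: "q \<le> D"
    and D: "D \<ge> 0" "64 * D \<le> N * min 4 \<sigma>" and N: "N \<ge> 0"
    and cb: "c \<le> N * l" and l: "l \<ge> 0" "\<sigma> * l \<le> v" and S: "N * v \<le> 2 * S"
  shows "(a + S) / 2 \<le> a + 2 * X + S"
proof -
  have S0: "0 \<le> S" using S mult_nonneg_nonneg[OF N v] by linarith
  have "64 * (D * c) \<le> N * (N * v)"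
  proof -
    have "64 * (D * c) \<le> 64 * (D * (N * l))" using D(1) cb by (intro mult_left_mono) auto
    also have "\<dots> = 64 * D * (N * l)" by simp
    also have "\<dots> \<le> N * min 4 \<sigma> * (N * l)" using N l by (intro mult_right_mono D(2)) auto
    also have "\<dots> \<le> N * \<sigma> * (N * l)" using N l by (intro mult_right_mono mult_left_mono) auto
    also have "\<dots> = N * N * (\<sigma> * l)" by simp
    also have "\<dots> \<le> N * N * v" using N l by (intro mult_left_mono) auto
    finally show ?thesis by simp
  qed
  moreover have "64 * (D * a) \<le> N * (4 * a)"
  proof -
    have "64 * (D * a) = 64 * D * a" by simp
    also have "\<dots> \<le> N * min 4 \<sigma> * a" using a by (intro mult_right_mono D(2))
    also have "\<dots> \<le> N * 4 * a" using a N by (intro mult_right_mono mult_left_mono) auto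
    finally show ?thesis by simp
  qed
  ultimately have "64 * (D * (c + a)) \<le> N * (N * v) + N * (4 * a)" by (simp add: distrib_left)
  then have 1: "v * (64 * (D * (c + a))) \<le> v * (N * (N * v) + N * (4 * a))" by (rule mult_left_mono[OF _ v])
  have "X\<^sup>2 \<le> v * (D * (c + a))"
    using a c by (intro order_trans[OF X] mult_left_mono[OF _ v] mult_right_mono[OF q]) auto
  then have "64 * X\<^sup>2 \<le> v * (N * (N * v) + N * (4 * a))" using 1 by linarith
  also have "\<dots> = (N * v)\<^sup>2 + 4 * a * (N * v)" by (simp add: power2_eq_square algebra_simps)
  also have "\<dots> \<le> (2 * S)\<^sup>2 + 4 * a * (2 * S)"
    using S a N v by (intro add_mono power_mono mult_left_mono) auto
  also have "\<dots> \<le> (2 * (a + S))\<^sup>2" using a S0 by (simp add: power2_eq_square algebra_simps)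
  also have "\<dots> = 64 * ((a + S) / 4)\<^sup>2" by (simp only: power_mult_distrib power_divide) simp
  finally have "X\<^sup>2 \<le> ((a + S) / 4)\<^sup>2" by linarith
  then have "\<bar>X\<bar> \<le> (a + S) / 4" using a S0 by (simp add: abs_le_square_iff[symmetric])
  then have "4 * \<bar>X\<bar> \<le> a + S" by simp
  then have "a + S \<le> 2 * (a + 2 * X + S)" by (simp add: abs_le_iff)
  then show ?thesis by simp
qed

lemma sum_square_le: "(\<Sum>i<p. f i)\<^sup>2 \<le> real p * (\<Sum>i<p. (f i)\<^sup>2)" for f :: "nat \<Rightarrow> real"
  using ip_cauchy_schwarz[of p "\<lambda>_. 1" f] by (simp add: ip_def power2_eq_square)

text \<open>With f = M^T b one has |f|^2 = b \<bullet> M f \<le> |b| |M| |f|; cancelling |f| bounds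
  the transpose by the norm of M itself.\<close>

lemma transpose_mult_vec_norm:
  assumes M: "M \<in> carrier_mat r c" and b: "b \<in> carrier_vec r"
  shows "(transpose_mat M *\<^sub>v b) \<bullet> (transpose_mat M *\<^sub>v b) \<le> (norm2 M)\<^sup>2 * (b \<bullet> b)"
proof -
  let ?f = "transpose_mat M *\<^sub>v b"
  have f: "?f \<in> carrier_vec c" using M b by simp
  have Mf: "M *\<^sub>v ?f \<in> carrier_vec r" using M by (intro mult_mat_vec_carrier[OF M f])
  have "?f \<bullet> ?f = b \<bullet> (M *\<^sub>v ?f)" by (rule transpose_vec_mult_scalar[OF M f b])
  then have "(?f \<bullet> ?f)\<^sup>2 \<le> (b \<bullet> b) * ((M *\<^sub>v ?f) \<bullet> (M *\<^sub>v ?f))"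
    using vec_cauchy_schwarz[OF b Mf] by simp
  also have "(M *\<^sub>v ?f) \<bullet> (M *\<^sub>v ?f) \<le> (norm2 M)\<^sup>2 * (?f \<bullet> ?f)"
    using power_mono[OF vnorm_mult_le_norm2[OF M f] vnorm_ge_0, of 2]
    by (simp add: vnorm_def power_mult_distrib scalar_self_ge_0)
  finally have sq: "(?f \<bullet> ?f)\<^sup>2 \<le> (b \<bullet> b) * ((norm2 M)\<^sup>2 * (?f \<bullet> ?f))"
    using scalar_self_ge_0[of b] by (simp add: mult_left_mono)
  show ?thesis
  proof (cases "?f \<bullet> ?f = 0")
    case True
    then show ?thesis using scalar_self_ge_0[of b] by simp
  next
    case False
    then have "0 < ?f \<bullet> ?f" using scalar_self_ge_0[of ?f] by simp
    moreover have "(?f \<bullet> ?f) * (?f \<bullet> ?f) \<le> ((norm2 M)\<^sup>2 * (b \<bullet> b)) * (?f \<bullet> ?f)"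
      using sq by (simp add: power2_eq_square mult_ac)
    ultimately show ?thesis by (rule mult_right_le_imp_le[rotated])
  qed
qed

section \<open>Pathwise bounds on the good events\<close>

context kalman_window
begin

text \<open>The regularisation for which \<open>obs_weight * |Op\<^sup>T b|\<^sup>2 \<le> N |b|\<^sup>2\<close>; the value for \<open>Op = 0\<close> is arbitrary.\<close>

definition obs_weight :: real where
  "obs_weight = (if norm2 Op = 0 then 1 else real N / (norm2 Op)\<^sup>2)"

lemma N_pos: "real N > 0" by (simp add: N_def)

lemma obs_weight_pos: "obs_weight > 0"
  using N_pos by (simp add: obs_weight_def)

text \<open>The sample-size condition in the multiplied-out form that
  \<open>cross_term_small\<close> expects.\<close>

lemma k2_bounds:
  assumes \<delta>: "0 < \<delta>" "\<delta> < 1" and k2: "real k \<ge> k2 n m p \<delta> (sigma_min R) (norm2 Op) (norm2 GammaX)"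
  defines "D \<equiv> 4 * real p * real n * ln (real n * norm2 Op ^ 2 * norm2 GammaX / \<delta> + 1) + 8 * real p * ln (real p * 5 ^ m / \<delta>)"
  shows "D \<ge> 0" "64 * D \<le> real N * min 4 (sigma_min R)"
proof -
  have "0 \<le> real n * norm2 Op ^ 2 * norm2 GammaX / \<delta>"
    using \<delta> norm2_ge_0[OF GammaX(1)] by simp
  then have l1: "0 \<le> ln (real n * norm2 Op ^ 2 * norm2 GammaX / \<delta> + 1)" by simp
  have "\<delta> \<le> 1 * 1" using \<delta> by simp
  also have "\<dots> \<le> real p * 5 ^ m" using p by (intro mult_mono) auto
  finally have "1 \<le> real p * 5 ^ m / \<delta>" using \<delta> by simp
  then have l2: "0 \<le> ln (real p * 5 ^ m / \<delta>)" by simp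
  show "D \<ge> 0" unfolding D_def using l1 l2 by (intro add_nonneg_nonneg mult_nonneg_nonneg) auto
  have s: "0 < min 4 (sigma_min R)" using sigma_min_pos[OF R m] by simp
  have "real p + 64 / min 4 (sigma_min R) * D \<le> real k" using k2 unfolding k2_def D_def .
  then have "64 / min 4 (sigma_min R) * D \<le> real N" using k by (simp add: N_def)
  then show "64 * D \<le> real N * min 4 (sigma_min R)" using s by (simp add: pos_divide_le_eq)
qed

text \<open>Expanding the square of b \<bullet> Z leaves, besides the two energies, a cross term
  that splits into the p offsets. The weight \<open>obs_weight\<close> balances the regularisation:
  it is small enough for its term to be at most N |b|^2, yet large enough to cancel N inside the
  logarithm.\<close>

lemma output_covariance_ge:
  assumes w: "\<omega> \<in> space M" and \<delta>: "0 < \<delta>" "\<delta> < 1"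
    and k2: "real k \<ge> k2 n m p \<delta> (sigma_min R) (norm2 Op) (norm2 GammaX)"
    and E: "\<And>z. z \<in> carrier_vec (m * p) \<Longrightarrow> real N / 2 * vB z \<le> (\<Sum>s<N. (z \<bullet> Es s \<omega>)\<^sup>2)"
    and X: "(\<Sum>s<N. xh \<omega> s \<bullet> xh \<omega> s) \<le> real N * real n * norm2 GammaX / \<delta>"
    and XE: "\<And>i b g. i < p \<Longrightarrow> b \<in> carrier_vec m \<Longrightarrow> g \<in> carrier_vec n \<Longrightarrow>
      (\<Sum>s<N. (b \<bullet> e \<omega> (s + i)) * (xh \<omega> s \<bullet> g))\<^sup>2 \<le> (b \<bullet> (Rbar *\<^sub>v b)) *
      (4 * (2 * ln (5 ^ m / (\<delta> / p)) + ln (Determinant.det (vec_gram obs_weight n (\<lambda>s. xh \<omega> s) N)) - n * ln obs_weight) *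
       (obs_weight * (g \<bullet> g) + (\<Sum>s<N. (xh \<omega> s \<bullet> g)\<^sup>2)))"
    and b: "b \<in> carrier_vec (m * p)"
  shows "1 / 2 * (\<Sum>s<N. (xh \<omega> s \<bullet> (transpose_mat Op *\<^sub>v b))\<^sup>2) + 1 / 2 * (\<Sum>s<N. (Es s \<omega> \<bullet> (transpose_mat Tp *\<^sub>v b))\<^sup>2)
    \<le> (\<Sum>s<N. (b \<bullet> Zs s \<omega>)\<^sup>2)"
proof -
  define z where "z = transpose_mat Tp *\<^sub>v b"
  define f where "f = transpose_mat Op *\<^sub>v b"
  have z: "z \<in> carrier_vec (m * p)" and f: "f \<in> carrier_vec n" using Tpt[OF b] Opt[OF b] by (simp_all add: z_def f_def)
  define a where "a = (\<Sum>s<N. (xh \<omega> s \<bullet> f)\<^sup>2)"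
  define S where "S = (\<Sum>s<N. (z \<bullet> Es s \<omega>)\<^sup>2)"
  define Y where "Y i = (\<Sum>s<N. (blk m i z \<bullet> e \<omega> (s + i)) * (xh \<omega> s \<bullet> f))" for i
  note xc = xh_carrier[OF w]
  have a0: "a \<ge> 0" and S0: "S \<ge> 0" by (simp_all add: a_def S_def sum_nonneg)
  have cross: "(\<Sum>s<N. (xh \<omega> s \<bullet> f) * (z \<bullet> Es s \<omega>)) = (\<Sum>i<p. Y i)"
    unfolding Es_prod[OF w z] Y_def sum_distrib_left
    by (subst sum.swap) (simp add: mult.commute)
  have "(b \<bullet> Zs s \<omega>)\<^sup>2 = (xh \<omega> s \<bullet> f)\<^sup>2 + 2 * ((xh \<omega> s \<bullet> f) * (z \<bullet> Es s \<omega>)) + (z \<bullet> Es s \<omega>)\<^sup>2" for s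
    unfolding Zs_decomp[OF w b] f_def[symmetric] z_def[symmetric]
    by (simp add: power2_sum comm_scalar_prod[OF f xc])
  then have Zsum: "(\<Sum>s<N. (b \<bullet> Zs s \<omega>)\<^sup>2) = a + 2 * (\<Sum>i<p. Y i) + S"
    unfolding cross[symmetric] a_def S_def sum_distrib_left by (simp only: sum.distrib)
  have ES: "(\<Sum>s<N. (Es s \<omega> \<bullet> z)\<^sup>2) = S"
    unfolding S_def by (simp only: comm_scalar_prod[OF stack_carrier z])
  have "(a + S) / 2 \<le> a + 2 * (\<Sum>i<p. Y i) + S"
  proof (cases "norm2 Op = 0")
    \<comment> \<open>If Op has norm zero then f = 0, so the cross term vanishes and no
      probabilistic bound is needed.\<close>
    case True
    have "f \<bullet> f \<le> 0" using transpose_mult_vec_norm[OF Op_carrier b] True by (simp add: f_def)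
    then have "f = 0\<^sub>v n" using scalar_self_eq_0[OF f] scalar_self_ge_0[of f] by simp
    then have "xh \<omega> s \<bullet> f = 0" for s using xc by simp
    then have "(\<Sum>i<p. Y i) = 0" by (simp add: Y_def)
    then show ?thesis using a0 S0 by simp
  next
    case False
    let ?D = "4 * real p * real n * ln (real n * norm2 Op ^ 2 * norm2 GammaX / \<delta> + 1) + 8 * real p * ln (real p * 5 ^ m / \<delta>)"
    define q where "q = 4 * (2 * ln (5 ^ m / (\<delta> / p)) + ln (Determinant.det (vec_gram obs_weight n (\<lambda>s. xh \<omega> s) N)) - n * ln obs_weight)"
    have \<mu>: "obs_weight = real N / (norm2 Op)\<^sup>2" using False by (simp add: obs_weight_def)
    have "real p * q \<le> real p * (4 * (2 * ln (5 ^ m / (\<delta> / p)) + n * ln ((real N * real n * norm2 GammaX / \<delta>) / obs_weight + 1)))"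
      unfolding q_def using ln_det_gram_le[where z = "\<lambda>s. xh \<omega> s", OF xc obs_weight_pos X]
      by (intro mult_left_mono) auto
    \<comment> \<open>N cancels and leaves exactly the argument of the logarithm in
      \<open>k2\<close>.\<close>
    also have "(real N * real n * norm2 GammaX / \<delta>) / obs_weight = real n * norm2 Op ^ 2 * norm2 GammaX / \<delta>"
      unfolding \<mu> using N_pos False by (simp add: field_simps)
    also have "5 ^ m / (\<delta> / p) = real p * 5 ^ m / \<delta>" by simp
    finally have qD: "real p * q \<le> ?D" by (simp add: algebra_simps)
    have Yi: "(Y i)\<^sup>2 \<le> (blk m i z \<bullet> (Rbar *\<^sub>v blk m i z)) * (q * (obs_weight * (f \<bullet> f) + a))" if "i < p" for i
      unfolding Y_def q_def a_def by (rule XE[OF that blk_carrier f])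
    \<comment> \<open>Summing over the offsets by Cauchy-Schwarz costs the factor p that multiplies
      both terms of \<open>k2\<close>.\<close>
    have "(\<Sum>i<p. Y i)\<^sup>2 \<le> real p * (\<Sum>i<p. (Y i)\<^sup>2)" by (rule sum_square_le)
    also have "\<dots> \<le> real p * (\<Sum>i<p. (blk m i z \<bullet> (Rbar *\<^sub>v blk m i z)) * (q * (obs_weight * (f \<bullet> f) + a)))"
      using Yi by (intro mult_left_mono sum_mono) auto
    also have "\<dots> = vB z * (real p * q * (obs_weight * (f \<bullet> f) + a))"
      unfolding vB_def sum_distrib_right[symmetric] by (simp add: mult_ac)
    finally have Y2: "(\<Sum>i<p. Y i)\<^sup>2 \<le> vB z * (real p * q * (obs_weight * (f \<bullet> f) + a))" .
    show ?thesis
    proof (rule cross_term_small[OF Y2 vB_ge_0 a0 _ qD k2_bounds[OF \<delta> k2]])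
      show "0 \<le> obs_weight * (f \<bullet> f)" using obs_weight_pos scalar_self_ge_0[of f] by simp
      have "obs_weight * (f \<bullet> f) \<le> obs_weight * ((norm2 Op)\<^sup>2 * (b \<bullet> b))"
        unfolding f_def using obs_weight_pos by (intro mult_left_mono transpose_mult_vec_norm[OF Op_carrier b]) simp
      also have "\<dots> = real N * (b \<bullet> b)" unfolding \<mu> using False by simp
      finally show "obs_weight * (f \<bullet> f) \<le> real N * (b \<bullet> b)" .
      show "sigma_min R * (b \<bullet> b) \<le> vB z" unfolding z_def by (rule vB_Tp_ge[OF b])
      show "real N * vB z \<le> 2 * S" using E[OF z] by (simp add: S_def)
    qed (auto simp: scalar_self_ge_0)
  qed
  then show ?thesis unfolding Zsum f_def[symmetric] z_def[symmetric] ES a_def[symmetric] by simp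
qed

text \<open>Put d = m p. The terms in ln N and l agree on both sides, so two comparisons remain: m
  ln 5 \<le> d ln 3, which holds as p \<ge> 2 and ln 5 \<le> 2 ln 3, and 2 ln (1 / \<delta>) \<le> d
  ln (d / \<delta>), which holds as d \<ge> 2.\<close>

lemma self_normalized_constant:
  assumes \<delta>: "0 < \<delta>" "\<delta> < 1"
  shows "4 * (2 * ln (5 ^ m / \<delta>) + (real (m * p) * ln (real N * (real (m * p) / \<delta>)) + l)) \<le>
    8 * (real m * real p) * (ln (3 * real m * real p / \<delta>) + 1 / 2 * ln (real N) + 1 / (2 * real m * real p) * l)"
proof -
  have m0: "real m > 0" and p0: "real p > 0" and p2: "2 \<le> real p" using m p by auto
  let ?d = "real m * real p"
  have d2: "2 \<le> ?d" using mult_mono[of 1 "real m" 2 "real p"] m p2 by simp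
  have e1: "ln (5 ^ m / \<delta>) = m * ln 5 + ln (1 / \<delta>)" using \<delta> by (simp add: ln_div ln_realpow)
  have e2: "ln (real N * (real (m * p) / \<delta>)) = ln (real N) + ln (?d / \<delta>)"
  proof -
    have "0 < ?d / \<delta>" using d2 \<delta> by (intro divide_pos_pos) auto
    then show ?thesis unfolding of_nat_mult by (rule ln_mult_pos[OF N_pos])
  qed
  have e3: "ln (3 * real m * real p / \<delta>) = ln 3 + ln (?d / \<delta>)"
  proof -
    have "3 * real m * real p / \<delta> = 3 * (?d / \<delta>)" by simp
    moreover have "0 < ?d / \<delta>" using d2 \<delta> by (intro divide_pos_pos) auto
    ultimately show ?thesis by (simp only:) (rule ln_mult_pos, simp_all)
  qed
  have l1: "ln (1 / \<delta>) \<le> ln (?d / \<delta>)" "0 \<le> ln (1 / \<delta>)" using d2 \<delta> by (auto simp: divide_right_mono)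
  have "2 * ln (1 / \<delta>) \<le> ?d * ln (?d / \<delta>)" using d2 l1 by (intro mult_mono) auto
  moreover have "m * ln 5 \<le> ?d * ln 3"
  proof -
    have "m * ln 5 \<le> m * (2 * ln (3::real))"
    proof (intro mult_left_mono)
      have "ln (9::real) = 2 * ln 3" using ln_realpow[of 3 2] by simp
      moreover have "ln (5::real) \<le> ln 9" by simp
      ultimately show "ln (5::real) \<le> 2 * ln 3" by linarith
    qed simp
    also have "\<dots> \<le> m * (real p * ln 3)" using p2 by (intro mult_left_mono mult_right_mono) auto
    finally show ?thesis by (simp add: mult.assoc)
  qed
  moreover have "4 * (2 * (x1 + x2) + (x3 + x4 + l)) \<le> 8 * x5 + 8 * x4 + 4 * x3 + 4 * l"
    if "2 * x2 \<le> x4" "x1 \<le> x5" for x1 x2 x3 x4 x5 using that by simp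
  moreover have eqR: "8 * ?d * (ln 3 + ln (?d / \<delta>) + 1 / 2 * ln (real N) + 1 / (2 * real m * real p) * l) =
     8 * (?d * ln 3) + 8 * (?d * ln (?d / \<delta>)) + 4 * (?d * ln (real N)) + 4 * l"
    using m0 p0 by (simp add: field_simps)
  moreover have eqL: "real (m * p) * (ln (real N) + ln (?d / \<delta>)) = ?d * ln (real N) + ?d * ln (?d / \<delta>)"
    by (simp add: distrib_left)
  ultimately show ?thesis unfolding e1 e2 e3 eqR eqL by blast
qed

lemma normalized_covariance:
  shows "(1 / lam) \<cdot>\<^sub>m GammaZ + 1\<^sub>m (m * p) \<in> carrier_mat (m * p) (m * p)"
    "transpose_mat ((1 / lam) \<cdot>\<^sub>m GammaZ + 1\<^sub>m (m * p)) = (1 / lam) \<cdot>\<^sub>m GammaZ + 1\<^sub>m (m * p)"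
    "\<And>x. x \<in> carrier_vec (m * p) \<Longrightarrow>
      x \<bullet> (((1 / lam) \<cdot>\<^sub>m GammaZ + 1\<^sub>m (m * p)) *\<^sub>v x) = 1 / lam * (x \<bullet> (GammaZ *\<^sub>v x)) + x \<bullet> x"
    "lam > 0 \<Longrightarrow> 1 \<le> Determinant.det ((1 / lam) \<cdot>\<^sub>m GammaZ + 1\<^sub>m (m * p))"
proof -
  let ?d = "m * p" and ?B = "(1 / lam) \<cdot>\<^sub>m GammaZ + 1\<^sub>m (m * p)"
  show B: "?B \<in> carrier_mat ?d ?d" "transpose_mat ?B = ?B"
    using GammaZ(1,2) by (auto simp: transpose_add[of _ ?d ?d] transpose_smult)
  have Bq: "x \<bullet> (?B *\<^sub>v x) = 1 / lam * (x \<bullet> (GammaZ *\<^sub>v x)) + x \<bullet> x" if x: "x \<in> carrier_vec ?d" for x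
  proof -
    have "?B *\<^sub>v x = ((1 / lam) \<cdot>\<^sub>m GammaZ) *\<^sub>v x + x"
      using GammaZ(1) x by (simp add: add_mult_distrib_mat_vec[of _ ?d ?d])
    then have "x \<bullet> (?B *\<^sub>v x) = x \<bullet> (((1 / lam) \<cdot>\<^sub>m GammaZ) *\<^sub>v x) + x \<bullet> x"
      using scalar_prod_add_distrib[OF x mult_mat_vec_carrier[OF smult_carrier_mat[OF GammaZ(1)] x] x] by simp
    then show ?thesis by (simp only: smult_mat_quad[OF GammaZ(1) x])
  qed
  then show "\<And>x. x \<in> carrier_vec ?d \<Longrightarrow> x \<bullet> (?B *\<^sub>v x) = 1 / lam * (x \<bullet> (GammaZ *\<^sub>v x)) + x \<bullet> x" by blast
  have G0: "0 \<le> x \<bullet> (GammaZ *\<^sub>v x)" if "x \<in> carrier_vec ?d" for x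
    using psd_matD(2)[OF pd_imp_psd[OF GammaZ_pd] GammaZ(1) that] .
  show "1 \<le> Determinant.det ?B" if lam: "lam > 0"
    by (rule det_ge_1[OF B]) (use G0 lam in \<open>simp only: Bq, simp\<close>)
qed

text \<open>With c = N m p / \<delta>, bound (b) gives V \<le> lam I + c GammaZ for the regularised
  Gram matrix V. Since c \<ge> 1 this is at most c lam (GammaZ / lam + I), whose determinant is a
  power of c lam times the one in \<open>g1\<close>.\<close>

lemma ln_det_output_gram_le:
  assumes \<delta>: "0 < \<delta>" "\<delta> < 1" and lam: "lam > 0"
    and Z: "\<And>b. b \<in> carrier_vec (m * p) \<Longrightarrow>
      (\<Sum>s<N. (b \<bullet> Zs s \<omega>)\<^sup>2) \<le> real N * (real (m * p) / \<delta>) * (b \<bullet> (GammaZ *\<^sub>v b))"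
  shows "ln (Determinant.det (vec_gram lam (m * p) (\<lambda>s. Zs s \<omega>) N)) - (m * p) * ln lam \<le>
    real (m * p) * ln (real N * (real (m * p) / \<delta>)) + ln (Determinant.det ((1 / lam) \<cdot>\<^sub>m GammaZ + 1\<^sub>m (m * p)))"
proof -
  let ?d = "m * p" and ?c = "real N * (real (m * p) / \<delta>)" and ?V = "vec_gram lam (m * p) (\<lambda>s. Zs s \<omega>) N"
  let ?B = "(1 / lam) \<cdot>\<^sub>m GammaZ + 1\<^sub>m ?d"
  have d1: "1 \<le> real ?d" using m p by (simp add: Suc_le_eq del: of_nat_mult)
  have "1 * 1 \<le> ?c" using d1 \<delta> by (intro mult_mono) (auto simp: N_def)
  then have c1: "1 \<le> ?c" by simp
  note B = normalized_covariance(1,2)[of lam] and Bq = normalized_covariance(3)[of _ lam]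
    and B1 = normalized_covariance(4)[OF lam]
  have V: "pd_mat ?V" by (rule gram_mat_pd[where z = "\<lambda>s. Zs s \<omega>", OF stack_carrier lam])
  have "Determinant.det ?V \<le> Determinant.det ((?c * lam) \<cdot>\<^sub>m ?B)"
  proof (rule det_mono_loewner[OF gram_mat_carrier V])
    show "(?c * lam) \<cdot>\<^sub>m ?B \<in> carrier_mat ?d ?d" "transpose_mat ((?c * lam) \<cdot>\<^sub>m ?B) = (?c * lam) \<cdot>\<^sub>m ?B"
      using B by (simp_all add: transpose_smult)
    fix x :: "real vec" assume x: "x \<in> carrier_vec ?d"
    have "x \<bullet> (?V *\<^sub>v x) = lam * (x \<bullet> x) + (\<Sum>s<N. (x \<bullet> Zs s \<omega>)\<^sup>2)"
      unfolding gram_mat_quad[where z = "\<lambda>s. Zs s \<omega>", OF stack_carrier x] comm_scalar_prod[OF stack_carrier x] ..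
    also have "\<dots> \<le> ?c * (lam * (x \<bullet> x)) + ?c * (x \<bullet> (GammaZ *\<^sub>v x))"
      using mult_right_mono[OF c1, of "lam * (x \<bullet> x)"] lam scalar_self_ge_0[of x] Z[OF x]
      by (intro add_mono) auto
    also have "\<dots> = (?c * lam) * (1 / lam * (x \<bullet> (GammaZ *\<^sub>v x)) + x \<bullet> x)"
    proof -
      have "c * (lam * X) + c * g = (c * lam) * (1 / lam * g + X)" for c X g using lam by (simp add: field_simps)
      then show ?thesis .
    qed
    also have "\<dots> = x \<bullet> ((?c * lam) \<cdot>\<^sub>m ?B *\<^sub>v x)" by (simp only: smult_mat_quad[OF B(1) x] Bq[OF x])
    finally show "x \<bullet> (?V *\<^sub>v x) \<le> x \<bullet> ((?c * lam) \<cdot>\<^sub>m ?B *\<^sub>v x)" .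
  qed
  also have "\<dots> = (?c * lam) ^ ?d * Determinant.det ?B" unfolding det_smult using B by simp
  finally have "ln (Determinant.det ?V) \<le> ln ((?c * lam) ^ ?d * Determinant.det ?B)"
    using det_pd[OF gram_mat_carrier V] by (intro ln_mono) auto
  also have "\<dots> = ?d * ln (?c * lam) + ln (Determinant.det ?B)"
    using c1 lam B1 by (subst ln_mult) (auto simp: ln_realpow simp del: of_nat_mult)
  also have "ln (?c * lam) = ln ?c + ln lam" using c1 lam by (intro ln_mult_pos) linarith+
  finally show ?thesis by (simp add: distrib_left)
qed

text \<open>For a vector x put f = V^(-1/2) x, so that f \<bullet> V f = |x|^2, and let u be S_k f.
  The self-normalised bound is tested in the direction u itself: it reads |u|^4 \<le> (u \<bullet>
  Rbar u) * q * |x|^2, and dividing by |u|^2 leaves the norm of \<open>Rbar\<close>.\<close>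

lemma cross_sum_norm:
  assumes w: "\<omega> \<in> space M" and \<delta>: "0 < \<delta>" "\<delta> < 1" and lam: "lam > 0"
    and Z: "\<And>b. b \<in> carrier_vec (m * p) \<Longrightarrow>
      (\<Sum>s<N. (b \<bullet> Zs s \<omega>)\<^sup>2) \<le> real N * (real (m * p) / \<delta>) * (b \<bullet> (GammaZ *\<^sub>v b))"
    and XE: "\<And>b g. b \<in> carrier_vec m \<Longrightarrow> g \<in> carrier_vec (m * p) \<Longrightarrow>
      (\<Sum>s<N. (b \<bullet> e \<omega> (s + p)) * (Zs s \<omega> \<bullet> g))\<^sup>2 \<le> (b \<bullet> (Rbar *\<^sub>v b)) *
      (4 * (2 * ln (5 ^ m / \<delta>) + ln (Determinant.det (vec_gram lam (m * p) (\<lambda>s. Zs s \<omega>) N)) - (m * p) * ln lam) *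
       (lam * (g \<bullet> g) + (\<Sum>s<N. (Zs s \<omega> \<bullet> g)\<^sup>2)))"
  shows "norm2 (cross_sum m p (e \<omega>) (y \<omega>) k * mat_inv (mat_sqrt (vec_gram lam (m * p) (\<lambda>s. Zs s \<omega>) N))) \<le>
    g1 m k p \<delta> (norm2 Rbar) lam (ln (Determinant.det ((1 / lam) \<cdot>\<^sub>m GammaZ + 1\<^sub>m (m * p))))"
proof -
  let ?d = "m * p" and ?V = "vec_gram lam (m * p) (\<lambda>s. Zs s \<omega>) N" and ?S = "cross_sum m p (e \<omega>) (y \<omega>) k"
  let ?l = "ln (Determinant.det ((1 / lam) \<cdot>\<^sub>m GammaZ + 1\<^sub>m ?d))"
  let ?H = "mat_sqrt ?V" and ?J = "mat_inv (mat_sqrt ?V)"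
  let ?g = "g1 m k p \<delta> (norm2 Rbar) lam ?l"
  define q where "q = 4 * (2 * ln (5 ^ m / \<delta>) + ln (Determinant.det ?V) - (m * p) * ln lam)"
  define i where "i = ln (3 * real m * real p / \<delta>) + 1 / 2 * ln (real N) + 1 / (2 * real m * real p) * ?l"
  have g: "?g = sqrt 8 * sqrt (norm2 Rbar * real m * real p) * sqrt i" by (simp only: g1_def i_def N_def)
  have i0: "0 \<le> i"
  proof -
    have "1 * 1 \<le> real m * real p" using m p by (intro mult_mono) auto
    then have "1 \<le> 3 * real m * real p / \<delta>" using \<delta> by simp
    then show ?thesis unfolding i_def using N_pos normalized_covariance(4)[OF lam]
      by (intro add_nonneg_nonneg mult_nonneg_nonneg) (auto simp: N_def)
  qed
  have qi: "q \<le> 8 * (real m * real p) * i"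
  proof -
    have "ln (Determinant.det ?V) - ?d * ln lam \<le> real ?d * ln (real N * (real ?d / \<delta>)) + ?l"
      by (rule ln_det_output_gram_le[OF \<delta> lam]) (rule Z)
    then have "q \<le> 4 * (2 * ln (5 ^ m / \<delta>) + (real ?d * ln (real N * (real ?d / \<delta>)) + ?l))"
      unfolding q_def by simp
    also have "\<dots> \<le> 8 * (real m * real p) * i" unfolding i_def by (rule self_normalized_constant[OF \<delta>])
    finally show ?thesis .
  qed
  have V: "pd_mat ?V" by (rule gram_mat_pd[where z = "\<lambda>s. Zs s \<omega>", OF stack_carrier lam])
  note H = mat_sqrt_pd[OF gram_mat_carrier V]
  have Ht: "transpose_mat ?H = ?H" by (rule pd_matD(1)[OF H(2,1)])
  obtain J where J: "J \<in> carrier_mat ?d ?d" "?H * J = 1\<^sub>m ?d"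
    using pd_inverse_exists[OF H(1,2)] by blast
  have JJ: "?J = J" by (rule mat_inv_eqI(1)[OF H(1) J])
  have S: "?S \<in> carrier_mat m ?d" by (simp add: cross_sum_def)
  have Sg: "u \<bullet> (?S *\<^sub>v g) = (\<Sum>s<N. (u \<bullet> e \<omega> (s + p)) * (Zs s \<omega> \<bullet> g))"
    if u: "u \<in> carrier_vec m" and g: "g \<in> carrier_vec ?d" for u g :: "real vec"
  proof -
    have r: "(\<Sum>t\<in>{p..k}. h t) = (\<Sum>s<N. h (s + p))" for h :: "nat \<Rightarrow> real"
      using k by (intro sum.reindex_bij_witness[of _ "\<lambda>s. s + p" "\<lambda>t. t - p"]) (auto simp: N_def)
    have "u \<bullet> (?S *\<^sub>v g) = (\<Sum>i<m. \<Sum>j<?d. \<Sum>s<N. u $ i * (e \<omega> (s + p) $ i * Zs s \<omega> $ j * g $ j))"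
      using u g by (simp add: cross_sum_def scalar_prod_def lessThan_atLeast0[symmetric] r sum_distrib_left sum_distrib_right add.commute)
    also have "\<dots> = (\<Sum>i<m. \<Sum>s<N. \<Sum>j<?d. u $ i * (e \<omega> (s + p) $ i * Zs s \<omega> $ j * g $ j))"
      by (rule sum.cong[OF refl], rule sum.swap)
    also have "\<dots> = (\<Sum>s<N. \<Sum>i<m. \<Sum>j<?d. u $ i * (e \<omega> (s + p) $ i * Zs s \<omega> $ j * g $ j))"
      by (rule sum.swap)
    also have "\<dots> = (\<Sum>s<N. (u \<bullet> e \<omega> (s + p)) * (Zs s \<omega> \<bullet> g))"
    proof (intro sum.cong refl)
      fix s
      have "u \<bullet> e \<omega> (s + p) = (\<Sum>i<m. u $ i * e \<omega> (s + p) $ i)"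
        using e_carrier[OF w, of "s + p"] by (simp add: scalar_prod_def lessThan_atLeast0)
      moreover have "Zs s \<omega> \<bullet> g = (\<Sum>j<?d. Zs s \<omega> $ j * g $ j)"
        using g by (simp add: scalar_prod_def lessThan_atLeast0)
      ultimately show "(\<Sum>i<m. \<Sum>j<?d. u $ i * (e \<omega> (s + p) $ i * Zs s \<omega> $ j * g $ j)) = (u \<bullet> e \<omega> (s + p)) * (Zs s \<omega> \<bullet> g)"
        by (simp only: sum_product mult.assoc)
    qed
    finally show ?thesis .
  qed
  have b: "(vnorm (?S * J *\<^sub>v x))\<^sup>2 \<le> 8 * (norm2 Rbar * real m * real p) * i * (x \<bullet> x)" if x: "x \<in> carrier_vec ?d" for x
  proof -
    define f where "f = J *\<^sub>v x"
    have f: "f \<in> carrier_vec ?d" using J x by (simp add: f_def)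
    have Hf: "?H *\<^sub>v f = x" unfolding f_def using assoc_mult_mat_vec[OF H(1) J(1) x] J(2) x by simp
    have "f \<bullet> (?V *\<^sub>v f) = f \<bullet> (?H *\<^sub>v (?H *\<^sub>v f))"
      using assoc_mult_mat_vec[OF H(1) H(1) f] H(3) by simp
    also have "\<dots> = x \<bullet> x"
      using transpose_vec_mult_scalar[OF H(1) x f] by (simp only: Ht Hf)
    finally have fV: "lam * (f \<bullet> f) + (\<Sum>s<N. (Zs s \<omega> \<bullet> f)\<^sup>2) = x \<bullet> x"
      unfolding gram_mat_quad[where z = "\<lambda>s. Zs s \<omega>", OF stack_carrier f] .
    define u where "u = ?S *\<^sub>v f"
    have u: "u \<in> carrier_vec m" using S f by (simp add: u_def)
    have q0: "q * (x \<bullet> x) \<le> 8 * (real m * real p) * i * (x \<bullet> x)" by (intro mult_right_mono qi scalar_self_ge_0)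
    have "(u \<bullet> u)\<^sup>2 \<le> (u \<bullet> (Rbar *\<^sub>v u)) * (q * (x \<bullet> x))"
      using XE[OF u f] unfolding Sg[OF u f, symmetric] fV u_def[symmetric] q_def by simp
    also have "\<dots> \<le> (u \<bullet> (Rbar *\<^sub>v u)) * (8 * (real m * real p) * i * (x \<bullet> x))"
      by (intro mult_left_mono q0 psd_matD(2)[OF pd_imp_psd[OF Rbar(2)] Rbar(1) u])
    finally have le: "(u \<bullet> u)\<^sup>2 \<le> (u \<bullet> (Rbar *\<^sub>v u)) * (8 * (real m * real p) * i * (x \<bullet> x))" .
    have "u \<bullet> u \<le> 8 * (norm2 Rbar * real m * real p) * i * (x \<bullet> x)"
    proof (cases "u \<bullet> u = 0")
      case True
      then show ?thesis using i0 norm2_ge_0[OF Rbar(1)] scalar_self_ge_0[of x] by simp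
    next
      case False
      then have u0: "0 < u \<bullet> u" using scalar_self_ge_0[of u] by simp
      have Ru: "u \<bullet> (Rbar *\<^sub>v u) \<le> norm2 Rbar * (u \<bullet> u)" by (rule quad_le_norm2[OF Rbar(1) u])
      have "u \<noteq> 0\<^sub>v m" using False by auto
      then have Ru0: "0 < u \<bullet> (Rbar *\<^sub>v u)" by (rule pd_matD(2)[OF Rbar(2,1) u])
      have "0 < (u \<bullet> u)\<^sup>2" using u0 by simp
      then have "0 < (u \<bullet> (Rbar *\<^sub>v u)) * (8 * (real m * real p) * i * (x \<bullet> x))" using le by linarith
      then have c0: "0 < 8 * (real m * real p) * i * (x \<bullet> x)" using Ru0 by (simp only: zero_less_mult_pos)
      have "(u \<bullet> u)\<^sup>2 \<le> (norm2 Rbar * (u \<bullet> u)) * (8 * (real m * real p) * i * (x \<bullet> x))"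
        using c0 by (intro order_trans[OF le] mult_right_mono[OF Ru]) simp
      then have "(u \<bullet> u) * (u \<bullet> u) \<le> (8 * (norm2 Rbar * real m * real p) * i * (x \<bullet> x)) * (u \<bullet> u)"
        by (simp add: power2_eq_square mult_ac)
      then show ?thesis using u0 by (rule mult_right_le_imp_le)
    qed
    moreover have "?S * J *\<^sub>v x = u" unfolding u_def f_def by (rule assoc_mult_mat_vec[OF S J(1) x])
    ultimately show ?thesis by (simp add: vnorm_def scalar_self_ge_0)
  qed
  show ?thesis unfolding JJ
  proof (rule norm2_le)
    show "?S * J \<in> carrier_mat m ?d" using S J by simp
    show "0 \<le> ?g" unfolding g using i0 norm2_ge_0[OF Rbar(1)] by simp
    fix x :: "real vec" assume x: "x \<in> carrier_vec ?d"
    have "vnorm (?S * J *\<^sub>v x) \<le> sqrt (8 * (norm2 Rbar * real m * real p) * i * (x \<bullet> x))"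
      using b[OF x] by (rule real_le_rsqrt)
    then show "vnorm (?S * J *\<^sub>v x) \<le> ?g * vnorm x" unfolding g by (simp add: vnorm_def real_sqrt_mult)
  qed
qed

end

section \<open>Loewner inequalities and assembly of the events\<close>

lemma (in prob_space) inter_event:
  assumes "F \<in> events" "prob F \<ge> 1 - \<alpha>" "G \<in> events" "prob G \<ge> 1 - \<gamma>"
  shows "F \<inter> G \<in> events" "prob (F \<inter> G) \<ge> 1 - (\<alpha> + \<gamma>)"
proof -
  show "F \<inter> G \<in> events" using assms by simp
  have "prob (F \<union> G) = prob F + prob (G - F)" using assms by (rule_tac finite_measure_Union') auto
  moreover have "prob (G - F) = prob G - prob (F \<inter> G)"
    using assms by (subst finite_measure_Diff') (auto simp: Int_commute)
  ultimately show "prob (F \<inter> G) \<ge> 1 - (\<alpha> + \<gamma>)" using assms(2,4) prob_le_1[of "F \<union> G"] by linarith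
qed

context kalman_window
begin

lemma data_mat_carrier: "data_mat m p f k \<in> carrier_mat (m * p) N"
  and state_mat_carrier: "state_mat n p f k \<in> carrier_mat n N"
  by (simp_all add: data_mat_def state_mat_def N_def)

lemma col_data_mat: "s < N \<Longrightarrow> col (data_mat m p f k) s = stack_past m p f (p + s)"
  by (intro eq_vecI) (auto simp: data_mat_def stack_past_def N_def)

lemma col_state_mat: "\<omega> \<in> space M \<Longrightarrow> s < N \<Longrightarrow> col (state_mat n p (xh \<omega>) k) s = xh \<omega> s"
  using xh_carrier[of \<omega> s] by (intro eq_vecI) (auto simp: state_mat_def N_def)

text \<open>It identifies the matrix normalising the score in (c) with the Gram matrix of the
  likelihood argument, with \<mu> = lam.\<close>

lemma regularised_gram:
  "lam \<cdot>\<^sub>m 1\<^sub>m (m * p) + data_mat m p f k * transpose_mat (data_mat m p f k) =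
    vec_gram lam (m * p) (\<lambda>s. stack_past m p f (p + s)) N"
  by (intro eq_matI)
    (auto simp: data_mat_def gram_mat_def gram_def scalar_prod_def N_def lessThan_atLeast0 stack_past_def)

lemma innovation_gram_ge:
  assumes E: "\<And>z. z \<in> carrier_vec (m * p) \<Longrightarrow> real N / 2 * vB z \<le> (\<Sum>s<N. (z \<bullet> Es s \<omega>)\<^sup>2)"
  shows "Tp * data_mat m p (e \<omega>) k * transpose_mat (data_mat m p (e \<omega>) k) * transpose_mat Tp
    \<succeq>\<^sub>L (real N / 2) \<cdot>\<^sub>m (Tp * blkdiag p Rbar * transpose_mat Tp)"
proof (rule loewner_geI)
  note F = gram_factor_quad[OF Tp_carrier data_mat_carrier]
  note S = SigmaE_quad
  show "Tp * data_mat m p (e \<omega>) k * transpose_mat (data_mat m p (e \<omega>) k) * transpose_mat Tp \<in> carrier_mat (m * p) (m * p)"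
    "transpose_mat (Tp * data_mat m p (e \<omega>) k * transpose_mat (data_mat m p (e \<omega>) k) * transpose_mat Tp) =
     Tp * data_mat m p (e \<omega>) k * transpose_mat (data_mat m p (e \<omega>) k) * transpose_mat Tp"
    by (rule F(2,3)[OF zero_carrier_vec])+
  show "(real N / 2) \<cdot>\<^sub>m (Tp * blkdiag p Rbar * transpose_mat Tp) \<in> carrier_mat (m * p) (m * p)"
    using S(2)[OF zero_carrier_vec] by simp
  show "transpose_mat ((real N / 2) \<cdot>\<^sub>m (Tp * blkdiag p Rbar * transpose_mat Tp)) = (real N / 2) \<cdot>\<^sub>m (Tp * blkdiag p Rbar * transpose_mat Tp)"
    by (simp only: transpose_smult S(3)[OF zero_carrier_vec])
  fix b :: "real vec" assume b: "b \<in> carrier_vec (m * p)"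
  have "b \<bullet> ((real N / 2) \<cdot>\<^sub>m (Tp * blkdiag p Rbar * transpose_mat Tp) *\<^sub>v b) = real N / 2 * vB (transpose_mat Tp *\<^sub>v b)"
    by (simp only: smult_mat_quad[OF S(2)[OF b] b] S(1)[OF b])
  also have "\<dots> \<le> (\<Sum>s<N. ((transpose_mat Tp *\<^sub>v b) \<bullet> Es s \<omega>)\<^sup>2)" by (rule E[OF Tpt[OF b]])
  also have "\<dots> = (\<Sum>s<N. (col (data_mat m p (e \<omega>) k) s \<bullet> (transpose_mat Tp *\<^sub>v b))\<^sup>2)"
    by (intro sum.cong refl) (simp only: col_data_mat lessThan_iff comm_scalar_prod[OF stack_carrier Tpt[OF b]])
  finally show "b \<bullet> ((real N / 2) \<cdot>\<^sub>m (Tp * blkdiag p Rbar * transpose_mat Tp) *\<^sub>v b) \<le>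
    b \<bullet> (Tp * data_mat m p (e \<omega>) k * transpose_mat (data_mat m p (e \<omega>) k) * transpose_mat Tp *\<^sub>v b)"
    by (simp only: F(1)[OF b])
qed

lemma innovation_covariance_ge:
  "(real N / 2) \<cdot>\<^sub>m (Tp * blkdiag p Rbar * transpose_mat Tp) \<succeq>\<^sub>L (real N / 2 * sigma_min R) \<cdot>\<^sub>m 1\<^sub>m (m * p)"
proof (rule loewner_geI)
  note S = SigmaE_quad
  show "(real N / 2) \<cdot>\<^sub>m (Tp * blkdiag p Rbar * transpose_mat Tp) \<in> carrier_mat (m * p) (m * p)"
    using S(2)[OF zero_carrier_vec] by simp
  show "transpose_mat ((real N / 2) \<cdot>\<^sub>m (Tp * blkdiag p Rbar * transpose_mat Tp)) = (real N / 2) \<cdot>\<^sub>m (Tp * blkdiag p Rbar * transpose_mat Tp)"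
    by (simp only: transpose_smult S(3)[OF zero_carrier_vec])
  fix b :: "real vec" assume b: "b \<in> carrier_vec (m * p)"
  have "b \<bullet> ((real N / 2 * sigma_min R) \<cdot>\<^sub>m 1\<^sub>m (m * p) *\<^sub>v b) = real N / 2 * (sigma_min R * (b \<bullet> b))"
    using b by (simp only: smult_mat_quad[OF one_carrier_mat b] one_mult_mat_vec mult.assoc)
  also have "\<dots> \<le> real N / 2 * vB (transpose_mat Tp *\<^sub>v b)" by (intro mult_left_mono vB_Tp_ge[OF b]) simp
  finally show "b \<bullet> ((real N / 2 * sigma_min R) \<cdot>\<^sub>m 1\<^sub>m (m * p) *\<^sub>v b) \<le> b \<bullet> ((real N / 2) \<cdot>\<^sub>m (Tp * blkdiag p Rbar * transpose_mat Tp) *\<^sub>v b)"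
    by (simp only: smult_mat_quad[OF S(2)[OF b] b] S(1)[OF b])
qed (simp_all add: transpose_smult)

lemma output_gram_quad:
  assumes b: "b \<in> carrier_vec (m * p)"
  shows "b \<bullet> (data_mat m p (y \<omega>) k * transpose_mat (data_mat m p (y \<omega>) k) *\<^sub>v b) = (\<Sum>s<N. (b \<bullet> Zs s \<omega>)\<^sup>2)"
  unfolding gram_quad(1)[OF data_mat_carrier b]
  by (intro sum.cong refl) (simp only: col_data_mat lessThan_iff comm_scalar_prod[OF stack_carrier b])

lemma output_gram_ge:
  assumes w: "\<omega> \<in> space M"
    and Z: "\<And>b. b \<in> carrier_vec (m * p) \<Longrightarrow>
      1 / 2 * (\<Sum>s<N. (xh \<omega> s \<bullet> (transpose_mat Op *\<^sub>v b))\<^sup>2) + 1 / 2 * (\<Sum>s<N. (Es s \<omega> \<bullet> (transpose_mat Tp *\<^sub>v b))\<^sup>2)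
      \<le> (\<Sum>s<N. (b \<bullet> Zs s \<omega>)\<^sup>2)"
  shows "data_mat m p (y \<omega>) k * transpose_mat (data_mat m p (y \<omega>) k) \<succeq>\<^sub>L
    (1 / 2) \<cdot>\<^sub>m (Op * state_mat n p (xh \<omega>) k * transpose_mat (state_mat n p (xh \<omega>) k) * transpose_mat Op)
    + (1 / 2) \<cdot>\<^sub>m (Tp * data_mat m p (e \<omega>) k * transpose_mat (data_mat m p (e \<omega>) k) * transpose_mat Tp)"
    (is "?ZZ \<succeq>\<^sub>L (1 / 2) \<cdot>\<^sub>m ?X + (1 / 2) \<cdot>\<^sub>m ?E")
proof (rule loewner_geI)
  note F = gram_factor_quad[OF Tp_carrier data_mat_carrier] and O = gram_factor_quad[OF Op_carrier state_mat_carrier]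
    and Z0 = gram_quad[OF data_mat_carrier]
  have X: "?X \<in> carrier_mat (m * p) (m * p)" "transpose_mat ?X = ?X" by (rule O(2,3)[OF zero_carrier_vec])+
  have E: "?E \<in> carrier_mat (m * p) (m * p)" "transpose_mat ?E = ?E" by (rule F(2,3)[OF zero_carrier_vec])+
  have X2: "(1 / 2) \<cdot>\<^sub>m ?X \<in> carrier_mat (m * p) (m * p)" and E2: "(1 / 2) \<cdot>\<^sub>m ?E \<in> carrier_mat (m * p) (m * p)"
    using X(1) E(1) by (simp_all only: smult_carrier_mat)
  show "?ZZ \<in> carrier_mat (m * p) (m * p)" "transpose_mat ?ZZ = ?ZZ" by (rule Z0(2,3)[OF zero_carrier_vec])+
  show "(1 / 2) \<cdot>\<^sub>m ?X + (1 / 2) \<cdot>\<^sub>m ?E \<in> carrier_mat (m * p) (m * p)" by (rule add_carrier_mat[OF E2])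
  show "transpose_mat ((1 / 2) \<cdot>\<^sub>m ?X + (1 / 2) \<cdot>\<^sub>m ?E) = (1 / 2) \<cdot>\<^sub>m ?X + (1 / 2) \<cdot>\<^sub>m ?E"
    by (simp only: transpose_add[OF X2 E2] transpose_smult X(2) E(2))
  fix b :: "real vec" assume b: "b \<in> carrier_vec (m * p)"
  have "b \<bullet> (((1 / 2) \<cdot>\<^sub>m ?X + (1 / 2) \<cdot>\<^sub>m ?E) *\<^sub>v b) = b \<bullet> ((1 / 2) \<cdot>\<^sub>m ?X *\<^sub>v b) + b \<bullet> ((1 / 2) \<cdot>\<^sub>m ?E *\<^sub>v b)"
    unfolding add_mult_distrib_mat_vec[OF X2 E2 b]
    by (rule scalar_prod_add_distrib[OF b mult_mat_vec_carrier[OF X2 b] mult_mat_vec_carrier[OF E2 b]])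
  also have "\<dots> = 1 / 2 * (\<Sum>s<N. (xh \<omega> s \<bullet> (transpose_mat Op *\<^sub>v b))\<^sup>2) + 1 / 2 * (\<Sum>s<N. (Es s \<omega> \<bullet> (transpose_mat Tp *\<^sub>v b))\<^sup>2)"
    unfolding smult_mat_quad[OF X(1) b] smult_mat_quad[OF E(1) b] O(1)[OF b] F(1)[OF b]
    by (simp add: col_data_mat col_state_mat[OF w])
  also have "\<dots> \<le> b \<bullet> (?ZZ *\<^sub>v b)" unfolding output_gram_quad[OF b] by (rule Z[OF b])
  finally show "b \<bullet> (((1 / 2) \<cdot>\<^sub>m ?X + (1 / 2) \<cdot>\<^sub>m ?E) *\<^sub>v b) \<le> b \<bullet> (?ZZ *\<^sub>v b)" .
qed

lemma output_gram_le:
  assumes Z: "\<And>b. b \<in> carrier_vec (m * p) \<Longrightarrow>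
      (\<Sum>s<N. (b \<bullet> Zs s \<omega>)\<^sup>2) \<le> real N * (real (m * p) / \<delta>) * (b \<bullet> (GammaZ *\<^sub>v b))"
  shows "(real N * (real (m * p) / \<delta>)) \<cdot>\<^sub>m GammaZ \<succeq>\<^sub>L data_mat m p (y \<omega>) k * transpose_mat (data_mat m p (y \<omega>) k)"
proof (rule loewner_geI)
  note Z0 = gram_quad[OF data_mat_carrier]
  show "data_mat m p (y \<omega>) k * transpose_mat (data_mat m p (y \<omega>) k) \<in> carrier_mat (m * p) (m * p)"
    "transpose_mat (data_mat m p (y \<omega>) k * transpose_mat (data_mat m p (y \<omega>) k)) = data_mat m p (y \<omega>) k * transpose_mat (data_mat m p (y \<omega>) k)"
    by (rule Z0(2,3)[OF zero_carrier_vec])+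
  show "(real N * (real (m * p) / \<delta>)) \<cdot>\<^sub>m GammaZ \<in> carrier_mat (m * p) (m * p)"
    "transpose_mat ((real N * (real (m * p) / \<delta>)) \<cdot>\<^sub>m GammaZ) = (real N * (real (m * p) / \<delta>)) \<cdot>\<^sub>m GammaZ"
    using GammaZ(1,2) by (simp_all only: smult_carrier_mat transpose_smult)
  fix b :: "real vec" assume b: "b \<in> carrier_vec (m * p)"
  show "b \<bullet> (data_mat m p (y \<omega>) k * transpose_mat (data_mat m p (y \<omega>) k) *\<^sub>v b) \<le>
    b \<bullet> ((real N * (real (m * p) / \<delta>)) \<cdot>\<^sub>m GammaZ *\<^sub>v b)"
    unfolding output_gram_quad[OF b] smult_mat_quad[OF GammaZ(1) b] by (rule Z[OF b])
qed

definition sample_bounds :: "real \<Rightarrow> real \<Rightarrow> 'a \<Rightarrow> bool" where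
  "sample_bounds lam \<delta> \<omega> \<longleftrightarrow>
    (real N * (real (m * p) / \<delta>)) \<cdot>\<^sub>m GammaZ \<succeq>\<^sub>L data_mat m p (y \<omega>) k * transpose_mat (data_mat m p (y \<omega>) k) \<and>
    norm2 (cross_sum m p (e \<omega>) (y \<omega>) k * mat_inv (mat_sqrt (vec_gram lam (m * p) (\<lambda>s. Zs s \<omega>) N))) \<le>
      g1 m k p \<delta> (norm2 Rbar) lam (ln (Determinant.det ((1 / lam) \<cdot>\<^sub>m GammaZ + 1\<^sub>m (m * p))))"

text \<open>The random part of (a). The comparison with sigma_R is deterministic and proved
  separately.\<close>

definition excitation_bounds :: "'a \<Rightarrow> bool" where
  "excitation_bounds \<omega> \<longleftrightarrow>
    Tp * data_mat m p (e \<omega>) k * transpose_mat (data_mat m p (e \<omega>) k) * transpose_mat Tp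
      \<succeq>\<^sub>L (real N / 2) \<cdot>\<^sub>m (Tp * blkdiag p Rbar * transpose_mat Tp) \<and>
    data_mat m p (y \<omega>) k * transpose_mat (data_mat m p (y \<omega>) k) \<succeq>\<^sub>L
      (1 / 2) \<cdot>\<^sub>m (Op * state_mat n p (xh \<omega>) k * transpose_mat (state_mat n p (xh \<omega>) k) * transpose_mat Op)
      + (1 / 2) \<cdot>\<^sub>m (Tp * data_mat m p (e \<omega>) k * transpose_mat (data_mat m p (e \<omega>) k) * transpose_mat Tp)"

lemma sample_bounds_event:
  assumes \<delta>: "0 < \<delta>" "\<delta> < 1" and lam: "lam > 0"
  shows "\<exists>F\<in>events. prob F \<ge> 1 - 2 * \<delta> \<and> (\<forall>\<omega>\<in>F. sample_bounds lam \<delta> \<omega>)"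
proof -
  obtain F where F: "F \<in> events" "prob F \<ge> 1 - \<delta>" "\<forall>\<omega>\<in>F. \<omega> \<in> space M \<and> (\<forall>b\<in>carrier_vec (m * p).
    (\<Sum>s<N. (b \<bullet> Zs s \<omega>)\<^sup>2) \<le> real N * (real (m * p) / \<delta>) * (b \<bullet> (GammaZ *\<^sub>v b)))"
    using output_covariance_event[OF \<delta>(1)] by (elim bexE conjE)
  obtain H where H: "H \<in> events" "prob H \<ge> 1 - \<delta>" "\<forall>\<omega>\<in>H. \<omega> \<in> space M \<and> (\<forall>b\<in>carrier_vec m. \<forall>g\<in>carrier_vec (m * p).
    (\<Sum>s<N. (b \<bullet> e \<omega> (s + p)) * (Zs s \<omega> \<bullet> g))\<^sup>2 \<le> (b \<bullet> (Rbar *\<^sub>v b)) *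
      (4 * (2 * ln (5 ^ m / \<delta>) + ln (Determinant.det (vec_gram lam (m * p) (\<lambda>s. Zs s \<omega>) N)) - (m * p) * ln lam) *
       (lam * (g \<bullet> g) + (\<Sum>s<N. (Zs s \<omega> \<bullet> g)\<^sup>2))))"
    using output_cross_event[OF lam \<delta>(1)] by (elim bexE conjE)
  note FH = inter_event[OF F(1,2) H(1,2)]
  show ?thesis
  proof (intro bexI[OF _ FH(1)] conjI ballI)
    show "prob (F \<inter> H) \<ge> 1 - 2 * \<delta>" using FH(2) by simp
    fix \<omega> assume w: "\<omega> \<in> F \<inter> H"
    note f = bspec[OF F(3) IntD1[OF w]] and h = bspec[OF H(3) IntD2[OF w]]
    note Z = bspec[OF conjunct2[OF f]]
    show "sample_bounds lam \<delta> \<omega>"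
      unfolding sample_bounds_def
    proof (intro conjI output_gram_le cross_sum_norm[OF conjunct1[OF f] \<delta> lam])
    qed (use Z h in \<open>(blast | fast)\<close>)+
  qed
qed

lemma excitation_bounds_event:
  assumes \<delta>: "0 < \<delta>" "\<delta> < 1" and k1: "real k \<ge> k1 m p \<delta>"
    and k2: "real k \<ge> k2 n m p \<delta> (sigma_min R) (norm2 Op) (norm2 GammaX)"
  shows "\<exists>F\<in>events. prob F \<ge> 1 - 3 * \<delta> \<and> (\<forall>\<omega>\<in>F. excitation_bounds \<omega>)"
proof -
  obtain F where F: "F \<in> events" "prob F \<ge> 1 - \<delta>" "\<forall>\<omega>\<in>F. \<omega> \<in> space M \<and> (\<forall>z\<in>carrier_vec (m * p).
    real N / 2 * vB z \<le> (\<Sum>s<N. (z \<bullet> Es s \<omega>)\<^sup>2))"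
    using innovation_covariance_event[OF \<delta> k1] by (elim bexE conjE)
  obtain H where H: "H \<in> events" "prob H \<ge> 1 - \<delta>" "\<forall>\<omega>\<in>H. \<omega> \<in> space M \<and> (\<forall>i<p. \<forall>b\<in>carrier_vec m. \<forall>g\<in>carrier_vec n.
    (\<Sum>s<N. (b \<bullet> e \<omega> (s + i)) * (xh \<omega> s \<bullet> g))\<^sup>2 \<le> (b \<bullet> (Rbar *\<^sub>v b)) *
      (4 * (2 * ln (5 ^ m / (\<delta> / p)) + ln (Determinant.det (vec_gram obs_weight n (\<lambda>s. xh \<omega> s) N)) - n * ln obs_weight) *
       (obs_weight * (g \<bullet> g) + (\<Sum>s<N. (xh \<omega> s \<bullet> g)\<^sup>2))))"
    using state_cross_event[OF obs_weight_pos \<delta>(1)] by (elim bexE conjE)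
  obtain J where J: "J \<in> events" "prob J \<ge> 1 - \<delta>" "\<forall>\<omega>\<in>J. \<omega> \<in> space M \<and>
    (\<Sum>s<N. xh \<omega> s \<bullet> xh \<omega> s) \<le> real N * real n * norm2 GammaX / \<delta>"
    using state_energy_event[OF \<delta>(1)] by (elim bexE conjE)
  note FH = inter_event[OF inter_event[OF F(1,2) H(1,2)] J(1,2)]
  show ?thesis
  proof (intro bexI[OF _ FH(1)] conjI ballI)
    show "prob (F \<inter> H \<inter> J) \<ge> 1 - 3 * \<delta>" using FH(2) by simp
    fix \<omega> assume w: "\<omega> \<in> F \<inter> H \<inter> J"
    note f = bspec[OF F(3) IntD1[OF IntD1[OF w]]] and h = bspec[OF H(3) IntD2[OF IntD1[OF w]]]
      and j = bspec[OF J(3) IntD2[OF w]]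
    note E = bspec[OF conjunct2[OF f]]
    show "excitation_bounds \<omega>"
      unfolding excitation_bounds_def
    proof (intro conjI innovation_gram_ge output_gram_ge[OF conjunct1[OF f]]
        output_covariance_ge[OF conjunct1[OF f] \<delta> k2 _ conjunct2[OF j]])
    qed (use E h in \<open>(blast | fast)\<close>)+
  qed
qed

text \<open>Whether k reaches the two thresholds does not depend on \<omega>, so the case
  distinction is made before the event is chosen. Below the thresholds the event for (b) and (c)
  suffices; above them three more exceptional sets are removed.\<close>

theorem bounds_event:
  assumes \<delta>: "0 < \<delta>" "\<delta> < 1" and lam: "lam > 0"
  shows "\<exists>F\<in>events. prob F \<ge> 1 - 5 * \<delta> \<and> (\<forall>\<omega>\<in>F. sample_bounds lam \<delta> \<omega> \<and>
    (max (k1 m p \<delta>) (k2 n m p \<delta> (sigma_min R) (norm2 Op) (norm2 GammaX)) \<le> real k \<longrightarrow> excitation_bounds \<omega>))"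
proof -
  obtain F where F: "F \<in> events" "prob F \<ge> 1 - 2 * \<delta>" "\<forall>\<omega>\<in>F. sample_bounds lam \<delta> \<omega>"
    using sample_bounds_event[OF assms] by (elim bexE conjE)
  show ?thesis
  proof (cases "max (k1 m p \<delta>) (k2 n m p \<delta> (sigma_min R) (norm2 Op) (norm2 GammaX)) \<le> real k")
    case True
    then obtain H where H: "H \<in> events" "prob H \<ge> 1 - 3 * \<delta>" "\<forall>\<omega>\<in>H. excitation_bounds \<omega>"
      using excitation_bounds_event[OF \<delta>] by (auto elim!: bexE)
    note FH = inter_event[OF F(1,2) H(1,2)]
    show ?thesis using FH F(3) H(3) by (intro bexI[OF _ FH(1)]) auto
  next
    case False
    then show ?thesis using F \<delta> by (intro bexI[OF _ F(1)]) auto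
  qed
qed

end

theorem mainTheorem13:
  fixes M :: "'a measure"
    and n m p k :: nat
    and A C Q R P K :: "real mat"
    and lam \<delta> :: real
    and x0 :: "'a \<Rightarrow> nat \<Rightarrow> real"
    and w v :: "nat \<Rightarrow> 'a \<Rightarrow> nat \<Rightarrow> real"
    and x y xh e :: "'a \<Rightarrow> nat \<Rightarrow> real vec"
  assumes M: "prob_space M"
    and dims: "n > 0" "m > 0"
    and A: "A \<in> carrier_mat n n" and C: "C \<in> carrier_mat m n"
    and Q: "Q \<in> carrier_mat n n" "psd_mat Q"
    and R: "R \<in> carrier_mat m m" "pd_mat R"
    and P: "P \<in> carrier_mat n n" "pd_mat P"
    and K: "K \<in> carrier_mat n m"
    and rho: "spectral_radius (map_mat complex_of_real A) \<le> 1"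
    and obs: "observable A C"
    and ctrQ: "controllable A (mat_sqrt Q)"
    and K_def: "K = A * P * transpose_mat C * mat_inv (C * P * transpose_mat C + R)"
    and riccati: "P = (A - K * C) * P * transpose_mat (A - K * C) + Q + K * R * transpose_mat K"
    and ctrK: "controllable A K"
    and x0_gauss: "gaussian_rv M n P x0"
    and w_gauss: "\<And>j. gaussian_rv M n Q (w j)"
    and v_gauss: "\<And>j. gaussian_rv M m R (v j)"
    and indep: "prob_space.indep_vars M
                  (\<lambda>s. rv_space (case s of V _ \<Rightarrow> m | _ \<Rightarrow> n))
                  (\<lambda>s. case s of X0 \<Rightarrow> x0 | W j \<Rightarrow> w j | V j \<Rightarrow> v j) UNIV"
    and state: "\<And>\<omega>. \<omega> \<in> space M \<Longrightarrow> x \<omega> 0 = vec n (x0 \<omega>)"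
               "\<And>\<omega> j. \<omega> \<in> space M \<Longrightarrow> x \<omega> (Suc j) = A *\<^sub>v x \<omega> j + vec n (w j \<omega>)"
    and outp: "\<And>\<omega> j. \<omega> \<in> space M \<Longrightarrow> y \<omega> j = C *\<^sub>v x \<omega> j + vec m (v j \<omega>)"
    and kf: "\<And>\<omega>. \<omega> \<in> space M \<Longrightarrow> xh \<omega> 0 = 0\<^sub>v n"
                "\<And>\<omega> j. \<omega> \<in> space M \<Longrightarrow> xh \<omega> (Suc j) = A *\<^sub>v xh \<omega> j + K *\<^sub>v e \<omega> j"
    and innov: "\<And>\<omega> j. \<omega> \<in> space M \<Longrightarrow> e \<omega> j = y \<omega> j - C *\<^sub>v xh \<omega> j"
    and p: "p \<ge> 2" and k: "k \<ge> p" and lam: "lam > 0" and \<delta>: "0 < \<delta>" "\<delta> < 1"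
  shows "\<exists>E \<in> sets M. measure M E \<ge> 1 - 5 * \<delta> \<and> (\<forall>\<omega> \<in> E.
     (let Rbar = C * P * transpose_mat C + R;
          Op = obs_mat p A C;
          Tp = toep_mat p A C K;
          SigmaE = Tp * blkdiag p Rbar * transpose_mat Tp;
          Zb = data_mat m p (y \<omega>) k;
          Eb = data_mat m p (e \<omega>) k;
          Xb = state_mat n p (xh \<omega>) k;
          Vb = lam \<cdot>\<^sub>m 1\<^sub>m (m * p) + Zb * transpose_mat Zb;
          Sk = cross_sum m p (e \<omega>) (y \<omega>) k;
          GammaZ = second_moment M (m * p) (\<lambda>\<omega>'. stack_past m p (y \<omega>') k);
          Gamma = second_moment M n (\<lambda>\<omega>'. xh \<omega>' (k - p));
          N = real (k - p + 1)
      in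
      (real k \<ge> max (k1 m p \<delta>) (k2 n m p \<delta> (sigma_min R) (norm2 Op) (norm2 Gamma)) \<longrightarrow>
         Tp * Eb * transpose_mat Eb * transpose_mat Tp \<succeq>\<^sub>L (N / 2) \<cdot>\<^sub>m SigmaE \<and>
         (N / 2) \<cdot>\<^sub>m SigmaE \<succeq>\<^sub>L (N / 2 * sigma_min R) \<cdot>\<^sub>m 1\<^sub>m (m * p) \<and>
         Zb * transpose_mat Zb \<succeq>\<^sub>L
           (1 / 2) \<cdot>\<^sub>m (Op * Xb * transpose_mat Xb * transpose_mat Op)
           + (1 / 2) \<cdot>\<^sub>m (Tp * Eb * transpose_mat Eb * transpose_mat Tp)) \<and>
      (N * (real (m * p) / \<delta>)) \<cdot>\<^sub>m GammaZ \<succeq>\<^sub>L Zb * transpose_mat Zb \<and>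
      norm2 (Sk * mat_inv (mat_sqrt Vb)) \<le>
        g1 m k p \<delta> (norm2 Rbar) lam (ln (det ((1 / lam) \<cdot>\<^sub>m GammaZ + 1\<^sub>m (m * p))))))"
proof -
  interpret prob_space M by (rule M)
  interpret kalman_window M n m A C Q R P K x0 w v x y xh e p k
    by (intro kalman_window.intro kalman.intro kalman_axioms.intro kalman_window_axioms.intro) fact+
  obtain F where F: "F \<in> events" "prob F \<ge> 1 - 5 * \<delta>" "\<forall>\<omega>\<in>F. sample_bounds lam \<delta> \<omega> \<and>
    (max (k1 m p \<delta>) (k2 n m p \<delta> (sigma_min R) (norm2 Op) (norm2 GammaX)) \<le> real k \<longrightarrow> excitation_bounds \<omega>)"
    using bounds_event[OF \<delta> lam] by (elim bexE conjE)
  show ?thesis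
    unfolding Let_def N_def[symmetric] Rbar_def[symmetric] GammaZ_def[symmetric] GammaX_def[symmetric] regularised_gram
  proof (intro bexI[OF _ F(1)] conjI F(2) ballI)
    fix \<omega> assume w: "\<omega> \<in> F"
    note B = bspec[OF F(3) w]
    show "max (k1 m p \<delta>) (k2 n m p \<delta> (sigma_min R) (norm2 Op) (norm2 GammaX)) \<le> real k \<longrightarrow>
       Tp * data_mat m p (e \<omega>) k * transpose_mat (data_mat m p (e \<omega>) k) * transpose_mat Tp
         \<succeq>\<^sub>L (real N / 2) \<cdot>\<^sub>m (Tp * blkdiag p Rbar * transpose_mat Tp) \<and>
       (real N / 2) \<cdot>\<^sub>m (Tp * blkdiag p Rbar * transpose_mat Tp) \<succeq>\<^sub>L (real N / 2 * sigma_min R) \<cdot>\<^sub>m 1\<^sub>m (m * p) \<and>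
       data_mat m p (y \<omega>) k * transpose_mat (data_mat m p (y \<omega>) k) \<succeq>\<^sub>L
         (1 / 2) \<cdot>\<^sub>m (Op * state_mat n p (xh \<omega>) k * transpose_mat (state_mat n p (xh \<omega>) k) * transpose_mat Op)
         + (1 / 2) \<cdot>\<^sub>m (Tp * data_mat m p (e \<omega>) k * transpose_mat (data_mat m p (e \<omega>) k) * transpose_mat Tp)"
      using B innovation_covariance_ge unfolding excitation_bounds_def by blast
  qed (use F(3) in \<open>auto simp: sample_bounds_def\<close>)
qed

end
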